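(* Let $d\ge 2$. (i) For every $\lambda>0$ there exists a connected quasi-conical open set $\Omega\subset\mathbb{R}^d$ such that $\lambda$ is an eigenvalue of the Dirichlet Laplacian $-\Delta_{\mathrm D}^{\Omega}$, i.e. $\lambda\in\sigma_{\mathrm p}(-\Delta_{\mathrm D}^{\Omega})$. (ii) The connected quasi-conical open set in (i) can be chosen so that, in addition, the absolutely continuous spectrum of $-\Delta_{\mathrm D}^{\Omega}$ is empty: $\sigma_{\mathrm{ac}}(-\Delta_{\mathrm D}^{\Omega})=\varnothing$.
   Context: An open set $\Omega\subset\mathbb{R}^d$ is called quasi-conical if it contains balls of arbitrarily large radius. For an open set $\Omega\subset\mathbb{R}^d$, the Dirichlet Laplacian $-\Delta_{\mathrm D}^{\Omega}$ is the self-adjoint operator in $L^2(\Omega)$ associated (via the first representation theorem) with the closed quadratic form $u\mapsto\int_\Omega|\nabla u|^2\,\mathrm{d}x$ on the form domain $H^1_0(\Omega)$; equivalently $-\Delta_{\mathrm D}^{\Omega}u=-\Delta u$ on $\{u\in H^1_0(\Omega):\Delta u\in L^2(\Omega)\}$. $\sigma_{\mathrm p}$ denotes the set of eigenvalues and $\sigma_{\mathrm{ac}}$ the absolutely continuous spectrum. *)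

theory Defs
  imports "HOL-Analysis.Analysis"
begin

text \<open>Functions on the whole space; functions on an open set are extended by zero.\<close>

text \<open>C-infinity functions on the whole space: all iterated partial derivatives
  exist and are continuous (greatest class closed under taking partial derivatives).\<close>
definition smooth_fun :: "('a::euclidean_space \<Rightarrow> real) \<Rightarrow> bool" where
  "smooth_fun f \<longleftrightarrow> (\<exists>S. f \<in> S \<and>
     (\<forall>g\<in>S. continuous_on UNIV g \<and> (\<forall>x. g differentiable (at x)) \<and>
        (\<forall>b\<in>Basis. (\<lambda>x. frechet_derivative g (at x) b) \<in> S)))"

definition grad :: "('a::euclidean_space \<Rightarrow> real) \<Rightarrow> 'a \<Rightarrow> 'a" where
  "grad f x = (\<Sum>b\<in>Basis. frechet_derivative f (at x) b *\<^sub>R b)"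

definition test_fun :: "'a::euclidean_space set \<Rightarrow> ('a \<Rightarrow> real) \<Rightarrow> bool" where
  "test_fun \<Omega> \<phi> \<longleftrightarrow> smooth_fun \<phi> \<and>
     (\<exists>K. compact K \<and> K \<subseteq> \<Omega> \<and> (\<forall>x. x \<notin> K \<longrightarrow> \<phi> x = 0))"

definition L2_dist2 :: "('a::euclidean_space \<Rightarrow> 'b::real_normed_vector) \<Rightarrow> ('a \<Rightarrow> 'b) \<Rightarrow> ennreal" where
  "L2_dist2 f g = (\<integral>\<^sup>+ x. ennreal ((norm (f x - g x))\<^sup>2) \<partial>lebesgue)"

text \<open>H^1_0(Omega): pairs (u, G) where u is the H^1-limit of test functions and
  G is its (weak) gradient, i.e. the L^2-limit of the gradients.
  This is the closure of C_c^infinity(Omega) in H^1(R^d).\<close>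
definition H10 :: "'a::euclidean_space set \<Rightarrow> (('a \<Rightarrow> real) \<times> ('a \<Rightarrow> 'a)) set" where
  "H10 \<Omega> = {(u, G). u \<in> borel_measurable lebesgue \<and> G \<in> borel_measurable lebesgue \<and>
      (\<exists>\<phi>::nat \<Rightarrow> 'a \<Rightarrow> real. (\<forall>n. test_fun \<Omega> (\<phi> n)) \<and>
         (\<lambda>n. L2_dist2 (\<phi> n) u) \<longlonglongrightarrow> 0 \<and>
         (\<lambda>n. L2_dist2 (grad (\<phi> n)) G) \<longlonglongrightarrow> 0)}"

text \<open>Point spectrum of the Dirichlet Laplacian: by the first representation
  theorem, u is in the operator domain with -Delta_D u = lambda u iff
  u is in the form domain and the form identity holds for all v in H^1_0.\<close>
definition dirichlet_point_spectrum :: "'a::euclidean_space set \<Rightarrow> real set" where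
  "dirichlet_point_spectrum \<Omega> = {lam. \<exists>u G. (u, G) \<in> H10 \<Omega> \<and>
      (\<integral>\<^sup>+ x. ennreal ((u x)\<^sup>2) \<partial>lebesgue) > 0 \<and>
      (\<forall>v H. (v, H) \<in> H10 \<Omega> \<longrightarrow> (\<integral> x. G x \<bullet> H x \<partial>lebesgue) = lam * (\<integral> x. u x * v x \<partial>lebesgue))}"

definition L2_on :: "'a::euclidean_space set \<Rightarrow> ('a \<Rightarrow> real) set" where
  "L2_on \<Omega> = {f. f \<in> borel_measurable lebesgue \<and>
      (\<integral>\<^sup>+ x. ennreal ((f x)\<^sup>2) \<partial>lebesgue) < \<infinity> \<and> (\<forall>x. x \<notin> \<Omega> \<longrightarrow> f x = 0)}"

definition dirichlet_resolvent :: "'a::euclidean_space set \<Rightarrow> real \<Rightarrow> ('a \<Rightarrow> real) \<Rightarrow> ('a \<Rightarrow> real) \<Rightarrow> bool" where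
  "dirichlet_resolvent \<Omega> s f w \<longleftrightarrow> (\<exists>Gw. (w, Gw) \<in> H10 \<Omega> \<and>
      (\<forall>v H. (v, H) \<in> H10 \<Omega> \<longrightarrow> (\<integral> x. Gw x \<bullet> H x \<partial>lebesgue) + s * (\<integral> x. w x * v x \<partial>lebesgue)
                          = (\<integral> x. f x * v x \<partial>lebesgue)))"

text \<open>Spectral measure of f for the nonnegative operator -Delta_D: the finite Borel
  measure mu on [0,infinity) with  <(-Delta_D + s)^{-1} f, f> = int 1/(t+s) dmu(t)
  for all s > 0 (this determines mu uniquely).\<close>
definition is_spectral_measure :: "'a::euclidean_space set \<Rightarrow> ('a \<Rightarrow> real) \<Rightarrow> real measure \<Rightarrow> bool" where
  "is_spectral_measure \<Omega> f \<mu> \<longleftrightarrow> sets \<mu> = sets borel \<and> finite_measure \<mu> \<and>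
      emeasure \<mu> {..<0} = 0 \<and>
      (\<forall>s>0. \<forall>w. dirichlet_resolvent \<Omega> s f w \<longrightarrow>
          (\<integral> x. w x * f x \<partial>lebesgue) = (\<integral> t. 1 / (t + s) \<partial>\<mu>))"

text \<open>Absolutely continuous subspace: vectors whose spectral measure is absolutely
  continuous w.r.t. Lebesgue measure. The ac spectrum (spectrum of the operator
  restricted to this reducing subspace) is empty iff this subspace is trivial.\<close>
definition ac_subspace :: "'a::euclidean_space set \<Rightarrow> ('a \<Rightarrow> real) set" where
  "ac_subspace \<Omega> = {f \<in> L2_on \<Omega>. \<exists>\<mu>. is_spectral_measure \<Omega> f \<mu> \<and> absolutely_continuous lborel \<mu>}"

definition dirichlet_ac_spectrum_empty :: "'a::euclidean_space set \<Rightarrow> bool" where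
  "dirichlet_ac_spectrum_empty \<Omega> \<longleftrightarrow>
     (\<forall>f\<in>ac_subspace \<Omega>. AE x in lebesgue. f x = 0)"

definition quasi_conical :: "'a::euclidean_space set \<Rightarrow> bool" where
  "quasi_conical \<Omega> \<longleftrightarrow> (\<forall>r>0. \<exists>x. ball x r \<subseteq> \<Omega>)"

end

theory Submission
  imports Defs "HOL-Computational_Algebra.Polynomial"
begin

text \<open>
  Work with the resolvent \<open>A = (1 - \<Delta>)\<inverse>\<close>, which is compact on bounded sets, so that an eigenvalue \<open>a\<close>
  of \<open>A\<close> is the eigenvalue \<open>1 / a - 1\<close> of the Dirichlet Laplacian. The domain is a chain of larger and
  larger rooms along an axis, consecutive rooms being joined by thin tubes. Rooms end in cusps, so the
  strip around a tube that is removed by a cutoff is much thinner than the strip is long; Poincare's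
  inequality then shows that opening the tube changes the resolvent by an arbitrarily small amount in
  operator norm.

  Eigenvalue: among all pairs of a bounded chain and an eigenvalue choose one of least multiplicity
  \<open>m\<close>. Attach a new room whose length is such that it does not have this eigenvalue, and open a tube.
  After this small perturbation the eigenvalue could only move or split; by minimality of \<open>m\<close> it
  cannot split, so every eigenvector is followed by a nearby one. With summable
  perturbations the eigenvectors converge to an eigenvector on the unbounded chain; a dilation gives
  it the required eigenvalue.

  Absolutely continuous spectrum: finitely many eigenvectors of the \<open>n\<close>-th chain nearly span the range of its
  resolvent, and they remain approximate eigenvectors of \<open>A\<close> if later tubes are thin enough. Hence a
  polynomial of \<open>A\<close> that is small off a set of measure \<open>2\<^bsup>-n\<^esup>\<close> almost fixes their span. By Borel-Cantelli a
  vector with absolutely continuous spectral measure is annihilated in the limit.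
\<close>

section \<open>Orthogonal projections\<close>

lemma minimizing_sequence_Cauchy:
  fixes V :: "'h::real_inner set"
  assumes "convex V" and in_V: "\<And>n. v n \<in> V"
    and lower: "\<And>w. w \<in> V \<Longrightarrow> d \<le> (norm (x - w))\<^sup>2"
    and lim: "(\<lambda>n. (norm (x - v n))\<^sup>2) \<longlonglongrightarrow> d"
  shows "Cauchy v"
proof (rule metric_CauchyI)
  have parallelogram: "(norm (v m - v n))\<^sup>2 \<le> 2 * ((norm (x - v m))\<^sup>2 - d) + 2 * ((norm (x - v n))\<^sup>2 - d)" for m n
  proof -
    define c where "c = midpoint (v m) (v n)"
    have "c \<in> V"
      unfolding c_def using \<open>convex V\<close> in_V closed_segment_subset midpoint_in_closed_segment by blast
    then have "d \<le> (norm (x - c))\<^sup>2" by (rule lower)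
    moreover have "(norm (v m - v n))\<^sup>2 = 2 * (norm (x - v m))\<^sup>2 + 2 * (norm (x - v n))\<^sup>2 - 4 * (norm (x - c))\<^sup>2"
      unfolding c_def power2_norm_eq_inner midpoint_def by (simp add: algebra_simps inner_commute)
    ultimately show ?thesis by (simp add: algebra_simps)
  qed
  fix e :: real assume "e > 0"
  then have "eventually (\<lambda>n. (norm (x - v n))\<^sup>2 < d + e\<^sup>2 / 4) sequentially"
    by (intro order_tendstoD(2)[OF lim]) simp
  then obtain N where near: "\<And>n. n \<ge> N \<Longrightarrow> (norm (x - v n))\<^sup>2 < d + e\<^sup>2 / 4"
    by (auto simp: eventually_sequentially)
  have "dist (v m) (v n) < e" if "m \<ge> N" "n \<ge> N" for m n
  proof -
    have "(norm (v m - v n))\<^sup>2 < e\<^sup>2"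
      using parallelogram[of m n] near[OF \<open>m \<ge> N\<close>] near[OF \<open>n \<ge> N\<close>] by (simp add: field_simps)
    then show ?thesis using \<open>e > 0\<close> by (simp add: dist_norm power2_less_imp_less)
  qed
  then show "\<exists>M. \<forall>m\<ge>M. \<forall>n\<ge>M. dist (v m) (v n) < e" by blast
qed

lemma Hilbert_closest_point_exists:
  fixes V :: "'h::{real_inner,banach} set"
  assumes "convex V" "closed V" "V \<noteq> {}"
  shows "\<exists>p\<in>V. \<forall>v\<in>V. dist x p \<le> dist x v"
proof -
  define d where "d = (INF v\<in>V. (norm (x - v))\<^sup>2)"
  have bdd: "bdd_below ((\<lambda>v. (norm (x - v))\<^sup>2) ` V)" by (rule bdd_belowI[of _ 0]) auto
  have lower: "d \<le> (norm (x - v))\<^sup>2" if "v \<in> V" for v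
    unfolding d_def using that bdd by (auto intro: cInf_lower)
  have "\<exists>v\<in>V. (norm (x - v))\<^sup>2 < d + inverse (real (Suc n))" for n
    using cINF_less_iff[OF \<open>V \<noteq> {}\<close> bdd, of "d + inverse (real (Suc n))"] by (simp add: d_def)
  then obtain v where in_V: "\<And>n. v n \<in> V"
    and upper: "\<And>n. (norm (x - v n))\<^sup>2 < d + inverse (real (Suc n))"
    by metis
  have lim: "(\<lambda>n. (norm (x - v n))\<^sup>2) \<longlonglongrightarrow> d"
  proof (rule tendsto_sandwich[of "\<lambda>_. d" _ _ "\<lambda>n. d + inverse (real (Suc n))"])
    show "(\<lambda>n. d + inverse (real (Suc n))) \<longlonglongrightarrow> d"
      using tendsto_add[OF tendsto_const LIMSEQ_inverse_real_of_nat, of d] by simp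
    show "eventually (\<lambda>n. d \<le> (norm (x - v n))\<^sup>2) sequentially" using lower in_V by simp
    show "eventually (\<lambda>n. (norm (x - v n))\<^sup>2 \<le> d + inverse (real (Suc n))) sequentially"
      using upper less_imp_le by (intro always_eventually allI) blast
  qed (rule tendsto_const)
  have "Cauchy v" by (rule minimizing_sequence_Cauchy[OF \<open>convex V\<close> in_V lower lim])
  then obtain p where p: "v \<longlonglongrightarrow> p" using Cauchy_convergent_iff convergent_def by blast
  then have "(\<lambda>n. (norm (x - v n))\<^sup>2) \<longlonglongrightarrow> (norm (x - p))\<^sup>2" by (intro tendsto_intros)
  then have "(norm (x - p))\<^sup>2 = d" using lim LIMSEQ_unique by blast
  then have "dist x p \<le> dist x v" if "v \<in> V" for v
    using lower[OF that] by (simp add: dist_norm power2_le_imp_le)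
  moreover have "p \<in> V" using \<open>closed V\<close> in_V p closed_sequentially by blast
  ultimately show ?thesis by blast
qed

lemma closest_point_orthogonal:
  assumes "subspace V" "closed V" "p \<in> V" "\<forall>v\<in>V. dist x p \<le> dist x v" "v \<in> V"
  shows "(x - p) \<bullet> v = 0"
proof -
  have "(x - p) \<bullet> w \<le> 0" if "w \<in> V" for w
    using any_closest_point_dot[of V p "p + w" x] assms that
    by (simp add: subspace_imp_convex subspace_add)
  from this[of v] this[of "- v"] show ?thesis using assms by (simp add: subspace_neg)
qed

definition orth_proj :: "'h::{real_inner,banach} set \<Rightarrow> 'h \<Rightarrow> 'h" where
  "orth_proj V x = (SOME p. p \<in> V \<and> (\<forall>v\<in>V. (x - p) \<bullet> v = 0))"

context
  fixes V :: "'h::{real_inner,banach} set"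
  assumes V: "subspace V" "closed V"
begin

lemma orth_proj_in: "orth_proj V x \<in> V"
  and orth_proj_orthogonal: "v \<in> V \<Longrightarrow> (x - orth_proj V x) \<bullet> v = 0"
proof -
  obtain p where p: "p \<in> V" "\<forall>v\<in>V. dist x p \<le> dist x v"
    using Hilbert_closest_point_exists[of V x] V subspace_imp_convex subspace_0 by blast
  then have "\<exists>p. p \<in> V \<and> (\<forall>v\<in>V. (x - p) \<bullet> v = 0)" using closest_point_orthogonal[OF V] by blast
  then have "orth_proj V x \<in> V \<and> (\<forall>v\<in>V. (x - orth_proj V x) \<bullet> v = 0)"
    unfolding orth_proj_def by (rule someI_ex)
  then show "orth_proj V x \<in> V" "v \<in> V \<Longrightarrow> (x - orth_proj V x) \<bullet> v = 0" by auto
qed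

lemma orth_proj_inner: "v \<in> V \<Longrightarrow> orth_proj V x \<bullet> v = x \<bullet> v"
  using orth_proj_orthogonal[of v x] by (simp add: inner_diff_left)

lemma orth_proj_unique:
  assumes "p \<in> V" "\<And>v. v \<in> V \<Longrightarrow> p \<bullet> v = x \<bullet> v"
  shows "orth_proj V x = p"
proof -
  let ?d = "orth_proj V x - p"
  have "?d \<in> V" using V orth_proj_in assms by (simp add: subspace_diff)
  then have "?d \<bullet> ?d = 0" using orth_proj_inner[of ?d x] assms(2)[of ?d] by (simp add: inner_diff_left)
  then show ?thesis by simp
qed

lemma linear_orth_proj: "linear (orth_proj V)"
proof (rule linearI)
  show "orth_proj V (x + y) = orth_proj V x + orth_proj V y" for x y
    using V by (intro orth_proj_unique) (auto simp: subspace_add orth_proj_in inner_add_left orth_proj_inner)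
  show "orth_proj V (c *\<^sub>R x) = c *\<^sub>R orth_proj V x" for c x
    using V by (intro orth_proj_unique) (auto simp: subspace_scale orth_proj_in orth_proj_inner)
qed

lemma orth_proj_symmetric: "orth_proj V x \<bullet> y = x \<bullet> orth_proj V y"
  using orth_proj_inner[of "orth_proj V y" x] orth_proj_inner[of "orth_proj V x" y] orth_proj_in
  by (metis inner_commute)

lemma norm_orth_proj: "(norm (orth_proj V x))\<^sup>2 = orth_proj V x \<bullet> x"
  using orth_proj_inner[of "orth_proj V x" x] orth_proj_in by (simp add: power2_norm_eq_inner inner_commute)

lemma orth_proj_maximizes:
  assumes "v \<in> V" shows "2 * (x \<bullet> v) - (norm v)\<^sup>2 \<le> orth_proj V x \<bullet> x"
proof -
  have "0 \<le> (norm (orth_proj V x - v))\<^sup>2" by simp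
  also have "\<dots> = orth_proj V x \<bullet> orth_proj V x - 2 * (orth_proj V x \<bullet> v) + (norm v)\<^sup>2"
    unfolding power2_norm_eq_inner by (simp add: algebra_simps inner_commute)
  also have "\<dots> = orth_proj V x \<bullet> x - 2 * (x \<bullet> v) + (norm v)\<^sup>2"
    using orth_proj_inner[OF assms] norm_orth_proj by (simp add: power2_norm_eq_inner)
  finally show ?thesis by simp
qed

lemma orth_proj_closest:
  assumes "v \<in> V" shows "norm (x - orth_proj V x) \<le> norm (x - v)"
proof -
  have "(x - orth_proj V x) \<bullet> (orth_proj V x - v) = 0"
    using V assms by (intro orth_proj_orthogonal subspace_diff orth_proj_in)
  then have "(norm (x - v))\<^sup>2 = (norm (x - orth_proj V x))\<^sup>2 + (norm (orth_proj V x - v))\<^sup>2"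
    unfolding power2_norm_eq_inner by (simp add: inner_diff_left inner_diff_right inner_commute)
  then show ?thesis by (simp add: power2_le_imp_le)
qed

end

lemma orth_proj_nested:
  fixes V W :: "'h::{real_inner,banach} set"
  assumes "subspace V" "closed V" "subspace W" "closed W" "V \<subseteq> W"
  shows "orth_proj V (orth_proj W x) = orth_proj V x"
  using assms by (intro orth_proj_unique) (auto simp: orth_proj_in orth_proj_inner subset_iff)

lemma orth_proj_tendsto:
  fixes V :: "nat \<Rightarrow> 'h::{real_inner,banach} set"
  assumes V: "\<And>n. subspace (V n)" "\<And>n. closed (V n)" "incseq V"
    and W: "subspace W" "closed W" "W = closure (\<Union>n. V n)"
  shows "(\<lambda>n. orth_proj (V n) x) \<longlonglongrightarrow> orth_proj W x"
proof (rule metric_LIMSEQ_I)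
  fix e :: real assume "e > 0"
  have "orth_proj W x \<in> closure (\<Union>n. V n)" using orth_proj_in[OF W(1,2)] W(3) by simp
  then obtain v N where v: "v \<in> V N" "dist v (orth_proj W x) < e"
    using \<open>e > 0\<close> by (auto simp: closure_approachable)
  have "dist (orth_proj (V n) x) (orth_proj W x) < e" if "n \<ge> N" for n
  proof -
    have "V n \<subseteq> W" using W(3) closure_subset[of "\<Union>n. V n"] by blast
    then have "orth_proj (V n) (orth_proj W x) = orth_proj (V n) x"
      by (intro orth_proj_nested V W)
    moreover have "v \<in> V n" using v(1) incseqD[OF V(3) that] by blast
    ultimately have "dist (orth_proj W x) (orth_proj (V n) x) \<le> dist (orth_proj W x) v"
      using orth_proj_closest[OF V(1,2), of v n "orth_proj W x"] by (simp add: dist_norm)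
    then show ?thesis using v(2) by (simp add: dist_commute)
  qed
  then show "\<exists>N. \<forall>n\<ge>N. dist (orth_proj (V n) x) (orth_proj W x) < e" by blast
qed

section \<open>Compact positive operators\<close>

definition positive_op :: "('h::real_inner \<Rightarrow> 'h) \<Rightarrow> bool" where
  "positive_op A \<longleftrightarrow> linear A \<and> (\<forall>x y. A x \<bullet> y = x \<bullet> A y) \<and> (\<forall>x. 0 \<le> A x \<bullet> x)"

lemma positive_op_linear: "positive_op A \<Longrightarrow> linear A"
  and positive_op_symmetric: "positive_op A \<Longrightarrow> A x \<bullet> y = x \<bullet> A y"
  and positive_op_nonneg: "positive_op A \<Longrightarrow> 0 \<le> A x \<bullet> x"
  by (auto simp: positive_op_def)

lemma positive_op_Cauchy_Schwarz:
  assumes "positive_op A"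
  shows "(A x \<bullet> y)\<^sup>2 \<le> (A x \<bullet> x) * (A y \<bullet> y)"
proof -
  note lin = positive_op_linear[OF assms]
  have form: "0 \<le> A x \<bullet> x + 2 * t * (A x \<bullet> y) + t\<^sup>2 * (A y \<bullet> y)" for t
  proof -
    have "A y \<bullet> x = A x \<bullet> y" using positive_op_symmetric[OF assms, of y x] by (simp add: inner_commute)
    moreover have "0 \<le> A (x + t *\<^sub>R y) \<bullet> (x + t *\<^sub>R y)" by (rule positive_op_nonneg[OF assms])
    ultimately show ?thesis
      by (simp add: linear_add[OF lin] linear_cmul[OF lin] algebra_simps power2_eq_square)
  qed
  show ?thesis
  proof (cases "A y \<bullet> y = 0")
    case True
    have "A x \<bullet> y = 0"
    proof (rule ccontr)
      assume "A x \<bullet> y \<noteq> 0"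
      then show False
        using form[of "- (A x \<bullet> x + 1) / (2 * (A x \<bullet> y))"] True by (simp add: field_simps)
    qed
    then show ?thesis using True by simp
  next
    case False
    then have "A y \<bullet> y > 0" using positive_op_nonneg[OF assms, of y] by simp
    then show ?thesis
      using form[of "- (A x \<bullet> y) / (A y \<bullet> y)"] by (simp add: power2_eq_square field_simps)
  qed
qed

lemma positive_op_norm_sq_le:
  assumes "positive_op A" and form_le: "A (A x) \<bullet> A x \<le> c * (norm (A x))\<^sup>2"
  shows "(norm (A x))\<^sup>2 \<le> c * (A x \<bullet> x)"
proof (cases "A x = 0")
  case False
  have "(norm (A x))\<^sup>2 * (norm (A x))\<^sup>2 = (A x \<bullet> A x)\<^sup>2"
    by (simp add: dot_square_norm power2_eq_square)
  also have "\<dots> \<le> (A x \<bullet> x) * (A (A x) \<bullet> A x)" by (rule positive_op_Cauchy_Schwarz[OF assms(1)])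
  also have "\<dots> \<le> (A x \<bullet> x) * (c * (norm (A x))\<^sup>2)"
    using form_le positive_op_nonneg[OF assms(1)] by (intro mult_left_mono)
  also have "\<dots> = c * (A x \<bullet> x) * (norm (A x))\<^sup>2" by simp
  finally show ?thesis by (rule mult_right_le_imp_le) (use False in simp)
qed simp

lemma positive_op_norm_le:
  assumes "positive_op A" "c \<ge> 0" and invariant: "\<And>x. x \<in> W \<Longrightarrow> A x \<in> W"
    and form_le: "\<And>x. x \<in> W \<Longrightarrow> A x \<bullet> x \<le> c * (norm x)\<^sup>2" and x: "x \<in> W"
  shows "norm (A x) \<le> c * norm x"
proof (rule power2_le_imp_le)
  have "(norm (A x))\<^sup>2 \<le> c * (A x \<bullet> x)"
    by (rule positive_op_norm_sq_le[OF assms(1) form_le[OF invariant[OF x]]])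
  also have "\<dots> \<le> c * (c * (norm x)\<^sup>2)" using form_le[OF x] assms(2) by (rule mult_left_mono)
  also have "\<dots> = (c * norm x)\<^sup>2" by (simp add: power2_eq_square)
  finally show "(norm (A x))\<^sup>2 \<le> (c * norm x)\<^sup>2" .
qed (simp add: assms(2))

definition pos_contraction :: "('h::real_inner \<Rightarrow> 'h) \<Rightarrow> bool" where
  "pos_contraction A \<longleftrightarrow> positive_op A \<and> (\<forall>x. A x \<bullet> x \<le> (norm x)\<^sup>2)"

lemma pos_contraction_positive: "pos_contraction A \<Longrightarrow> positive_op A"
  and pos_contraction_inner_le: "pos_contraction A \<Longrightarrow> A x \<bullet> x \<le> (norm x)\<^sup>2"
  by (auto simp: pos_contraction_def)

lemma pos_contraction_linear: "pos_contraction A \<Longrightarrow> linear A"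
  and pos_contraction_symmetric: "pos_contraction A \<Longrightarrow> A x \<bullet> y = x \<bullet> A y"
  and pos_contraction_nonneg: "pos_contraction A \<Longrightarrow> 0 \<le> A x \<bullet> x"
  by (auto simp: pos_contraction_def positive_op_def)

lemma pos_contraction_norm:
  assumes "pos_contraction A" shows "norm (A x) \<le> norm x"
  using positive_op_norm_le[of A 1 UNIV x] assms by (simp add: pos_contraction_def)

lemma pos_contraction_norm_sq:
  assumes "pos_contraction A" shows "(norm (A x))\<^sup>2 \<le> A x \<bullet> x"
  using positive_op_norm_sq_le[OF pos_contraction_positive[OF assms], of x 1]
    pos_contraction_inner_le[OF assms, of "A x"] by simp

lemma pos_contractionI:
  assumes "linear A" "\<And>x y. A x \<bullet> y = x \<bullet> A y" and norm_sq: "\<And>x. (norm (A x))\<^sup>2 \<le> A x \<bullet> x"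
  shows "pos_contraction A"
proof -
  have nonneg: "0 \<le> A x \<bullet> x" for x using norm_sq[of x] zero_le_power2 order_trans by blast
  have "A x \<bullet> x \<le> (norm x)\<^sup>2" for x
  proof -
    have "norm (A x) * norm (A x) \<le> norm (A x) * norm x"
      using norm_sq[of x] norm_cauchy_schwarz[of "A x" x] by (simp add: power2_eq_square)
    then have "norm (A x) \<le> norm x" using mult_le_cancel_left_pos[of "norm (A x)"] by fastforce
    then show ?thesis
      using norm_cauchy_schwarz[of "A x" x] mult_right_mono[of "norm (A x)" "norm x" "norm x"]
      by (simp add: power2_eq_square)
  qed
  then show ?thesis using assms nonneg by (simp add: pos_contraction_def positive_op_def)
qed

lemma pos_contraction_bounded_linear:
  assumes "pos_contraction A" shows "bounded_linear A"
  using pos_contraction_linear[OF assms] pos_contraction_norm[OF assms]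
  by (intro bounded_linear_intro[where K = 1]) (auto simp: linear_add linear_cmul)

lemma pos_contraction_tendsto:
  "pos_contraction A \<Longrightarrow> (f \<longlongrightarrow> l) F \<Longrightarrow> ((\<lambda>x. A (f x)) \<longlongrightarrow> A l) F"
  by (rule bounded_linear.tendsto[OF pos_contraction_bounded_linear])

definition compact_op :: "('h::real_normed_vector \<Rightarrow> 'h) \<Rightarrow> bool" where
  "compact_op A \<longleftrightarrow> linear A \<and> compact (closure (A ` cball 0 1))"

lemma compact_op_bounded_linear:
  assumes "compact_op A" shows "bounded_linear A"
proof -
  have lin: "linear A" and "bounded (A ` cball 0 1)"
    using assms compact_imp_bounded bounded_subset[OF _ closure_subset] by (auto simp: compact_op_def)
  then obtain B where "\<forall>x\<in>cball 0 1. norm (A x) \<le> B" by (auto simp: bounded_iff)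
  then have bound: "norm (A x) \<le> B" if "norm x \<le> 1" for x using that by simp
  have "norm (A x) \<le> norm x * B" for x
  proof (cases "x = 0")
    case False
    then have "norm (A ((1 / norm x) *\<^sub>R x)) \<le> B" by (intro bound) simp
    then show ?thesis using False by (simp add: linear_cmul[OF lin] field_simps)
  qed (simp add: linear_0[OF lin])
  then show ?thesis
    by (intro bounded_linear_intro) (simp_all add: linear_add[OF lin] linear_cmul[OF lin])
qed

lemma compact_op_subsequence:
  assumes "compact_op A" "\<And>n. norm (x n) \<le> 1"
  obtains l r where "strict_mono (r::nat \<Rightarrow> nat)" "(\<lambda>n. A (x (r n))) \<longlonglongrightarrow> l"
proof -
  have "seq_compact (closure (A ` cball 0 1))"
    using assms(1) by (simp add: compact_op_def compact_imp_seq_compact)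
  moreover have "\<forall>n. A (x n) \<in> closure (A ` cball 0 1)"
    using assms(2) by (auto intro!: subsetD[OF closure_subset])
  ultimately obtain l r where "strict_mono (r::nat \<Rightarrow> nat)" "((\<lambda>n. A (x n)) \<circ> r) \<longlonglongrightarrow> l"
    by (rule seq_compactE)
  then show ?thesis by (intro that) (simp_all add: o_def)
qed

lemma compact_op_approximate_eigenvectors:
  fixes A :: "'h::real_normed_vector \<Rightarrow> 'h"
  assumes "compact_op A" "a \<noteq> 0" and unit: "\<And>n. norm (x n) = 1"
    and lim: "(\<lambda>n. A (x n) - a *\<^sub>R x n) \<longlonglongrightarrow> 0"
  obtains r \<psi> where "strict_mono (r::nat \<Rightarrow> nat)" "(\<lambda>n. x (r n)) \<longlonglongrightarrow> \<psi>" "norm \<psi> = 1" "A \<psi> = a *\<^sub>R \<psi>"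
proof -
  obtain l r where r: "strict_mono (r::nat \<Rightarrow> nat)" and image: "(\<lambda>n. A (x (r n))) \<longlonglongrightarrow> l"
    using compact_op_subsequence[OF assms(1), of x] unit by (metis order_refl)
  have "(\<lambda>n. A (x (r n)) - a *\<^sub>R x (r n)) \<longlonglongrightarrow> 0"
    using LIMSEQ_subseq_LIMSEQ[OF lim r] by (simp add: o_def)
  from tendsto_diff[OF image this] have "(\<lambda>n. a *\<^sub>R x (r n)) \<longlonglongrightarrow> l" by simp
  from tendsto_scaleR[OF tendsto_const this, of "1 / a"]
  have conv: "(\<lambda>n. x (r n)) \<longlonglongrightarrow> (1 / a) *\<^sub>R l" using assms(2) by simp
  have "(\<lambda>n. norm (x (r n))) \<longlonglongrightarrow> norm ((1 / a) *\<^sub>R l)" by (intro tendsto_norm conv)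
  then have norm_limit: "norm ((1 / a) *\<^sub>R l) = 1"
    using unit LIMSEQ_unique[OF tendsto_const] by fastforce
  have "A ((1 / a) *\<^sub>R l) = l"
    using bounded_linear.tendsto[OF compact_op_bounded_linear[OF assms(1)] conv] image LIMSEQ_unique by blast
  then have "A ((1 / a) *\<^sub>R l) = a *\<^sub>R ((1 / a) *\<^sub>R l)" using assms(2) by simp
  then show ?thesis by (rule that[OF r conv norm_limit])
qed

definition eigenspace :: "('h::real_vector \<Rightarrow> 'h) \<Rightarrow> real \<Rightarrow> 'h set" where
  "eigenspace A a = {x. A x = a *\<^sub>R x}"

lemma subspace_eigenspace: "linear A \<Longrightarrow> subspace (eigenspace A a)"
  by (auto simp: subspace_def eigenspace_def linear_0 linear_add linear_cmul scaleR_add_right scaleR_left_commute)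

lemma eigenspace_nontrivialE:
  assumes "linear A" "eigenspace A a \<noteq> {0}"
  obtains x where "A x = a *\<^sub>R x" "x \<noteq> 0"
  using assms subspace_0[OF subspace_eigenspace, of A a] by (auto simp: eigenspace_def)

lemma closed_eigenspace: "bounded_linear A \<Longrightarrow> closed (eigenspace A a)"
  unfolding eigenspace_def
  by (intro closed_Collect_eq linear_continuous_on continuous_intros)

lemma pos_contraction_eigenvalue_le_1:
  assumes "pos_contraction A" "A x = a *\<^sub>R x" "x \<noteq> 0" shows "a \<le> 1"
  using pos_contraction_inner_le[OF assms(1), of x] assms(2,3) by (simp add: power2_norm_eq_inner)

lemma eigenvectors_orthogonal:
  assumes "positive_op A" "A x = a *\<^sub>R x" "A y = b *\<^sub>R y" "a \<noteq> b"
  shows "x \<bullet> y = 0"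
  using positive_op_symmetric[OF assms(1), of x y] assms(2-4) by simp

lemma rayleigh_residual:
  assumes "norm (A x) \<le> M" "norm x = 1"
  shows "(norm (A x - M *\<^sub>R x))\<^sup>2 \<le> 2 * M * (M - A x \<bullet> x)"
proof -
  have "(norm (A x))\<^sup>2 \<le> M\<^sup>2" using assms(1) by (simp add: power_mono)
  moreover have "(norm (A x - M *\<^sub>R x))\<^sup>2 = (norm (A x))\<^sup>2 - 2 * M * (A x \<bullet> x) + M\<^sup>2 * (norm x)\<^sup>2"
    unfolding power2_norm_eq_inner by (simp add: algebra_simps inner_commute power2_eq_square)
  ultimately show ?thesis using assms(2) by (simp add: power2_eq_square algebra_simps)
qed

lemma positive_op_rayleigh_supremum:
  assumes A: "positive_op A" "bounded_linear A" and W: "subspace W" "\<And>x. x \<in> W \<Longrightarrow> A x \<in> W"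
    and z: "z \<in> W" "z \<noteq> 0"
  obtains M x where "M \<ge> 0" "\<forall>y\<in>W. norm (A y) \<le> M * norm y"
    "\<forall>n. x n \<in> W \<and> norm (x n) = 1 \<and> M - inverse (real (Suc n)) < A (x n) \<bullet> x n"
proof -
  note lin = positive_op_linear[OF A(1)]
  define S where "S = {x \<in> W. norm x = 1}"
  define M where "M = (SUP x\<in>S. A x \<bullet> x)"
  have normalized: "(1 / norm x) *\<^sub>R x \<in> S" if "x \<in> W" "x \<noteq> 0" for x
    using W(1) that by (simp add: S_def subspace_scale)
  then have "S \<noteq> {}" using z by blast
  obtain B where "\<And>x. norm (A x) \<le> norm x * B" using bounded_linear.bounded[OF A(2)] by blast
  then have "A x \<bullet> x \<le> B" if "x \<in> S" for x
    using that norm_cauchy_schwarz[of "A x" x] by (fastforce simp: S_def intro: order_trans)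
  then have bdd: "bdd_above ((\<lambda>x. A x \<bullet> x) ` S)" by (rule bdd_aboveI2)
  have S_le: "A x \<bullet> x \<le> M" if "x \<in> S" for x unfolding M_def using that bdd by (rule cSUP_upper)
  then have "M \<ge> 0" using \<open>S \<noteq> {}\<close> positive_op_nonneg[OF A(1)] by (meson ex_in_conv order_trans)
  have W_le: "A x \<bullet> x \<le> M * (norm x)\<^sup>2" if "x \<in> W" for x
  proof (cases "x = 0")
    case False
    from S_le[OF normalized[OF that this]] show ?thesis
      using False by (simp add: linear_cmul[OF lin] power2_eq_square field_simps)
  qed (simp add: linear_0[OF lin])
  have norm_le: "norm (A x) \<le> M * norm x" if "x \<in> W" for x
    by (rule positive_op_norm_le[OF A(1) \<open>M \<ge> 0\<close> W(2) W_le that])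
  have "\<exists>x\<in>S. M - inverse (real (Suc n)) < A x \<bullet> x" for n
    using less_cSUP_iff[OF \<open>S \<noteq> {}\<close> bdd, of "M - inverse (real (Suc n))"] by (simp add: M_def)
  then obtain x where x: "\<And>n. x n \<in> S" "\<And>n. M - inverse (real (Suc n)) < A (x n) \<bullet> x n" by metis
  have "x n \<in> W \<and> norm (x n) = 1 \<and> M - inverse (real (Suc n)) < A (x n) \<bullet> x n" for n
    using x(1)[of n] x(2)[of n] by (simp add: S_def)
  with \<open>M \<ge> 0\<close> norm_le show ?thesis by (intro that[of M x] ballI allI)
qed

text \<open>The supremum of the Rayleigh quotient on the invariant subspace is attained, and at an eigenvector.\<close>

lemma compact_positive_eigenvector_in:
  fixes A :: "'h::real_inner \<Rightarrow> 'h"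
  assumes A: "positive_op A" "compact_op A" and W: "subspace W" "closed W" "\<And>x. x \<in> W \<Longrightarrow> A x \<in> W"
    and "\<epsilon> \<ge> 0" and z: "z \<in> W" "\<epsilon> * norm z < norm (A z)"
  shows "\<exists>\<psi>\<in>W. \<exists>a>\<epsilon>. norm \<psi> = 1 \<and> A \<psi> = a *\<^sub>R \<psi>"
proof -
  have "z \<noteq> 0" using z(2) linear_0[OF positive_op_linear[OF A(1)]] by auto
  obtain M x where M: "M \<ge> 0" "\<forall>y\<in>W. norm (A y) \<le> M * norm y"
    and maximizing: "\<forall>n. x n \<in> W \<and> norm (x n) = 1 \<and> M - inverse (real (Suc n)) < A (x n) \<bullet> x n"
    by (rule positive_op_rayleigh_supremum[OF A(1) compact_op_bounded_linear[OF A(2)] W(1,3) z(1) \<open>z \<noteq> 0\<close>])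
  have x: "x n \<in> W" "norm (x n) = 1" "M - inverse (real (Suc n)) < A (x n) \<bullet> x n" for n using maximizing by auto
  have "\<epsilon> * norm z < M * norm z" by (rule less_le_trans[OF z(2) M(2)[rule_format, OF z(1)]])
  then have "M > \<epsilon>" using \<open>z \<noteq> 0\<close> by simp
  have "(\<lambda>n. A (x n) - M *\<^sub>R x n) \<longlonglongrightarrow> 0"
  proof (rule Lim_null_comparison)
    have "norm (A (x n) - M *\<^sub>R x n) \<le> sqrt (2 * M * inverse (real (Suc n)))" for n
    proof (rule real_le_rsqrt)
      have "(norm (A (x n) - M *\<^sub>R x n))\<^sup>2 \<le> 2 * M * (M - A (x n) \<bullet> x n)"
        using M(2)[rule_format, OF x(1)[of n]] x(2)[of n] by (intro rayleigh_residual) auto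
      also have "\<dots> \<le> 2 * M * inverse (real (Suc n))"
        using x(3)[of n] M(1) by (intro mult_left_mono) auto
      finally show "(norm (A (x n) - M *\<^sub>R x n))\<^sup>2 \<le> 2 * M * inverse (real (Suc n))" .
    qed
    then show "\<forall>\<^sub>F n in sequentially. norm (A (x n) - M *\<^sub>R x n) \<le> sqrt (2 * M * inverse (real (Suc n)))"
      by simp
    show "(\<lambda>n. sqrt (2 * M * inverse (real (Suc n)))) \<longlonglongrightarrow> 0"
      using tendsto_real_sqrt[OF tendsto_mult[OF tendsto_const LIMSEQ_inverse_real_of_nat, of "2 * M"]] by simp
  qed
  moreover have "M \<noteq> 0" using \<open>M > \<epsilon>\<close> \<open>\<epsilon> \<ge> 0\<close> by simp
  ultimately obtain r \<psi> where \<psi>: "(\<lambda>n. x (r n)) \<longlonglongrightarrow> \<psi>" "norm \<psi> = 1" "A \<psi> = M *\<^sub>R \<psi>"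
    using compact_op_approximate_eigenvectors[OF A(2), of M x] x(2) by blast
  have "\<psi> \<in> W" using closed_sequentially[OF W(2) _ \<psi>(1)] x(1) by simp
  then show ?thesis using \<psi>(2,3) \<open>M > \<epsilon>\<close> by blast
qed

definition orthonormal :: "'h::real_inner set \<Rightarrow> bool" where
  "orthonormal \<Phi> \<longleftrightarrow> pairwise orthogonal \<Phi> \<and> (\<forall>\<phi>\<in>\<Phi>. norm \<phi> = 1)"

lemma orthonormal_norm: "orthonormal \<Phi> \<Longrightarrow> \<phi> \<in> \<Phi> \<Longrightarrow> norm \<phi> = 1"
  and orthonormal_inner: "orthonormal \<Phi> \<Longrightarrow> \<phi> \<in> \<Phi> \<Longrightarrow> \<psi> \<in> \<Phi> \<Longrightarrow> \<phi> \<bullet> \<psi> = (if \<phi> = \<psi> then 1 else 0)"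
  by (auto simp: orthonormal_def pairwise_def orthogonal_def norm_eq_1)

lemma orthonormal_insert:
  assumes "orthonormal \<Phi>" "norm \<psi> = 1" "\<And>\<phi>. \<phi> \<in> \<Phi> \<Longrightarrow> \<psi> \<bullet> \<phi> = 0"
  shows "orthonormal (insert \<psi> \<Phi>)"
  using assms by (auto simp: orthonormal_def pairwise_insert orthogonal_def inner_commute)

lemma orthonormal_subset: "orthonormal \<Phi> \<Longrightarrow> \<Psi> \<subseteq> \<Phi> \<Longrightarrow> orthonormal \<Psi>"
  by (auto simp: orthonormal_def pairwise_def)

lemma finite_span_orthonormal_basis:
  fixes B :: "'h::real_inner set"
  assumes "finite B"
  obtains \<Phi> where "finite \<Phi>" "orthonormal \<Phi>" "span \<Phi> = span B"
proof -
  obtain C where C: "finite C" "span C = span B" "pairwise orthogonal C"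
    using basis_orthogonal[OF assms] by blast
  define \<Phi> where "\<Phi> = (\<lambda>v. (1 / norm v) *\<^sub>R v) ` (C - {0})"
  have "orthonormal \<Phi>"
    using C(3) unfolding orthonormal_def \<Phi>_def
    by (auto simp: pairwise_def orthogonal_def orthogonal_clauses)
  moreover have "span \<Phi> = span C"
  proof
    show "span \<Phi> \<subseteq> span C"
      by (rule span_minimal) (auto simp: \<Phi>_def intro: span_scale span_base)
    have "v \<in> span \<Phi>" if "v \<in> C" for v
    proof (cases "v = 0")
      case False
      then have "(1 / norm v) *\<^sub>R v \<in> span \<Phi>" using that by (intro span_base) (auto simp: \<Phi>_def)
      then have "norm v *\<^sub>R ((1 / norm v) *\<^sub>R v) \<in> span \<Phi>" by (rule span_scale)
      then show ?thesis using False by simp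
    qed (simp add: span_zero)
    then show "span C \<subseteq> span \<Phi>" by (intro span_minimal) auto
  qed
  moreover have "finite \<Phi>" using C(1) by (simp add: \<Phi>_def)
  ultimately show ?thesis using C(2) by (intro that[of \<Phi>]) simp_all
qed

lemma orthonormal_sum_inner:
  assumes "finite \<Phi>" "orthonormal \<Phi>" "\<psi> \<in> \<Phi>"
  shows "(\<Sum>\<phi>\<in>\<Phi>. c \<phi> *\<^sub>R \<phi>) \<bullet> \<psi> = c \<psi>"
proof -
  have "(\<Sum>\<phi>\<in>\<Phi>. c \<phi> *\<^sub>R \<phi>) \<bullet> \<psi> = (\<Sum>\<phi>\<in>\<Phi>. if \<phi> = \<psi> then c \<psi> else 0)"
    unfolding inner_sum_left using assms(2,3) by (intro sum.cong) (auto simp: orthonormal_inner)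
  then show ?thesis using assms by simp
qed

lemma orthonormal_sum_norm:
  assumes "finite \<Phi>" "orthonormal \<Phi>"
  shows "(norm (\<Sum>\<phi>\<in>\<Phi>. c \<phi> *\<^sub>R \<phi>))\<^sup>2 = (\<Sum>\<phi>\<in>\<Phi>. (c \<phi>)\<^sup>2)"
  unfolding power2_norm_eq_inner inner_sum_right
  using orthonormal_sum_inner[OF assms] by (simp add: power2_eq_square)

definition fourier_sum :: "'h::real_inner set \<Rightarrow> 'h \<Rightarrow> 'h" where
  "fourier_sum \<Phi> x = (\<Sum>\<phi>\<in>\<Phi>. (x \<bullet> \<phi>) *\<^sub>R \<phi>)"

lemma fourier_sum_in_span: "fourier_sum \<Phi> x \<in> span \<Phi>"
  unfolding fourier_sum_def by (intro span_sum span_scale span_base)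

context
  fixes \<Phi> :: "'h::real_inner set"
  assumes \<Phi>: "finite \<Phi>" "orthonormal \<Phi>"
begin

lemma fourier_sum_residual: "\<psi> \<in> \<Phi> \<Longrightarrow> (x - fourier_sum \<Phi> x) \<bullet> \<psi> = 0"
  by (simp add: inner_diff_left fourier_sum_def orthonormal_sum_inner[OF \<Phi>])

lemma fourier_sum_residual_span: "y \<in> span \<Phi> \<Longrightarrow> (x - fourier_sum \<Phi> x) \<bullet> y = 0"
  using orthogonal_to_span[of y \<Phi> "x - fourier_sum \<Phi> x"] fourier_sum_residual
  by (auto simp: orthogonal_def)

lemma fourier_sum_pythagoras:
  "(norm x)\<^sup>2 = (norm (fourier_sum \<Phi> x))\<^sup>2 + (norm (x - fourier_sum \<Phi> x))\<^sup>2"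
  using fourier_sum_residual_span[OF fourier_sum_in_span, of x x]
  unfolding power2_norm_eq_inner by (simp add: algebra_simps inner_commute)

lemma norm_fourier_residual: "norm (x - fourier_sum \<Phi> x) \<le> norm x"
  by (rule power2_le_imp_le) (use fourier_sum_pythagoras[of x] in auto)

lemma fourier_sum_best_approx:
  assumes "y \<in> span \<Phi>" shows "norm (x - fourier_sum \<Phi> x) \<le> norm (x - y)"
proof -
  have "(x - fourier_sum \<Phi> x) \<bullet> (fourier_sum \<Phi> x - y) = 0"
    using assms by (intro fourier_sum_residual_span span_diff fourier_sum_in_span)
  then have "(norm (x - y))\<^sup>2 = (norm (x - fourier_sum \<Phi> x))\<^sup>2 + (norm (fourier_sum \<Phi> x - y))\<^sup>2"
    unfolding power2_norm_eq_inner by (simp add: inner_diff_left inner_diff_right inner_commute)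
  then show ?thesis by (simp add: power2_le_imp_le)
qed

end

lemma compact_op_orthonormal_eigenvectors_finite:
  assumes A: "compact_op A" and \<Phi>: "orthonormal \<Phi>"
    and eigen: "\<And>\<phi>. \<phi> \<in> \<Phi> \<Longrightarrow> A \<phi> = a \<phi> *\<^sub>R \<phi>" "\<And>\<phi>. \<phi> \<in> \<Phi> \<Longrightarrow> \<epsilon> \<le> a \<phi>" and "\<epsilon> > 0"
  shows "finite \<Phi>"
proof (rule ccontr)
  assume "infinite \<Phi>"
  then obtain x :: "nat \<Rightarrow> 'a" where x: "inj x" "range x \<subseteq> \<Phi>" using infinite_countable_subset by blast
  have "norm (x n) = 1" for n using orthonormal_norm[OF \<Phi>] x(2) by blast
  then have "norm (x n) \<le> 1" for n by simp
  then obtain l r where r: "strict_mono (r::nat \<Rightarrow> nat)" and "(\<lambda>n. A (x (r n))) \<longlonglongrightarrow> l"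
    by (rule compact_op_subsequence[OF A])
  then have "Cauchy (\<lambda>n. A (x (r n)))" by (simp add: LIMSEQ_imp_Cauchy)
  then obtain N where "\<And>m n. m \<ge> N \<Longrightarrow> n \<ge> N \<Longrightarrow> dist (A (x (r m))) (A (x (r n))) < \<epsilon>"
    using \<open>\<epsilon> > 0\<close> unfolding Cauchy_def by blast
  then have close: "dist (A (x (r N))) (A (x (r (Suc N)))) < \<epsilon>" by simp
  let ?u = "x (r N)" and ?v = "x (r (Suc N))"
  have "?u \<noteq> ?v" using x(1) r by (metis injD lessI less_irrefl strict_mono_less)
  moreover have in_\<Phi>: "?u \<in> \<Phi>" "?v \<in> \<Phi>" using x(2) by auto
  ultimately have "(norm (A ?u - A ?v))\<^sup>2 = (a ?u)\<^sup>2 + (a ?v)\<^sup>2"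
    unfolding power2_norm_eq_inner using eigen(1) \<Phi>
    by (simp add: inner_diff_left inner_diff_right power2_eq_square orthonormal_inner)
  moreover have "\<epsilon>\<^sup>2 \<le> (a ?u)\<^sup>2" using eigen(2)[OF in_\<Phi>(1)] \<open>\<epsilon> > 0\<close> by (intro power_mono) auto
  ultimately have "\<epsilon>\<^sup>2 \<le> (norm (A ?u - A ?v))\<^sup>2" by (simp add: add_increasing2)
  then have "\<epsilon> \<le> norm (A ?u - A ?v)" by (rule power2_le_imp_le) simp
  then show False using close by (simp add: dist_norm)
qed

definition eigen_truncation :: "('h::real_inner \<Rightarrow> 'h) \<Rightarrow> real \<Rightarrow> 'h set \<Rightarrow> ('h \<Rightarrow> real) \<Rightarrow> bool" where
  "eigen_truncation A \<epsilon> \<Phi> a \<longleftrightarrow> finite \<Phi> \<and> orthonormal \<Phi> \<and>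
     (\<forall>\<phi>\<in>\<Phi>. A \<phi> = a \<phi> *\<^sub>R \<phi> \<and> \<epsilon> \<le> a \<phi>) \<and>
     (\<forall>x. (\<forall>\<phi>\<in>\<Phi>. x \<bullet> \<phi> = 0) \<longrightarrow> norm (A x) \<le> \<epsilon> * norm x)"

lemma eigen_truncationD:
  assumes "eigen_truncation A \<epsilon> \<Phi> a"
  shows "finite \<Phi>" "orthonormal \<Phi>" "\<And>\<phi>. \<phi> \<in> \<Phi> \<Longrightarrow> A \<phi> = a \<phi> *\<^sub>R \<phi>" "\<And>\<phi>. \<phi> \<in> \<Phi> \<Longrightarrow> \<epsilon> \<le> a \<phi>"
    "\<And>x. (\<And>\<phi>. \<phi> \<in> \<Phi> \<Longrightarrow> x \<bullet> \<phi> = 0) \<Longrightarrow> norm (A x) \<le> \<epsilon> * norm x"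
  using assms by (auto simp: eigen_truncation_def)

lemma maximal_orthonormal_set_exists:
  obtains \<Phi> where "orthonormal \<Phi>" "\<forall>\<phi>\<in>\<Phi>. P \<phi>"
    "\<forall>\<psi>. norm \<psi> = 1 \<and> P \<psi> \<longrightarrow> (\<exists>\<phi>\<in>\<Phi>. \<psi> \<bullet> \<phi> \<noteq> 0)"
proof -
  define \<O> where "\<O> = {\<Phi>. orthonormal \<Phi> \<and> (\<forall>\<phi>\<in>\<Phi>. P \<phi>)}"
  have "\<exists>M\<in>\<O>. \<forall>X\<in>\<O>. M \<subseteq> X \<longrightarrow> X = M"
  proof (rule subset_Zorn')
    fix C assume "subset.chain \<O> C"
    then have sub: "C \<subseteq> \<O>" and chain: "\<And>X Y. X \<in> C \<Longrightarrow> Y \<in> C \<Longrightarrow> X \<subseteq> Y \<or> Y \<subseteq> X"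
      by (simp_all add: subset_chain_def)
    have "pairwise orthogonal X" if "X \<in> C" for X using sub that by (auto simp: \<O>_def orthonormal_def)
    moreover have "chain\<^sub>\<subseteq> C" unfolding chain_subset_def using chain by blast
    ultimately have "pairwise orthogonal (\<Union>C)" by (rule pairwise_chain_Union)
    then show "\<Union>C \<in> \<O>" using sub by (auto simp: \<O>_def orthonormal_def)
  qed
  then obtain \<Phi> where \<Phi>: "\<Phi> \<in> \<O>" and maximal: "\<forall>X\<in>\<O>. \<Phi> \<subseteq> X \<longrightarrow> X = \<Phi>" by (rule bexE)
  show ?thesis
  proof (rule that)
    show "orthonormal \<Phi>" "\<forall>\<phi>\<in>\<Phi>. P \<phi>" using \<Phi> by (simp_all add: \<O>_def)
    show "\<forall>\<psi>. norm \<psi> = 1 \<and> P \<psi> \<longrightarrow> (\<exists>\<phi>\<in>\<Phi>. \<psi> \<bullet> \<phi> \<noteq> 0)"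
    proof (rule ccontr)
      assume "\<not> ?thesis"
      then obtain \<psi> where \<psi>: "norm \<psi> = 1" "P \<psi>" "\<forall>\<phi>\<in>\<Phi>. \<psi> \<bullet> \<phi> = 0" by blast
      have "insert \<psi> \<Phi> \<in> \<O>" using \<Phi> \<psi> by (simp add: \<O>_def orthonormal_insert)
      then have "\<psi> \<in> \<Phi>" using maximal by (metis insertI1 subset_insertI)
      then show False using \<psi>(1,3) by force
    qed
  qed
qed

lemma eigen_truncation_exists:
  fixes A :: "'h::real_inner \<Rightarrow> 'h"
  assumes A: "positive_op A" "compact_op A" and "\<epsilon> > 0"
  obtains \<Phi> a where "eigen_truncation A \<epsilon> \<Phi> a"
proof -
  define P where "P \<phi> \<longleftrightarrow> (\<exists>a\<ge>\<epsilon>. A \<phi> = a *\<^sub>R \<phi>)" for \<phi>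
  obtain \<Phi> where \<Phi>: "orthonormal \<Phi>" "\<forall>\<phi>\<in>\<Phi>. P \<phi>"
    and maximal: "\<forall>\<psi>. norm \<psi> = 1 \<and> P \<psi> \<longrightarrow> (\<exists>\<phi>\<in>\<Phi>. \<psi> \<bullet> \<phi> \<noteq> 0)"
    by (rule maximal_orthonormal_set_exists[of P])
  obtain a where eigen: "\<And>\<phi>. \<phi> \<in> \<Phi> \<Longrightarrow> A \<phi> = a \<phi> *\<^sub>R \<phi>" "\<And>\<phi>. \<phi> \<in> \<Phi> \<Longrightarrow> \<epsilon> \<le> a \<phi>"
    using \<Phi>(2) unfolding P_def by metis
  define W where "W = {x. \<forall>\<phi>\<in>\<Phi>. x \<bullet> \<phi> = 0}"
  have "subspace W" by (auto simp: W_def subspace_def inner_add_left)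
  moreover have "closed W"
  proof -
    have "W = (\<Inter>\<phi>\<in>\<Phi>. {x. x \<bullet> \<phi> = 0})" by (auto simp: W_def)
    then show ?thesis by (simp add: closed_INT closed_Collect_eq continuous_intros)
  qed
  moreover have "A x \<in> W" if "x \<in> W" for x
    using that eigen(1) unfolding W_def by (simp add: positive_op_symmetric[OF A(1), of x])
  ultimately have new: "\<exists>\<psi>\<in>W. \<exists>a>\<epsilon>. norm \<psi> = 1 \<and> A \<psi> = a *\<^sub>R \<psi>" if "x \<in> W" "\<epsilon> * norm x < norm (A x)" for x
    using compact_positive_eigenvector_in[OF A, of W \<epsilon> x] that \<open>\<epsilon> > 0\<close> by auto
  have "norm (A x) \<le> \<epsilon> * norm x" if "x \<in> W" for x
  proof (rule ccontr)
    assume "\<not> norm (A x) \<le> \<epsilon> * norm x"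
    with \<open>x \<in> W\<close> obtain \<psi> a where "\<psi> \<in> W" "\<epsilon> < a" "norm \<psi> = 1" "A \<psi> = a *\<^sub>R \<psi>"
      using new[of x] by auto
    moreover from this have "P \<psi>" unfolding P_def by (intro exI[of _ a]) simp
    ultimately show False using maximal by (auto simp: W_def)
  qed
  moreover have "finite \<Phi>"
    by (rule compact_op_orthonormal_eigenvectors_finite[OF A(2) \<Phi>(1) eigen \<open>\<epsilon> > 0\<close>])
  ultimately show ?thesis
    using \<Phi>(1) eigen by (intro that[of \<Phi> a]) (auto simp: eigen_truncation_def W_def)
qed

lemma eigen_truncation_range_approx:
  assumes "linear A" and T: "eigen_truncation A \<epsilon> \<Phi> a" and "\<epsilon> \<ge> 0"
  shows "\<exists>h\<in>span \<Phi>. norm (A x - h) \<le> \<epsilon> * norm x"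
proof
  note \<Phi> = eigen_truncationD[OF T]
  let ?h = "A (fourier_sum \<Phi> x)"
  have "?h = (\<Sum>\<phi>\<in>\<Phi>. (x \<bullet> \<phi>) *\<^sub>R (a \<phi> *\<^sub>R \<phi>))"
    unfolding fourier_sum_def linear_sum[OF assms(1)]
    using \<Phi>(3) by (intro sum.cong) (auto simp: linear_cmul[OF assms(1)])
  then show "?h \<in> span \<Phi>" by (simp add: span_sum span_scale span_base)
  have "norm (A x - ?h) = norm (A (x - fourier_sum \<Phi> x))" by (simp add: linear_diff[OF assms(1)])
  also have "\<dots> \<le> \<epsilon> * norm (x - fourier_sum \<Phi> x)"
    by (intro \<Phi>(5) fourier_sum_residual[OF \<Phi>(1,2)])
  also have "\<dots> \<le> \<epsilon> * norm x" by (intro mult_left_mono norm_fourier_residual[OF \<Phi>(1,2)] assms(3))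
  finally show "norm (A x - ?h) \<le> \<epsilon> * norm x" .
qed

lemma eigen_truncation_fourier_shift:
  assumes "linear A" and T: "eigen_truncation A \<epsilon> \<Phi> b"
  shows "A (fourier_sum \<Phi> u) - a *\<^sub>R fourier_sum \<Phi> u = (\<Sum>\<phi>\<in>\<Phi>. ((b \<phi> - a) * (u \<bullet> \<phi>)) *\<^sub>R \<phi>)"
  unfolding fourier_sum_def linear_sum[OF assms(1)] scaleR_sum_right sum_subtractf[symmetric]
  using eigen_truncationD(3)[OF T]
  by (intro sum.cong) (simp_all add: linear_cmul[OF assms(1)] algebra_simps)

text \<open>The components of \<open>u\<close> in \<open>span \<Phi>\<close> and in its orthogonal complement are both moved by at least
  the factor \<open>\<rho>\<close>, and \<open>A - a\<close> keeps them orthogonal.\<close>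

lemma eigen_truncation_shift_ge:
  assumes A: "positive_op A" and T: "eigen_truncation A \<epsilon> \<Phi> b" and \<rho>: "0 \<le> \<rho>" "\<rho> \<le> a - \<epsilon>" "0 \<le> a"
    and far: "\<And>\<phi>. \<phi> \<in> \<Phi> \<Longrightarrow> u \<bullet> \<phi> \<noteq> 0 \<Longrightarrow> \<rho> \<le> \<bar>b \<phi> - a\<bar>"
  shows "\<rho> * norm u \<le> norm (A u - a *\<^sub>R u)"
proof -
  note \<Phi> = eigen_truncationD[OF T] and lin = positive_op_linear[OF A]
  let ?p = "fourier_sum \<Phi> u"
  let ?y = "u - ?p" and ?Tp = "A ?p - a *\<^sub>R ?p"
  let ?Ty = "A ?y - a *\<^sub>R ?y"
  note shift = eigen_truncation_fourier_shift[OF lin T, of u a]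
  have "\<rho>\<^sup>2 * (norm ?p)\<^sup>2 = (\<Sum>\<phi>\<in>\<Phi>. \<rho>\<^sup>2 * (u \<bullet> \<phi>)\<^sup>2)"
    unfolding fourier_sum_def orthonormal_sum_norm[OF \<Phi>(1,2)] by (simp add: sum_distrib_left)
  also have "\<dots> \<le> (\<Sum>\<phi>\<in>\<Phi>. (b \<phi> - a)\<^sup>2 * (u \<bullet> \<phi>)\<^sup>2)"
  proof (rule sum_mono)
    show "\<rho>\<^sup>2 * (u \<bullet> \<phi>)\<^sup>2 \<le> (b \<phi> - a)\<^sup>2 * (u \<bullet> \<phi>)\<^sup>2" if "\<phi> \<in> \<Phi>" for \<phi>
      using power_mono[OF far[OF that] \<rho>(1), of 2] by (cases "u \<bullet> \<phi> = 0") (auto intro: mult_right_mono)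
  qed
  also have "\<dots> = (norm ?Tp)\<^sup>2"
    unfolding shift orthonormal_sum_norm[OF \<Phi>(1,2)] by (simp add: power_mult_distrib)
  finally have span_part: "\<rho>\<^sup>2 * (norm ?p)\<^sup>2 \<le> (norm ?Tp)\<^sup>2" .
  have residual: "?y \<bullet> \<phi> = 0" if "\<phi> \<in> \<Phi>" for \<phi> by (rule fourier_sum_residual[OF \<Phi>(1,2) that])
  have "\<rho> * norm ?y \<le> a * norm ?y - \<epsilon> * norm ?y"
    using mult_right_mono[OF \<rho>(2), of "norm ?y"] by (simp add: left_diff_distrib)
  also have "\<dots> \<le> norm (a *\<^sub>R ?y) - norm (A ?y)" using \<Phi>(5)[of ?y] residual \<rho>(3) by simp
  also have "\<dots> \<le> norm ?Ty" by (metis norm_minus_commute norm_triangle_ineq2)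
  finally have "(\<rho> * norm ?y)\<^sup>2 \<le> (norm ?Ty)\<^sup>2" using \<rho>(1) by (intro power_mono) auto
  then have complement_part: "\<rho>\<^sup>2 * (norm ?y)\<^sup>2 \<le> (norm ?Ty)\<^sup>2" by (simp add: power_mult_distrib)
  have "\<phi> \<bullet> ?Ty = 0" if "\<phi> \<in> \<Phi>" for \<phi>
    using residual[OF that] positive_op_symmetric[OF A, of \<phi> ?y] \<Phi>(3)[OF that]
    by (simp add: inner_diff_right inner_commute)
  then have "?Tp \<bullet> ?Ty = 0" unfolding shift by (simp add: inner_sum_left)
  moreover have "A u - a *\<^sub>R u = ?Tp + ?Ty" by (simp add: linear_diff[OF lin] algebra_simps)
  ultimately have "(norm (A u - a *\<^sub>R u))\<^sup>2 = (norm ?Tp)\<^sup>2 + (norm ?Ty)\<^sup>2"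
    by (simp add: norm_add_Pythagorean orthogonal_def)
  then have "(\<rho> * norm u)\<^sup>2 \<le> (norm (A u - a *\<^sub>R u))\<^sup>2"
    using span_part complement_part fourier_sum_pythagoras[OF \<Phi>(1,2), of u]
    by (simp add: power_mult_distrib distrib_left)
  then show ?thesis by (rule power2_le_imp_le) simp
qed

lemma eigenspace_subset_span:
  assumes A: "positive_op A" and T: "eigen_truncation A \<epsilon> \<Phi> b" and "0 \<le> \<epsilon>" "\<epsilon> < a"
  shows "eigenspace A a \<subseteq> span {\<phi>\<in>\<Phi>. b \<phi> = a}"
proof
  note \<Phi> = eigen_truncationD[OF T] and E = subspace_eigenspace[OF positive_op_linear[OF A], of a]
  fix x assume x: "x \<in> eigenspace A a"
  let ?\<Psi> = "{\<phi>\<in>\<Phi>. b \<phi> = a}"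
  have \<Psi>: "finite ?\<Psi>" "orthonormal ?\<Psi>" using \<Phi>(1,2) by (auto intro: orthonormal_subset)
  let ?y = "x - fourier_sum ?\<Psi> x"
  have "fourier_sum ?\<Psi> x \<in> eigenspace A a"
    unfolding fourier_sum_def using \<Phi>(3) by (intro subspace_sum[OF E] subspace_scale[OF E]) (auto simp: eigenspace_def)
  then have y: "A ?y = a *\<^sub>R ?y" using subspace_diff[OF E x] by (simp add: eigenspace_def)
  have "?y \<bullet> \<phi> = 0" if "\<phi> \<in> \<Phi>" for \<phi>
    using fourier_sum_residual[OF \<Psi>, of \<phi> x] eigenvectors_orthogonal[OF A y \<Phi>(3)[OF that]] that by auto
  then have "norm (A ?y) \<le> \<epsilon> * norm ?y" by (rule \<Phi>(5))
  then have "?y = 0" using y assms(3,4) by (simp add: mult_le_cancel_right)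
  then show "x \<in> span ?\<Psi>" using fourier_sum_in_span[of ?\<Psi> x] by simp
qed

context
  fixes A :: "'h::real_inner \<Rightarrow> 'h"
  assumes A: "positive_op A" "compact_op A"
begin

lemma eigenspace_finite_basis:
  assumes "a > 0"
  obtains B where "finite B" "independent B" "span B = eigenspace A a" "card B = dim (eigenspace A a)"
proof -
  obtain \<Phi> b where T: "eigen_truncation A (a / 2) \<Phi> b" using eigen_truncation_exists[OF A half_gt_zero[OF assms]] .
  obtain B where B: "B \<subseteq> eigenspace A a" "independent B" "eigenspace A a \<subseteq> span B" "card B = dim (eigenspace A a)"
    by (rule real_vector.basis_exists)
  have "eigenspace A a \<subseteq> span {\<phi>\<in>\<Phi>. b \<phi> = a}" using assms by (intro eigenspace_subset_span[OF A(1) T]) auto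
  then have "finite B"
    using independent_span_bound[of "{\<phi>\<in>\<Phi>. b \<phi> = a}" B] B eigen_truncationD(1)[OF T] by auto
  moreover have "span B = eigenspace A a"
    using B span_minimal[OF B(1) subspace_eigenspace[OF positive_op_linear[OF A(1)]]] by auto
  ultimately show ?thesis using that B(2,4) by blast
qed

lemma countable_eigenvalues: "countable {a. a > 0 \<and> eigenspace A a \<noteq> {0}}"
proof -
  have "finite {a. a > inverse (real (Suc n)) \<and> eigenspace A a \<noteq> {0}}" for n
  proof -
    have "0 < inverse (real (Suc n))" by simp
    then obtain \<Phi> b where T: "eigen_truncation A (inverse (real (Suc n))) \<Phi> b"
      using eigen_truncation_exists[OF A] by blast
    have "a \<in> b ` \<Phi>" if a: "a > inverse (real (Suc n))" "eigenspace A a \<noteq> {0}" for a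
    proof (rule ccontr)
      assume "a \<notin> b ` \<Phi>"
      then have "{\<phi>\<in>\<Phi>. b \<phi> = a} = {}" by auto
      moreover have "eigenspace A a \<subseteq> span {\<phi>\<in>\<Phi>. b \<phi> = a}" by (rule eigenspace_subset_span[OF A(1) T _ a(1)]) simp
      ultimately have "eigenspace A a \<subseteq> {0}" by (simp only: span_empty)
      then show False using a(2) subspace_0[OF subspace_eigenspace[OF positive_op_linear[OF A(1)]]] by blast
    qed
    then have "{a. a > inverse (real (Suc n)) \<and> eigenspace A a \<noteq> {0}} \<subseteq> b ` \<Phi>" by blast
    then show ?thesis by (rule finite_surj[OF eigen_truncationD(1)[OF T]])
  qed
  moreover have "{a. a > 0 \<and> eigenspace A a \<noteq> {0}}
      \<subseteq> (\<Union>n. {a. a > inverse (real (Suc n)) \<and> eigenspace A a \<noteq> {0}})"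
    using reals_Archimedean by auto
  ultimately show ?thesis
    by (intro countable_subset[OF \<open>_ \<subseteq> _\<close>] countable_UN) (auto intro: countable_finite)
qed

lemma compact_positive_eigenvalue_exists:
  assumes "A x \<noteq> 0" shows "\<exists>a>0. eigenspace A a \<noteq> {0}"
proof -
  obtain \<psi> a where "norm \<psi> = 1" "A \<psi> = a *\<^sub>R \<psi>" "a > 0"
    using compact_positive_eigenvector_in[OF A, of UNIV 0 x] assms by auto
  then have "\<psi> \<in> eigenspace A a" "\<psi> \<noteq> 0" by (auto simp: eigenspace_def)
  then show ?thesis using \<open>a > 0\<close> by blast
qed

lemma compact_positive_spectral_gap:
  assumes "a > 0"
  obtains \<gamma> where "\<gamma> > 0" "\<And>x. (\<And>y. y \<in> eigenspace A a \<Longrightarrow> x \<bullet> y = 0) \<Longrightarrow> \<gamma> * norm x \<le> norm (A x - a *\<^sub>R x)"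
proof -
  obtain \<Phi> b where T: "eigen_truncation A (a / 2) \<Phi> b" using eigen_truncation_exists[OF A half_gt_zero[OF assms]] .
  note \<Phi> = eigen_truncationD[OF T]
  obtain \<rho> where \<rho>: "\<rho> > 0" "\<And>\<phi>. \<phi> \<in> \<Phi> \<Longrightarrow> b \<phi> \<noteq> a \<Longrightarrow> \<rho> \<le> \<bar>b \<phi> - a\<bar>"
    using finite_set_avoid[OF finite_imageI[OF \<Phi>(1), of b], of a] by (auto simp: dist_real_def abs_minus_commute)
  show ?thesis
  proof (rule that[of "min \<rho> (a / 2)"])
    fix x assume x: "\<And>y. y \<in> eigenspace A a \<Longrightarrow> x \<bullet> y = 0"
    show "min \<rho> (a / 2) * norm x \<le> norm (A x - a *\<^sub>R x)"
    proof (rule eigen_truncation_shift_ge[OF A(1) T])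
      show "min \<rho> (a / 2) \<le> \<bar>b \<phi> - a\<bar>" if "\<phi> \<in> \<Phi>" "x \<bullet> \<phi> \<noteq> 0" for \<phi>
        using \<rho>(2)[OF that(1)] x[of \<phi>] that(2) \<Phi>(3)[OF that(1)] by (force simp: eigenspace_def)
    qed (use \<rho>(1) assms in auto)
  qed (use \<rho>(1) assms in simp)
qed

lemma approximate_eigenvector_eigenvalue:
  assumes \<delta>: "0 < \<delta>" "2 * \<delta> < a" and u: "norm (A u - a *\<^sub>R u) \<le> \<delta> * norm u" "u \<noteq> 0"
  shows "\<exists>b. \<bar>b - a\<bar> \<le> \<delta> \<and> eigenspace A b \<noteq> {0}"
proof (rule ccontr)
  assume none: "\<not> ?thesis"
  have "a / 2 > 0" using \<delta> by simp
  then obtain \<Phi> b where T: "eigen_truncation A (a / 2) \<Phi> b" using eigen_truncation_exists[OF A] by blast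
  note \<Phi> = eigen_truncationD[OF T]
  have far: "\<delta> < \<bar>b \<phi> - a\<bar>" if "\<phi> \<in> \<Phi>" for \<phi>
  proof -
    have "\<phi> \<in> eigenspace A (b \<phi>)" "\<phi> \<noteq> 0"
      using \<Phi>(3)[OF that] orthonormal_norm[OF \<Phi>(2) that] by (auto simp: eigenspace_def)
    then show ?thesis using none by (metis not_le singletonD)
  qed
  define \<rho> where "\<rho> = Min (insert (a / 2) ((\<lambda>\<phi>. \<bar>b \<phi> - a\<bar>) ` \<Phi>))"
  have "\<delta> < \<rho>" unfolding \<rho>_def using \<Phi>(1) far \<delta>(2) by simp
  have \<rho>_le: "\<rho> \<le> t" if "t \<in> insert (a / 2) ((\<lambda>\<phi>. \<bar>b \<phi> - a\<bar>) ` \<Phi>)" for t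
    unfolding \<rho>_def using \<Phi>(1) that by (intro Min_le) auto
  have "\<rho> * norm u \<le> norm (A u - a *\<^sub>R u)"
    by (rule eigen_truncation_shift_ge[OF A(1) T]) (use \<delta> \<open>\<delta> < \<rho>\<close> \<rho>_le \<rho>_le[of "a / 2"] in auto)
  then have "\<rho> * norm u \<le> \<delta> * norm u" using u(1) by linarith
  then show False using \<open>\<delta> < \<rho>\<close> u(2) by simp
qed

end

section \<open>Persistence of eigenvectors of minimal multiplicity\<close>

lemma orth_proj_onto_of_close:
  fixes E :: "'h::{real_inner,banach} set"
  assumes E: "subspace E" "closed E" and B: "finite B" "span B = E"
    and C: "independent C" "card B \<le> card C"
    and close: "\<And>x. x \<in> span C \<Longrightarrow> norm (x - orth_proj E x) \<le> \<theta> * norm x" and "\<theta> < 1"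
  shows "card C = card B" "E \<subseteq> orth_proj E ` span C"
proof -
  let ?P = "orth_proj E"
  have "x = 0" if "x \<in> span C" "?P x = 0" for x
  proof (rule ccontr)
    assume "x \<noteq> 0"
    then have "\<theta> * norm x < 1 * norm x" using \<open>\<theta> < 1\<close> by (intro mult_strict_right_mono) auto
    then show False using close[OF that(1)] that(2) by simp
  qed
  then have inj: "inj_on ?P (span C)"
    by (simp add: linear_injective_on_subspace_0[OF linear_orth_proj[OF E] subspace_span])
  then have ind: "independent (?P ` C)"
    by (rule linear_independent_injective_image[OF linear_orth_proj[OF E] C(1)])
  have card_image: "card (?P ` C) = card C" by (rule card_image[OF inj_on_subset[OF inj span_superset]])
  have "?P ` C \<subseteq> span B" using orth_proj_in[OF E] B(2) by auto
  then have fin: "finite (?P ` C)" and "card (?P ` C) \<le> card B"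
    using independent_span_bound[OF B(1) ind] by auto
  then show card_eq: "card C = card B" using card_image C(2) by simp
  have "u \<in> span (?P ` C)" if "u \<in> E" for u
  proof (rule ccontr)
    assume new: "u \<notin> span (?P ` C)"
    then have "independent (insert u (?P ` C))" using ind by (rule real_vector.independent_insertI)
    moreover have "insert u (?P ` C) \<subseteq> span B" using \<open>?P ` C \<subseteq> span B\<close> that B(2) by auto
    ultimately have "card (insert u (?P ` C)) \<le> card B" using independent_span_bound[OF B(1)] by blast
    moreover have "u \<notin> ?P ` C" using new span_base[of u "?P ` C"] by auto
    ultimately show False using fin card_image card_eq by simp
  qed
  then show "E \<subseteq> ?P ` span C" unfolding linear_span_image[OF linear_orth_proj[OF E], symmetric] by blast
qed

lemma perturbed_eigenvector_near_eigenspace: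
  fixes K :: "'h::{real_inner,banach} \<Rightarrow> 'h"
  assumes K: "bounded_linear K"
    and gap: "\<And>x. (\<And>y. y \<in> eigenspace K a \<Longrightarrow> x \<bullet> y = 0) \<Longrightarrow> \<gamma> * norm x \<le> norm (K x - a *\<^sub>R x)"
    and perturbed: "L x = b *\<^sub>R x" "norm (L x - K x) \<le> \<delta> * norm x" "\<bar>b - a\<bar> \<le> \<delta>"
  shows "\<gamma> * norm (x - orth_proj (eigenspace K a) x) \<le> 2 * \<delta> * norm x"
proof -
  have lin: "linear K" using K by (rule bounded_linear.linear)
  note E = subspace_eigenspace[OF lin, of a] closed_eigenspace[OF K, of a]
  let ?y = "x - orth_proj (eigenspace K a) x"
  have "\<gamma> * norm ?y \<le> norm (K ?y - a *\<^sub>R ?y)" by (rule gap[OF orth_proj_orthogonal[OF E]])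
  also have "K ?y - a *\<^sub>R ?y = K x - a *\<^sub>R x"
    using orth_proj_in[OF E, of x] by (simp add: linear_diff[OF lin] eigenspace_def algebra_simps)
  also have "\<dots> = (K x - L x) + (b - a) *\<^sub>R x" using perturbed(1) by (simp add: algebra_simps)
  also have "norm \<dots> \<le> norm (K x - L x) + \<bar>b - a\<bar> * norm x"
    using norm_triangle_ineq[of "K x - L x" "(b - a) *\<^sub>R x"] by simp
  also have "\<dots> \<le> \<delta> * norm x + \<delta> * norm x"
    using perturbed(2,3) by (intro add_mono mult_right_mono) (auto simp: norm_minus_commute)
  finally show ?thesis by simp
qed

text \<open>If the eigenspace of the perturbed operator is not smaller than the unperturbed one, the orthogonal
  projection between the two nearby eigenspaces is onto, so a given eigenvector is followed by a
  nearby one.\<close>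

lemma close_eigenspace_follows:
  fixes K :: "'h::{real_inner,banach} \<Rightarrow> 'h"
  assumes K: "positive_op K" "compact_op K" "a > 0" and L: "positive_op L" "compact_op L" "b > 0"
    and close: "\<And>x. x \<in> eigenspace L b \<Longrightarrow> norm (x - orth_proj (eigenspace K a) x) \<le> \<theta> * norm x"
    and \<theta>: "0 \<le> \<theta>" "\<theta> \<le> 1/2"
    and dim_le: "dim (eigenspace K a) \<le> dim (eigenspace L b)" and u: "u \<in> eigenspace K a"
  shows "dim (eigenspace L b) = dim (eigenspace K a)"
    "\<exists>v. L v = b *\<^sub>R v \<and> norm (v - u) \<le> 2 * \<theta> * norm u"
proof -
  note E = subspace_eigenspace[OF positive_op_linear[OF K(1)], of a]
    closed_eigenspace[OF compact_op_bounded_linear[OF K(2)], of a]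
  obtain B where B: "finite B" "span B = eigenspace K a" "card B = dim (eigenspace K a)"
    by (rule eigenspace_finite_basis[OF K])
  obtain C where C: "independent C" "span C = eigenspace L b" "card C = dim (eigenspace L b)"
    by (rule eigenspace_finite_basis[OF L])
  have "card B \<le> card C" "\<theta> < 1" using dim_le B(3) C(3) \<theta>(2) by simp_all
  note onto = orth_proj_onto_of_close[OF E B(1,2) C(1) this(1) close[folded C(2)] this(2)]
  show "dim (eigenspace L b) = dim (eigenspace K a)" using onto(1) B(3) C(3) by simp
  obtain v where v: "v \<in> eigenspace L b" "u = orth_proj (eigenspace K a) v" using onto(2) u C(2) by blast
  have v_close: "norm (v - u) \<le> \<theta> * norm v" using close[OF v(1)] v(2) by simp
  also have "\<dots> \<le> (1/2) * norm v" using \<theta>(2) by (intro mult_right_mono) auto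
  finally have "norm v \<le> 2 * norm u" using norm_triangle_sub[of v u] by simp
  then have "\<theta> * norm v \<le> \<theta> * (2 * norm u)" using \<theta>(1) by (rule mult_left_mono)
  then have "norm (v - u) \<le> 2 * \<theta> * norm u" using v_close by simp
  then show "\<exists>v. L v = b *\<^sub>R v \<and> norm (v - u) \<le> 2 * \<theta> * norm u"
    using v(1) by (auto simp: eigenspace_def)
qed

lemma eigenvector_persistence:
  fixes K :: "'h::{real_inner,banach} \<Rightarrow> 'h"
  assumes K: "positive_op K" "compact_op K" and "a > 0" and nontrivial: "eigenspace K a \<noteq> {0}" and "\<eta> > 0"
  obtains \<delta> where "\<delta> > 0"
    "\<And>L u. \<lbrakk>positive_op L; compact_op L; \<And>x. norm (L x - K x) \<le> \<delta> * norm x;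
        \<forall>b>0. eigenspace L b \<noteq> {0} \<longrightarrow> dim (eigenspace K a) \<le> dim (eigenspace L b);
        u \<in> eigenspace K a\<rbrakk>
      \<Longrightarrow> \<exists>b v. b > 0 \<and> \<bar>b - a\<bar> \<le> \<eta> \<and> L v = b *\<^sub>R v \<and> norm (v - u) \<le> \<eta> * norm u \<and>
            dim (eigenspace L b) = dim (eigenspace K a)"
proof -
  obtain \<gamma> where \<gamma>: "\<gamma> > 0"
      "\<And>x. (\<And>y. y \<in> eigenspace K a \<Longrightarrow> x \<bullet> y = 0) \<Longrightarrow> \<gamma> * norm x \<le> norm (K x - a *\<^sub>R x)"
    using compact_positive_spectral_gap[OF K \<open>a > 0\<close>] by blast
  define \<theta> where "\<theta> = min (1/2) (\<eta>/2)"
  have \<theta>: "0 < \<theta>" "0 \<le> \<theta>" "\<theta> \<le> 1/2" "2 * \<theta> \<le> \<eta>" using \<open>\<eta> > 0\<close> by (auto simp: \<theta>_def)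
  define \<delta> where "\<delta> = min (min (a/4) \<eta>) (\<gamma> * \<theta> / 2)"
  have \<delta>: "\<delta> > 0" "\<delta> \<le> a/4" "\<delta> \<le> \<eta>" "2 * \<delta> \<le> \<gamma> * \<theta>"
    using \<open>a > 0\<close> \<gamma>(1) \<theta>(1) \<open>\<eta> > 0\<close> by (auto simp: \<delta>_def)
  show ?thesis
  proof (rule that[OF \<delta>(1)])
    fix L u
    assume L: "positive_op L" "compact_op L" and near: "\<And>x. norm (L x - K x) \<le> \<delta> * norm x"
      and minimal: "\<forall>b>0. eigenspace L b \<noteq> {0} \<longrightarrow> dim (eigenspace K a) \<le> dim (eigenspace L b)"
      and u: "u \<in> eigenspace K a"
    obtain w where w: "K w = a *\<^sub>R w" "w \<noteq> 0"
      by (rule eigenspace_nontrivialE[OF positive_op_linear[OF K(1)] nontrivial])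
    then obtain b where b: "\<bar>b - a\<bar> \<le> \<delta>" "eigenspace L b \<noteq> {0}"
      using approximate_eigenvector_eigenvalue[OF L, of \<delta> a w] near[of w] \<delta>(1,2) \<open>a > 0\<close> by auto
    then have "b > 0" using \<delta>(2) \<open>a > 0\<close> by linarith
    have close: "norm (x - orth_proj (eigenspace K a) x) \<le> \<theta> * norm x" if "x \<in> eigenspace L b" for x
    proof -
      have "\<gamma> * norm (x - orth_proj (eigenspace K a) x) \<le> 2 * \<delta> * norm x"
      proof (rule perturbed_eigenvector_near_eigenspace[OF compact_op_bounded_linear[OF K(2)]])
        show "L x = b *\<^sub>R x" using that by (simp add: eigenspace_def)
      qed (fact \<gamma>(2) near b(1))+
      also have "\<dots> \<le> (\<gamma> * \<theta>) * norm x" using \<delta>(4) by (rule mult_right_mono) simp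
      finally show ?thesis using \<gamma>(1) by simp
    qed
    note follows = close_eigenspace_follows[OF K \<open>a > 0\<close> L \<open>b > 0\<close> close \<theta>(2,3)
      minimal[rule_format, OF \<open>b > 0\<close> b(2)] u]
    obtain v where v: "L v = b *\<^sub>R v" "norm (v - u) \<le> 2 * \<theta> * norm u" using follows(2) by blast
    have "2 * \<theta> * norm u \<le> \<eta> * norm u" using \<theta>(4) by (rule mult_right_mono) simp
    then show "\<exists>b v. b > 0 \<and> \<bar>b - a\<bar> \<le> \<eta> \<and> L v = b *\<^sub>R v \<and> norm (v - u) \<le> \<eta> * norm u \<and>
            dim (eigenspace L b) = dim (eigenspace K a)"
      using \<open>b > 0\<close> order_trans[OF b(1) \<delta>(3)] v(1) order_trans[OF v(2)] follows(1) by (intro exI conjI)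
  qed
qed

section \<open>Polynomials of an operator\<close>

definition poly_op :: "('h::real_vector \<Rightarrow> 'h) \<Rightarrow> real poly \<Rightarrow> 'h \<Rightarrow> 'h" where
  "poly_op A p x = (\<Sum>i\<le>degree p. coeff p i *\<^sub>R (A ^^ i) x)"

lemma poly_op_0 [simp]: "poly_op A 0 x = 0"
  by (simp add: poly_op_def)

context
  fixes A :: "'h::real_vector \<Rightarrow> 'h"
  assumes lin: "linear A"
begin

lemma poly_op_pCons: "poly_op A (pCons c p) x = c *\<^sub>R x + A (poly_op A p x)"
proof (cases "p = 0")
  case False
  then have "poly_op A (pCons c p) x = c *\<^sub>R x + (\<Sum>i\<le>degree p. coeff p i *\<^sub>R A ((A ^^ i) x))"
    by (simp add: poly_op_def sum.atMost_Suc_shift del: sum.atMost_Suc)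
  then show ?thesis by (simp add: poly_op_def linear_sum[OF lin] linear_cmul[OF lin])
qed (simp add: poly_op_def linear_0[OF lin])

lemma poly_op_1: "poly_op A 1 x = x"
  by (simp add: one_pCons poly_op_pCons linear_0[OF lin])

lemma poly_op_add: "poly_op A (p + q) x = poly_op A p x + poly_op A q x"
  by (induction p q rule: poly_induct2) (auto simp: poly_op_pCons linear_add[OF lin] algebra_simps)

lemma poly_op_smult: "poly_op A (smult c p) x = c *\<^sub>R poly_op A p x"
  by (induction p) (auto simp: poly_op_pCons linear_cmul[OF lin] algebra_simps)

lemma poly_op_diff: "poly_op A (p - q) x = poly_op A p x - poly_op A q x"
  using poly_op_add[of p "smult (-1) q" x] poly_op_smult[of "-1" q x] by simp

lemma linear_poly_op: "linear (poly_op A p)"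
proof (rule linearI)
  show "poly_op A p (x + y) = poly_op A p x + poly_op A p y" for x y
    by (induction p) (auto simp: poly_op_pCons linear_add[OF lin] algebra_simps)
  show "poly_op A p (c *\<^sub>R x) = c *\<^sub>R poly_op A p x" for c x
    by (induction p) (auto simp: poly_op_pCons linear_cmul[OF lin] algebra_simps)
qed

lemma poly_op_commute: "poly_op A p (A x) = A (poly_op A p x)"
  by (induction p) (auto simp: poly_op_pCons linear_0[OF lin] linear_add[OF lin] linear_cmul[OF lin])

lemma poly_op_mult: "poly_op A (p * q) x = poly_op A p (poly_op A q x)"
  by (induction p) (auto simp: poly_op_pCons poly_op_add poly_op_smult)

end

lemma poly_op_symmetric:
  assumes "linear A" and symmetric: "\<And>x y. A x \<bullet> y = x \<bullet> A y"
  shows "poly_op A p x \<bullet> y = x \<bullet> poly_op A p y"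
proof (induction p arbitrary: y)
  case (pCons c p)
  have "A (poly_op A p x) \<bullet> y = x \<bullet> A (poly_op A p y)"
    using pCons(2)[of "A y"] symmetric[of "poly_op A p x" y] by (simp add: poly_op_commute[OF assms(1)])
  then show ?case by (simp add: poly_op_pCons[OF assms(1)] inner_add_left inner_add_right)
qed simp

lemma norm_diff_square_le:
  assumes symmetric: "\<And>x y. T x \<bullet> y = x \<bullet> T y" and contraction: "\<And>x. norm (T x) \<le> norm x"
  shows "norm (x - T (T x)) \<le> norm x"
proof -
  have "(norm (x - T (T x)))\<^sup>2 = (norm x)\<^sup>2 - 2 * (x \<bullet> T (T x)) + (norm (T (T x)))\<^sup>2"
    unfolding power2_norm_eq_inner by (simp add: algebra_simps inner_commute)
  also have "x \<bullet> T (T x) = (norm (T x))\<^sup>2" by (simp add: power2_norm_eq_inner flip: symmetric)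
  also have "(norm x)\<^sup>2 - 2 * (norm (T x))\<^sup>2 + (norm (T (T x)))\<^sup>2 \<le> (norm x)\<^sup>2"
    using power_mono[OF contraction[of "T x"] norm_ge_zero, of 2] zero_le_power2[of "norm (T x)"] by linarith
  finally show ?thesis by (rule power2_le_imp_le) simp
qed

definition bell_poly :: "real \<Rightarrow> real poly" where
  "bell_poly a = 1 - [:-a, 1:] * [:-a, 1:]"

lemma poly_bell_poly: "poly (bell_poly a) y = 1 - (y - a)\<^sup>2"
  by (simp add: bell_poly_def power2_eq_square algebra_simps)

definition notch_poly :: "real set \<Rightarrow> nat \<Rightarrow> real poly" where
  "notch_poly S M = (\<Prod>a\<in>S. 1 - bell_poly a ^ (2 * M))"

context
  fixes A :: "'h::real_inner \<Rightarrow> 'h"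
  assumes A: "pos_contraction A"
begin

private lemmas lin = pos_contraction_linear[OF A]
private lemmas symmetric = poly_op_symmetric[OF lin pos_contraction_symmetric[OF A]]

lemma norm_shift_le:
  assumes "0 \<le> a" "a \<le> 1"
  shows "norm (A x - a *\<^sub>R x) \<le> norm x"
proof -
  have "(norm (A x - a *\<^sub>R x))\<^sup>2 = (norm (A x))\<^sup>2 - 2 * a * (A x \<bullet> x) + a\<^sup>2 * (norm x)\<^sup>2"
    unfolding power2_norm_eq_inner by (simp add: algebra_simps inner_commute power2_eq_square)
  also have "\<dots> \<le> (1 - 2 * a) * (A x \<bullet> x) + a\<^sup>2 * (norm x)\<^sup>2"
    using pos_contraction_norm_sq[OF A, of x] by (simp add: algebra_simps)
  also have "\<dots> \<le> max 0 (1 - 2 * a) * (norm x)\<^sup>2 + a\<^sup>2 * (norm x)\<^sup>2"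
    using pos_contraction_nonneg[OF A, of x] pos_contraction_inner_le[OF A, of x]
    by (intro add_right_mono mult_mono) auto
  also have "\<dots> = (max 0 (1 - 2 * a) + a\<^sup>2) * (norm x)\<^sup>2" by (simp add: distrib_right)
  also have "\<dots> \<le> 1 * (norm x)\<^sup>2"
  proof (rule mult_right_mono)
    have "a\<^sup>2 \<le> 1" "(1 - a)\<^sup>2 \<le> 1" using assms by (simp_all add: power_le_one)
    moreover have "(1 - 2 * a) + a\<^sup>2 = (1 - a)\<^sup>2" by (simp add: power2_eq_square algebra_simps)
    ultimately show "max 0 (1 - 2 * a) + a\<^sup>2 \<le> 1" by auto
  qed simp
  finally show ?thesis by (intro power2_le_imp_le[of "norm _"]) auto
qed

lemma poly_op_shift: "poly_op A [:-a, 1:] x = A x - a *\<^sub>R x"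
  by (simp add: poly_op_pCons[OF lin] linear_0[OF lin])

lemma poly_op_bell: "poly_op A (bell_poly a) x = x - poly_op A [:-a, 1:] (poly_op A [:-a, 1:] x)"
  unfolding bell_poly_def by (simp only: poly_op_diff[OF lin] poly_op_1[OF lin] poly_op_mult[OF lin])

lemma norm_poly_op_bell:
  assumes "0 \<le> a" "a \<le> 1" shows "norm (poly_op A (bell_poly a) x) \<le> norm x"
  unfolding poly_op_bell
  by (rule norm_diff_square_le[OF symmetric]) (simp only: poly_op_shift norm_shift_le[OF assms])

lemma norm_poly_op_bell_power:
  assumes "0 \<le> a" "a \<le> 1" shows "norm (poly_op A (bell_poly a ^ k) x) \<le> norm x"
  by (induction k)
     (auto simp: poly_op_1[OF lin] poly_op_mult[OF lin] intro: order_trans[OF norm_poly_op_bell[OF assms]])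

lemma norm_poly_op_notch:
  assumes "0 \<le> a" "a \<le> 1" shows "norm (poly_op A (1 - bell_poly a ^ (2 * M)) x) \<le> norm x"
proof -
  have "poly_op A (1 - bell_poly a ^ (2 * M)) x
      = x - poly_op A (bell_poly a ^ M) (poly_op A (bell_poly a ^ M) x)"
    by (simp only: poly_op_diff[OF lin] poly_op_1[OF lin] mult_2 power_add poly_op_mult[OF lin])
  then show ?thesis using norm_diff_square_le[OF symmetric norm_poly_op_bell_power[OF assms]] by simp
qed

lemma norm_poly_op_notch_eigen:
  assumes a: "0 \<le> a" "a \<le> 1"
  shows "norm (poly_op A (1 - bell_poly a ^ k) x) \<le> real k * norm (A x - a *\<^sub>R x)"
proof (induction k)
  case (Suc k)
  have "1 - bell_poly a ^ Suc k = (1 - bell_poly a) + bell_poly a * (1 - bell_poly a ^ k)"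
    by (simp add: algebra_simps)
  then have "poly_op A (1 - bell_poly a ^ Suc k) x
      = poly_op A (1 - bell_poly a) x + poly_op A (bell_poly a) (poly_op A (1 - bell_poly a ^ k) x)"
    by (simp only: poly_op_add[OF lin] poly_op_mult[OF lin])
  also have "norm \<dots> \<le> norm (poly_op A (1 - bell_poly a) x) + norm (poly_op A (1 - bell_poly a ^ k) x)"
    by (intro order_trans[OF norm_triangle_ineq] add_left_mono norm_poly_op_bell a)
  also have "poly_op A (1 - bell_poly a) x = poly_op A [:-a, 1:] (poly_op A [:-a, 1:] x)"
    by (simp add: poly_op_diff[OF lin] poly_op_1[OF lin] poly_op_bell)
  also have "norm \<dots> \<le> norm (A x - a *\<^sub>R x)"
    unfolding poly_op_shift by (rule norm_shift_le[OF a])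
  also have "norm (A x - a *\<^sub>R x) + norm (poly_op A (1 - bell_poly a ^ k) x) \<le> real (Suc k) * norm (A x - a *\<^sub>R x)"
    using Suc by (simp add: algebra_simps)
  finally show ?case by simp
qed simp

lemma norm_notch_poly:
  assumes "finite S" "S \<subseteq> {0..1}"
  shows "norm (poly_op A (notch_poly S M) x) \<le> norm x"
  using assms
proof (induction S rule: finite_induct)
  case empty
  show ?case by (simp add: notch_poly_def poly_op_1[OF lin])
next
  case (insert a S)
  have "notch_poly (insert a S) M = (1 - bell_poly a ^ (2 * M)) * notch_poly S M"
    using insert by (simp add: notch_poly_def)
  then have "norm (poly_op A (notch_poly (insert a S) M) x) \<le> norm (poly_op A (notch_poly S M) x)"
    using insert.prems norm_poly_op_notch[of a M] by (simp add: poly_op_mult[OF lin])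
  then show ?case using insert by simp
qed

lemma norm_notch_poly_eigen:
  assumes S: "finite S" "S \<subseteq> {0..1}" "a \<in> S"
  shows "norm (poly_op A (notch_poly S M) x) \<le> real (2 * M) * norm (A x - a *\<^sub>R x)"
proof -
  have "notch_poly S M = notch_poly (S - {a}) M * (1 - bell_poly a ^ (2 * M))"
    unfolding notch_poly_def using S by (subst prod.remove[of S a]) (auto simp: mult.commute)
  then have "norm (poly_op A (notch_poly S M) x) \<le> norm (poly_op A (1 - bell_poly a ^ (2 * M)) x)"
    using norm_notch_poly[of "S - {a}" M] S by (auto simp: poly_op_mult[OF lin])
  also have "\<dots> \<le> real (2 * M) * norm (A x - a *\<^sub>R x)"
    using S by (intro norm_poly_op_notch_eigen) auto
  finally show ?thesis .
qed

end

lemma one_minus_prod_le_sum: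
  fixes q :: "'i \<Rightarrow> real"
  assumes "finite S" "\<And>i. i \<in> S \<Longrightarrow> 0 \<le> q i \<and> q i \<le> 1"
  shows "1 - (\<Prod>i\<in>S. 1 - q i) \<le> (\<Sum>i\<in>S. q i)"
  using assms
proof (induction S rule: finite_induct)
  case (insert i S)
  have "0 \<le> (\<Prod>i\<in>S. 1 - q i)" "(\<Prod>i\<in>S. 1 - q i) \<le> 1"
    using insert by (auto intro!: prod_nonneg prod_le_1)
  then have "q i * (\<Prod>i\<in>S. 1 - q i) \<le> q i" using insert.prems[of i] by (simp add: mult_left_le)
  then show ?case using insert by (simp add: algebra_simps)
qed simp

definition localized_poly :: "real \<Rightarrow> real set \<Rightarrow> real poly \<Rightarrow> bool" where
  "localized_poly \<epsilon> Y Q \<longleftrightarrow> (\<forall>y\<in>{0..1}. 0 \<le> poly Q y \<and> poly Q y \<le> 1) \<and> (\<forall>y\<in>{0..1} - Y. poly Q y \<le> \<epsilon>)"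

lemma localized_one_minus_notch:
  assumes S: "finite S" "S \<subseteq> {0..1}" and "0 < \<eta>" and small: "real (card S) * (1 - \<eta>\<^sup>2) ^ (2 * M) \<le> \<epsilon>"
  shows "localized_poly \<epsilon> (\<Union>\<alpha>\<in>S. {\<alpha> - \<eta><..<\<alpha> + \<eta>}) (1 - notch_poly S M)"
  unfolding localized_poly_def
proof (intro conjI ballI)
  fix y :: real
  let ?q = "\<lambda>\<alpha>. (1 - (y - \<alpha>)\<^sup>2) ^ (2 * M)"
  have poly_eq: "poly (1 - notch_poly S M) y = 1 - (\<Prod>\<alpha>\<in>S. 1 - ?q \<alpha>)"
    by (simp add: notch_poly_def poly_prod poly_bell_poly)
  have sq_le_1: "(y - \<alpha>)\<^sup>2 \<le> 1" if "y \<in> {0..1}" "\<alpha> \<in> S" for \<alpha>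
    using that S(2) by (intro abs_square_le_1[THEN iffD2]) (auto simp: abs_if subset_iff)
  have q_range: "0 \<le> ?q \<alpha> \<and> ?q \<alpha> \<le> 1" if "y \<in> {0..1}" "\<alpha> \<in> S" for \<alpha>
    using sq_le_1[OF that] by (auto intro: power_le_one)
  show "0 \<le> poly (1 - notch_poly S M) y" "poly (1 - notch_poly S M) y \<le> 1" if "y \<in> {0..1}"
    unfolding poly_eq using q_range[OF that] by (simp_all add: prod_le_1 prod_nonneg)
  show "poly (1 - notch_poly S M) y \<le> \<epsilon>" if y: "y \<in> {0..1} - (\<Union>\<alpha>\<in>S. {\<alpha> - \<eta><..<\<alpha> + \<eta>})"
  proof -
    have "?q \<alpha> \<le> (1 - \<eta>\<^sup>2) ^ (2 * M)" if "\<alpha> \<in> S" for \<alpha>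
    proof (rule power_mono)
      have "\<eta> \<le> \<bar>y - \<alpha>\<bar>" using y that by (auto simp: abs_if)
      then show "1 - (y - \<alpha>)\<^sup>2 \<le> 1 - \<eta>\<^sup>2" using \<open>0 < \<eta>\<close> by (simp add: abs_le_square_iff[symmetric])
      show "0 \<le> 1 - (y - \<alpha>)\<^sup>2" using sq_le_1 y that by simp
    qed
    then have "(\<Sum>\<alpha>\<in>S. ?q \<alpha>) \<le> real (card S) * (1 - \<eta>\<^sup>2) ^ (2 * M)" by (rule sum_bounded_above)
    then have "(\<Sum>\<alpha>\<in>S. ?q \<alpha>) \<le> \<epsilon>" using small by linarith
    then show ?thesis unfolding poly_eq using one_minus_prod_le_sum[OF S(1), of ?q] q_range y by simp
  qed
qed

lemma emeasure_Union_intervals_le: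
  assumes "finite S" "0 \<le> \<eta>"
  shows "emeasure lborel (\<Union>\<alpha>\<in>S. {\<alpha> - \<eta><..<\<alpha> + \<eta>}) \<le> ennreal (real (card S) * (2 * \<eta>))"
proof -
  have "emeasure lborel (\<Union>\<alpha>\<in>S. {\<alpha> - \<eta><..<\<alpha> + \<eta>}) \<le> (\<Sum>\<alpha>\<in>S. emeasure lborel {\<alpha> - \<eta><..<\<alpha> + \<eta>})"
    by (intro emeasure_subadditive_finite assms) auto
  then show ?thesis using assms by (simp add: ennreal_mult' ennreal_of_nat_eq_real_of_nat)
qed

lemma norm_le_on_orthonormal_span:
  assumes \<Phi>: "finite \<Phi>" "orthonormal \<Phi>" and "linear T" and bound: "\<And>\<phi>. \<phi> \<in> \<Phi> \<Longrightarrow> norm (T \<phi>) \<le> c" and "h \<in> span \<Phi>"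
  shows "norm (T h) \<le> real (card \<Phi>) * c * norm h"
proof -
  obtain k where h: "h = (\<Sum>\<phi>\<in>\<Phi>. k \<phi> *\<^sub>R \<phi>)" using \<open>h \<in> span \<Phi>\<close> span_finite[OF \<Phi>(1)] by auto
  have "norm (k \<phi> *\<^sub>R T \<phi>) \<le> norm h * c" if "\<phi> \<in> \<Phi>" for \<phi>
  proof -
    have "\<bar>k \<phi>\<bar> \<le> norm h"
      using Cauchy_Schwarz_ineq2[of h \<phi>] orthonormal_sum_inner[OF \<Phi> that, of k] orthonormal_norm[OF \<Phi>(2) that]
      by (simp add: h[symmetric])
    then show ?thesis using bound[OF that] by (auto intro: mult_mono)
  qed
  then have "norm (\<Sum>\<phi>\<in>\<Phi>. k \<phi> *\<^sub>R T \<phi>) \<le> (\<Sum>\<phi>\<in>\<Phi>. norm h * c)" by (rule sum_norm_le)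
  moreover have "T h = (\<Sum>\<phi>\<in>\<Phi>. k \<phi> *\<^sub>R T \<phi>)"
    unfolding h by (simp add: linear_sum[OF \<open>linear T\<close>] linear_cmul[OF \<open>linear T\<close>])
  ultimately show ?thesis by (simp add: mult_ac)
qed

definition stably_fixes :: "real \<Rightarrow> real \<Rightarrow> ('h::real_inner \<Rightarrow> real) \<Rightarrow> 'h set \<Rightarrow> real poly \<Rightarrow> bool" where
  "stably_fixes \<delta> \<epsilon> a \<Phi> Q \<longleftrightarrow> (\<forall>A. pos_contraction A \<longrightarrow> (\<forall>\<phi>\<in>\<Phi>. norm (A \<phi> - a \<phi> *\<^sub>R \<phi>) \<le> \<delta>) \<longrightarrow>
     (\<forall>h\<in>span \<Phi>. norm (h - poly_op A Q h) \<le> \<epsilon> * norm h))"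

lemma stably_fixes_antimono: "stably_fixes \<delta> \<epsilon> a \<Phi> Q \<Longrightarrow> \<beta> \<le> \<delta> \<Longrightarrow> stably_fixes \<beta> \<epsilon> a \<Phi> Q"
  unfolding stably_fixes_def by (blast intro: order_trans)

lemma stably_fixes_one_minus_notch:
  assumes \<Phi>: "finite \<Phi>" "orthonormal \<Phi>" and a: "a ` \<Phi> \<subseteq> {0..1}"
    and small: "real (card \<Phi>) * (real (2 * M) * \<delta>) \<le> \<epsilon>"
  shows "stably_fixes \<delta> \<epsilon> a \<Phi> (1 - notch_poly (a ` \<Phi>) M)"
  unfolding stably_fixes_def
proof (intro allI impI ballI)
  fix A h assume A: "pos_contraction A" and near: "\<forall>\<phi>\<in>\<Phi>. norm (A \<phi> - a \<phi> *\<^sub>R \<phi>) \<le> \<delta>" and "h \<in> span \<Phi>"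
  note lin = pos_contraction_linear[OF A]
  let ?R = "poly_op A (notch_poly (a ` \<Phi>) M)"
  have "norm (?R \<phi>) \<le> real (2 * M) * \<delta>" if "\<phi> \<in> \<Phi>" for \<phi>
  proof -
    have "norm (?R \<phi>) \<le> real (2 * M) * norm (A \<phi> - a \<phi> *\<^sub>R \<phi>)"
      using that \<Phi>(1) a by (intro norm_notch_poly_eigen[OF A]) auto
    also have "\<dots> \<le> real (2 * M) * \<delta>" using near that by (intro mult_left_mono) auto
    finally show ?thesis .
  qed
  then have "norm (?R h) \<le> real (card \<Phi>) * (real (2 * M) * \<delta>) * norm h"
    by (rule norm_le_on_orthonormal_span[OF \<Phi> linear_poly_op[OF lin] _ \<open>h \<in> span \<Phi>\<close>])
  also have "\<dots> \<le> \<epsilon> * norm h" using small by (rule mult_right_mono) simp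
  finally show "norm (h - poly_op A (1 - notch_poly (a ` \<Phi>) M) h) \<le> \<epsilon> * norm h"
    by (simp add: poly_op_diff[OF lin] poly_op_1[OF lin])
qed

lemma spectral_selector_exists:
  fixes \<Phi> :: "'h::real_inner set"
  assumes \<Phi>: "finite \<Phi>" "orthonormal \<Phi>" and a: "a ` \<Phi> \<subseteq> {0..1}" and "\<epsilon> > 0"
  obtains \<delta> Q Y where "\<delta> > 0" "open Y" "emeasure lborel Y \<le> ennreal \<epsilon>" "localized_poly \<epsilon> Y Q"
    "stably_fixes \<delta> \<epsilon> a \<Phi> Q"
proof -
  define S where "S = a ` \<Phi>"
  have S: "finite S" "S \<subseteq> {0..1}" using \<Phi>(1) a by (auto simp: S_def)
  define \<eta> where "\<eta> = min (1/2) (\<epsilon> / (2 * (real (card S) + 1)))"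
  have "\<eta> \<le> 1/2" unfolding \<eta>_def by (rule min.cobounded1)
  moreover have "0 < \<eta>" using \<open>\<epsilon> > 0\<close> by (simp add: \<eta>_def add_nonneg_pos)
  ultimately have \<eta>: "0 < \<eta>" "\<eta> \<le> 1/2" by auto
  have "\<eta> \<le> \<epsilon> / (2 * (real (card S) + 1))" by (simp add: \<eta>_def)
  then have measure_small: "real (card S) * (2 * \<eta>) \<le> \<epsilon>" using \<eta>(1) by (simp add: le_divide_eq algebra_simps)
  have "(\<lambda>M. (1 - \<eta>\<^sup>2) ^ M) \<longlonglongrightarrow> 0"
    using \<eta> by (intro LIMSEQ_realpow_zero) (auto simp: power_le_one)
  from tendsto_mult_right_zero[OF this, of "real (card S)"]
  have "eventually (\<lambda>M. real (card S) * (1 - \<eta>\<^sup>2) ^ M < \<epsilon>) sequentially"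
    by (rule order_tendstoD(2)) (rule \<open>\<epsilon> > 0\<close>)
  then obtain M where "\<And>n. n \<ge> M \<Longrightarrow> real (card S) * (1 - \<eta>\<^sup>2) ^ n < \<epsilon>" by (auto simp: eventually_sequentially)
  then have value_small: "real (card S) * (1 - \<eta>\<^sup>2) ^ (2 * M) \<le> \<epsilon>" by (intro less_imp_le) simp
  define \<delta> where "\<delta> = \<epsilon> / (real (card \<Phi>) * real (2 * M) + 1)"
  have "\<delta> > 0" using \<open>\<epsilon> > 0\<close> by (simp add: \<delta>_def add_nonneg_pos)
  have operator_small: "real (card \<Phi>) * (real (2 * M) * \<delta>) \<le> \<epsilon>"
    using \<open>\<epsilon> > 0\<close> by (simp add: \<delta>_def divide_le_eq add_nonneg_pos mult_ac)
  show ?thesis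
  proof (rule that)
    show "\<delta> > 0" by fact
    show "open (\<Union>\<alpha>\<in>S. {\<alpha> - \<eta><..<\<alpha> + \<eta>})" by auto
    show "emeasure lborel (\<Union>\<alpha>\<in>S. {\<alpha> - \<eta><..<\<alpha> + \<eta>}) \<le> ennreal \<epsilon>"
      using \<eta>(1) measure_small by (intro order_trans[OF emeasure_Union_intervals_le[OF S(1)]] ennreal_leI) auto
    show "localized_poly \<epsilon> (\<Union>\<alpha>\<in>S. {\<alpha> - \<eta><..<\<alpha> + \<eta>}) (1 - notch_poly S M)"
      by (rule localized_one_minus_notch[OF S \<eta>(1) value_small])
    show "stably_fixes \<delta> \<epsilon> a \<Phi> (1 - notch_poly S M)"
      unfolding S_def by (rule stably_fixes_one_minus_notch[OF \<Phi> a operator_small])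
  qed
qed

section \<open>Spectral measures\<close>

lemma sums_zero_coeffs_zero:
  fixes c :: "nat \<Rightarrow> 'a::{real_normed_field,banach}"
  assumes "\<And>x. \<lbrakk>x \<noteq> 0; norm x < 1\<rbrakk> \<Longrightarrow> (\<lambda>n. c n * x ^ n) sums 0"
  shows "c k = 0"
  using assms
proof (induction k arbitrary: c)
  case 0
  have "((\<lambda>_. 0) \<longlongrightarrow> c 0) (at (0::'a))"
    using 0 by (intro powser_limit_0_strong[of 1 c "\<lambda>_. 0"]) auto
  then show ?case by (simp add: tendsto_const_iff)
next
  case (Suc k)
  have "((\<lambda>_. 0) \<longlongrightarrow> c 0) (at (0::'a))"
    using Suc.prems by (intro powser_limit_0_strong[of 1 c "\<lambda>_. 0"]) auto
  then have "c 0 = 0" by (simp add: tendsto_const_iff)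
  show ?case
  proof (rule Suc.IH[of "\<lambda>n. c (Suc n)"])
    fix x :: 'a assume x: "x \<noteq> 0" "norm x < 1"
    have "(\<lambda>n. c (Suc n) * x ^ Suc n) sums 0"
      using sums_Suc_iff[of "\<lambda>n. c n * x ^ n" 0] Suc.prems[OF x] \<open>c 0 = 0\<close> by simp
    from sums_mult[OF this, of "inverse x"] show "(\<lambda>n. c (Suc n) * x ^ n) sums 0"
      using x by (simp add: field_simps)
  qed
qed

lemma resolvent_power_series:
  fixes A :: "'h::{real_inner,banach} \<Rightarrow> 'h"
  assumes A: "pos_contraction A" and x: "\<bar>x\<bar> < 1"
  shows "\<exists>w. w = A (f + x *\<^sub>R w) \<and> (\<lambda>k. x ^ k * ((A ^^ Suc k) f \<bullet> f)) sums (w \<bullet> f)"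
proof -
  note lin = pos_contraction_linear[OF A]
  let ?t = "\<lambda>k. x ^ k *\<^sub>R (A ^^ Suc k) f"
  have norm_iterate: "norm ((A ^^ n) f) \<le> norm f" for n
    by (induction n) (auto intro: order_trans[OF pos_contraction_norm[OF A]])
  have "summable (\<lambda>k. norm f * \<bar>x\<bar> ^ k)" using x by (intro summable_mult summable_geometric) auto
  then have "summable ?t"
  proof (rule summable_comparison_test'[where N = 0])
    show "norm (?t n) \<le> norm f * \<bar>x\<bar> ^ n" for n
      using mult_left_mono[OF norm_iterate[of "Suc n"], of "\<bar>x\<bar> ^ n"]
      by (simp add: power_abs mult.commute)
  qed
  then obtain w where w: "?t sums w" by (auto simp: summable_def)
  have "(\<lambda>k. x *\<^sub>R A (?t k)) sums (x *\<^sub>R A w)"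
    by (intro sums_scaleR_right bounded_linear.sums[OF pos_contraction_bounded_linear[OF A] w])
  moreover have "x *\<^sub>R A (?t k) = ?t (Suc k)" for k by (simp add: linear_cmul[OF lin])
  ultimately have "(\<lambda>k. ?t (Suc k)) sums (x *\<^sub>R A w)" by (simp only:)
  then have "?t sums (x *\<^sub>R A w + ?t 0)" by (rule sums_Suc)
  then have "w = x *\<^sub>R A w + A f" using w sums_unique2 by fastforce
  then have "w = A (f + x *\<^sub>R w)" by (simp add: linear_add[OF lin] linear_cmul[OF lin] add.commute)
  moreover have "(\<lambda>k. x ^ k * ((A ^^ Suc k) f \<bullet> f)) sums (w \<bullet> f)"
    using bounded_linear.sums[OF bounded_linear_inner_left[of f] w] by (simp only: inner_scaleR_left)
  ultimately show ?thesis by blast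
qed

context
  fixes \<mu> :: "real measure"
  assumes \<mu>: "sets \<mu> = sets borel" "finite_measure \<mu>" "emeasure \<mu> {..<0} = 0"
begin

lemma AE_nonneg_spectral: "AE t in \<mu>. 0 \<le> t"
  using \<mu> by (intro AE_I'[of "{..<0}"]) (auto simp: null_sets_def)

lemma AE_resolvent_range: "AE t in \<mu>. 1 / (1 + t) \<in> {0..1}"
  using AE_nonneg_spectral by eventually_elim auto

lemma integrable_resolvent_poly: "integrable \<mu> (\<lambda>t. poly p (1 / (1 + t)))"
proof -
  have "compact (poly p ` {0..1})"
    by (intro compact_continuous_image continuous_intros) auto
  then have "bounded (poly p ` {0..1})" by (rule compact_imp_bounded)
  then obtain C where bound: "\<forall>z\<in>poly p ` {0..1}. norm z \<le> C" by (auto simp: bounded_iff)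
  show ?thesis
  proof (rule finite_measure.integrable_const_bound[OF \<mu>(2)])
    show "AE t in \<mu>. norm (poly p (1 / (1 + t))) \<le> C"
      using AE_resolvent_range by eventually_elim (use bound in blast)
    have "poly p \<in> borel_measurable borel" by (intro borel_measurable_continuous_onI continuous_intros)
    then show "(\<lambda>t. poly p (1 / (1 + t))) \<in> borel_measurable \<mu>"
      unfolding measurable_cong_sets[OF \<mu>(1) refl] by measurable
  qed
qed

lemma integrable_resolvent_power: "integrable \<mu> (\<lambda>t. (1 / (1 + t)) ^ k)"
  using integrable_resolvent_poly[of "monom 1 k"] by (simp add: poly_monom)

lemma sums_resolvent:
  assumes "x \<noteq> 0" "\<bar>x\<bar> < 1" "0 \<le> (t::real)"
  shows "(\<lambda>k. x ^ k * (1 / (1 + t)) ^ Suc k) sums (1 / (t + (1 - x)))"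
proof -
  have "\<bar>x\<bar> * \<bar>1 / (1 + t)\<bar> \<le> \<bar>x\<bar> * 1" using assms by (intro mult_left_mono) auto
  then have "norm (x * (1 / (1 + t))) < 1" using assms by (simp only: real_norm_def abs_mult)
  from sums_mult[OF geometric_sums[OF this], of "1 / (1 + t)"]
  have "(\<lambda>k. x ^ k * (1 / (1 + t)) ^ Suc k) sums (1 / (1 + t) * (1 / (1 - x * (1 / (1 + t)))))"
    by (simp add: power_mult_distrib mult_ac power_divide)
  moreover have "1 / (1 + t) * (1 / (1 - x * (1 / (1 + t)))) = 1 / (t + (1 - x))"
    using assms by (simp add: field_simps abs_if split: if_splits)
  ultimately show ?thesis by simp
qed

lemma sums_integral_resolvent_power:
  assumes x: "x \<noteq> 0" "\<bar>x\<bar> < 1"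
  shows "(\<lambda>k. x ^ k * (\<integral> t. (1 / (1 + t)) ^ Suc k \<partial>\<mu>)) sums (\<integral> t. 1 / (t + (1 - x)) \<partial>\<mu>)"
proof -
  let ?f = "\<lambda>k t. x ^ k * (1 / (1 + t)) ^ Suc k"
  have int: "integrable \<mu> (?f k)" for k by (intro integrable_mult_right integrable_resolvent_power)
  have bound: "AE t in \<mu>. \<forall>k. norm (?f k t) \<le> \<bar>x\<bar> ^ k"
    using AE_resolvent_range
  proof (eventually_elim, intro allI)
    fix t k assume "1 / (1 + t) \<in> {0..1::real}"
    then have "\<bar>1 / (1 + t)\<bar> ^ Suc k \<le> 1" by (intro power_le_one) auto
    then have "\<bar>x\<bar> ^ k * \<bar>1 / (1 + t)\<bar> ^ Suc k \<le> \<bar>x\<bar> ^ k * 1" by (intro mult_left_mono) auto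
    then show "norm (?f k t) \<le> \<bar>x\<bar> ^ k" by (simp only: real_norm_def abs_mult power_abs mult_1_right)
  qed
  have geo: "summable (\<lambda>k. \<bar>x\<bar> ^ k)" using x by (intro summable_geometric) auto
  have "(\<lambda>k. \<integral> t. ?f k t \<partial>\<mu>) sums (\<integral> t. (\<Sum>k. ?f k t) \<partial>\<mu>)"
  proof (rule sums_integral[OF int])
    show "AE t in \<mu>. summable (\<lambda>k. norm (?f k t))"
      using bound by eventually_elim (rule summable_comparison_test'[OF geo, where N = 0], simp)
    show "summable (\<lambda>k. \<integral> t. norm (?f k t) \<partial>\<mu>)"
    proof (rule summable_comparison_test'[where N = 0])
      show "summable (\<lambda>k. \<bar>x\<bar> ^ k * measure \<mu> (space \<mu>))" by (intro summable_mult2 geo)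
      fix k
      have "(\<integral> t. norm (?f k t) \<partial>\<mu>) \<le> (\<integral> t. \<bar>x\<bar> ^ k \<partial>\<mu>)"
      proof (rule integral_mono_AE)
        show "AE t in \<mu>. norm (?f k t) \<le> \<bar>x\<bar> ^ k" using bound by eventually_elim blast
      qed (rule integrable_norm[OF int] finite_measure.integrable_const[OF \<mu>(2)])+
      then show "norm (\<integral> t. norm (?f k t) \<partial>\<mu>) \<le> \<bar>x\<bar> ^ k * measure \<mu> (space \<mu>)" by (simp add: mult.commute)
    qed
  qed
  also have "(\<integral> t. (\<Sum>k. ?f k t) \<partial>\<mu>) = (\<integral> t. 1 / (t + (1 - x)) \<partial>\<mu>)"
  proof (rule integral_cong_AE)
    show "AE t in \<mu>. (\<Sum>k. ?f k t) = 1 / (t + (1 - x))"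
      using AE_nonneg_spectral by eventually_elim (use sums_resolvent[OF x] in \<open>simp add: sums_iff\<close>)
    show "(\<lambda>t. \<Sum>k. ?f k t) \<in> borel_measurable \<mu>" "(\<lambda>t. 1 / (t + (1 - x))) \<in> borel_measurable \<mu>"
      unfolding measurable_cong_sets[OF \<mu>(1) refl] by measurable
  qed
  finally show ?thesis by (simp only: integral_mult_right_zero)
qed

lemma spectral_moments:
  fixes A :: "'h::{real_inner,banach} \<Rightarrow> 'h"
  assumes A: "pos_contraction A"
    and resolvent: "\<And>s w. \<lbrakk>0 < s; w = A (f + (1 - s) *\<^sub>R w)\<rbrakk> \<Longrightarrow> w \<bullet> f = (\<integral> t. 1 / (t + s) \<partial>\<mu>)"
  shows "(A ^^ Suc k) f \<bullet> f = (\<integral> t. (1 / (1 + t)) ^ Suc k \<partial>\<mu>)"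
proof -
  let ?c = "\<lambda>k. (A ^^ Suc k) f \<bullet> f - (\<integral> t. (1 / (1 + t)) ^ Suc k \<partial>\<mu>)"
  have "(\<lambda>k. ?c k * x ^ k) sums 0" if x: "x \<noteq> 0" "norm x < 1" for x :: real
  proof -
    have "\<bar>x\<bar> < 1" using x by simp
    then obtain w where w: "w = A (f + x *\<^sub>R w)" "(\<lambda>k. x ^ k * ((A ^^ Suc k) f \<bullet> f)) sums (w \<bullet> f)"
      using resolvent_power_series[OF A] by blast
    have "w \<bullet> f = (\<integral> t. 1 / (t + (1 - x)) \<partial>\<mu>)" using \<open>\<bar>x\<bar> < 1\<close> w(1) by (intro resolvent) auto
    with sums_diff[OF w(2) sums_integral_resolvent_power[OF x(1) \<open>\<bar>x\<bar> < 1\<close>]]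
    show ?thesis by (simp only: right_diff_distrib mult.commute diff_self)
  qed
  then have "?c k = 0" by (rule sums_zero_coeffs_zero)
  then show ?thesis by simp
qed

context
  fixes A :: "'h::{real_inner,banach} \<Rightarrow> 'h" and f
  assumes A: "pos_contraction A"
    and moments: "\<And>k. (A ^^ Suc k) f \<bullet> f = (\<integral> t. (1 / (1 + t)) ^ Suc k \<partial>\<mu>)"
begin

lemma inner_poly_op_spectral: "poly_op A p (A f) \<bullet> f = (\<integral> t. 1 / (1 + t) * poly p (1 / (1 + t)) \<partial>\<mu>)"
proof -
  have "poly_op A p (A f) \<bullet> f = (\<Sum>i\<le>degree p. coeff p i * ((A ^^ Suc i) f \<bullet> f))"
    by (simp add: poly_op_def inner_sum_left funpow_swap1)
  also have "\<dots> = (\<Sum>i\<le>degree p. \<integral> t. coeff p i * (1 / (1 + t)) ^ Suc i \<partial>\<mu>)"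
    by (simp only: moments integral_mult_right_zero)
  also have "\<dots> = (\<integral> t. (\<Sum>i\<le>degree p. coeff p i * (1 / (1 + t)) ^ Suc i) \<partial>\<mu>)"
    by (rule Bochner_Integration.integral_sum[symmetric]) (intro integrable_mult_right integrable_resolvent_power)
  also have "\<dots> = (\<integral> t. 1 / (1 + t) * poly p (1 / (1 + t)) \<partial>\<mu>)"
    by (simp only: poly_altdef sum_distrib_left power_Suc mult.left_commute)
  finally show ?thesis .
qed

lemma norm_poly_op_spectral: "(norm (poly_op A p (A f)))\<^sup>2 = (\<integral> t. (1 / (1 + t) * poly p (1 / (1 + t)))\<^sup>2 \<partial>\<mu>)"
proof -
  note lin = pos_contraction_linear[OF A]
  have "(norm (poly_op A p (A f)))\<^sup>2 = poly_op A p (poly_op A p (A f)) \<bullet> A f"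
    unfolding power2_norm_eq_inner
    by (rule poly_op_symmetric[OF lin pos_contraction_symmetric[OF A], symmetric])
  also have "\<dots> = poly_op A [:0, 1:] (poly_op A (p * p) (A f)) \<bullet> f"
    by (simp add: poly_op_pCons[OF lin] linear_0[OF lin] poly_op_mult[OF lin] pos_contraction_symmetric[OF A])
  also have "\<dots> = poly_op A ([:0, 1:] * (p * p)) (A f) \<bullet> f" by (simp only: poly_op_mult[OF lin])
  also have "\<dots> = (\<integral> t. (1 / (1 + t) * poly p (1 / (1 + t)))\<^sup>2 \<partial>\<mu>)"
    unfolding inner_poly_op_spectral
    by (intro Bochner_Integration.integral_cong) (simp_all add: power2_eq_square)
  finally show ?thesis .
qed

lemma localized_poly_op_tendsto_0:
  assumes Q: "\<And>n. localized_poly (\<epsilon> n) (Y n) (Q n)" and "\<epsilon> \<longlonglongrightarrow> 0"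
    and avoid: "AE t in \<mu>. eventually (\<lambda>n. 1 / (1 + t) \<notin> Y n) sequentially"
  shows "(\<lambda>n. poly_op A (Q n) (A f)) \<longlonglongrightarrow> 0"
proof -
  let ?y = "\<lambda>t::real. 1 / (1 + t)"
  have "(\<lambda>n. \<integral> t. (?y t * poly (Q n) (?y t))\<^sup>2 \<partial>\<mu>) \<longlonglongrightarrow> (\<integral> t. 0 \<partial>\<mu>)"
  proof (rule integral_dominated_convergence)
    show "integrable \<mu> (\<lambda>t. 1::real)" using \<mu>(2) by (simp add: finite_measure.integrable_const)
    show "(\<lambda>t. (?y t * poly (Q n) (?y t))\<^sup>2) \<in> borel_measurable \<mu>" for n
      using integrable_resolvent_poly[of "([:0, 1:] * Q n)\<^sup>2"] by (simp add: poly_power)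
    show "AE t in \<mu>. (\<lambda>n. (?y t * poly (Q n) (?y t))\<^sup>2) \<longlonglongrightarrow> 0"
      using avoid AE_resolvent_range
    proof eventually_elim
      case (elim t)
      have "(\<lambda>n. poly (Q n) (?y t)) \<longlonglongrightarrow> 0"
      proof (rule Lim_null_comparison[OF _ \<open>\<epsilon> \<longlonglongrightarrow> 0\<close>])
        show "eventually (\<lambda>n. norm (poly (Q n) (?y t)) \<le> \<epsilon> n) sequentially"
          using elim(1) by eventually_elim (use Q elim(2) in \<open>auto simp: localized_poly_def\<close>)
      qed
      from tendsto_power[OF tendsto_mult[OF tendsto_const[of "?y t"] this], of 2] show ?case by simp
    qed
    show "AE t in \<mu>. norm ((?y t * poly (Q n) (?y t))\<^sup>2) \<le> 1" for n
      using AE_resolvent_range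
    proof eventually_elim
      case (elim t)
      then have "0 \<le> poly (Q n) (?y t)" "poly (Q n) (?y t) \<le> 1" using Q by (auto simp: localized_poly_def)
      then have "0 \<le> ?y t * poly (Q n) (?y t)" "?y t * poly (Q n) (?y t) \<le> 1"
        using elim mult_le_one[of "?y t" "poly (Q n) (?y t)"] by auto
      then show ?case by (simp add: power_le_one)
    qed
  qed simp
  then have "(\<lambda>n. (norm (poly_op A (Q n) (A f)))\<^sup>2) \<longlonglongrightarrow> 0" by (simp only: norm_poly_op_spectral integral_zero)
  from tendsto_real_sqrt[OF this] show ?thesis by (simp add: tendsto_norm_zero_iff)
qed

end

lemma AE_resolvent_of_AE_lborel:
  assumes ac: "absolutely_continuous lborel \<mu>" and "AE y in lborel. P y"
  shows "AE t in \<mu>. P (1 / (1 + t))"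
proof -
  obtain N where N: "{y. \<not> P y} \<subseteq> N" "N \<in> null_sets lborel"
    using assms(2) by (auto elim!: AE_E simp: null_sets_def)
  have "negligible N" using N(2) by (simp add: negligible_iff_null_sets null_sets_completionI)
  then have "negligible (N \<inter> {0<..})" by (rule negligible_subset) auto
  then have "negligible ((\<lambda>y. 1 / y - 1) ` (N \<inter> {0<..}))"
    by (rule negligible_differentiable_image_negligible[OF order_refl])
       (auto simp: differentiable_on_def intro!: derivative_intros)
  then obtain N' where N': "(\<lambda>y. 1 / y - 1) ` (N \<inter> {0<..}) \<subseteq> N'" "N' \<in> null_sets lborel"
    unfolding negligible_iff_null_sets null_sets_completion_iff2 by blast
  then have "N' \<in> null_sets \<mu>" using ac by (auto simp: absolutely_continuous_def)
  then have "AE t in \<mu>. t \<notin> N'" by (rule AE_not_in)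
  then show ?thesis using AE_nonneg_spectral
  proof eventually_elim
    case (elim t)
    show ?case
    proof (rule ccontr)
      assume "\<not> P (1 / (1 + t))"
      then have "1 / (1 + t) \<in> N \<inter> {0<..}" using N(1) elim by auto
      then have "1 / (1 / (1 + t)) - 1 \<in> N'" using N'(1) by blast
      then show False using elim by simp
    qed
  qed
qed

end

lemma AE_eventually_avoids:
  assumes "\<And>n. Y n \<in> sets M" and small: "\<And>n. emeasure M (Y n) \<le> ennreal ((1/2) ^ n)"
  shows "AE y in M. eventually (\<lambda>n. y \<notin> Y n) sequentially"
proof -
  have "AE y in M. eventually (\<lambda>n. y \<in> space M - Y n) sequentially"
  proof (rule borel_cantelli_AE1)
    show "emeasure M (Y n) < \<infinity>" for n using small[of n]
      by (metis ennreal_less_top infinity_ennreal_def order_le_less_trans)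
    show "summable (\<lambda>n. measure M (Y n))"
    proof (rule summable_comparison_test'[where N = 0])
      show "summable (\<lambda>n. (1/2::real) ^ n)" by (intro summable_geometric) auto
      show "norm (measure M (Y n)) \<le> (1/2) ^ n" for n using small[of n] by (simp add: measure_def enn2real_leI)
    qed
  qed (rule assms)
  then show ?thesis by eventually_elim (auto elim: eventually_mono)
qed

lemma zero_of_annihilated_almost_fixed:
  fixes g :: "'h::real_inner"
  assumes symmetric: "\<And>n x y. T n x \<bullet> y = x \<bullet> T n y" and annihilated: "(\<lambda>n. T n g) \<longlonglongrightarrow> 0"
    and h: "h \<longlonglongrightarrow> g" and fixed: "(\<lambda>n. h n - T n (h n)) \<longlonglongrightarrow> 0"
  shows "g = 0"
proof -
  have "g \<bullet> h n = T n g \<bullet> h n + g \<bullet> (h n - T n (h n))" for n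
    by (simp add: symmetric[of n g] inner_diff_right)
  then have "(\<lambda>n. g \<bullet> h n) \<longlonglongrightarrow> 0 \<bullet> g + g \<bullet> 0" by (simp only:) (intro tendsto_intros assms)
  moreover have "(\<lambda>n. g \<bullet> h n) \<longlonglongrightarrow> g \<bullet> g" by (intro tendsto_intros h)
  ultimately have "g \<bullet> g = 0" using LIMSEQ_unique by fastforce
  then show ?thesis by simp
qed

section \<open>The Hilbert space of square integrable functions\<close>

definition L2_fun :: "('a::euclidean_space \<Rightarrow> 'b::euclidean_space) \<Rightarrow> bool" where
  "L2_fun f \<longleftrightarrow> f \<in> borel_measurable lebesgue \<and> integrable lebesgue (\<lambda>x. (norm (f x))\<^sup>2)"

lemma L2_fun_measurable [measurable_dest]: "L2_fun f \<Longrightarrow> f \<in> borel_measurable lebesgue"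
  and L2_fun_integrable_sq: "L2_fun f \<Longrightarrow> integrable lebesgue (\<lambda>x. (norm (f x))\<^sup>2)"
  by (auto simp: L2_fun_def)

lemma norm_add_sq_le: "(norm (x + y))\<^sup>2 \<le> 2 * (norm x)\<^sup>2 + 2 * (norm (y::'a::real_inner))\<^sup>2"
proof -
  have "0 \<le> (norm (x - y))\<^sup>2" by simp
  then show ?thesis
    unfolding power2_norm_eq_inner by (simp add: algebra_simps inner_commute)
qed

lemma L2_fun_bound:
  assumes "f \<in> borel_measurable lebesgue" "L2_fun g" "AE x in lebesgue. norm (f x) \<le> C * norm (g x)"
  shows "L2_fun f"
  unfolding L2_fun_def
proof
  show "integrable lebesgue (\<lambda>x. (norm (f x))\<^sup>2)"
  proof (rule Bochner_Integration.integrable_bound)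
    show "integrable lebesgue (\<lambda>x. C\<^sup>2 * (norm (g x))\<^sup>2)" using assms(2) by (simp add: L2_fun_def)
    show "AE x in lebesgue. norm ((norm (f x))\<^sup>2) \<le> norm (C\<^sup>2 * (norm (g x))\<^sup>2)"
      using assms(3)
    proof eventually_elim
      case (elim x)
      then have "(norm (f x))\<^sup>2 \<le> (C * norm (g x))\<^sup>2" by (intro power_mono) auto
      then show ?case by (simp add: power_mult_distrib)
    qed
  qed (use assms in measurable)
qed (rule assms)

lemma L2_fun_zero: "L2_fun (\<lambda>x. 0)"
  by (simp add: L2_fun_def)

lemma L2_fun_add:
  assumes "L2_fun f" "L2_fun g" shows "L2_fun (\<lambda>x. f x + g x)"
  unfolding L2_fun_def
proof
  have [measurable]: "f \<in> borel_measurable lebesgue" "g \<in> borel_measurable lebesgue"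
    using assms by (auto simp: L2_fun_def)
  show "(\<lambda>x. f x + g x) \<in> borel_measurable lebesgue" by measurable
  show "integrable lebesgue (\<lambda>x. (norm (f x + g x))\<^sup>2)"
  proof (rule Bochner_Integration.integrable_bound)
    show "integrable lebesgue (\<lambda>x. 2 * (norm (f x))\<^sup>2 + 2 * (norm (g x))\<^sup>2)"
      using assms by (intro Bochner_Integration.integrable_add integrable_mult_right L2_fun_integrable_sq)
    show "AE x in lebesgue. norm ((norm (f x + g x))\<^sup>2) \<le> norm (2 * (norm (f x))\<^sup>2 + 2 * (norm (g x))\<^sup>2)"
      using norm_add_sq_le by (intro AE_I2) auto
  qed measurable
qed

lemma L2_fun_scaleR: assumes "L2_fun f" shows "L2_fun (\<lambda>x. c *\<^sub>R f x)"
  by (rule L2_fun_bound[of _ f "\<bar>c\<bar>"]) (use assms in \<open>auto simp: L2_fun_def\<close>)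

lemma L2_fun_uminus: "L2_fun f \<Longrightarrow> L2_fun (\<lambda>x. - f x)"
  using L2_fun_scaleR[of f "-1"] by simp

lemma L2_fun_diff: "L2_fun f \<Longrightarrow> L2_fun g \<Longrightarrow> L2_fun (\<lambda>x. f x - g x)"
  using L2_fun_add[of f "\<lambda>x. - g x"] L2_fun_uminus[of g] by simp

lemma L2_fun_indicator:
  assumes "S \<in> sets lebesgue" "L2_fun f" shows "L2_fun (\<lambda>x. indicator S x *\<^sub>R f x)"
proof (rule L2_fun_bound[where g = f and C = 1])
  show "(\<lambda>x. indicator S x *\<^sub>R f x) \<in> borel_measurable lebesgue"
    using assms by (intro borel_measurable_scaleR borel_measurable_indicator) (auto simp: L2_fun_def)
qed (auto simp: assms indicator_def)

lemma L2_fun_indicator_lmeasurable: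
  assumes "S \<in> lmeasurable" shows "L2_fun (\<lambda>x. indicator S x :: real)"
proof -
  have "integrable lebesgue (\<lambda>x. indicator S x :: real)"
    using assms by (intro integrable_real_indicator) (auto simp: fmeasurable_def)
  moreover have "(norm (indicator S x :: real))\<^sup>2 = indicator S x" for x by (simp add: indicator_def)
  ultimately show ?thesis unfolding L2_fun_def by auto
qed

lemma integrable_inner_L2:
  assumes "L2_fun f" "L2_fun g" shows "integrable lebesgue (\<lambda>x. f x \<bullet> g x)"
proof (rule Bochner_Integration.integrable_bound)
  show "(\<lambda>x. f x \<bullet> g x) \<in> borel_measurable lebesgue"
    using assms by (intro borel_measurable_inner) (auto simp: L2_fun_def)
  show "integrable lebesgue (\<lambda>x. (norm (f x))\<^sup>2 + (norm (g x))\<^sup>2)"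
    using assms by (intro Bochner_Integration.integrable_add L2_fun_integrable_sq)
  show "AE x in lebesgue. norm (f x \<bullet> g x) \<le> norm ((norm (f x))\<^sup>2 + (norm (g x))\<^sup>2)"
  proof (rule AE_I2)
    fix x
    have "\<bar>f x \<bullet> g x\<bar> \<le> norm (f x) * norm (g x)" by (rule Cauchy_Schwarz_ineq2)
    also have "\<dots> \<le> (norm (f x))\<^sup>2 + (norm (g x))\<^sup>2"
      using sum_squares_bound[of "norm (f x)" "norm (g x)"]
        mult_nonneg_nonneg[OF norm_ge_zero norm_ge_zero, of "f x" "g x"] by linarith
    finally show "norm (f x \<bullet> g x) \<le> norm ((norm (f x))\<^sup>2 + (norm (g x))\<^sup>2)" by simp
  qed
qed

quotient_type (overloaded) ('a, 'b) l2 = "'a::euclidean_space \<Rightarrow> 'b::euclidean_space" /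
  partial: "\<lambda>f g. L2_fun f \<and> L2_fun g \<and> (AE x in lebesgue. f x = g x)"
proof (rule part_equivpI)
  show "\<exists>f::'a \<Rightarrow> 'b. L2_fun f \<and> L2_fun f \<and> (AE x in lebesgue. f x = f x)"
    using L2_fun_zero by (intro exI[of _ "\<lambda>_. 0"]) auto
  show "symp (\<lambda>f g::'a \<Rightarrow> 'b. L2_fun f \<and> L2_fun g \<and> (AE x in lebesgue. f x = g x))"
    by (rule sympI) (auto simp: eq_commute)
  show "transp (\<lambda>f g::'a \<Rightarrow> 'b. L2_fun f \<and> L2_fun g \<and> (AE x in lebesgue. f x = g x))"
    by (rule transpI) auto
qed

instantiation l2 :: (euclidean_space, euclidean_space) real_vector
begin

lift_definition zero_l2 :: "('a, 'b) l2" is "\<lambda>x. 0"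
  by (simp add: L2_fun_zero)

lift_definition plus_l2 :: "('a, 'b) l2 \<Rightarrow> ('a, 'b) l2 \<Rightarrow> ('a, 'b) l2" is "\<lambda>f g x. f x + g x"
  by (auto simp: L2_fun_add)

lift_definition minus_l2 :: "('a, 'b) l2 \<Rightarrow> ('a, 'b) l2 \<Rightarrow> ('a, 'b) l2" is "\<lambda>f g x. f x - g x"
  by (auto simp: L2_fun_diff)

lift_definition uminus_l2 :: "('a, 'b) l2 \<Rightarrow> ('a, 'b) l2" is "\<lambda>f x. - f x"
  by (auto simp: L2_fun_uminus)

lift_definition scaleR_l2 :: "real \<Rightarrow> ('a, 'b) l2 \<Rightarrow> ('a, 'b) l2" is "\<lambda>c f x. c *\<^sub>R f x"
  by (auto simp: L2_fun_scaleR)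

instance
proof
  fix x y z :: "('a, 'b) l2" and a b :: real
  show "x + y + z = x + (y + z)" by transfer (auto simp: L2_fun_add algebra_simps)
  show "x + y = y + x" by transfer (auto simp: L2_fun_add algebra_simps)
  show "0 + x = x" by transfer (auto simp: L2_fun_add L2_fun_zero)
  show "- x + x = 0" by transfer (auto simp: L2_fun_zero)
  show "x - y = x + - y" by transfer (auto simp: L2_fun_diff)
  show "a *\<^sub>R (x + y) = a *\<^sub>R x + a *\<^sub>R y" by transfer (auto simp: L2_fun_add L2_fun_scaleR algebra_simps)
  show "(a + b) *\<^sub>R x = a *\<^sub>R x + b *\<^sub>R x" by transfer (auto simp: L2_fun_add L2_fun_scaleR algebra_simps)
  show "a *\<^sub>R b *\<^sub>R x = (a * b) *\<^sub>R x" by transfer (auto simp: L2_fun_scaleR)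
  show "1 *\<^sub>R x = x" by transfer auto
qed

end

instantiation l2 :: (euclidean_space, euclidean_space) real_inner
begin

lift_definition inner_l2 :: "('a, 'b) l2 \<Rightarrow> ('a, 'b) l2 \<Rightarrow> real" is "\<lambda>f g. \<integral> x. f x \<bullet> g x \<partial>lebesgue"
proof -
  fix f f' g g' :: "'a \<Rightarrow> 'b"
  assume f: "L2_fun f \<and> L2_fun f' \<and> (AE x in lebesgue. f x = f' x)"
    and g: "L2_fun g \<and> L2_fun g' \<and> (AE x in lebesgue. g x = g' x)"
  then have [measurable]: "f \<in> borel_measurable lebesgue" "g \<in> borel_measurable lebesgue"
    "f' \<in> borel_measurable lebesgue" "g' \<in> borel_measurable lebesgue" by (auto simp: L2_fun_def)
  show "(\<integral> x. f x \<bullet> g x \<partial>lebesgue) = (\<integral> x. f' x \<bullet> g' x \<partial>lebesgue)"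
    using f g by (intro integral_cong_AE) auto
qed

definition norm_l2 :: "('a, 'b) l2 \<Rightarrow> real" where "norm_l2 f = sqrt (f \<bullet> f)"
definition sgn_l2 :: "('a, 'b) l2 \<Rightarrow> ('a, 'b) l2" where "sgn_l2 f = f /\<^sub>R norm f"
definition dist_l2 :: "('a, 'b) l2 \<Rightarrow> ('a, 'b) l2 \<Rightarrow> real" where "dist_l2 f g = norm (f - g)"
definition uniformity_l2 :: "(('a, 'b) l2 \<times> ('a, 'b) l2) filter" where
  "uniformity_l2 = (INF e\<in>{0<..}. principal {(f, g). dist f g < e})"
definition open_l2 :: "('a, 'b) l2 set \<Rightarrow> bool" where
  "open_l2 U = (\<forall>x\<in>U. eventually (\<lambda>(x', y). x' = x \<longrightarrow> y \<in> U) uniformity)"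

instance
proof
  fix x y z :: "('a, 'b) l2" and a :: real and U :: "('a, 'b) l2 set"
  show "dist x y = norm (x - y)" by (simp add: dist_l2_def)
  show "sgn x = x /\<^sub>R norm x" by (simp add: sgn_l2_def)
  show "uniformity = (INF e\<in>{0<..}. principal {(x::('a, 'b) l2, y). dist x y < e})"
    by (simp add: uniformity_l2_def)
  show "open U = (\<forall>x\<in>U. \<forall>\<^sub>F (x', y) in uniformity. x' = x \<longrightarrow> y \<in> U)" by (simp add: open_l2_def)
  show "x \<bullet> y = y \<bullet> x" by transfer (auto simp: inner_commute)
  show "(x + y) \<bullet> z = x \<bullet> z + y \<bullet> z"
    by transfer (auto simp: inner_add_left integrable_inner_L2)
  show "(a *\<^sub>R x) \<bullet> y = a * (x \<bullet> y)" by transfer auto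
  show "0 \<le> x \<bullet> x" by transfer auto
  show "(x \<bullet> x = 0) = (x = 0)"
  proof transfer
    fix f :: "'a \<Rightarrow> 'b"
    assume f: "L2_fun f \<and> L2_fun f \<and> (AE x in lebesgue. f x = f x)"
    have "((\<integral> x. f x \<bullet> f x \<partial>lebesgue) = 0) = (AE x in lebesgue. f x \<bullet> f x = 0)"
      using f by (intro integral_nonneg_eq_0_iff_AE integrable_inner_L2) auto
    then show "((\<integral> x. f x \<bullet> f x \<partial>lebesgue) = 0) = (L2_fun f \<and> L2_fun (\<lambda>x. 0::'b) \<and> (AE x in lebesgue. f x = 0))"
      using f L2_fun_zero by auto
  qed
  show "norm x = sqrt (x \<bullet> x)" by (simp add: norm_l2_def)
qed

end

lemma L2_fun_rep: "L2_fun (rep_l2 f)"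
  using Quotient3_rep_reflp[OF Quotient3_l2, of f] by simp

lemma abs_rep_l2 [simp]: "abs_l2 (rep_l2 f) = f"
  by (rule Quotient3_abs_rep[OF Quotient3_l2])

lemma abs_l2_eq_iff: "L2_fun f \<Longrightarrow> L2_fun g \<Longrightarrow> abs_l2 f = abs_l2 g \<longleftrightarrow> (AE x in lebesgue. f x = g x)"
  using Quotient3_rel[OF Quotient3_l2, of f g] by auto

lemma rep_abs_l2: assumes "L2_fun f" shows "AE x in lebesgue. rep_l2 (abs_l2 f) x = f x"
  using abs_l2_eq_iff[OF L2_fun_rep[of "abs_l2 f"] assms] by simp

lemma abs_l2_eq_0_iff: "L2_fun f \<Longrightarrow> abs_l2 f = 0 \<longleftrightarrow> (AE x in lebesgue. f x = 0)"
  by (simp add: zero_l2_def abs_l2_eq_iff L2_fun_zero)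

lemma inner_abs_l2: "L2_fun f \<Longrightarrow> L2_fun g \<Longrightarrow> abs_l2 f \<bullet> abs_l2 g = (\<integral> x. f x \<bullet> g x \<partial>lebesgue)"
  by (simp add: inner_l2.abs_eq)

lemma inner_rep_l2:
  assumes "L2_fun f" shows "u \<bullet> abs_l2 f = (\<integral> x. rep_l2 u x \<bullet> f x \<partial>lebesgue)"
  using inner_abs_l2[OF L2_fun_rep[of u] assms] by simp

lemma abs_l2_add: "L2_fun f \<Longrightarrow> L2_fun g \<Longrightarrow> abs_l2 f + abs_l2 g = abs_l2 (\<lambda>x. f x + g x)"
  by (simp add: plus_l2.abs_eq)

lemma abs_l2_diff: "L2_fun f \<Longrightarrow> L2_fun g \<Longrightarrow> abs_l2 f - abs_l2 g = abs_l2 (\<lambda>x. f x - g x)"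
  by (simp add: minus_l2.abs_eq)

lemma abs_l2_scaleR: "L2_fun f \<Longrightarrow> c *\<^sub>R abs_l2 f = abs_l2 (\<lambda>x. c *\<^sub>R f x)"
  by (simp add: scaleR_l2.abs_eq)

lemma abs_l2_zero: "abs_l2 (\<lambda>x. 0) = 0"
  by (simp add: zero_l2_def)

lemma L2_fun_sum: "(\<And>i. i \<in> I \<Longrightarrow> L2_fun (f i)) \<Longrightarrow> L2_fun (\<lambda>x. \<Sum>i\<in>I. f i x)"
  by (induction I rule: infinite_finite_induct) (auto simp: L2_fun_zero L2_fun_add)

lemma abs_l2_sum: "(\<And>i. i \<in> I \<Longrightarrow> L2_fun (f i)) \<Longrightarrow> (\<Sum>i\<in>I. abs_l2 (f i)) = abs_l2 (\<lambda>x. \<Sum>i\<in>I. f i x)"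
  by (induction I rule: infinite_finite_induct) (auto simp: abs_l2_zero abs_l2_add L2_fun_sum)

lemma norm_abs_l2: "L2_fun f \<Longrightarrow> (norm (abs_l2 f))\<^sup>2 = (\<integral> x. (norm (f x))\<^sup>2 \<partial>lebesgue)"
  by (simp add: power2_norm_eq_inner inner_abs_l2)

lemma norm_abs_l2_mono:
  assumes "L2_fun f" "L2_fun g" "C \<ge> 0" "\<And>x. norm (f x) \<le> C * norm (g x)"
  shows "norm (abs_l2 f) \<le> C * norm (abs_l2 g)"
proof -
  have "(norm (abs_l2 f))\<^sup>2 = (\<integral> x. (norm (f x))\<^sup>2 \<partial>lebesgue)" by (rule norm_abs_l2[OF assms(1)])
  also have "\<dots> \<le> (\<integral> x. C\<^sup>2 * (norm (g x))\<^sup>2 \<partial>lebesgue)"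
  proof (rule integral_mono)
    show "(norm (f x))\<^sup>2 \<le> C\<^sup>2 * (norm (g x))\<^sup>2" for x
      using power_mono[OF assms(4) norm_ge_zero, of x 2] by (simp add: power_mult_distrib)
  qed (use assms L2_fun_integrable_sq in auto)
  also have "\<dots> = (C * norm (abs_l2 g))\<^sup>2" by (simp add: norm_abs_l2[OF assms(2)] power_mult_distrib)
  finally show ?thesis by (rule power2_le_imp_le) (use assms(3) in simp)
qed

lemma nn_integral_L2:
  assumes "L2_fun f" shows "(\<integral>\<^sup>+ x. ennreal ((norm (f x))\<^sup>2) \<partial>lebesgue) = ennreal ((norm (abs_l2 f))\<^sup>2)"
  using assms by (simp add: norm_abs_l2 nn_integral_eq_integral L2_fun_integrable_sq)

lemma L2_fun_iff_nn_integral: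
  "L2_fun f \<longleftrightarrow> f \<in> borel_measurable lebesgue \<and> (\<integral>\<^sup>+ x. ennreal ((norm (f x))\<^sup>2) \<partial>lebesgue) < \<infinity>"
  unfolding L2_fun_def by (auto simp: integrable_iff_bounded)

lemma summable_increments_converge:
  fixes x :: "nat \<Rightarrow> 'v::banach"
  assumes bound: "\<And>n. norm (x (Suc n) - x n) \<le> c n" and "c sums C"
  shows "\<exists>l. x \<longlonglongrightarrow> l \<and> norm (l - x 0) \<le> C"
proof -
  let ?d = "\<lambda>n. x (Suc n) - x n"
  have abs_summable: "summable (\<lambda>n. norm (?d n))"
    by (rule summable_comparison_test'[OF sums_summable[OF \<open>c sums C\<close>], where N = 0]) (use bound in auto)
  then have "(\<lambda>n. \<Sum>k<n. ?d k) \<longlonglongrightarrow> suminf ?d" by (rule summable_LIMSEQ[OF summable_norm_cancel])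
  then have "(\<lambda>n. x n - x 0) \<longlonglongrightarrow> suminf ?d" by (simp only: sum_lessThan_telescope)
  from tendsto_add[OF this tendsto_const[of "x 0"]] have "x \<longlonglongrightarrow> suminf ?d + x 0" by simp
  moreover have "norm (suminf ?d) \<le> C"
  proof -
    have "norm (suminf ?d) \<le> (\<Sum>n. norm (?d n))" using abs_summable by (rule summable_norm)
    also have "\<dots> \<le> (\<Sum>n. c n)" by (intro suminf_le bound abs_summable sums_summable[OF \<open>c sums C\<close>])
    finally show ?thesis using \<open>c sums C\<close> by (simp add: sums_iff)
  qed
  ultimately show ?thesis by (intro exI[of _ "suminf ?d + x 0"]) simp
qed

lemma fast_Cauchy_subsequence:
  fixes X :: "nat \<Rightarrow> 'm::metric_space"
  assumes "Cauchy X" "\<And>n. e n > 0"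
  obtains r where "strict_mono (r::nat \<Rightarrow> nat)" "\<And>n m. m \<ge> n \<Longrightarrow> dist (X (r m)) (X (r n)) < e n"
proof -
  have "\<exists>N. \<forall>m\<ge>N. \<forall>k\<ge>N. dist (X m) (X k) < e n" for n
    using assms by (auto simp: Cauchy_def)
  then obtain N where N: "\<And>n m k. m \<ge> N n \<Longrightarrow> k \<ge> N n \<Longrightarrow> dist (X m) (X k) < e n" by metis
  define r where "r n = (\<Sum>i\<le>n. Suc (N i))" for n
  have r: "strict_mono r" by (rule strict_monoI_Suc) (simp add: r_def)
  have ge: "r n \<ge> N n" for n
  proof -
    have "Suc (N n) \<le> r n" unfolding r_def by (rule member_le_sum) auto
    then show ?thesis by simp
  qed
  show ?thesis
  proof (rule that[OF r])
    show "dist (X (r m)) (X (r n)) < e n" if "m \<ge> n" for m n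
      using ge[of n] strict_mono_less_eq[OF r, of n m] that by (intro N) auto
  qed
qed

lemma AE_suminf_finite:
  fixes d :: "nat \<Rightarrow> 'a \<Rightarrow> ennreal"
  assumes [measurable]: "\<And>n. d n \<in> borel_measurable M"
    and bound: "\<And>n. (\<integral>\<^sup>+ x. d n x \<partial>M) \<le> ennreal (c n)" and c: "summable c" "\<And>n. 0 \<le> c n"
  shows "AE x in M. (\<Sum>n. d n x) \<noteq> \<infinity>"
proof (rule nn_integral_PInf_AE)
  have "(\<integral>\<^sup>+ x. (\<Sum>n. d n x) \<partial>M) = (\<Sum>n. \<integral>\<^sup>+ x. d n x \<partial>M)" by (rule nn_integral_suminf) measurable
  also have "\<dots> \<le> (\<Sum>n. ennreal (c n))" by (intro suminf_le allI bound) auto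
  also have "\<dots> = ennreal (\<Sum>n. c n)" by (rule suminf_ennreal2[OF c(2,1)])
  finally show "(\<integral>\<^sup>+ x. (\<Sum>n. d n x) \<partial>M) \<noteq> \<infinity>"
    by (simp add: neq_top_trans[OF ennreal_neq_top])
qed measurable

lemma convergent_of_weighted_squares:
  fixes f :: "nat \<Rightarrow> 'b::banach"
  assumes "(\<Sum>n. ennreal (4 ^ n * (norm (f (Suc n) - f n))\<^sup>2)) \<noteq> \<infinity>"
  shows "convergent f"
proof -
  let ?t = "\<lambda>n. 4 ^ n * (norm (f (Suc n) - f n))\<^sup>2"
  define C where "C = enn2real (\<Sum>n. ennreal (?t n))"
  have "ennreal C = (\<Sum>n. ennreal (?t n))" using assms by (simp only: C_def ennreal_enn2real_if) simp
  have increments: "norm (f (Suc n) - f n) \<le> sqrt C * (1/2) ^ n" for n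
  proof -
    have "(\<Sum>k\<in>{n}. ennreal (?t k)) \<le> (\<Sum>k. ennreal (?t k))" by (rule sum_le_suminf) auto
    then have "ennreal (?t n) \<le> ennreal C" by (simp only: \<open>ennreal C = _\<close>) simp
    then have "?t n \<le> C" by (rule ennreal_le_iff[THEN iffD1, rotated]) (simp add: C_def)
    moreover have "(4::real) ^ n = (2 ^ n)\<^sup>2" by (simp add: power2_eq_square flip: power_mult_distrib)
    ultimately have "(2 ^ n * norm (f (Suc n) - f n))\<^sup>2 \<le> C" by (simp only: power_mult_distrib)
    then have "2 ^ n * norm (f (Suc n) - f n) \<le> sqrt C" by (rule real_le_rsqrt)
    then show ?thesis by (simp add: field_simps power_divide)
  qed
  have "(\<lambda>n. sqrt C * (1/2) ^ n) sums (sqrt C * (1 / (1 - 1/2)))"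
    by (rule sums_mult[OF geometric_sums]) simp
  from summable_increments_converge[OF increments this] show ?thesis by (auto simp: convergent_def)
qed

lemma fast_L2_sequence_converges_AE:
  fixes f :: "nat \<Rightarrow> 'a \<Rightarrow> 'b::{banach, second_countable_topology}"
  assumes [measurable]: "\<And>n. f n \<in> borel_measurable M"
    and fast: "\<And>n. (\<integral>\<^sup>+ x. ennreal ((norm (f (Suc n) x - f n x))\<^sup>2) \<partial>M) \<le> ennreal ((1/16) ^ n)"
  shows "AE x in M. convergent (\<lambda>n. f n x)"
proof -
  let ?d = "\<lambda>n x. ennreal (4 ^ n * (norm (f (Suc n) x - f n x))\<^sup>2)"
  have "AE x in M. (\<Sum>n. ?d n x) \<noteq> \<infinity>"
  proof (rule AE_suminf_finite)
    fix n
    have "?d n x = ennreal (4 ^ n) * ennreal ((norm (f (Suc n) x - f n x))\<^sup>2)" for x by (rule ennreal_mult) auto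
    then have "(\<integral>\<^sup>+ x. ?d n x \<partial>M) = (\<integral>\<^sup>+ x. ennreal (4 ^ n) * ennreal ((norm (f (Suc n) x - f n x))\<^sup>2) \<partial>M)"
      by (simp only:)
    also have "\<dots> = ennreal (4 ^ n) * (\<integral>\<^sup>+ x. ennreal ((norm (f (Suc n) x - f n x))\<^sup>2) \<partial>M)"
      by (rule nn_integral_cmult) measurable
    also have "\<dots> \<le> ennreal (4 ^ n) * ennreal ((1/16) ^ n)" by (intro mult_left_mono fast) auto
    also have "\<dots> = ennreal (4 ^ n * (1/16) ^ n)" by (rule ennreal_mult[symmetric]) auto
    also have "4 ^ n * (1/16) ^ n = (1/4 :: real) ^ n" by (subst power_mult_distrib[symmetric]) simp
    finally show "(\<integral>\<^sup>+ x. ?d n x \<partial>M) \<le> ennreal ((1/4) ^ n)" .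
  next
    show "?d n \<in> borel_measurable M" for n by measurable
  qed (simp_all add: summable_geometric)
  then show ?thesis by eventually_elim (rule convergent_of_weighted_squares)
qed

lemma nn_integral_sq_dist_limit_le:
  fixes f :: "nat \<Rightarrow> 'a \<Rightarrow> 'b::{real_normed_vector, second_countable_topology}"
  assumes [measurable]: "\<And>n. f n \<in> borel_measurable M" "h \<in> borel_measurable M"
    and lim: "AE x in M. (\<lambda>n. f n x) \<longlonglongrightarrow> g x"
    and bound: "eventually (\<lambda>n. (\<integral>\<^sup>+ x. ennreal ((norm (f n x - h x))\<^sup>2) \<partial>M) \<le> C) sequentially"
  shows "(\<integral>\<^sup>+ x. ennreal ((norm (g x - h x))\<^sup>2) \<partial>M) \<le> C"
proof -
  have "(\<integral>\<^sup>+ x. ennreal ((norm (g x - h x))\<^sup>2) \<partial>M)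
      = (\<integral>\<^sup>+ x. liminf (\<lambda>n. ennreal ((norm (f n x - h x))\<^sup>2)) \<partial>M)"
  proof (rule nn_integral_cong_AE)
    show "AE x in M. ennreal ((norm (g x - h x))\<^sup>2) = liminf (\<lambda>n. ennreal ((norm (f n x - h x))\<^sup>2))"
      using lim
    proof eventually_elim
      case (elim x)
      then have "(\<lambda>n. ennreal ((norm (f n x - h x))\<^sup>2)) \<longlonglongrightarrow> ennreal ((norm (g x - h x))\<^sup>2)"
        by (intro tendsto_ennrealI tendsto_intros)
      then show ?case using lim_imp_Liminf[OF sequentially_bot] by metis
    qed
  qed
  also have "\<dots> \<le> liminf (\<lambda>n. \<integral>\<^sup>+ x. ennreal ((norm (f n x - h x))\<^sup>2) \<partial>M)"
    by (rule nn_integral_liminf) measurable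
  also have "\<dots> \<le> limsup (\<lambda>n. \<integral>\<^sup>+ x. ennreal ((norm (f n x - h x))\<^sup>2) \<partial>M)"
    by (intro Liminf_le_Limsup) auto
  also have "\<dots> \<le> C" by (rule Limsup_bounded[OF bound])
  finally show ?thesis .
qed

lemma nn_integral_rep_l2_diff:
  "(\<integral>\<^sup>+ x. ennreal ((norm (rep_l2 X x - rep_l2 Y x))\<^sup>2) \<partial>lebesgue) = ennreal ((dist X Y)\<^sup>2)"
  using nn_integral_L2[OF L2_fun_diff[OF L2_fun_rep[of X] L2_fun_rep[of Y]]]
  by (simp only: dist_norm abs_l2_diff[OF L2_fun_rep L2_fun_rep, symmetric] abs_rep_l2)

lemma norm_diff_abs_l2_le:
  fixes g :: "'a::euclidean_space \<Rightarrow> 'b::euclidean_space"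
  assumes [measurable]: "g \<in> borel_measurable lebesgue" and C: "C \<ge> 0"
    and bound: "(\<integral>\<^sup>+ x. ennreal ((norm (g x - rep_l2 X x))\<^sup>2) \<partial>lebesgue) \<le> ennreal (C\<^sup>2)"
  shows "norm (X - abs_l2 g) \<le> C"
proof -
  have [measurable]: "rep_l2 X \<in> borel_measurable lebesgue" using L2_fun_rep[of X] by (simp add: L2_fun_def)
  have diff: "L2_fun (\<lambda>x. g x - rep_l2 X x)"
    unfolding L2_fun_iff_nn_integral using le_less_trans[OF bound ennreal_less_top] by simp
  then have g: "L2_fun g" using L2_fun_add[OF diff L2_fun_rep[of X]] by simp
  have "ennreal ((norm (abs_l2 g - X))\<^sup>2) \<le> ennreal (C\<^sup>2)"
    using bound by (simp only: nn_integral_L2[OF diff] abs_l2_diff[OF g L2_fun_rep, symmetric] abs_rep_l2)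
  then have "(norm (abs_l2 g - X))\<^sup>2 \<le> C\<^sup>2" by (rule ennreal_le_iff[THEN iffD1, rotated]) simp
  then have "norm (abs_l2 g - X) \<le> C" using C by (rule power2_le_imp_le)
  then show ?thesis by (simp only: norm_minus_commute)
qed

lemma fast_Cauchy_l2_convergent:
  fixes X :: "nat \<Rightarrow> ('a::euclidean_space, 'b::euclidean_space) l2"
  assumes fast: "\<And>n m. m \<ge> n \<Longrightarrow> dist (X m) (X n) < (1/4) ^ n"
  shows "convergent X"
proof -
  define f where "f n = rep_l2 (X n)" for n
  have [measurable]: "f n \<in> borel_measurable lebesgue" for n
    using L2_fun_rep[of "X n"] by (simp add: L2_fun_def f_def)
  have dist_le: "(\<integral>\<^sup>+ x. ennreal ((norm (f m x - f n x))\<^sup>2) \<partial>lebesgue) \<le> ennreal (((1/4) ^ n)\<^sup>2)" if "m \<ge> n" for m n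
    unfolding f_def nn_integral_rep_l2_diff
    using fast[OF that] by (intro ennreal_leI power_mono) (auto simp: less_imp_le)
  have "AE x in lebesgue. convergent (\<lambda>n. f n x)"
  proof (rule fast_L2_sequence_converges_AE)
    fix n
    have "((1/4) ^ n)\<^sup>2 = (1/16 :: real) ^ n"
      unfolding power2_eq_square by (subst power_mult_distrib[symmetric]) simp
    then show "(\<integral>\<^sup>+ x. ennreal ((norm (f (Suc n) x - f n x))\<^sup>2) \<partial>lebesgue) \<le> ennreal ((1/16) ^ n)"
      using dist_le[of n "Suc n"] by (simp only: le_SucI order_refl)
  qed measurable
  then have lim: "AE x in lebesgue. (\<lambda>n. f n x) \<longlonglongrightarrow> lim (\<lambda>n. f n x)" by (simp add: convergent_LIMSEQ_iff)
  define g where "g x = lim (\<lambda>n. f n x)" for x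
  have [measurable]: "g \<in> borel_measurable lebesgue"
    unfolding g_def by (rule borel_measurable_lim_metric) measurable
  have "(\<integral>\<^sup>+ x. ennreal ((norm (g x - f n x))\<^sup>2) \<partial>lebesgue) \<le> ennreal (((1/4) ^ n)\<^sup>2)" for n
  proof (rule nn_integral_sq_dist_limit_le)
    show "AE x in lebesgue. (\<lambda>m. f m x) \<longlonglongrightarrow> g x" using lim by (simp only: g_def)
    show "eventually (\<lambda>m. (\<integral>\<^sup>+ x. ennreal ((norm (f m x - f n x))\<^sup>2) \<partial>lebesgue) \<le> ennreal (((1/4) ^ n)\<^sup>2)) sequentially"
      using eventually_ge_at_top[of n] by eventually_elim (rule dist_le)
  qed measurable
  then have "norm (X n - abs_l2 g) \<le> (1/4) ^ n" for n by (intro norm_diff_abs_l2_le) (simp_all add: f_def)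
  moreover have "(\<lambda>n. (1/4::real) ^ n) \<longlonglongrightarrow> 0" by (rule LIMSEQ_realpow_zero) auto
  ultimately have "(\<lambda>n. X n - abs_l2 g) \<longlonglongrightarrow> 0" by (rule Lim_null_comparison[OF always_eventually[OF allI]])
  then show ?thesis by (auto simp: convergent_def LIM_zero_iff)
qed

instance l2 :: (euclidean_space, euclidean_space) banach
proof
  fix X :: "nat \<Rightarrow> ('a, 'b) l2"
  assume X: "Cauchy X"
  obtain r where r: "strict_mono r" "\<And>n m. m \<ge> n \<Longrightarrow> dist (X (r m)) (X (r n)) < (1/4) ^ n"
    using fast_Cauchy_subsequence[OF X, of "\<lambda>n. (1/4) ^ n"] by auto
  have "convergent (\<lambda>n. X (r n))" by (rule fast_Cauchy_l2_convergent[OF r(2)])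
  then obtain l where "(X \<circ> r) \<longlonglongrightarrow> l" by (auto simp: convergent_def o_def)
  then have "X \<longlonglongrightarrow> l" using Cauchy_converges_subseq[OF X r(1)] by simp
  then show "convergent X" by (auto simp: convergent_def)
qed

section \<open>Smooth functions\<close>

primrec Ck :: "nat \<Rightarrow> ('a::euclidean_space \<Rightarrow> real) \<Rightarrow> bool" where
  "Ck 0 f \<longleftrightarrow> continuous_on UNIV f"
| "Ck (Suc k) f \<longleftrightarrow> (\<forall>x. f differentiable (at x)) \<and> (\<forall>b\<in>Basis. Ck k (\<lambda>x. frechet_derivative f (at x) b))"

lemma Ck_Suc_imp: "Ck (Suc k) f \<Longrightarrow> Ck k f"
  by (induction k arbitrary: f) (auto intro!: differentiable_imp_continuous_on simp: differentiable_on_def)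

lemma smooth_fun_iff_Ck: "smooth_fun f \<longleftrightarrow> (\<forall>k. Ck k f)"
proof
  assume "smooth_fun f"
  then obtain S where S: "f \<in> S" "\<And>g. g \<in> S \<Longrightarrow> continuous_on UNIV g \<and> (\<forall>x. g differentiable (at x)) \<and>
        (\<forall>b\<in>Basis. (\<lambda>x. frechet_derivative g (at x) b) \<in> S)"
    unfolding smooth_fun_def by blast
  have "Ck k g" if "g \<in> S" for k g
    using that by (induction k arbitrary: g) (use S(2) in auto)
  then show "\<forall>k. Ck k f" using S(1) by blast
next
  assume f: "\<forall>k. Ck k f"
  have "continuous_on UNIV g \<and> (\<forall>x. g differentiable (at x)) \<and>
        (\<forall>b\<in>Basis. (\<lambda>x. frechet_derivative g (at x) b) \<in> {g. \<forall>k. Ck k g})" if "\<forall>k. Ck k g" for g :: "'a \<Rightarrow> real"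
  proof -
    have "Ck 0 g" "Ck (Suc k) g" for k using that by blast+
    then show ?thesis by auto
  qed
  then show "smooth_fun f" unfolding smooth_fun_def using f by (intro exI[of _ "{g. \<forall>k. Ck k g}"]) blast
qed

lemma Ck_SucI:
  assumes "\<And>x. (f has_derivative D x) (at x)" "\<And>b. b \<in> Basis \<Longrightarrow> Ck k (\<lambda>x. D x b)"
  shows "Ck (Suc k) f"
  using assms by (auto simp: differentiable_def frechet_derivative_at[OF assms(1), symmetric])

lemma Ck_SucD: "Ck (Suc k) f \<Longrightarrow> (f has_derivative frechet_derivative f (at x)) (at x)"
  by (simp add: frechet_derivative_works)

lemma Ck_local:
  assumes "\<And>x. \<exists>S g. open S \<and> x \<in> S \<and> Ck k g \<and> (\<forall>y\<in>S. f y = g y)"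
  shows "Ck k f"
  using assms
proof (induction k arbitrary: f)
  case 0
  have "isCont f x" for x
  proof -
    obtain S g where S: "open S" "x \<in> S" "Ck 0 g" "\<And>y. y \<in> S \<Longrightarrow> f y = g y" using 0 by metis
    have "isCont g x" using S(3) by (simp add: continuous_on_eq_continuous_at)
    moreover have "\<forall>\<^sub>F y in nhds x. f y = g y"
      using eventually_nhds_in_open[OF S(1,2)] by eventually_elim (rule S(4))
    ultimately show ?thesis by (simp add: isCont_cong)
  qed
  then show ?case by (simp add: continuous_on_eq_continuous_at)
next
  case (Suc k)
  have partial_eq: "frechet_derivative f (at y) = frechet_derivative g (at y)"
    if "open S" "y \<in> S" "Ck (Suc k) g" "\<forall>z\<in>S. f z = g z" for S y g
    using that frechet_derivative_transform_within_open[of g y S f] by simp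
  have "f differentiable (at x)" for x
  proof -
    obtain S g where S: "open S" "x \<in> S" "Ck (Suc k) g" "\<forall>y\<in>S. f y = g y" using Suc.prems by metis
    have "(f has_derivative frechet_derivative g (at x)) (at x)"
      by (rule has_derivative_transform_within_open[OF Ck_SucD[OF S(3)] S(1,2)]) (simp add: S(4))
    then show ?thesis by (rule differentiableI)
  qed
  moreover have "Ck k (\<lambda>x. frechet_derivative f (at x) b)" if b: "b \<in> Basis" for b
  proof (rule Suc.IH)
    fix x
    obtain S g where S: "open S" "x \<in> S" "Ck (Suc k) g" "\<forall>y\<in>S. f y = g y" using Suc.prems by metis
    have "\<forall>y\<in>S. frechet_derivative f (at y) b = frechet_derivative g (at y) b"
      using partial_eq[OF S(1) _ S(3,4)] by simp
    moreover have "Ck k (\<lambda>x. frechet_derivative g (at x) b)" using S(3) b by simp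
    ultimately show "\<exists>S h. open S \<and> x \<in> S \<and> Ck k h \<and> (\<forall>y\<in>S. frechet_derivative f (at y) b = h y)"
      using S(1,2) by blast
  qed
  ultimately show ?case by simp
qed

lemma Ck_const: "Ck k (\<lambda>x. c)"
proof (induction k arbitrary: c)
  case (Suc k)
  show ?case by (rule Ck_SucI[where D = "\<lambda>_ _. 0"]) (auto intro: Suc)
qed simp

lemma Ck_add: "Ck k f \<Longrightarrow> Ck k g \<Longrightarrow> Ck k (\<lambda>x. f x + g x)"
proof (induction k arbitrary: f g)
  case (Suc k)
  show ?case
    by (rule Ck_SucI[OF has_derivative_add[OF Ck_SucD[OF Suc.prems(1)] Ck_SucD[OF Suc.prems(2)]]])
       (use Suc in auto)
qed (auto intro: continuous_intros)

lemma Ck_mult: "Ck k f \<Longrightarrow> Ck k g \<Longrightarrow> Ck k (\<lambda>x. f x * g x)"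
proof (induction k arbitrary: f g)
  case (Suc k)
  show ?case
  proof (rule Ck_SucI[OF has_derivative_mult[OF Ck_SucD[OF Suc.prems(1)] Ck_SucD[OF Suc.prems(2)]]])
    show "Ck k (\<lambda>x. f x * frechet_derivative g (at x) b + frechet_derivative f (at x) b * g x)" if "b \<in> Basis" for b
      using Suc.prems that Ck_Suc_imp[OF Suc.prems(1)] Ck_Suc_imp[OF Suc.prems(2)]
      by (intro Ck_add Suc.IH) auto
  qed
qed (auto intro: continuous_intros)

lemma Ck_inverse: "Ck k g \<Longrightarrow> (\<And>x. g x \<noteq> 0) \<Longrightarrow> Ck k (\<lambda>x. inverse (g x))"
proof (induction k arbitrary: g)
  case (Suc k)
  show ?case
  proof (rule Ck_SucI)
    show "((\<lambda>x. inverse (g x)) has_derivative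
        (\<lambda>h. - (inverse (g x) * frechet_derivative g (at x) h * inverse (g x)))) (at x)" for x
      using Suc.prems by (intro Deriv.has_derivative_inverse Ck_SucD[of k]) auto
    show "Ck k (\<lambda>x. - (inverse (g x) * frechet_derivative g (at x) b * inverse (g x)))" if "b \<in> Basis" for b
    proof -
      have "Ck k (\<lambda>x. (-1) * (inverse (g x) * frechet_derivative g (at x) b * inverse (g x)))"
        using Suc.prems that Ck_Suc_imp[OF Suc.prems(1)] by (intro Ck_mult Ck_const Suc.IH) auto
      then show ?thesis by simp
    qed
  qed
qed (auto intro: continuous_intros)

lemma Ck_sum: "(\<And>i. i \<in> I \<Longrightarrow> Ck k (f i)) \<Longrightarrow> Ck k (\<lambda>x. \<Sum>i\<in>I. f i x)"
  by (induction I rule: infinite_finite_induct) (auto intro: Ck_const Ck_add)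

lemma Ck_prod: "(\<And>i. i \<in> I \<Longrightarrow> Ck k (f i)) \<Longrightarrow> Ck k (\<lambda>x. \<Prod>i\<in>I. f i x)"
  by (induction I rule: infinite_finite_induct) (auto intro: Ck_const Ck_mult)

lemma Ck_compose_affine:
  fixes f :: "'b::euclidean_space \<Rightarrow> real" and L :: "'a::euclidean_space \<Rightarrow> 'b"
  assumes L: "bounded_linear L"
  shows "Ck k f \<Longrightarrow> Ck k (\<lambda>x. f (L x + c))"
proof (induction k arbitrary: f)
  case 0
  have "continuous_on UNIV (\<lambda>x. L x + c)"
    by (intro continuous_intros linear_continuous_on L)
  then show ?case using 0 continuous_on_compose2[of UNIV f UNIV "\<lambda>x. L x + c"] by simp
next
  case (Suc k)
  let ?D = "\<lambda>x h. frechet_derivative f (at (L x + c)) (L h)"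
  have D: "((\<lambda>x. f (L x + c)) has_derivative ?D x) (at x)" for x
  proof -
    have "((\<lambda>x. L x + c) has_derivative L) (at x)"
      using has_derivative_add[OF bounded_linear_imp_has_derivative[OF L] has_derivative_const[of c]] by simp
    then show ?thesis
      using has_derivative_compose[of "\<lambda>x. L x + c" L x UNIV f] Ck_SucD[OF Suc.prems, of "L x + c"] by simp
  qed
  show ?case
  proof (rule Ck_SucI[OF D])
    fix b :: 'a assume "b \<in> Basis"
    have "?D x b = (\<Sum>i\<in>Basis. (L b \<bullet> i) * frechet_derivative f (at (L x + c)) i)" for x
    proof -
      have "linear (frechet_derivative f (at (L x + c)))"
        using Ck_SucD[OF Suc.prems] has_derivative_linear by blast
      then show ?thesis
        by (subst (1) euclidean_representation[of "L b", symmetric]) (simp add: linear_sum linear_cmul)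
    qed
    moreover have "Ck k (\<lambda>x. \<Sum>i\<in>Basis. (L b \<bullet> i) * frechet_derivative f (at (L x + c)) i)"
      using Suc.prems by (intro Ck_sum Ck_mult Ck_const Suc.IH) auto
    ultimately show "Ck k (\<lambda>x. ?D x b)" by simp
  qed
qed

lemma Ck_real_SucI:
  fixes f :: "real \<Rightarrow> real"
  assumes "\<And>t. (f has_real_derivative f' t) (at t)" "Ck k f'"
  shows "Ck (Suc k) f"
  by (rule Ck_SucI[where D = "\<lambda>t h. f' t * h"])
     (use assms in \<open>auto simp: has_field_derivative_def\<close>)

lemma smooth_fun_const: "smooth_fun (\<lambda>x. c)"
  and smooth_fun_add: "smooth_fun f \<Longrightarrow> smooth_fun g \<Longrightarrow> smooth_fun (\<lambda>x. f x + g x)"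
  and smooth_fun_mult: "smooth_fun f \<Longrightarrow> smooth_fun g \<Longrightarrow> smooth_fun (\<lambda>x. f x * g x)"
  by (auto simp: smooth_fun_iff_Ck Ck_const Ck_add Ck_mult)

lemma smooth_fun_prod: "(\<And>i. i \<in> I \<Longrightarrow> smooth_fun (f i)) \<Longrightarrow> smooth_fun (\<lambda>x. \<Prod>i\<in>I. f i x)"
  by (auto simp: smooth_fun_iff_Ck Ck_prod)

lemma smooth_fun_compose_affine: "bounded_linear L \<Longrightarrow> smooth_fun f \<Longrightarrow> smooth_fun (\<lambda>x. f (L x + c))"
  by (auto simp: smooth_fun_iff_Ck Ck_compose_affine)

lemma smooth_fun_inverse: "smooth_fun f \<Longrightarrow> (\<And>x. f x \<noteq> 0) \<Longrightarrow> smooth_fun (\<lambda>x. inverse (f x))"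
  by (auto simp: smooth_fun_iff_Ck Ck_inverse)

lemma smooth_fun_local:
  assumes "\<And>x. \<exists>S g. open S \<and> x \<in> S \<and> smooth_fun g \<and> (\<forall>y\<in>S. f y = g y)"
  shows "smooth_fun f"
  unfolding smooth_fun_iff_Ck
proof (intro allI Ck_local)
  show "\<exists>S g. open S \<and> x \<in> S \<and> Ck k g \<and> (\<forall>y\<in>S. f y = g y)" for k x
    using assms[of x] by (auto simp: smooth_fun_iff_Ck)
qed

lemma smooth_fun_differentiable: "smooth_fun f \<Longrightarrow> f differentiable (at x)"
  and smooth_fun_continuous: "smooth_fun f \<Longrightarrow> continuous_on UNIV f"
  and smooth_fun_partial_continuous: "smooth_fun f \<Longrightarrow> b \<in> Basis \<Longrightarrow> continuous_on UNIV (\<lambda>x. frechet_derivative f (at x) b)"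
proof -
  assume "smooth_fun f"
  then have "Ck 0 f" "Ck 1 f" by (auto simp: smooth_fun_iff_Ck)
  then show "f differentiable (at x)" "continuous_on UNIV f"
    "b \<in> Basis \<Longrightarrow> continuous_on UNIV (\<lambda>x. frechet_derivative f (at x) b)" by auto
qed

lemma smooth_fun_has_real_derivative: "smooth_fun f \<Longrightarrow> (f has_real_derivative deriv f t) (at t)"
  by (simp add: DERIV_deriv_iff_real_differentiable smooth_fun_differentiable)

lemma smooth_fun_continuous_deriv:
  assumes "smooth_fun f" shows "continuous_on UNIV (deriv f)"
proof -
  have "(*) (deriv f t) = frechet_derivative f (at t)" for t
    using smooth_fun_has_real_derivative[OF assms, of t]
    unfolding has_field_derivative_def by (rule frechet_derivative_at)
  from fun_cong[OF this, of _ 1] have "deriv f = (\<lambda>t. frechet_derivative f (at t) 1)" by auto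
  then show ?thesis using smooth_fun_partial_continuous[OF assms, of 1] by simp
qed

lemma bounded_range_of_compact_support:
  fixes f :: "'a::topological_space \<Rightarrow> 'b::real_normed_vector"
  assumes f: "continuous_on UNIV f" and K: "compact K" "\<And>x. x \<notin> K \<Longrightarrow> f x = 0"
  shows "bounded (range f)"
proof -
  have "bounded (insert 0 (f ` K))"
    using compact_continuous_image[OF continuous_on_subset[OF f] K(1)] by (simp add: compact_imp_bounded)
  then show ?thesis by (rule bounded_subset) (use K(2) in auto)
qed

definition flat_exp :: "real \<Rightarrow> real" where
  "flat_exp t = (if t > 0 then exp (- inverse t) else 0)"

lemma flat_exp_nonneg: "0 \<le> flat_exp t" and flat_exp_pos: "t > 0 \<Longrightarrow> 0 < flat_exp t"
  and flat_exp_zero: "t \<le> 0 \<Longrightarrow> flat_exp t = 0" and flat_exp_le_1: "flat_exp t \<le> 1"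
  by (auto simp: flat_exp_def)

definition poly_flat_exp :: "real poly \<Rightarrow> real \<Rightarrow> real" where
  "poly_flat_exp p t = poly p (inverse t) * flat_exp t"

lemma poly_times_exp_tendsto_0:
  fixes p :: "real poly"
  shows "((\<lambda>y. poly p y * exp (- y)) \<longlongrightarrow> 0) at_top"
proof -
  have "((\<lambda>y::real. coeff p i * (y ^ i / exp y)) \<longlongrightarrow> 0) at_top" for i
    using tendsto_mult[OF tendsto_const[of "coeff p i"] tendsto_power_div_exp_0[of i]] by simp
  then have "((\<lambda>y::real. \<Sum>i\<le>degree p. coeff p i * (y ^ i / exp y)) \<longlongrightarrow> (\<Sum>i\<le>degree p. 0)) at_top"
    by (intro tendsto_sum)
  then show ?thesis
    by (simp add: poly_altdef exp_minus divide_inverse sum_distrib_right mult.assoc)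
qed

lemma poly_flat_exp_slope_at_0: "((\<lambda>h. poly_flat_exp p h / h) \<longlongrightarrow> 0) (at 0)"
proof -
  have "((\<lambda>h. poly ([:0, 1:] * p) (inverse h) * exp (- inverse h)) \<longlongrightarrow> 0) (at_right (0::real))"
    using filterlim_compose[OF poly_times_exp_tendsto_0[of "[:0, 1:] * p"] filterlim_inverse_at_top_right] .
  moreover have "\<forall>\<^sub>F h in at_right (0::real).
      poly ([:0, 1:] * p) (inverse h) * exp (- inverse h) = poly_flat_exp p h / h"
    using eventually_at_right_less[of 0]
    by eventually_elim (simp add: poly_flat_exp_def flat_exp_def divide_inverse)
  ultimately have "((\<lambda>h. poly_flat_exp p h / h) \<longlongrightarrow> 0) (at_right 0)" by (rule Lim_transform_eventually)
  moreover have "\<forall>\<^sub>F h in at_left (0::real). poly_flat_exp p h / h = 0"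
    by (auto simp: eventually_at_filter poly_flat_exp_def flat_exp_def)
  ultimately show ?thesis by (simp add: filterlim_at_split tendsto_eventually)
qed

lemma poly_flat_exp_derivative:
  "(poly_flat_exp p has_real_derivative poly_flat_exp ([:0, 0, 1:] * (p - pderiv p)) t) (at t)"
proof -
  consider (positive) "t > 0" | (negative) "t < 0" | (zero) "t = 0" by linarith
  then show ?thesis
  proof cases
    case positive
    have "((\<lambda>t. poly p (inverse t) * exp (- inverse t)) has_real_derivative
        poly (pderiv p) (inverse t) * (- (inverse t ^ 2)) * exp (- inverse t)
          + (exp (- inverse t) * (inverse t ^ 2)) * poly p (inverse t)) (at t)"
      using positive by (auto intro!: derivative_eq_intros DERIV_chain2[OF poly_DERIV] simp: power2_eq_square)
    moreover have "poly (pderiv p) (inverse t) * (- (inverse t ^ 2)) * exp (- inverse t)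
          + (exp (- inverse t) * (inverse t ^ 2)) * poly p (inverse t)
        = poly_flat_exp ([:0, 0, 1:] * (p - pderiv p)) t"
      using positive by (simp add: poly_flat_exp_def flat_exp_def power2_eq_square algebra_simps)
    moreover have "\<forall>\<^sub>F s in nhds t. poly_flat_exp p s = poly p (inverse s) * exp (- inverse s)"
      using eventually_nhds_in_open[of "{0<..}" t] positive
      by (auto simp: poly_flat_exp_def flat_exp_def elim!: eventually_mono)
    ultimately show ?thesis by (subst DERIV_cong_ev[OF refl _ refl]) auto
  next
    case negative
    have "\<forall>\<^sub>F s in nhds t. poly_flat_exp p s = 0"
      using eventually_nhds_in_open[of "{..<0}" t] negative
      by (auto simp: poly_flat_exp_def flat_exp_def elim!: eventually_mono)
    moreover have "poly_flat_exp ([:0, 0, 1:] * (p - pderiv p)) t = 0"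
      using negative by (simp add: poly_flat_exp_def flat_exp_def)
    ultimately show ?thesis by (subst DERIV_cong_ev[OF refl _ refl]) auto
  next
    case zero
    then show ?thesis
      using poly_flat_exp_slope_at_0[of p] by (simp add: has_field_derivative_iff poly_flat_exp_def flat_exp_def)
  qed
qed

lemma smooth_flat_exp: "smooth_fun flat_exp"
proof -
  have "Ck k (poly_flat_exp p)" for k p
  proof (induction k arbitrary: p)
    case 0
    have "isCont (poly_flat_exp p) t" for t using poly_flat_exp_derivative by (rule DERIV_isCont)
    then show ?case by (simp add: continuous_at_imp_continuous_on)
  next
    case (Suc k)
    then show ?case by (intro Ck_real_SucI[OF poly_flat_exp_derivative])
  qed
  moreover have "poly_flat_exp 1 = flat_exp" by (auto simp: poly_flat_exp_def)
  ultimately show ?thesis by (metis smooth_fun_iff_Ck)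
qed

definition smooth_step :: "real \<Rightarrow> real" where
  "smooth_step t = flat_exp t * inverse (flat_exp t + flat_exp (1 - t))"

lemma flat_exp_sum_pos: "flat_exp t + flat_exp (1 - t) > 0"
proof (cases "t > 0")
  case True
  then show ?thesis by (intro add_pos_nonneg flat_exp_pos flat_exp_nonneg)
next
  case False
  then show ?thesis by (intro add_nonneg_pos flat_exp_pos flat_exp_nonneg) simp
qed

lemma smooth_smooth_step: "smooth_fun smooth_step"
proof -
  have "smooth_fun (\<lambda>t. flat_exp (1 - t))"
    using smooth_fun_compose_affine[OF bounded_linear_minus[OF bounded_linear_ident] smooth_flat_exp, of 1]
    by (simp add: add.commute)
  moreover have "flat_exp t + flat_exp (1 - t) \<noteq> 0" for t using flat_exp_sum_pos[of t] by simp
  ultimately have "smooth_fun (\<lambda>t. flat_exp t * inverse (flat_exp t + flat_exp (1 - t)))"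
    by (intro smooth_fun_mult smooth_fun_inverse smooth_fun_add smooth_flat_exp)
  then show ?thesis by (simp add: smooth_step_def[abs_def])
qed

lemma smooth_step_0: "t \<le> 0 \<Longrightarrow> smooth_step t = 0"
  by (simp add: smooth_step_def flat_exp_zero)

lemma smooth_step_1: "t \<ge> 1 \<Longrightarrow> smooth_step t = 1"
  using flat_exp_pos[of t] by (simp add: smooth_step_def flat_exp_zero)

lemma smooth_step_range: "0 \<le> smooth_step t" "smooth_step t \<le> 1"
proof -
  show "0 \<le> smooth_step t" using flat_exp_sum_pos[of t] flat_exp_nonneg[of t] by (simp add: smooth_step_def)
  show "smooth_step t \<le> 1"
    using flat_exp_sum_pos[of t] flat_exp_nonneg[of "1 - t"] by (simp add: smooth_step_def field_simps)
qed

lemma deriv_smooth_step_eq_0: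
  assumes "t \<notin> {0..1}" shows "deriv smooth_step t = 0"
proof -
  consider (left) "t < 0" | (right) "t > 1" using assms by force
  then show ?thesis
  proof cases
    case left
    then have "\<forall>\<^sub>F s in nhds t. smooth_step s = 0"
      using eventually_nhds_in_open[of "{..<0}" t] by (auto simp: smooth_step_0 elim!: eventually_mono)
    then show ?thesis by (simp add: deriv_cong_ev)
  next
    case right
    then have "\<forall>\<^sub>F s in nhds t. smooth_step s = 1"
      using eventually_nhds_in_open[of "{1<..}" t] by (auto simp: smooth_step_1 elim!: eventually_mono)
    then show ?thesis by (simp add: deriv_cong_ev)
  qed
qed

definition smooth_step_slope :: real where
  "smooth_step_slope = (SUP t. \<bar>deriv smooth_step t\<bar>)"

lemma deriv_smooth_step_le: "\<bar>deriv smooth_step t\<bar> \<le> smooth_step_slope"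
  unfolding smooth_step_slope_def
proof (rule cSUP_upper)
  have "bounded (range (deriv smooth_step))"
    by (rule bounded_range_of_compact_support[OF smooth_fun_continuous_deriv[OF smooth_smooth_step], of "{0..1}"])
       (auto intro: deriv_smooth_step_eq_0)
  then show "bdd_above (range (\<lambda>t. \<bar>deriv smooth_step t\<bar>))" by (auto simp: bounded_iff bdd_above_def)
qed simp

lemma smooth_step_slope_pos: "0 < smooth_step_slope"
proof -
  obtain t where "smooth_step 1 - smooth_step 0 = (1 - 0) * deriv smooth_step t"
    using MVT2[of 0 1 smooth_step "deriv smooth_step"] smooth_fun_has_real_derivative[OF smooth_smooth_step]
    by (metis zero_less_one)
  then have "deriv smooth_step t = 1" by (simp add: smooth_step_0 smooth_step_1)
  then show ?thesis using deriv_smooth_step_le[of t] by simp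
qed

lemma grad_eqI:
  assumes "(f has_derivative (\<lambda>h. v \<bullet> h)) (at x)" shows "grad f x = v"
  using frechet_derivative_at[OF assms, symmetric] by (simp add: grad_def euclidean_representation)

lemma grad_inner:
  assumes "f differentiable (at x)" shows "grad f x \<bullet> h = frechet_derivative f (at x) h"
proof -
  have lin: "linear (frechet_derivative f (at x))"
    using assms frechet_derivative_works has_derivative_linear by blast
  have "frechet_derivative f (at x) h = frechet_derivative f (at x) (\<Sum>b\<in>Basis. (h \<bullet> b) *\<^sub>R b)"
    by (simp add: euclidean_representation)
  also have "\<dots> = (\<Sum>b\<in>Basis. (h \<bullet> b) * frechet_derivative f (at x) b)"
    by (simp add: linear_sum[OF lin] linear_cmul[OF lin])
  finally show ?thesis by (simp add: grad_def inner_sum_left inner_commute[of h] mult.commute)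
qed

lemma has_derivative_grad: "f differentiable (at x) \<Longrightarrow> (f has_derivative (\<lambda>h. grad f x \<bullet> h)) (at x)"
  using frechet_derivative_works[of f "at x"] by (simp add: grad_inner)

lemma grad_const: "grad (\<lambda>_. c) = (\<lambda>_. 0)"
  by (rule ext, rule grad_eqI) simp

lemma grad_add: "f differentiable (at x) \<Longrightarrow> g differentiable (at x) \<Longrightarrow> grad (\<lambda>x. f x + g x) x = grad f x + grad g x"
  by (rule grad_eqI) (auto intro!: derivative_eq_intros has_derivative_grad simp: inner_add_left)

lemma grad_mult:
  "f differentiable (at x) \<Longrightarrow> g differentiable (at x) \<Longrightarrow> grad (\<lambda>x. f x * g x) x = f x *\<^sub>R grad g x + g x *\<^sub>R grad f x"
  by (rule grad_eqI) (auto intro!: derivative_eq_intros has_derivative_grad simp: inner_add_left mult.commute)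

lemma grad_compose_inner:
  assumes "(g has_real_derivative g') (at (x \<bullet> e + c))"
  shows "grad (\<lambda>x. g (x \<bullet> e + c)) x = g' *\<^sub>R e"
proof (rule grad_eqI)
  have "((\<lambda>x. x \<bullet> e + c) has_derivative (\<lambda>h. h \<bullet> e)) (at x)" by (auto intro!: derivative_eq_intros)
  from has_derivative_compose[OF this assms[unfolded has_field_derivative_def]]
  show "((\<lambda>x. g (x \<bullet> e + c)) has_derivative (\<lambda>h. (g' *\<^sub>R e) \<bullet> h)) (at x)"
    by (simp add: inner_commute)
qed

lemma grad_cong_open:
  assumes "open S" "x \<in> S" "\<And>y. y \<in> S \<Longrightarrow> f y = g y" "g differentiable (at x)"
  shows "grad f x = grad g x"
  by (rule grad_eqI, rule has_derivative_transform_within_open[OF has_derivative_grad[OF assms(4)] assms(1,2)])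
     (use assms(3) in auto)

lemma grad_eq_0_off_support:
  assumes "closed K" "\<And>x. x \<notin> K \<Longrightarrow> f x = 0" "x \<notin> K"
  shows "grad f x = 0"
  using grad_cong_open[of "- K" x f "\<lambda>_. 0"] assms by (auto simp: grad_const)

lemma continuous_grad: "smooth_fun f \<Longrightarrow> continuous_on UNIV (grad f)"
  unfolding grad_def[abs_def] by (intro continuous_intros smooth_fun_partial_continuous)

lemma L2_fun_continuous_compact:
  fixes f :: "'a::euclidean_space \<Rightarrow> 'b::euclidean_space"
  assumes f: "continuous_on UNIV f" and K: "compact K" "\<And>x. x \<notin> K \<Longrightarrow> f x = 0"
  shows "L2_fun f"
proof -
  obtain C where C: "\<And>x. norm (f x) \<le> C"
    using bounded_range_of_compact_support[OF f K] by (auto simp: bounded_iff)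
  have bound: "norm (f x) \<le> C * norm (indicator K x :: real)" for x
    using C[of x] K(2)[of x] by (auto simp: indicator_def)
  have "f \<in> borel_measurable lebesgue"
    using borel_measurable_continuous_onI[OF f] by (simp add: measurable_completion)
  then show ?thesis
    by (rule L2_fun_bound[OF _ L2_fun_indicator_lmeasurable[OF lmeasurable_compact[OF K(1)]] AE_I2[OF bound]])
qed

lemma test_fun_smooth: "test_fun \<Omega> \<phi> \<Longrightarrow> smooth_fun \<phi>"
  and test_fun_differentiable: "test_fun \<Omega> \<phi> \<Longrightarrow> \<phi> differentiable (at x)"
  by (auto simp: test_fun_def smooth_fun_differentiable)

lemma L2_fun_test: assumes "test_fun \<Omega> \<phi>" shows "L2_fun \<phi>" "L2_fun (grad \<phi>)"
proof -
  obtain K where K: "smooth_fun \<phi>" "compact K" "\<And>x. x \<notin> K \<Longrightarrow> \<phi> x = 0"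
    using assms by (auto simp: test_fun_def)
  show "L2_fun \<phi>" by (rule L2_fun_continuous_compact[OF smooth_fun_continuous[OF K(1)] K(2,3)])
  show "L2_fun (grad \<phi>)"
    by (rule L2_fun_continuous_compact[OF continuous_grad[OF K(1)] K(2)])
       (rule grad_eq_0_off_support[OF compact_imp_closed[OF K(2)] K(3)])
qed

lemma test_fun_zero_outside: assumes "test_fun \<Omega> \<phi>" "x \<notin> \<Omega>" shows "\<phi> x = 0" "grad \<phi> x = 0"
proof -
  obtain K where "compact K" "\<And>x. x \<notin> K \<Longrightarrow> \<phi> x = 0" "K \<subseteq> \<Omega>"
    using assms(1) by (auto simp: test_fun_def)
  then show "\<phi> x = 0" "grad \<phi> x = 0"
    using grad_eq_0_off_support[of K \<phi> x] assms(2) by (auto simp: compact_imp_closed)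
qed

lemma test_fun_mono: "test_fun \<Omega> \<phi> \<Longrightarrow> \<Omega> \<subseteq> \<Omega>' \<Longrightarrow> test_fun \<Omega>' \<phi>"
  by (auto simp: test_fun_def)

lemma test_fun_zero: "test_fun \<Omega> (\<lambda>x. 0)"
  by (auto simp: test_fun_def smooth_fun_const intro!: exI[of _ "{}"])

lemma test_fun_add: assumes "test_fun \<Omega> \<phi>" "test_fun \<Omega> \<psi>" shows "test_fun \<Omega> (\<lambda>x. \<phi> x + \<psi> x)"
proof -
  obtain K L where "smooth_fun \<phi>" "compact K" "K \<subseteq> \<Omega>" "\<And>x. x \<notin> K \<Longrightarrow> \<phi> x = 0"
    "smooth_fun \<psi>" "compact L" "L \<subseteq> \<Omega>" "\<And>x. x \<notin> L \<Longrightarrow> \<psi> x = 0"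
    using assms by (auto simp: test_fun_def)
  then show ?thesis unfolding test_fun_def
    by (intro conjI smooth_fun_add exI[of _ "K \<union> L"]) auto
qed

lemma test_fun_mult:
  assumes "test_fun \<Omega> \<phi>" "smooth_fun \<xi>" "closed C" "\<And>x. x \<notin> C \<Longrightarrow> \<xi> x = 0" "\<Omega> \<inter> C \<subseteq> \<Omega>'"
  shows "test_fun \<Omega>' (\<lambda>x. \<xi> x * \<phi> x)"
proof -
  obtain K where K: "smooth_fun \<phi>" "compact K" "K \<subseteq> \<Omega>" "\<And>x. x \<notin> K \<Longrightarrow> \<phi> x = 0"
    using assms(1) by (auto simp: test_fun_def)
  have "compact (K \<inter> C)" using K(2) assms(3) by (rule compact_Int_closed)
  moreover have "K \<inter> C \<subseteq> \<Omega>'" using K(3) assms(5) by auto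
  moreover have "\<xi> x * \<phi> x = 0" if "x \<notin> K \<inter> C" for x using that K(4) assms(4) by auto
  ultimately show ?thesis unfolding test_fun_def using smooth_fun_mult[OF assms(2) K(1)] by blast
qed

section \<open>The resolvent of the Dirichlet Laplacian\<close>

abbreviation l2_graph :: "('a::euclidean_space \<Rightarrow> real) \<Rightarrow> ('a, real) l2 \<times> ('a, 'a) l2" where
  "l2_graph \<phi> \<equiv> (abs_l2 \<phi>, abs_l2 (grad \<phi>))"

definition form_space :: "'a::euclidean_space set \<Rightarrow> (('a, real) l2 \<times> ('a, 'a) l2) set" where
  "form_space \<Omega> = closure (l2_graph ` Collect (test_fun \<Omega>))"

lemma subspace_l2_graph_test: "subspace (l2_graph ` Collect (test_fun \<Omega>))"
  unfolding subspace_def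
proof (intro conjI ballI allI)
  show "0 \<in> l2_graph ` Collect (test_fun \<Omega>)"
    unfolding zero_prod_def using test_fun_zero
    by (auto simp: grad_const abs_l2_zero intro!: image_eqI[of _ _ "\<lambda>x. 0"])
next
  fix p q assume "p \<in> l2_graph ` Collect (test_fun \<Omega>)" "q \<in> l2_graph ` Collect (test_fun \<Omega>)"
  then obtain \<phi> \<psi> where test: "test_fun \<Omega> \<phi>" "test_fun \<Omega> \<psi>" and pq: "p = l2_graph \<phi>" "q = l2_graph \<psi>" by auto
  have "grad (\<lambda>x. \<phi> x + \<psi> x) = (\<lambda>x. grad \<phi> x + grad \<psi> x)"
    using test by (auto intro!: grad_add test_fun_differentiable)
  then have "p + q = l2_graph (\<lambda>x. \<phi> x + \<psi> x)"
    using pq L2_fun_test[OF test(1)] L2_fun_test[OF test(2)] by (simp add: abs_l2_add)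
  then show "p + q \<in> l2_graph ` Collect (test_fun \<Omega>)" using test_fun_add[OF test] by auto
next
  fix p and c :: real assume "p \<in> l2_graph ` Collect (test_fun \<Omega>)"
  then obtain \<phi> where \<phi>: "test_fun \<Omega> \<phi>" and p: "p = l2_graph \<phi>" by auto
  have "grad (\<lambda>x. c * \<phi> x) = (\<lambda>x. c *\<^sub>R grad \<phi> x)"
    using grad_mult[OF differentiable_const test_fun_differentiable[OF \<phi>]] by (auto simp: grad_const)
  then have "c *\<^sub>R p = l2_graph (\<lambda>x. c * \<phi> x)"
    using p L2_fun_test[OF \<phi>] by (simp add: abs_l2_scaleR)
  moreover have "test_fun \<Omega> (\<lambda>x. c * \<phi> x)"
    using test_fun_mult[OF \<phi> smooth_fun_const[of c], of UNIV \<Omega>] by simp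
  ultimately show "c *\<^sub>R p \<in> l2_graph ` Collect (test_fun \<Omega>)" by auto
qed

lemma subspace_closure:
  fixes S :: "'h::real_normed_vector set"
  assumes S: "subspace S" shows "subspace (closure S)"
  unfolding subspace_def
proof (intro conjI ballI allI)
  show "0 \<in> closure S" using subspace_0[OF S] closure_subset by blast
  fix x assume x: "x \<in> closure S"
  then obtain f where f: "\<And>n. f n \<in> S" "f \<longlonglongrightarrow> x" by (auto simp: closure_sequential)
  show "c *\<^sub>R x \<in> closure S" for c
    unfolding closure_sequential using f S
    by (intro exI[of _ "\<lambda>n. c *\<^sub>R f n"]) (auto intro!: tendsto_intros simp: subspace_scale)
  fix y assume "y \<in> closure S"
  then obtain g where g: "\<And>n. g n \<in> S" "g \<longlonglongrightarrow> y" by (auto simp: closure_sequential)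
  show "x + y \<in> closure S"
    unfolding closure_sequential using f g S
    by (intro exI[of _ "\<lambda>n. f n + g n"]) (auto intro!: tendsto_intros simp: subspace_add)
qed

lemma closed_subspace_form_space: "subspace (form_space \<Omega>)" "closed (form_space \<Omega>)"
  by (simp_all add: form_space_def subspace_closure subspace_l2_graph_test)

lemma l2_graph_in_form_space: "test_fun \<Omega> \<phi> \<Longrightarrow> l2_graph \<phi> \<in> form_space \<Omega>"
  unfolding form_space_def by (rule subsetD[OF closure_subset], rule imageI) simp

lemma form_space_mono: "\<Omega> \<subseteq> \<Omega>' \<Longrightarrow> form_space \<Omega> \<subseteq> form_space \<Omega>'"
  unfolding form_space_def by (intro closure_mono image_mono) (auto intro: test_fun_mono)

lemma form_space_induct [consumes 1, case_names closed test]: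
  assumes "(u, G) \<in> form_space \<Omega>" "closed {p. P (fst p) (snd p)}"
    "\<And>\<phi>. test_fun \<Omega> \<phi> \<Longrightarrow> P (abs_l2 \<phi>) (abs_l2 (grad \<phi>))"
  shows "P u G"
proof -
  have "form_space \<Omega> \<subseteq> {p. P (fst p) (snd p)}"
    unfolding form_space_def by (intro closure_minimal assms(2)) (use assms(3) in auto)
  then show ?thesis using assms(1) by auto
qed

text \<open>The resolvent of the Dirichlet Laplacian at \<open>-1\<close>: the Riesz representative with respect to the
  \<open>H\<^sup>1\<close> inner product is the projection of \<open>(f, 0)\<close> onto the graph of the weak gradient.\<close>

definition dres :: "'a::euclidean_space set \<Rightarrow> ('a, real) l2 \<Rightarrow> ('a, real) l2" where
  "dres \<Omega> f = fst (orth_proj (form_space \<Omega>) (f, 0))"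

definition dres_grad :: "'a::euclidean_space set \<Rightarrow> ('a, real) l2 \<Rightarrow> ('a, 'a) l2" where
  "dres_grad \<Omega> f = snd (orth_proj (form_space \<Omega>) (f, 0))"

lemma orth_proj_form_space: "orth_proj (form_space \<Omega>) (f, 0) = (dres \<Omega> f, dres_grad \<Omega> f)"
  by (simp add: dres_def dres_grad_def)

lemma dres_in_form_space: "(dres \<Omega> f, dres_grad \<Omega> f) \<in> form_space \<Omega>"
  using orth_proj_in[OF closed_subspace_form_space] by (metis orth_proj_form_space)

lemma dres_weak:
  assumes "(v, H) \<in> form_space \<Omega>" shows "dres \<Omega> f \<bullet> v + dres_grad \<Omega> f \<bullet> H = f \<bullet> v"
  using orth_proj_inner[OF closed_subspace_form_space assms, of "(f, 0)"]
  by (simp add: orth_proj_form_space inner_prod_def)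

lemma dres_eqI:
  assumes "(w, G) \<in> form_space \<Omega>" "\<And>v H. (v, H) \<in> form_space \<Omega> \<Longrightarrow> w \<bullet> v + G \<bullet> H = f \<bullet> v"
  shows "dres \<Omega> f = w"
proof -
  have "orth_proj (form_space \<Omega>) (f, 0) = (w, G)"
    using assms by (intro orth_proj_unique[OF closed_subspace_form_space]) (auto simp: inner_prod_def)
  then show ?thesis by (simp add: dres_def)
qed

lemma dres_energy: "(norm (dres \<Omega> f, dres_grad \<Omega> f))\<^sup>2 = dres \<Omega> f \<bullet> f"
  using norm_orth_proj[OF closed_subspace_form_space, of \<Omega> "(f, 0)"]
  by (simp add: orth_proj_form_space inner_prod_def)

lemma dres_variational:
  assumes "(v, H) \<in> form_space \<Omega>" shows "2 * (f \<bullet> v) - (norm (v, H))\<^sup>2 \<le> dres \<Omega> f \<bullet> f"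
  using orth_proj_maximizes[OF closed_subspace_form_space assms, of "(f, 0)"]
  by (simp add: orth_proj_form_space inner_prod_def)

lemma pos_contraction_dres: "pos_contraction (dres \<Omega>)"
proof (rule pos_contractionI)
  note proj_linear = linear_orth_proj[OF closed_subspace_form_space, of \<Omega>]
  show "linear (dres \<Omega>)"
  proof (rule linearI)
    show "dres \<Omega> (f + g) = dres \<Omega> f + dres \<Omega> g" for f g
      using linear_add[OF proj_linear, of "(f, 0)" "(g, 0)"] by (simp add: dres_def)
    show "dres \<Omega> (c *\<^sub>R f) = c *\<^sub>R dres \<Omega> f" for c f
      using linear_cmul[OF proj_linear, of c "(f, 0)"] by (simp add: dres_def)
  qed
  show "dres \<Omega> f \<bullet> g = f \<bullet> dres \<Omega> g" for f g
    using orth_proj_symmetric[OF closed_subspace_form_space, of \<Omega> "(f, 0)" "(g, 0)"]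
    by (simp add: orth_proj_form_space inner_prod_def)
  show "(norm (dres \<Omega> f))\<^sup>2 \<le> dres \<Omega> f \<bullet> f" for f
    by (simp add: norm_prod_def flip: dres_energy)
qed

lemma norm_dres_graph_le: "norm (dres \<Omega> f, dres_grad \<Omega> f) \<le> norm f"
proof (rule power2_le_imp_le)
  show "(norm (dres \<Omega> f, dres_grad \<Omega> f))\<^sup>2 \<le> (norm f)\<^sup>2"
    unfolding dres_energy by (rule pos_contraction_inner_le[OF pos_contraction_dres])
qed simp

lemma dres_mono:
  assumes "\<Omega>' \<subseteq> \<Omega>" shows "dres \<Omega>' f \<bullet> f \<le> dres \<Omega> f \<bullet> f"
proof -
  have "(dres \<Omega>' f, dres_grad \<Omega>' f) \<in> form_space \<Omega>"
    using dres_in_form_space form_space_mono[OF assms] by blast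
  from dres_variational[OF this, of f] show ?thesis by (simp add: dres_energy inner_commute)
qed

definition test_approximable :: "real \<Rightarrow> 'a::euclidean_space set \<Rightarrow> 'a set \<Rightarrow> bool" where
  "test_approximable c \<Omega> \<Omega>' \<longleftrightarrow> (\<forall>\<phi>. test_fun \<Omega> \<phi> \<longrightarrow> (\<exists>\<psi>. test_fun \<Omega>' \<psi> \<and>
     norm (abs_l2 \<phi> - abs_l2 \<psi>) \<le> c * norm (l2_graph \<phi>) \<and>
     (norm (l2_graph \<psi>))\<^sup>2 \<le> (1 + c) * (norm (l2_graph \<phi>))\<^sup>2))"

lemma test_approximable_variational:
  assumes "test_approximable c \<Omega> \<Omega>'" and "(v, H) \<in> form_space \<Omega>"
  shows "2 * (f \<bullet> v) - (norm (v, H))\<^sup>2 \<le> dres \<Omega>' f \<bullet> f + 2 * c * norm f * norm (v, H) + c * (norm (v, H))\<^sup>2"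
  using assms(2)
proof (induction rule: form_space_induct)
  case closed
  show ?case by (intro closed_Collect_le continuous_intros)
next
  case (test \<phi>)
  let ?p = "l2_graph \<phi>"
  obtain \<psi> where \<psi>: "test_fun \<Omega>' \<psi>" "norm (abs_l2 \<phi> - abs_l2 \<psi>) \<le> c * norm ?p"
    "(norm (l2_graph \<psi>))\<^sup>2 \<le> (1 + c) * (norm ?p)\<^sup>2"
    using assms(1) test unfolding test_approximable_def by blast
  have "f \<bullet> abs_l2 \<phi> - f \<bullet> abs_l2 \<psi> \<le> norm f * norm (abs_l2 \<phi> - abs_l2 \<psi>)"
    by (metis inner_diff_right norm_cauchy_schwarz)
  also have "\<dots> \<le> norm f * (c * norm ?p)" using \<psi>(2) by (intro mult_left_mono) auto
  finally have "2 * (f \<bullet> abs_l2 \<phi>) \<le> 2 * (f \<bullet> abs_l2 \<psi>) + 2 * c * norm f * norm ?p" by (simp add: ac_simps)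
  moreover have "2 * (f \<bullet> abs_l2 \<psi>) - (norm (l2_graph \<psi>))\<^sup>2 \<le> dres \<Omega>' f \<bullet> f"
    by (rule dres_variational[OF l2_graph_in_form_space[OF \<psi>(1)]])
  moreover have "(norm (l2_graph \<psi>))\<^sup>2 \<le> (norm ?p)\<^sup>2 + c * (norm ?p)\<^sup>2"
    using \<psi>(3) by (simp only: distrib_right mult_1)
  ultimately show ?case by linarith
qed

lemma dres_perturbation:
  assumes sub: "\<Omega>' \<subseteq> \<Omega>" and c: "c \<ge> 0" and approx: "test_approximable c \<Omega> \<Omega>'"
  shows "norm (dres \<Omega> f - dres \<Omega>' f) \<le> 3 * c * norm f"
proof (rule positive_op_norm_le[where W = UNIV])
  note contraction = pos_contraction_dres[of \<Omega>] pos_contraction_dres[of \<Omega>']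
  show "positive_op (\<lambda>f. dres \<Omega> f - dres \<Omega>' f)"
    unfolding positive_op_def
  proof (intro conjI allI)
    show "linear (\<lambda>f. dres \<Omega> f - dres \<Omega>' f)" by (intro linear_compose_sub pos_contraction_linear contraction)
    show "(dres \<Omega> f - dres \<Omega>' f) \<bullet> g = f \<bullet> (dres \<Omega> g - dres \<Omega>' g)" for f g
      by (simp add: inner_diff_left inner_diff_right contraction[THEN pos_contraction_symmetric])
    show "0 \<le> (dres \<Omega> f - dres \<Omega>' f) \<bullet> f" for f using dres_mono[OF sub, of f] by (simp add: inner_diff_left)
  qed
  show "(dres \<Omega> f - dres \<Omega>' f) \<bullet> f \<le> 3 * c * (norm f)\<^sup>2" for f
  proof -
    let ?p = "(dres \<Omega> f, dres_grad \<Omega> f)"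
    have "dres \<Omega> f \<bullet> f = 2 * (f \<bullet> dres \<Omega> f) - (norm ?p)\<^sup>2" by (simp add: dres_energy inner_commute)
    also have "\<dots> \<le> dres \<Omega>' f \<bullet> f + 2 * c * norm f * norm ?p + c * (norm ?p)\<^sup>2"
      by (rule test_approximable_variational[OF approx dres_in_form_space])
    also have "\<dots> \<le> dres \<Omega>' f \<bullet> f + 2 * c * norm f * norm f + c * (norm f)\<^sup>2"
      using c norm_dres_graph_le by (intro add_mono mult_left_mono power_mono) auto
    finally show ?thesis by (simp add: inner_diff_left power2_eq_square)
  qed
qed (use c in auto)

lemma test_fun_UN_incseq:
  assumes "test_fun (\<Union>n. U n) \<phi>" "\<And>n. open (U n)" "incseq U"
  obtains n :: nat where "test_fun (U n) \<phi>"
proof -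
  obtain K where K: "smooth_fun \<phi>" "compact K" "K \<subseteq> (\<Union>n. U n)" "\<forall>x. x \<notin> K \<longrightarrow> \<phi> x = 0"
    using assms(1) by (auto simp: test_fun_def)
  obtain I where I: "finite I" "K \<subseteq> (\<Union>n\<in>I. U n)"
    by (rule compactE_image[OF K(2), of UNIV U]) (use assms(2) K(3) in auto)
  obtain N where "\<And>n. n \<in> I \<Longrightarrow> n \<le> N" using I(1) by (auto simp: finite_nat_set_iff_bounded_le)
  then have "K \<subseteq> U N" using I(2) incseqD[OF assms(3)] by blast
  then show ?thesis using that K unfolding test_fun_def by blast
qed

lemma form_space_exhaustion:
  assumes "\<And>n. open (U n)" "incseq U"
  shows "form_space (\<Union>n. U n) = closure (\<Union>n. form_space (U n))"
proof (rule subset_antisym)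
  have "l2_graph ` Collect (test_fun (\<Union>n. U n)) \<subseteq> (\<Union>n. form_space (U n))"
  proof (rule image_subsetI)
    fix \<phi> assume "\<phi> \<in> Collect (test_fun (\<Union>n. U n))"
    then obtain n where "test_fun (U n) \<phi>" using test_fun_UN_incseq[OF _ assms] by auto
    then show "l2_graph \<phi> \<in> (\<Union>n. form_space (U n))" using l2_graph_in_form_space by auto
  qed
  then show "form_space (\<Union>n. U n) \<subseteq> closure (\<Union>n. form_space (U n))"
    unfolding form_space_def[of "\<Union>n. U n"] by (rule closure_mono)
  show "closure (\<Union>n. form_space (U n)) \<subseteq> form_space (\<Union>n. U n)"
    by (intro closure_minimal closed_subspace_form_space UN_least form_space_mono) auto
qed

lemma dres_exhaustion:
  assumes "\<And>n. open (U n)" "incseq U"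
  shows "(\<lambda>n. dres (U n) f) \<longlonglongrightarrow> dres (\<Union>n. U n) f"
  unfolding dres_def
proof (rule tendsto_fst[OF orth_proj_tendsto])
  show "incseq (\<lambda>n. form_space (U n))"
    using assms(2) by (intro incseq_SucI form_space_mono) (rule incseq_SucD)
qed (rule closed_subspace_form_space form_space_exhaustion[OF assms])+

definition restr :: "'a::euclidean_space set \<Rightarrow> ('a, 'b::euclidean_space) l2 \<Rightarrow> ('a, 'b) l2" where
  "restr S f = abs_l2 (\<lambda>x. indicator S x *\<^sub>R rep_l2 f x)"

lemma restr_abs_l2:
  assumes "S \<in> sets lebesgue" "L2_fun f" shows "restr S (abs_l2 f) = abs_l2 (\<lambda>x. indicator S x *\<^sub>R f x)"
  unfolding restr_def
  using rep_abs_l2[OF assms(2)] by (subst abs_l2_eq_iff) (auto intro!: L2_fun_indicator L2_fun_rep assms)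

lemma restr_restr:
  assumes "S \<in> sets lebesgue" "T \<in> sets lebesgue"
  shows "restr S (restr T f) = restr (S \<inter> T) f"
proof -
  have "restr S (restr T f) = abs_l2 (\<lambda>x. indicator S x *\<^sub>R indicator T x *\<^sub>R rep_l2 f x)"
    unfolding restr_def[of T] by (rule restr_abs_l2[OF assms(1) L2_fun_indicator[OF assms(2) L2_fun_rep]])
  then show ?thesis by (simp add: restr_def indicator_inter_arith)
qed

lemma restr_empty: "restr {} f = 0"
  by (simp add: restr_def abs_l2_zero)

lemma restr_disjoint_union:
  assumes "S \<in> sets lebesgue" "T \<in> sets lebesgue" "S \<inter> T = {}"
  shows "restr (S \<union> T) f = restr S f + restr T f"
proof -
  have "abs_l2 (\<lambda>x. indicator S x *\<^sub>R rep_l2 f x) + abs_l2 (\<lambda>x. indicator T x *\<^sub>R rep_l2 f x)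
      = abs_l2 (\<lambda>x. indicator S x *\<^sub>R rep_l2 f x + indicator T x *\<^sub>R rep_l2 f x)"
    by (intro abs_l2_add L2_fun_indicator L2_fun_rep assms)
  moreover have "indicator (S \<union> T) x *\<^sub>R rep_l2 f x = indicator S x *\<^sub>R rep_l2 f x + indicator T x *\<^sub>R rep_l2 f x" for x
    using assms(3) by (auto simp: indicator_def)
  ultimately show ?thesis unfolding restr_def by (simp only:)
qed

context
  fixes S :: "'a::euclidean_space set"
  assumes S: "S \<in> sets lebesgue"
begin

lemma restr_symmetric: "restr S f \<bullet> g = f \<bullet> restr S g"
proof -
  have "restr S (abs_l2 (rep_l2 f)) \<bullet> abs_l2 (rep_l2 g) = abs_l2 (rep_l2 f) \<bullet> restr S (abs_l2 (rep_l2 g))"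
    unfolding restr_abs_l2[OF S L2_fun_rep] by (simp add: inner_abs_l2 L2_fun_rep L2_fun_indicator S del: abs_rep_l2)
  then show ?thesis by simp
qed

lemma linear_restr: "linear (restr S :: ('a, 'b::euclidean_space) l2 \<Rightarrow> _)"
proof (rule linearI)
  fix f g :: "('a, 'b) l2" and c :: real
  have "restr S (abs_l2 (rep_l2 f) + abs_l2 (rep_l2 g)) = restr S (abs_l2 (rep_l2 f)) + restr S (abs_l2 (rep_l2 g))"
    by (simp add: restr_abs_l2[OF S] abs_l2_add L2_fun_add L2_fun_rep L2_fun_indicator S scaleR_add_right
          del: abs_rep_l2)
  then show "restr S (f + g) = restr S f + restr S g" by simp
  have "restr S (c *\<^sub>R abs_l2 (rep_l2 f)) = c *\<^sub>R restr S (abs_l2 (rep_l2 f))"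
    by (simp add: restr_abs_l2[OF S] abs_l2_scaleR L2_fun_scaleR L2_fun_rep L2_fun_indicator S mult.commute
          del: abs_rep_l2)
  then show "restr S (c *\<^sub>R f) = c *\<^sub>R restr S f" by simp
qed

lemma pos_contraction_restr: "pos_contraction (restr S :: ('a, 'b::euclidean_space) l2 \<Rightarrow> _)"
  by (rule pos_contractionI)
     (simp_all add: linear_restr restr_symmetric power2_norm_eq_inner restr_restr S)

lemma restr_eq_self_iff: "restr S f = f \<longleftrightarrow> (AE x in lebesgue. x \<notin> S \<longrightarrow> rep_l2 f x = 0)"
proof -
  have "restr S f = f \<longleftrightarrow> abs_l2 (\<lambda>x. indicator S x *\<^sub>R rep_l2 f x) = abs_l2 (rep_l2 f)"
    unfolding restr_def by simp
  also have "\<dots> \<longleftrightarrow> (AE x in lebesgue. indicator S x *\<^sub>R rep_l2 f x = rep_l2 f x)"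
    by (rule abs_l2_eq_iff[OF L2_fun_indicator[OF S L2_fun_rep] L2_fun_rep])
  also have "\<dots> \<longleftrightarrow> (AE x in lebesgue. x \<notin> S \<longrightarrow> rep_l2 f x = 0)"
    by (intro AE_cong) (auto simp: indicator_def)
  finally show ?thesis .
qed

lemma restr_abs_l2_self:
  assumes "L2_fun f" "\<And>x. x \<notin> S \<Longrightarrow> f x = 0" shows "restr S (abs_l2 f) = abs_l2 f"
proof -
  have "indicator S x *\<^sub>R f x = f x" for x using assms(2) by (cases "x \<in> S") auto
  then show ?thesis by (simp add: restr_abs_l2[OF S assms(1)])
qed

lemma continuous_restr: "continuous_on UNIV (restr S :: ('a, 'b::euclidean_space) l2 \<Rightarrow> _)"
  by (rule bounded_linear.continuous_on[OF pos_contraction_bounded_linear[OF pos_contraction_restr] continuous_on_id])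

end

lemma continuous_on_restr_compose [continuous_intros]:
  "S \<in> sets lebesgue \<Longrightarrow> continuous_on A g \<Longrightarrow> continuous_on A (\<lambda>x. restr S (g x))"
  by (rule continuous_on_compose2[OF continuous_restr]) auto

lemma form_space_support:
  assumes "open \<Omega>" "(u, G) \<in> form_space \<Omega>"
  shows "restr \<Omega> u = u" "restr \<Omega> G = G"
proof -
  have \<Omega>: "\<Omega> \<in> sets lebesgue" using assms(1) by simp
  have "restr \<Omega> u = u \<and> restr \<Omega> G = G"
    using assms(2)
  proof (induction rule: form_space_induct)
    case closed
    show ?case using \<Omega> by (intro closed_Collect_conj closed_Collect_eq continuous_intros)
  next
    case (test \<phi>)
    then show ?case using L2_fun_test[OF test] test_fun_zero_outside[OF test] by (simp add: restr_abs_l2_self[OF \<Omega>])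
  qed
  then show "restr \<Omega> u = u" "restr \<Omega> G = G" by auto
qed

lemma dres_support:
  assumes "open \<Omega>" shows "restr \<Omega> (dres \<Omega> f) = dres \<Omega> f" "dres \<Omega> (restr \<Omega> f) = dres \<Omega> f"
proof -
  show "restr \<Omega> (dres \<Omega> f) = dres \<Omega> f" by (rule form_space_support[OF assms dres_in_form_space])
  show "dres \<Omega> (restr \<Omega> f) = dres \<Omega> f"
  proof (rule dres_eqI[OF dres_in_form_space])
    fix v and H :: "('a, 'a) l2" assume v: "(v, H) \<in> form_space \<Omega>"
    then show "dres \<Omega> f \<bullet> v + dres_grad \<Omega> f \<bullet> H = restr \<Omega> f \<bullet> v"
      using dres_weak[OF v] form_space_support(1)[OF assms v] restr_symmetric[of \<Omega> f v] assms by simp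
  qed
qed

lemma dres_0: "dres \<Omega> 0 = 0"
  by (rule linear_0[OF pos_contraction_linear[OF pos_contraction_dres]])

lemma dres_restr_disjoint:
  assumes "open U" "S \<in> sets lebesgue" "U \<inter> S = {}" shows "dres U (restr S f) = 0"
proof -
  have "dres U (restr S f) = dres U (restr U (restr S f))" by (simp add: dres_support(2)[OF assms(1)])
  then show ?thesis using assms by (simp add: restr_restr restr_empty dres_0)
qed

lemma dres_eigenvector_support:
  assumes "open U" "dres U x = a *\<^sub>R x" "a \<noteq> 0" shows "restr U x = x"
proof -
  have "a *\<^sub>R restr U x = a *\<^sub>R x"
    using dres_support(1)[OF assms(1), of x] assms(1,2) by (simp add: linear_cmul linear_restr)
  then show ?thesis using assms(3) by simp
qed

lemma test_fun_restr_component: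
  assumes UW: "open U" "open W" "U \<inter> W = {}" and \<phi>: "test_fun (U \<union> W) \<phi>"
  shows "test_fun U (\<lambda>x. indicator U x * \<phi> x)"
proof -
  obtain K where K: "smooth_fun \<phi>" "compact K" "K \<subseteq> U \<union> W" "\<And>x. x \<notin> K \<Longrightarrow> \<phi> x = 0"
    using \<phi> by (auto simp: test_fun_def)
  have "K \<inter> U = K - W" using K(3) UW(3) by auto
  then have "compact (K \<inter> U)" using compact_diff[OF K(2) UW(2)] by simp
  moreover have "smooth_fun (\<lambda>x. indicator U x * \<phi> x)"
  proof (rule smooth_fun_local)
    fix x
    consider (inside) "x \<in> U" | (vanishing) "x \<in> - (K \<inter> U)" by auto
    then show "\<exists>S g. open S \<and> x \<in> S \<and> smooth_fun g \<and> (\<forall>y\<in>S. indicator U y * \<phi> y = g y)"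
    proof cases
      case inside
      then show ?thesis using UW(1) K(1) by (intro exI[of _ U] exI[of _ \<phi>]) auto
    next
      case vanishing
      have "open (- (K \<inter> U))" by (rule open_Compl[OF compact_imp_closed[OF \<open>compact (K \<inter> U)\<close>]])
      moreover have "\<forall>y\<in>- (K \<inter> U). indicator U y * \<phi> y = 0" using K(4) by (auto simp: indicator_def)
      ultimately show ?thesis
        using vanishing smooth_fun_const[of 0] by (intro exI[of _ "- (K \<inter> U)"] exI[of _ "\<lambda>_. 0"] conjI)
    qed
  qed
  ultimately show ?thesis
    unfolding test_fun_def using K(4) by (intro conjI exI[of _ "K \<inter> U"]) (auto simp: indicator_def)
qed

lemma form_space_restr_component:
  assumes UW: "open U" "open W" "U \<inter> W = {}" and "(u, G) \<in> form_space (U \<union> W)"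
  shows "(restr U u, restr U G) \<in> form_space U"
  using assms(4)
proof (induction rule: form_space_induct)
  case closed
  show ?case
    using UW(1) by (intro closed_vimage[unfolded vimage_def, OF closed_subspace_form_space(2)] continuous_intros) auto
next
  case (test \<phi>)
  have U: "U \<in> sets lebesgue" using UW(1) by simp
  let ?\<psi> = "\<lambda>x. indicator U x * \<phi> x"
  have \<psi>: "test_fun U ?\<psi>" by (rule test_fun_restr_component[OF UW test])
  have "grad ?\<psi> x = indicator U x *\<^sub>R grad \<phi> x" for x
  proof (cases "x \<in> U")
    case True
    then show ?thesis
      using grad_cong_open[OF UW(1) True, of ?\<psi> \<phi>] test_fun_differentiable[OF test] by simp
  next
    case False
    then show ?thesis using test_fun_zero_outside(2)[OF \<psi>] by simp
  qed
  then have "grad ?\<psi> = (\<lambda>x. indicator U x *\<^sub>R grad \<phi> x)" by (rule ext)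
  then have "l2_graph ?\<psi> = (restr U (abs_l2 \<phi>), restr U (abs_l2 (grad \<phi>)))"
    by (simp add: restr_abs_l2[OF U] L2_fun_test[OF test])
  then show ?case using l2_graph_in_form_space[OF \<psi>] by simp
qed

lemma dres_restr_component:
  assumes UW: "open U" "open W" "U \<inter> W = {}"
  shows "dres U f = restr U (dres (U \<union> W) f)"
proof (rule dres_eqI[OF form_space_restr_component[OF UW dres_in_form_space]])
  fix v H assume v: "(v, H) \<in> form_space U"
  then have "(v, H) \<in> form_space (U \<union> W)" using form_space_mono[of U "U \<union> W"] by auto
  from dres_weak[OF this, of f]
  show "restr U (dres (U \<union> W) f) \<bullet> v + restr U (dres_grad (U \<union> W) f) \<bullet> H = f \<bullet> v"
    using form_space_support[OF UW(1) v] UW(1) by (simp add: restr_symmetric)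
qed

lemma dres_disjoint_union:
  assumes UW: "open U" "open W" "U \<inter> W = {}"
  shows "dres (U \<union> W) f = dres U f + dres W f"
proof -
  have WU: "W \<inter> U = {}" using UW(3) by auto
  have "dres (U \<union> W) f = restr (U \<union> W) (dres (U \<union> W) f)" using UW by (simp add: dres_support(1) open_Un)
  also have "\<dots> = restr U (dres (U \<union> W) f) + restr W (dres (W \<union> U) f)"
    using UW by (simp add: restr_disjoint_union Un_commute)
  also have "\<dots> = dres U f + dres W f"
    by (simp flip: dres_restr_component[OF UW] dres_restr_component[OF UW(2,1) WU])
  finally show ?thesis .
qed

lemma eigenspace_disjoint_union:
  assumes UW: "open U" "open W" "U \<inter> W = {}"
    and a: "a \<noteq> 0" and no_eigenvalue: "eigenspace (dres W) a = {0}"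
  shows "eigenspace (dres (U \<union> W)) a = eigenspace (dres U) a"
proof (intro set_eqI iffI)
  have sets: "U \<in> sets lebesgue" "W \<in> sets lebesgue" and WU: "W \<inter> U = {}" using UW by auto
  note union = dres_disjoint_union[OF UW]
  have W_vanishes: "dres W x = 0" if "restr U x = x" for x
    using dres_restr_disjoint[OF UW(2) sets(1) WU, of x] that by simp
  fix x
  show "x \<in> eigenspace (dres (U \<union> W)) a" if "x \<in> eigenspace (dres U) a"
  proof -
    have x: "dres U x = a *\<^sub>R x" using that by (simp add: eigenspace_def)
    then show ?thesis
      using W_vanishes[OF dres_eigenvector_support[OF UW(1) x a]] by (simp add: eigenspace_def union)
  qed
  show "x \<in> eigenspace (dres U) a" if "x \<in> eigenspace (dres (U \<union> W)) a"
  proof -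
    have x: "dres (U \<union> W) x = a *\<^sub>R x" using that by (simp add: eigenspace_def)
    have "dres W (restr W x) = dres W x" by (rule dres_support(2)[OF UW(2)])
    also have "\<dots> = restr W (dres (U \<union> W) x)" using dres_restr_component[OF UW(2,1) WU] by (simp only: Un_commute)
    also have "\<dots> = a *\<^sub>R restr W x" unfolding x by (rule linear_cmul[OF linear_restr[OF sets(2)]])
    finally have "restr W x = 0" using no_eigenvalue by (auto simp: eigenspace_def)
    moreover have "restr (U \<union> W) x = x" by (rule dres_eigenvector_support[OF open_Un[OF UW(1,2)] x a])
    ultimately have "restr U x = x" by (simp add: restr_disjoint_union[OF sets UW(3)])
    then show ?thesis using x W_vanishes by (simp add: eigenspace_def union)
  qed
qed

lemma L2_dist2_eq:
  assumes "L2_fun f" "L2_fun g" shows "L2_dist2 f g = ennreal ((norm (abs_l2 f - abs_l2 g))\<^sup>2)"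
  using nn_integral_L2[OF L2_fun_diff[OF assms]] by (simp add: L2_dist2_def abs_l2_diff[OF assms])

lemma L2_fun_of_dist2:
  assumes f: "L2_fun f" and g: "g \<in> borel_measurable lebesgue" and "L2_dist2 f g < \<infinity>"
  shows "L2_fun g"
proof -
  have "L2_fun (\<lambda>x. f x - g x)"
    using assms by (auto simp: L2_fun_iff_nn_integral L2_dist2_def L2_fun_def)
  from L2_fun_diff[OF f this] show ?thesis by simp
qed

lemma L2_dist2_tendsto_iff:
  assumes "\<And>n. L2_fun (f n)" "L2_fun g"
  shows "(\<lambda>n. L2_dist2 (f n) g) \<longlonglongrightarrow> 0 \<longleftrightarrow> (\<lambda>n. abs_l2 (f n)) \<longlonglongrightarrow> abs_l2 g"
proof -
  have "(\<lambda>n. L2_dist2 (f n) g) \<longlonglongrightarrow> 0 \<longleftrightarrow> (\<lambda>n. ennreal ((norm (abs_l2 (f n) - abs_l2 g))\<^sup>2)) \<longlonglongrightarrow> ennreal 0"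
    using assms by (simp add: L2_dist2_eq)
  also have "\<dots> \<longleftrightarrow> (\<lambda>n. (norm (abs_l2 (f n) - abs_l2 g))\<^sup>2) \<longlonglongrightarrow> 0"
    by (rule tendsto_ennreal_iff) auto
  also have "\<dots> \<longleftrightarrow> (\<lambda>n. norm (abs_l2 (f n) - abs_l2 g)) \<longlonglongrightarrow> 0"
    using tendsto_power[of "\<lambda>n. norm (abs_l2 (f n) - abs_l2 g)" 0 sequentially 2]
      tendsto_real_sqrt[of "\<lambda>n. (norm (abs_l2 (f n) - abs_l2 g))\<^sup>2" 0 sequentially] by auto
  also have "\<dots> \<longleftrightarrow> (\<lambda>n. abs_l2 (f n)) \<longlonglongrightarrow> abs_l2 g"
    by (simp add: tendsto_norm_zero_iff LIM_zero_iff)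
  finally show ?thesis .
qed

lemma L2_fun_of_L2_dist2_tendsto:
  assumes "\<And>n. L2_fun (f n)" "g \<in> borel_measurable lebesgue" "(\<lambda>n. L2_dist2 (f n) g) \<longlonglongrightarrow> 0"
  shows "L2_fun g"
proof -
  have "eventually (\<lambda>n. L2_dist2 (f n) g < 1) sequentially" using assms(3) by (rule order_tendstoD(2)) simp
  then obtain n where "L2_dist2 (f n) g < 1" by (auto simp: eventually_sequentially)
  then show ?thesis
    using L2_fun_of_dist2[OF assms(1,2)] less_trans[OF _ ennreal_one_less_top] by auto
qed

lemma H10_iff: "(u, G) \<in> H10 \<Omega> \<longleftrightarrow> L2_fun u \<and> L2_fun G \<and> (abs_l2 u, abs_l2 G) \<in> form_space \<Omega>"
proof
  assume "(u, G) \<in> H10 \<Omega>"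
  then obtain \<phi> where measurable: "u \<in> borel_measurable lebesgue" "G \<in> borel_measurable lebesgue"
    and \<phi>: "\<And>n. test_fun \<Omega> (\<phi> n)" "(\<lambda>n. L2_dist2 (\<phi> n) u) \<longlonglongrightarrow> 0" "(\<lambda>n. L2_dist2 (grad (\<phi> n)) G) \<longlonglongrightarrow> 0"
    by (auto simp: H10_def)
  note \<phi>_L2 = L2_fun_test[OF \<phi>(1)]
  have L2: "L2_fun u" "L2_fun G"
    by (rule L2_fun_of_L2_dist2_tendsto[OF \<phi>_L2(1) measurable(1) \<phi>(2)],
        rule L2_fun_of_L2_dist2_tendsto[OF \<phi>_L2(2) measurable(2) \<phi>(3)])
  have "(\<lambda>n. l2_graph (\<phi> n)) \<longlonglongrightarrow> (abs_l2 u, abs_l2 G)"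
    using \<phi> \<phi>_L2 L2 by (intro tendsto_Pair) (auto simp: L2_dist2_tendsto_iff)
  then have "(abs_l2 u, abs_l2 G) \<in> form_space \<Omega>"
    by (rule closed_sequentially[OF closed_subspace_form_space(2) l2_graph_in_form_space[OF \<phi>(1)]])
  then show "L2_fun u \<and> L2_fun G \<and> (abs_l2 u, abs_l2 G) \<in> form_space \<Omega>" using L2 by simp
next
  assume L2: "L2_fun u \<and> L2_fun G \<and> (abs_l2 u, abs_l2 G) \<in> form_space \<Omega>"
  then obtain p where "\<And>n. p n \<in> l2_graph ` Collect (test_fun \<Omega>)" and p: "p \<longlonglongrightarrow> (abs_l2 u, abs_l2 G)"
    unfolding form_space_def closure_sequential by blast
  then have "\<forall>n. \<exists>\<phi>. test_fun \<Omega> \<phi> \<and> p n = l2_graph \<phi>" by blast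
  then obtain \<phi> where \<phi>: "\<And>n. test_fun \<Omega> (\<phi> n)" "\<And>n. p n = l2_graph (\<phi> n)" by metis
  have "(\<lambda>n. abs_l2 (\<phi> n)) \<longlonglongrightarrow> abs_l2 u" "(\<lambda>n. abs_l2 (grad (\<phi> n))) \<longlonglongrightarrow> abs_l2 G"
    using tendsto_fst[OF p] tendsto_snd[OF p] \<phi>(2) by auto
  then have "(\<lambda>n. L2_dist2 (\<phi> n) u) \<longlonglongrightarrow> 0" "(\<lambda>n. L2_dist2 (grad (\<phi> n)) G) \<longlonglongrightarrow> 0"
    using L2 L2_fun_test[OF \<phi>(1)] by (auto simp: L2_dist2_tendsto_iff)
  then show "(u, G) \<in> H10 \<Omega>" using L2 \<phi>(1) by (auto simp: H10_def L2_fun_def)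
qed

lemma H10_rep_iff: "(rep_l2 u, rep_l2 G) \<in> H10 \<Omega> \<longleftrightarrow> (u, G) \<in> form_space \<Omega>"
  by (simp add: H10_iff L2_fun_rep)

lemma dirichlet_resolvent_dres:
  assumes f: "L2_fun f" and w: "w = dres \<Omega> (abs_l2 f + (1 - s) *\<^sub>R w)"
  shows "dirichlet_resolvent \<Omega> s f (rep_l2 w)"
proof -
  define G where "G = dres_grad \<Omega> (abs_l2 f + (1 - s) *\<^sub>R w)"
  have in_form: "(w, G) \<in> form_space \<Omega>"
    using dres_in_form_space[of \<Omega> "abs_l2 f + (1 - s) *\<^sub>R w"] by (simp only: G_def w[symmetric])
  have weak: "G \<bullet> H + s * (w \<bullet> v) = abs_l2 f \<bullet> v" if "(v, H) \<in> form_space \<Omega>" for v H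
  proof -
    have "w \<bullet> v + G \<bullet> H = (abs_l2 f + (1 - s) *\<^sub>R w) \<bullet> v"
      using dres_weak[OF that, of "abs_l2 f + (1 - s) *\<^sub>R w"] by (simp only: G_def w[symmetric])
    then show ?thesis by (simp add: algebra_simps)
  qed
  show ?thesis unfolding dirichlet_resolvent_def
  proof (intro exI[of _ "rep_l2 G"] conjI allI impI)
    show "(rep_l2 w, rep_l2 G) \<in> H10 \<Omega>" using in_form by (simp add: H10_rep_iff)
    fix v H assume "(v, H) \<in> H10 \<Omega>"
    then have v: "L2_fun v" "L2_fun H" "(abs_l2 v, abs_l2 H) \<in> form_space \<Omega>" by (auto simp: H10_iff)
    show "(\<integral> x. rep_l2 G x \<bullet> H x \<partial>lebesgue) + s * (\<integral> x. rep_l2 w x * v x \<partial>lebesgue) = (\<integral> x. f x * v x \<partial>lebesgue)"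
      using weak[OF v(3)] inner_abs_l2[OF f v(1)] inner_rep_l2[OF v(1), of w] inner_rep_l2[OF v(2), of G] by simp
  qed
qed

lemma dres_eigenvalue_imp_point_spectrum:
  assumes x: "dres \<Omega> x = a *\<^sub>R x" "x \<noteq> 0" "a > 0"
  shows "1 / a - 1 \<in> dirichlet_point_spectrum \<Omega>"
proof -
  let ?g = "(1 / a) *\<^sub>R dres_grad \<Omega> x"
  have "(1 / a) *\<^sub>R (dres \<Omega> x, dres_grad \<Omega> x) \<in> form_space \<Omega>"
    by (intro subspace_scale closed_subspace_form_space dres_in_form_space)
  then have "(rep_l2 x, rep_l2 ?g) \<in> H10 \<Omega>" using x by (simp add: H10_rep_iff)
  moreover have "(\<integral>\<^sup>+ y. ennreal ((rep_l2 x y)\<^sup>2) \<partial>lebesgue) > 0"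
    using nn_integral_L2[OF L2_fun_rep[of x]] x(2) by simp
  moreover have "(\<integral> y. rep_l2 ?g y \<bullet> H y \<partial>lebesgue) = (1 / a - 1) * (\<integral> y. rep_l2 x y * v y \<partial>lebesgue)"
    if "(v, H) \<in> H10 \<Omega>" for v H
  proof -
    have v: "L2_fun v" "L2_fun H" "(abs_l2 v, abs_l2 H) \<in> form_space \<Omega>" using that by (auto simp: H10_iff)
    have "?g \<bullet> abs_l2 H = (1 / a - 1) * (x \<bullet> abs_l2 v)"
      using dres_weak[OF v(3), of x] x(1,3) by (simp add: field_simps)
    then show ?thesis unfolding inner_rep_l2[OF v(1)] inner_rep_l2[OF v(2)] by simp
  qed
  ultimately show ?thesis unfolding dirichlet_point_spectrum_def by blast
qed

lemma point_spectrum_imp_dres_eigenvalue: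
  assumes "lam \<in> dirichlet_point_spectrum \<Omega>"
  shows "lam \<ge> 0" "eigenspace (dres \<Omega>) (1 / (1 + lam)) \<noteq> {0}"
proof -
  obtain u G where u: "(u, G) \<in> H10 \<Omega>" "(\<integral>\<^sup>+ x. ennreal ((u x)\<^sup>2) \<partial>lebesgue) > 0"
    "\<And>v H. (v, H) \<in> H10 \<Omega> \<Longrightarrow> (\<integral> x. G x \<bullet> H x \<partial>lebesgue) = lam * (\<integral> x. u x * v x \<partial>lebesgue)"
    using assms by (auto simp: dirichlet_point_spectrum_def)
  have L2: "L2_fun u" "L2_fun G" "(abs_l2 u, abs_l2 G) \<in> form_space \<Omega>" using u(1) by (auto simp: H10_iff)
  have nonzero: "abs_l2 u \<noteq> 0" using u(2) nn_integral_L2[OF L2(1)] by auto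
  have weak: "abs_l2 G \<bullet> H = lam * (abs_l2 u \<bullet> v)" if "(v, H) \<in> form_space \<Omega>" for v H
  proof -
    have "(\<integral> x. G x \<bullet> rep_l2 H x \<partial>lebesgue) = lam * (\<integral> x. u x * rep_l2 v x \<partial>lebesgue)"
      using u(3)[of "rep_l2 v" "rep_l2 H"] that by (simp add: H10_rep_iff)
    then show ?thesis
      using inner_abs_l2[OF L2(2) L2_fun_rep[of H]] inner_abs_l2[OF L2(1) L2_fun_rep[of v]] by simp
  qed
  have "lam * (abs_l2 u \<bullet> abs_l2 u) \<ge> 0" using weak[OF L2(3)] inner_ge_zero[of "abs_l2 G"] by simp
  moreover have "abs_l2 u \<bullet> abs_l2 u > 0" using nonzero by simp
  ultimately show lam: "lam \<ge> 0" by (simp add: zero_le_mult_iff)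
  have "dres \<Omega> ((1 + lam) *\<^sub>R abs_l2 u) = abs_l2 u"
    by (rule dres_eqI[OF L2(3)]) (simp add: weak algebra_simps)
  then have "(1 + lam) *\<^sub>R dres \<Omega> (abs_l2 u) = abs_l2 u"
    using linear_cmul[OF pos_contraction_linear[OF pos_contraction_dres]] by metis
  then have "(1 / (1 + lam)) *\<^sub>R ((1 + lam) *\<^sub>R dres \<Omega> (abs_l2 u)) = (1 / (1 + lam)) *\<^sub>R abs_l2 u" by simp
  then have "dres \<Omega> (abs_l2 u) = (1 / (1 + lam)) *\<^sub>R abs_l2 u" using lam by simp
  then show "eigenspace (dres \<Omega>) (1 / (1 + lam)) \<noteq> {0}" using nonzero by (auto simp: eigenspace_def)
qed

section \<open>Poincare inequality and compactness on bounded sets\<close>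

lemma sq_integral_unit_interval_le:
  fixes g :: "real \<Rightarrow> real"
  assumes "continuous_on {0..1} g"
  shows "(integral {0..1} g)\<^sup>2 \<le> integral {0..1} (\<lambda>t. (g t)\<^sup>2)"
proof -
  let ?m = "integral {0..1} g"
  have "g integrable_on {0..1}" "(\<lambda>t. (g t)\<^sup>2) integrable_on {0..1}"
    using assms by (auto intro!: integrable_continuous_interval continuous_intros)
  then have "((\<lambda>t. (g t)\<^sup>2 - 2 * ?m * g t + ?m\<^sup>2) has_integral
      (integral {0..1} (\<lambda>t. (g t)\<^sup>2) - 2 * ?m * ?m + ?m\<^sup>2)) {0..1}"
    using has_integral_const_real[of "?m\<^sup>2" 0 1]
    by (intro has_integral_add has_integral_diff has_integral_mult_right integrable_integral) auto
  then have "0 \<le> integral {0..1} (\<lambda>t. (g t)\<^sup>2) - 2 * ?m * ?m + ?m\<^sup>2"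
  proof (rule has_integral_nonneg)
    fix t
    have "(g t)\<^sup>2 - 2 * ?m * g t + ?m\<^sup>2 = (g t - ?m)\<^sup>2" by (simp add: power2_eq_square algebra_simps)
    then show "0 \<le> (g t)\<^sup>2 - 2 * ?m * g t + ?m\<^sup>2" by simp
  qed
  then show ?thesis by (simp add: power2_eq_square)
qed

lemma nn_integral_lborel_shift:
  fixes f :: "'a::euclidean_space \<Rightarrow> ennreal"
  assumes [measurable]: "f \<in> borel_measurable borel"
  shows "(\<integral>\<^sup>+ x. f (x + c) \<partial>lborel) = (\<integral>\<^sup>+ x. f x \<partial>lborel)"
proof -
  have "(\<integral>\<^sup>+ x. f x \<partial>lborel) = (\<integral>\<^sup>+ x. f x \<partial>(distr lborel borel ((+) c)))"
    by (simp add: lborel_distr_plus)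
  also have "\<dots> = (\<integral>\<^sup>+ x. f (c + x) \<partial>lborel)" by (rule nn_integral_distr) measurable
  finally show ?thesis by (simp add: add.commute)
qed

lemma smooth_fun_increment_eq_integral:
  assumes \<phi>: "smooth_fun \<phi>"
  shows "((\<lambda>t. grad \<phi> (x + t *\<^sub>R z) \<bullet> z) has_integral \<phi> (x + z) - \<phi> x) {0..1}"
proof -
  have "((\<lambda>t. \<phi> (x + t *\<^sub>R z)) has_vector_derivative grad \<phi> (x + t *\<^sub>R z) \<bullet> z) (at t within {0..1})" for t
  proof -
    have "((\<lambda>t. \<phi> (x + t *\<^sub>R z)) has_derivative (\<lambda>h. grad \<phi> (x + t *\<^sub>R z) \<bullet> (h *\<^sub>R z))) (at t)"
      by (rule has_derivative_compose[OF _ has_derivative_grad[OF smooth_fun_differentiable[OF \<phi>]]])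
         (auto intro!: derivative_eq_intros)
    then show ?thesis by (simp add: has_vector_derivative_def has_derivative_at_withinI)
  qed
  then have "((\<lambda>t. grad \<phi> (x + t *\<^sub>R z) \<bullet> z) has_integral \<phi> (x + 1 *\<^sub>R z) - \<phi> (x + 0 *\<^sub>R z)) {0..1}"
    by (intro fundamental_theorem_of_calculus) auto
  then show ?thesis by simp
qed

lemma sq_increment_le_nn_integral_grad:
  assumes \<phi>: "smooth_fun \<phi>"
  shows "ennreal ((\<phi> (x + z) - \<phi> x)\<^sup>2)
    \<le> (\<integral>\<^sup>+ t. indicator {0..1} t * (ennreal ((norm z)\<^sup>2) * ennreal ((norm (grad \<phi> (x + t *\<^sub>R z)))\<^sup>2)) \<partial>lborel)"
proof -
  let ?g = "\<lambda>t. grad \<phi> (x + t *\<^sub>R z) \<bullet> z"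
  have continuous: "continuous_on {0..1} ?g"
    by (intro continuous_intros continuous_on_compose2[OF continuous_grad[OF \<phi>]]) auto
  have "ennreal ((\<phi> (x + z) - \<phi> x)\<^sup>2) \<le> ennreal (integral {0..1} (\<lambda>t. (?g t)\<^sup>2))"
    using sq_integral_unit_interval_le[OF continuous] integral_unique[OF smooth_fun_increment_eq_integral[OF \<phi>]]
    by (simp add: ennreal_leI)
  also have "\<dots> = (\<integral>\<^sup>+ t. ennreal ((?g t)\<^sup>2) * indicator {0..1} t \<partial>lborel)"
  proof (rule nn_integral_has_integral_lebesgue'[symmetric])
    show "((\<lambda>t. (?g t)\<^sup>2) has_integral integral {0..1} (\<lambda>t. (?g t)\<^sup>2)) {0..1}"
      by (intro integrable_integral integrable_continuous_interval continuous_intros continuous)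
  qed simp
  also have "\<dots> \<le> (\<integral>\<^sup>+ t. indicator {0..1} t * (ennreal ((norm z)\<^sup>2) * ennreal ((norm (grad \<phi> (x + t *\<^sub>R z)))\<^sup>2)) \<partial>lborel)"
  proof (rule nn_integral_mono)
    fix t
    have "(?g t)\<^sup>2 \<le> (norm z * norm (grad \<phi> (x + t *\<^sub>R z)))\<^sup>2"
      using power_mono[OF Cauchy_Schwarz_ineq2[of "grad \<phi> (x + t *\<^sub>R z)" z], of 2] by (simp add: mult.commute)
    then have "ennreal ((?g t)\<^sup>2) \<le> ennreal ((norm z)\<^sup>2) * ennreal ((norm (grad \<phi> (x + t *\<^sub>R z)))\<^sup>2)"
      by (simp add: ennreal_mult[symmetric] power_mult_distrib ennreal_leI)
    then show "ennreal ((?g t)\<^sup>2) * indicator {0..1} t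
        \<le> indicator {0..1} t * (ennreal ((norm z)\<^sup>2) * ennreal ((norm (grad \<phi> (x + t *\<^sub>R z)))\<^sup>2))"
      by (simp add: indicator_def)
  qed
  finally show ?thesis .
qed

lemma translation_estimate:
  fixes \<phi> :: "'a::euclidean_space \<Rightarrow> real"
  assumes \<phi>: "smooth_fun \<phi>" and S [measurable]: "S \<in> sets borel" and invariant: "\<And>x t. x + t *\<^sub>R z \<in> S \<longleftrightarrow> x \<in> S"
  shows "(\<integral>\<^sup>+ x. indicator S x * ennreal ((\<phi> (x + z) - \<phi> x)\<^sup>2) \<partial>lborel)
     \<le> ennreal ((norm z)\<^sup>2) * (\<integral>\<^sup>+ x. indicator S x * ennreal ((norm (grad \<phi> x))\<^sup>2) \<partial>lborel)"
proof -
  let ?n = "\<lambda>x. ennreal ((norm (grad \<phi> x))\<^sup>2)" and ?c = "ennreal ((norm z)\<^sup>2)"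
  let ?I = "\<integral>\<^sup>+ x. indicator S x * ?n x \<partial>lborel"
  have [measurable]: "grad \<phi> \<in> borel_measurable borel"
    by (rule borel_measurable_continuous_onI[OF continuous_grad[OF \<phi>]])
  have "(\<integral>\<^sup>+ x. indicator S x * ennreal ((\<phi> (x + z) - \<phi> x)\<^sup>2) \<partial>lborel)
      \<le> (\<integral>\<^sup>+ x. indicator S x * (\<integral>\<^sup>+ t. indicator {0..1} t * (?c * ?n (x + t *\<^sub>R z)) \<partial>lborel) \<partial>lborel)"
    by (intro nn_integral_mono mult_left_mono sq_increment_le_nn_integral_grad[OF \<phi>]) auto
  also have "\<dots> = (\<integral>\<^sup>+ x. (\<integral>\<^sup>+ t. indicator S x * (indicator {0..1} t * (?c * ?n (x + t *\<^sub>R z))) \<partial>lborel) \<partial>lborel)"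
    by (intro nn_integral_cong nn_integral_cmult[symmetric]) measurable
  also have "\<dots> = (\<integral>\<^sup>+ t. (\<integral>\<^sup>+ x. indicator S x * (indicator {0..1} t * (?c * ?n (x + t *\<^sub>R z))) \<partial>lborel) \<partial>lborel)"
    by (rule lborel_pair.Fubini'[symmetric]) measurable
  also have "\<dots> = (\<integral>\<^sup>+ t. indicator {0..1} t * (?c * ?I) \<partial>(lborel :: real measure))"
  proof (intro nn_integral_cong)
    fix t :: real
    have "(\<integral>\<^sup>+ x. indicator S x * (indicator {0..1} t * (?c * ?n (x + t *\<^sub>R z))) \<partial>lborel)
        = (\<integral>\<^sup>+ x. (indicator {0..1} t * ?c) * (indicator S (x + t *\<^sub>R z) * ?n (x + t *\<^sub>R z)) \<partial>lborel)"
      using invariant by (intro nn_integral_cong) (auto simp: indicator_def mult_ac)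
    also have "\<dots> = (indicator {0..1} t * ?c) * (\<integral>\<^sup>+ x. indicator S (x + t *\<^sub>R z) * ?n (x + t *\<^sub>R z) \<partial>lborel)"
      by (rule nn_integral_cmult) measurable
    also have "(\<integral>\<^sup>+ x. indicator S (x + t *\<^sub>R z) * ?n (x + t *\<^sub>R z) \<partial>lborel) = ?I"
      using nn_integral_lborel_shift[of "\<lambda>x. indicator S x * ?n x" "t *\<^sub>R z"] by simp
    finally show "(\<integral>\<^sup>+ x. indicator S x * (indicator {0..1} t * (?c * ?n (x + t *\<^sub>R z))) \<partial>lborel)
      = indicator {0..1} t * (?c * ?I)" by (simp only: mult.assoc)
  qed
  also have "\<dots> = ?c * ?I" by (simp add: nn_integral_multc)
  finally show ?thesis .
qed

lemma norm_restr_nn_integral: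
  assumes "S \<in> sets lebesgue" "L2_fun f"
  shows "ennreal ((norm (restr S (abs_l2 f)))\<^sup>2) = (\<integral>\<^sup>+ x. indicator S x * ennreal ((norm (f x))\<^sup>2) \<partial>lborel)"
proof -
  have "ennreal ((norm (restr S (abs_l2 f)))\<^sup>2) = (\<integral>\<^sup>+ x. ennreal ((norm (indicator S x *\<^sub>R f x))\<^sup>2) \<partial>lebesgue)"
    using nn_integral_L2[OF L2_fun_indicator[OF assms]] by (simp add: restr_abs_l2 assms)
  also have "\<dots> = (\<integral>\<^sup>+ x. indicator S x * ennreal ((norm (f x))\<^sup>2) \<partial>lborel)"
    unfolding nn_integral_completion by (intro nn_integral_cong) (auto simp: indicator_def)
  finally show ?thesis .
qed

text \<open>Translating by twice the width moves every point of the strip out of \<open>\<Omega>\<close>.\<close>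

lemma strip_poincare_test:
  fixes e e2 :: "'a::euclidean_space"
  assumes e2: "norm e2 = 1" "e \<bullet> e2 = 0" and I: "I \<in> sets borel" and M: "M \<ge> 0"
    and width: "\<And>x. x \<in> \<Omega> \<Longrightarrow> x \<bullet> e \<in> I \<Longrightarrow> \<bar>x \<bullet> e2\<bar> < M"
    and \<phi>: "test_fun \<Omega> \<phi>"
  shows "norm (restr {x. x \<bullet> e \<in> I} (abs_l2 \<phi>)) \<le> 2 * M * norm (restr {x. x \<bullet> e \<in> I} (abs_l2 (grad \<phi>)))"
proof (rule power2_le_imp_le)
  let ?S = "{x. x \<bullet> e \<in> I}" and ?z = "(2 * M) *\<^sub>R e2"
  have S: "?S \<in> sets borel"
    using measurable_sets_borel[of "\<lambda>x. x \<bullet> e" borel I] I by (simp add: vimage_def)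
  then have S_lebesgue: "?S \<in> sets lebesgue" by simp
  have shift_e: "(x + t *\<^sub>R ?z) \<bullet> e = x \<bullet> e" for x t
    using e2(2) by (simp add: inner_add_left inner_commute[of e2])
  have outside: "x + ?z \<notin> \<Omega>" if "x \<in> \<Omega>" "x \<in> ?S" for x
  proof -
    have "(x + ?z) \<bullet> e2 = x \<bullet> e2 + 2 * M" using e2(1) by (simp add: inner_add_left norm_eq_1)
    moreover have "\<bar>x \<bullet> e2\<bar> < M" using width that by simp
    ultimately show ?thesis using width[of "x + ?z"] that(2) shift_e[of x 1] by auto
  qed
  have "ennreal ((norm (restr ?S (abs_l2 \<phi>)))\<^sup>2) = (\<integral>\<^sup>+ x. indicator ?S x * ennreal ((\<phi> x)\<^sup>2) \<partial>lborel)"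
    using norm_restr_nn_integral[OF S_lebesgue L2_fun_test(1)[OF \<phi>]] by simp
  also have "\<dots> \<le> (\<integral>\<^sup>+ x. indicator ?S x * ennreal ((\<phi> (x + ?z) - \<phi> x)\<^sup>2) \<partial>lborel)"
  proof (rule nn_integral_mono)
    fix x
    show "indicator ?S x * ennreal ((\<phi> x)\<^sup>2) \<le> indicator ?S x * ennreal ((\<phi> (x + ?z) - \<phi> x)\<^sup>2)"
      using outside[of x] test_fun_zero_outside(1)[OF \<phi>, of x] test_fun_zero_outside(1)[OF \<phi>, of "x + ?z"]
      by (cases "x \<in> \<Omega>"; cases "x \<in> ?S") auto
  qed
  also have "\<dots> \<le> ennreal ((norm ?z)\<^sup>2) * (\<integral>\<^sup>+ x. indicator ?S x * ennreal ((norm (grad \<phi> x))\<^sup>2) \<partial>lborel)"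
    using shift_e by (intro translation_estimate[OF test_fun_smooth[OF \<phi>] S]) simp
  also have "\<dots> = ennreal ((2 * M)\<^sup>2 * (norm (restr ?S (abs_l2 (grad \<phi>))))\<^sup>2)"
    using norm_restr_nn_integral[OF S_lebesgue L2_fun_test(2)[OF \<phi>]] e2(1) M by (simp add: ennreal_mult)
  finally show "(norm (restr ?S (abs_l2 \<phi>)))\<^sup>2 \<le> (2 * M * norm (restr ?S (abs_l2 (grad \<phi>))))\<^sup>2"
    by (simp add: power_mult_distrib)
qed (use M in simp)

lemma strip_poincare:
  fixes e e2 :: "'a::euclidean_space"
  assumes e2: "norm e2 = 1" "e \<bullet> e2 = 0" and I: "I \<in> sets borel" and M: "M \<ge> 0"
    and width: "\<And>x. x \<in> \<Omega> \<Longrightarrow> x \<bullet> e \<in> I \<Longrightarrow> \<bar>x \<bullet> e2\<bar> < M"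
    and "(u, G) \<in> form_space \<Omega>"
  shows "norm (restr {x. x \<bullet> e \<in> I} u) \<le> 2 * M * norm (restr {x. x \<bullet> e \<in> I} G)"
  using assms(6)
proof (induction rule: form_space_induct)
  case closed
  have "{x. x \<bullet> e \<in> I} \<in> sets borel"
    using measurable_sets_borel[of "\<lambda>x. x \<bullet> e" borel I] I by (simp add: vimage_def)
  then have "{x. x \<bullet> e \<in> I} \<in> sets lebesgue" by simp
  then show ?case by (intro closed_Collect_le continuous_intros)
next
  case (test \<phi>)
  show ?case by (rule strip_poincare_test[OF e2 I M width test])
qed

lemma compact_bounded_coefficient_sums:
  fixes \<Phi> :: "'h::real_normed_vector set"
  assumes "finite \<Phi>"
  obtains T where "compact T" "\<And>c. (\<And>\<phi>. \<phi> \<in> \<Phi> \<Longrightarrow> \<bar>c \<phi>\<bar> \<le> r) \<Longrightarrow> (\<Sum>\<phi>\<in>\<Phi>. c \<phi> *\<^sub>R \<phi>) \<in> T"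
proof
  let ?r = "real (card \<Phi>) * r"
  let ?T = "convex hull (insert 0 (\<Union>\<phi>\<in>\<Phi>. {- ?r *\<^sub>R \<phi>, ?r *\<^sub>R \<phi>}))"
  show "compact ?T" using assms by (intro finite_imp_compact_convex_hull) auto
  fix c :: "'h \<Rightarrow> real" assume c: "\<And>\<phi>. \<phi> \<in> \<Phi> \<Longrightarrow> \<bar>c \<phi>\<bar> \<le> r"
  show "(\<Sum>\<phi>\<in>\<Phi>. c \<phi> *\<^sub>R \<phi>) \<in> ?T"
  proof (cases "\<Phi> = {}")
    case False
    then have card: "real (card \<Phi>) > 0" using assms by (simp add: card_gt_0_iff)
    have scaled: "(real (card \<Phi>) * c \<phi>) *\<^sub>R \<phi> \<in> ?T" if "\<phi> \<in> \<Phi>" for \<phi>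
    proof -
      have "\<bar>real (card \<Phi>) * c \<phi>\<bar> \<le> ?r" using c[OF that] by (simp add: abs_mult mult_left_mono)
      then have "real (card \<Phi>) * c \<phi> \<in> closed_segment (- ?r) ?r"
        by (auto simp: closed_segment_eq_real_ivl abs_le_iff)
      then have "(real (card \<Phi>) * c \<phi>) *\<^sub>R \<phi> \<in> (\<lambda>t. t *\<^sub>R \<phi>) ` closed_segment (- ?r) ?r" by (rule imageI)
      also have "\<dots> = closed_segment (- ?r *\<^sub>R \<phi>) (?r *\<^sub>R \<phi>)"
        by (rule closed_segment_linear_image[symmetric, OF linear_scaleR_left])
      also have "\<dots> \<subseteq> ?T" unfolding segment_convex_hull by (rule hull_mono) (use that in auto)
      finally show ?thesis .
    qed
    have "(\<Sum>\<phi>\<in>\<Phi>. (1 / real (card \<Phi>)) *\<^sub>R ((real (card \<Phi>) * c \<phi>) *\<^sub>R \<phi>)) \<in> ?T"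
      using card by (intro convex_sum[OF assms convex_convex_hull] scaled) auto
    then show ?thesis using card by simp
  qed (simp add: hull_inc)
qed

lemma compact_closure_of_compact_approx:
  fixes S :: "'h::complete_space set"
  assumes approx: "\<And>\<epsilon>. \<epsilon> > 0 \<Longrightarrow> \<exists>T. compact T \<and> (\<forall>s\<in>S. \<exists>t\<in>T. dist t s < \<epsilon>)"
  shows "compact (closure S)"
  unfolding compact_eq_totally_bounded
proof (intro conjI allI impI)
  show "complete (closure S)" by (simp add: complete_eq_closed)
  fix \<epsilon> :: real assume "\<epsilon> > 0"
  then have "\<epsilon> / 3 > 0" by simp
  then obtain T where T: "compact T" "\<And>s. s \<in> S \<Longrightarrow> \<exists>t\<in>T. dist t s < \<epsilon> / 3" using approx[of "\<epsilon> / 3"] by auto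
  obtain F where F: "finite F" "T \<subseteq> (\<Union>y\<in>F. ball y (\<epsilon> / 3))"
    using conjunct2[OF compact_eq_totally_bounded[THEN iffD1, OF T(1)]] \<open>\<epsilon> / 3 > 0\<close> by blast
  have "closure S \<subseteq> (\<Union>y\<in>F. ball y \<epsilon>)"
  proof
    fix x assume "x \<in> closure S"
    then obtain s where s: "s \<in> S" "dist s x < \<epsilon> / 3"
      using \<open>\<epsilon> / 3 > 0\<close> by (auto simp only: closure_approachable)
    obtain t where t: "t \<in> T" "dist t s < \<epsilon> / 3" using T(2)[OF s(1)] by blast
    obtain y where y: "y \<in> F" "dist y t < \<epsilon> / 3" using F(2) t(1) by auto
    have "dist y x < \<epsilon>"
      using dist_triangle[of y x t] dist_triangle[of t x s] s(2) t(2) y(2) by linarith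
    then show "x \<in> (\<Union>y\<in>F. ball y \<epsilon>)" using y(1) by auto
  qed
  then show "\<exists>F. finite F \<and> closure S \<subseteq> (\<Union>y\<in>F. ball y \<epsilon>)" using F(1) by blast
qed

lemma compact_op_of_finite_rank_approx:
  fixes K :: "'h::{real_inner,banach} \<Rightarrow> 'h"
  assumes K: "bounded_linear K"
    and approx: "\<And>\<epsilon>. \<epsilon> > 0 \<Longrightarrow> \<exists>\<Phi>. finite \<Phi> \<and> orthonormal \<Phi> \<and> (\<forall>x. norm x \<le> 1 \<longrightarrow> norm (K x - fourier_sum \<Phi> (K x)) \<le> \<epsilon>)"
  shows "compact_op K"
proof -
  obtain r where r: "\<And>x. norm (K x) \<le> norm x * r" using bounded_linear.bounded[OF K] by blast
  have "compact (closure (K ` cball 0 1))"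
  proof (rule compact_closure_of_compact_approx)
    fix \<epsilon> :: real assume "\<epsilon> > 0"
    then obtain \<Phi> where \<Phi>: "finite \<Phi>" "orthonormal \<Phi>"
      and close: "\<And>x. norm x \<le> 1 \<Longrightarrow> norm (K x - fourier_sum \<Phi> (K x)) \<le> \<epsilon> / 2"
      using approx[of "\<epsilon> / 2"] by auto
    obtain T where T: "compact T" "\<And>c. (\<And>\<phi>. \<phi> \<in> \<Phi> \<Longrightarrow> \<bar>c \<phi>\<bar> \<le> \<bar>r\<bar>) \<Longrightarrow> (\<Sum>\<phi>\<in>\<Phi>. c \<phi> *\<^sub>R \<phi>) \<in> T"
      using compact_bounded_coefficient_sums[OF \<Phi>(1)] by blast
    have "\<exists>t\<in>T. dist t (K x) < \<epsilon>" if x: "norm x \<le> 1" for x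
    proof
      show "fourier_sum \<Phi> (K x) \<in> T"
        unfolding fourier_sum_def
      proof (rule T(2))
        fix \<phi> assume "\<phi> \<in> \<Phi>"
        then have "\<bar>K x \<bullet> \<phi>\<bar> \<le> norm (K x)"
          using Cauchy_Schwarz_ineq2[of "K x" \<phi>] orthonormal_norm[OF \<Phi>(2)] by simp
        also have "\<dots> \<le> norm x * \<bar>r\<bar>" by (rule order_trans[OF r]) (simp add: mult_left_mono)
        also have "\<dots> \<le> \<bar>r\<bar>" using x by (simp add: mult_left_le_one_le)
        finally show "\<bar>K x \<bullet> \<phi>\<bar> \<le> \<bar>r\<bar>" .
      qed
      show "dist (fourier_sum \<Phi> (K x)) (K x) < \<epsilon>"
        using close[OF x] \<open>\<epsilon> > 0\<close> by (simp add: dist_norm norm_minus_commute)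
    qed
    then show "\<exists>T. compact T \<and> (\<forall>s\<in>K ` cball 0 1. \<exists>t\<in>T. dist t s < \<epsilon>)" using T(1) by auto
  qed
  then show ?thesis using bounded_linear.linear[OF K] by (simp add: compact_op_def)
qed

definition grid_corner :: "real \<Rightarrow> 'a::euclidean_space \<Rightarrow> 'a" where
  "grid_corner h x = (\<Sum>b\<in>Basis. (h * of_int \<lfloor>(x \<bullet> b) / h\<rfloor>) *\<^sub>R b)"

lemma grid_corner_inner: "b \<in> Basis \<Longrightarrow> grid_corner h x \<bullet> b = h * of_int \<lfloor>(x \<bullet> b) / h\<rfloor>"
  by (simp add: grid_corner_def)

lemma measurable_grid_corner [measurable]: "grid_corner h \<in> borel_measurable borel"
  unfolding grid_corner_def[abs_def] by measurable

lemma grid_corner_bounds: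
  assumes "h > 0" "b \<in> Basis" shows "0 \<le> (x - grid_corner h x) \<bullet> b" "(x - grid_corner h x) \<bullet> b < h"
proof -
  have "h * of_int \<lfloor>(x \<bullet> b) / h\<rfloor> \<le> h * ((x \<bullet> b) / h)"
    using assms(1) by (intro mult_left_mono of_int_floor_le) auto
  moreover have "h * ((x \<bullet> b) / h) < h * (of_int \<lfloor>(x \<bullet> b) / h\<rfloor> + 1)"
    using assms(1) by (intro mult_strict_left_mono) linarith+
  ultimately show "0 \<le> (x - grid_corner h x) \<bullet> b" "(x - grid_corner h x) \<bullet> b < h"
    using assms by (auto simp: inner_diff_left grid_corner_inner algebra_simps)
qed

lemma norm_le_DIM_mult:
  fixes x :: "'a::euclidean_space"
  assumes "\<And>b. b \<in> Basis \<Longrightarrow> \<bar>x \<bullet> b\<bar> \<le> r" shows "norm x \<le> real DIM('a) * r"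
  using norm_le_l1[of x] sum_mono[of Basis "\<lambda>b. \<bar>x \<bullet> b\<bar>" "\<lambda>_. r"] assms by simp

lemma norm_diff_grid_corner_le:
  fixes x :: "'a::euclidean_space"
  assumes "h > 0" shows "norm (x - grid_corner h x) \<le> real DIM('a) * h"
proof (rule norm_le_DIM_mult)
  show "\<bar>(x - grid_corner h x) \<bullet> b\<bar> \<le> h" if "b \<in> Basis" for b
    using grid_corner_bounds[OF assms that, of x] by simp
qed

lemma finite_grid_corners:
  assumes "h > 0" "bounded B" shows "finite (range (grid_corner h) \<inter> (B :: 'a::euclidean_space set))"
proof -
  obtain R where R: "\<And>x. x \<in> B \<Longrightarrow> norm x \<le> R" using assms(2) by (auto simp: bounded_iff)
  let ?corner = "\<lambda>k. \<Sum>b\<in>(Basis::'a set). (h * of_int (k b)) *\<^sub>R b" and ?N = "\<lceil>R / h\<rceil>"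
  have "range (grid_corner h) \<inter> B \<subseteq> ?corner ` (PiE Basis (\<lambda>_. {- ?N..?N}))"
  proof
    fix q assume "q \<in> range (grid_corner h) \<inter> B"
    then obtain x where q: "q = grid_corner h x" "q \<in> B" by auto
    let ?k = "restrict (\<lambda>b. \<lfloor>(x \<bullet> b) / h\<rfloor>) (Basis :: 'a set)"
    have "q = ?corner ?k" unfolding q(1) grid_corner_def by (intro sum.cong) auto
    moreover have "?k \<in> PiE Basis (\<lambda>_. {- ?N..?N})"
      unfolding restrict_PiE_iff
    proof
      show "\<lfloor>(x \<bullet> b) / h\<rfloor> \<in> {- ?N..?N}" if "b \<in> Basis" for b
      proof -
        have "\<bar>h * of_int \<lfloor>(x \<bullet> b) / h\<rfloor>\<bar> \<le> R"
          using Basis_le_norm[OF that, of q] R[OF q(2)] that by (simp add: q(1) grid_corner_inner)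
        then have "\<bar>of_int \<lfloor>(x \<bullet> b) / h\<rfloor>\<bar> \<le> R / h" using assms(1) by (simp add: abs_mult field_simps)
        then have "\<bar>of_int \<lfloor>(x \<bullet> b) / h\<rfloor>\<bar> \<le> (of_int ?N :: real)" by linarith
        then show ?thesis by auto
      qed
    qed
    ultimately show "q \<in> ?corner ` (PiE Basis (\<lambda>_. {- ?N..?N}))" by (rule image_eqI)
  qed
  moreover have "finite (PiE (Basis :: 'a set) (\<lambda>_. {- ?N..?N}))" by (intro finite_PiE) auto
  ultimately show ?thesis using finite_surj by blast
qed

definition cell_l2 :: "real \<Rightarrow> 'a::euclidean_space \<Rightarrow> ('a, real) l2" where
  "cell_l2 h q = abs_l2 (\<lambda>x. indicator (grid_corner h -` {q}) x)"

lemma L2_fun_grid_cell: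
  assumes "h > 0" shows "L2_fun (\<lambda>x. indicator (grid_corner h -` {q}) x :: real)"
proof (rule L2_fun_indicator_lmeasurable[OF bounded_set_imp_lmeasurable])
  show "bounded (grid_corner h -` {q})"
    unfolding bounded_def using norm_diff_grid_corner_le[OF assms]
    by (intro exI[of _ q] exI) (auto simp: dist_norm norm_minus_commute)
  have "grid_corner h -` {q} \<in> sets borel"
    using measurable_sets_borel[OF measurable_grid_corner, of "{q}" h] by simp
  then show "grid_corner h -` {q} \<in> sets lebesgue" by simp
qed

lemma grid_sample_in_span:
  fixes U :: "'a::euclidean_space set"
  assumes h: "h > 0" and U: "U \<subseteq> cball 0 R" and \<phi>: "test_fun U \<phi>" and w: "w \<in> box 0 (h *\<^sub>R One)"
  defines "Q \<equiv> range (grid_corner h) \<inter> cball 0 (R + real DIM('a) * h)"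
  shows "L2_fun (\<lambda>x. \<phi> (grid_corner h x + w))" "abs_l2 (\<lambda>x. \<phi> (grid_corner h x + w)) \<in> span (cell_l2 h ` Q)"
proof -
  have finite: "finite Q" unfolding Q_def by (intro finite_grid_corners h bounded_cball)
  have outside: "\<phi> (q + w) = 0" if "q \<in> range (grid_corner h)" "q \<notin> Q" for q
  proof (rule test_fun_zero_outside(1)[OF \<phi>])
    have "norm w \<le> real DIM('a) * h" by (rule norm_le_DIM_mult) (use w in \<open>auto simp: mem_box less_imp_le\<close>)
    then show "q + w \<notin> U" using that U norm_triangle_ineq4[of "q + w" w] by (auto simp: Q_def subset_iff)
  qed
  let ?term = "\<lambda>q x. \<phi> (q + w) *\<^sub>R (indicator (grid_corner h -` {q}) x :: real)"
  have sample: "(\<lambda>x. \<phi> (grid_corner h x + w)) = (\<lambda>x. \<Sum>q\<in>Q. ?term q x)"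
  proof
    fix x
    have "(\<Sum>q\<in>Q. ?term q x) = (\<Sum>q\<in>Q. if q = grid_corner h x then \<phi> (q + w) else 0)"
      by (intro sum.cong) (auto simp: indicator_def)
    then show "\<phi> (grid_corner h x + w) = (\<Sum>q\<in>Q. ?term q x)" using finite outside by simp
  qed
  have L2: "L2_fun (?term q)" for q by (intro L2_fun_scaleR L2_fun_grid_cell h)
  show "L2_fun (\<lambda>x. \<phi> (grid_corner h x + w))" unfolding sample by (rule L2_fun_sum[OF L2])
  have "abs_l2 (\<lambda>x. \<phi> (grid_corner h x + w)) = (\<Sum>q\<in>Q. abs_l2 (?term q))"
    unfolding sample by (rule abs_l2_sum[OF L2, symmetric])
  also have "\<dots> = (\<Sum>q\<in>Q. \<phi> (q + w) *\<^sub>R cell_l2 h q)"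
    by (simp only: cell_l2_def abs_l2_scaleR[OF L2_fun_grid_cell[OF h]])
  also have "\<dots> \<in> span (cell_l2 h ` Q)" by (intro span_sum span_scale span_base imageI)
  finally show "abs_l2 (\<lambda>x. \<phi> (grid_corner h x + w)) \<in> span (cell_l2 h ` Q)" .
qed

lemma nn_integral_grid_corner_shift_le:
  fixes F :: "'a::euclidean_space \<Rightarrow> ennreal"
  assumes h: "h > 0" and [measurable]: "F \<in> borel_measurable borel"
  shows "(\<integral>\<^sup>+ w. indicator (box 0 (h *\<^sub>R One)) w * F (grid_corner h x + w) \<partial>lborel)
    \<le> (\<integral>\<^sup>+ z. indicator (cbox (- h *\<^sub>R One) (h *\<^sub>R One)) z * F (x + z) \<partial>lborel)"
proof -
  let ?W = "box 0 (h *\<^sub>R One) :: 'a set" and ?Z = "cbox (- h *\<^sub>R One) (h *\<^sub>R One) :: 'a set"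
  let ?s = "x - grid_corner h x"
  have "(\<integral>\<^sup>+ w. indicator ?W w * F (grid_corner h x + w) \<partial>lborel)
      = (\<integral>\<^sup>+ z. indicator ?W (z + ?s) * F (grid_corner h x + (z + ?s)) \<partial>lborel)"
    by (rule nn_integral_lborel_shift[symmetric]) measurable
  also have "\<dots> \<le> (\<integral>\<^sup>+ z. indicator ?Z z * F (x + z) \<partial>lborel)"
  proof (rule nn_integral_mono)
    fix z :: 'a
    have "z \<in> ?Z" if "z + ?s \<in> ?W"
    proof -
      have "- h \<le> z \<bullet> b \<and> z \<bullet> b \<le> h" if "b \<in> Basis" for b
        using \<open>z + ?s \<in> ?W\<close> that grid_corner_bounds[OF h that, of x] by (force simp: mem_box inner_add_left)
      then show ?thesis by (auto simp: mem_box)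
    qed
    then show "indicator ?W (z + ?s) * F (grid_corner h x + (z + ?s)) \<le> indicator ?Z z * F (x + z)"
      by (cases "z + ?s \<in> ?W") (auto simp: add.commute)
  qed
  finally show ?thesis .
qed

text \<open>Sampling \<open>\<phi>\<close> at offset \<open>w\<close> inside each grid cell and averaging over \<open>w\<close> costs only translations
  by less than the mesh size.\<close>

lemma grid_sampling_estimate:
  fixes \<phi> :: "'a::euclidean_space \<Rightarrow> real"
  assumes \<phi>: "smooth_fun \<phi>" and h: "h > 0"
  shows "(\<integral>\<^sup>+ w. indicator (box 0 (h *\<^sub>R One)) w *
        (\<integral>\<^sup>+ x. ennreal ((\<phi> (grid_corner h x + w) - \<phi> x)\<^sup>2) \<partial>lborel) \<partial>lborel)
    \<le> ennreal ((2 * h) ^ DIM('a)) * (ennreal ((real DIM('a) * h)\<^sup>2) * (\<integral>\<^sup>+ x. ennreal ((norm (grad \<phi> x))\<^sup>2) \<partial>lborel))"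
proof -
  let ?W = "box 0 (h *\<^sub>R One) :: 'a set" and ?Z = "cbox (- h *\<^sub>R One) (h *\<^sub>R One) :: 'a set"
  let ?d = "\<lambda>x y. ennreal ((\<phi> y - \<phi> x)\<^sup>2)" and ?N = "\<integral>\<^sup>+ x. ennreal ((norm (grad \<phi> x))\<^sup>2) \<partial>lborel"
  let ?C = "ennreal ((real DIM('a) * h)\<^sup>2)"
  have [measurable]: "\<phi> \<in> borel_measurable borel"
    by (rule borel_measurable_continuous_onI[OF smooth_fun_continuous[OF \<phi>]])
  have "(\<integral>\<^sup>+ w. indicator ?W w * (\<integral>\<^sup>+ x. ?d x (grid_corner h x + w) \<partial>lborel) \<partial>lborel)
      = (\<integral>\<^sup>+ w. (\<integral>\<^sup>+ x. indicator ?W w * ?d x (grid_corner h x + w) \<partial>lborel) \<partial>lborel)"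
    by (intro nn_integral_cong nn_integral_cmult[symmetric]) measurable
  also have "\<dots> = (\<integral>\<^sup>+ x. (\<integral>\<^sup>+ w. indicator ?W w * ?d x (grid_corner h x + w) \<partial>lborel) \<partial>lborel)"
    by (rule lborel_pair.Fubini') measurable
  also have "\<dots> \<le> (\<integral>\<^sup>+ x. (\<integral>\<^sup>+ z. indicator ?Z z * ?d x (x + z) \<partial>lborel) \<partial>lborel)"
    by (intro nn_integral_mono nn_integral_grid_corner_shift_le[OF h]) measurable
  also have "\<dots> = (\<integral>\<^sup>+ z. (\<integral>\<^sup>+ x. indicator ?Z z * ?d x (x + z) \<partial>lborel) \<partial>lborel)"
    by (rule lborel_pair.Fubini'[symmetric]) measurable
  also have "\<dots> = (\<integral>\<^sup>+ z. indicator ?Z z * (\<integral>\<^sup>+ x. ?d x (x + z) \<partial>lborel) \<partial>lborel)"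
    by (intro nn_integral_cong nn_integral_cmult) measurable
  also have "\<dots> \<le> (\<integral>\<^sup>+ z. indicator ?Z z * (?C * ?N) \<partial>lborel)"
  proof (rule nn_integral_mono)
    fix z :: 'a
    have "(\<integral>\<^sup>+ x. ?d x (x + z) \<partial>lborel) \<le> ?C * ?N" if "z \<in> ?Z"
    proof -
      have "norm z \<le> real DIM('a) * h"
        by (rule norm_le_DIM_mult) (use that in \<open>auto simp: mem_box abs_le_iff minus_le_iff\<close>)
      then have "ennreal ((norm z)\<^sup>2) \<le> ?C" by (intro ennreal_leI power_mono) auto
      from order_trans[OF _ mult_right_mono[OF this]] show ?thesis
        using translation_estimate[OF \<phi>, of UNIV z] by simp
    qed
    then show "indicator ?Z z * (\<integral>\<^sup>+ x. ?d x (x + z) \<partial>lborel) \<le> indicator ?Z z * (?C * ?N)"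
      by (cases "z \<in> ?Z") auto
  qed
  also have "\<dots> = emeasure lborel ?Z * (?C * ?N)" by (simp add: nn_integral_multc)
  also have "emeasure lborel ?Z = ennreal ((2 * h) ^ DIM('a))"
    using h by (subst emeasure_lborel_cbox) (auto simp: algebra_simps)
  finally show ?thesis .
qed

lemma grid_residual_test:
  fixes U :: "'a::euclidean_space set"
  assumes h: "h > 0" and U: "U \<subseteq> cball 0 R" and \<phi>: "test_fun U \<phi>"
    and \<Phi>: "finite \<Phi>" "orthonormal \<Phi>"
    and span: "span \<Phi> = span (cell_l2 h ` (range (grid_corner h) \<inter> cball 0 (R + real DIM('a) * h)))"
  shows "norm (abs_l2 \<phi> - fourier_sum \<Phi> (abs_l2 \<phi>)) \<le> sqrt (2 ^ DIM('a)) * real DIM('a) * h * norm (abs_l2 (grad \<phi>))"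
    (is "norm ?r \<le> ?C * norm ?g")
proof (rule power2_le_imp_le)
  let ?W = "box 0 (h *\<^sub>R One) :: 'a set"
  let ?sq = "\<lambda>w. \<integral>\<^sup>+ x. ennreal ((\<phi> (grid_corner h x + w) - \<phi> x)\<^sup>2) \<partial>lborel"
  have residual_le: "ennreal ((norm ?r)\<^sup>2) \<le> ?sq w" if w: "w \<in> ?W" for w
  proof -
    let ?s = "\<lambda>x. \<phi> (grid_corner h x + w)"
    note sample = grid_sample_in_span[OF h U \<phi> w]
    have "norm ?r \<le> norm (abs_l2 \<phi> - abs_l2 ?s)"
      by (rule fourier_sum_best_approx[OF \<Phi>]) (simp only: span sample(2))
    then have "ennreal ((norm ?r)\<^sup>2) \<le> ennreal ((norm (abs_l2 ?s - abs_l2 \<phi>))\<^sup>2)"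
      by (intro ennreal_leI power_mono) (auto simp: norm_minus_commute)
    also have "\<dots> = ?sq w"
      using nn_integral_L2[OF L2_fun_diff[OF sample(1) L2_fun_test(1)[OF \<phi>]]]
      by (simp add: abs_l2_diff[OF sample(1) L2_fun_test(1)[OF \<phi>]] nn_integral_completion)
    finally show ?thesis .
  qed
  have "ennreal (h ^ DIM('a)) * ennreal ((norm ?r)\<^sup>2) = (\<integral>\<^sup>+ w. indicator ?W w * ennreal ((norm ?r)\<^sup>2) \<partial>lborel)"
    using h by (simp add: nn_integral_multc emeasure_lborel_box_eq)
  also have "\<dots> \<le> (\<integral>\<^sup>+ w. indicator ?W w * ?sq w \<partial>lborel)"
    using residual_le by (intro nn_integral_mono) (auto simp: indicator_def)
  also have "\<dots> \<le> ennreal ((2 * h) ^ DIM('a)) *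
      (ennreal ((real DIM('a) * h)\<^sup>2) * (\<integral>\<^sup>+ x. ennreal ((norm (grad \<phi> x))\<^sup>2) \<partial>lborel))"
    by (rule grid_sampling_estimate[OF test_fun_smooth[OF \<phi>] h])
  also have "(\<integral>\<^sup>+ x. ennreal ((norm (grad \<phi> x))\<^sup>2) \<partial>lborel) = ennreal ((norm ?g)\<^sup>2)"
    using nn_integral_L2[OF L2_fun_test(2)[OF \<phi>]] by (simp add: nn_integral_completion)
  finally have "h ^ DIM('a) * (norm ?r)\<^sup>2 \<le> (2 * h) ^ DIM('a) * ((real DIM('a) * h)\<^sup>2 * (norm ?g)\<^sup>2)"
    using h by (simp add: ennreal_mult[symmetric])
  also have "\<dots> = h ^ DIM('a) * (?C * norm ?g)\<^sup>2" by (simp add: power_mult_distrib)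
  finally show "(norm ?r)\<^sup>2 \<le> (?C * norm ?g)\<^sup>2" using h by simp
qed (use h in simp)

lemma grid_approximation:
  fixes U :: "'a::euclidean_space set"
  assumes U: "bounded U" and h: "h > 0"
  obtains \<Phi> where "finite \<Phi>" "orthonormal \<Phi>"
    "\<And>u G. (u, G) \<in> form_space U \<Longrightarrow> norm (u - fourier_sum \<Phi> u) \<le> sqrt (2 ^ DIM('a)) * real DIM('a) * h * norm G"
proof -
  obtain R where "\<forall>x\<in>U. norm x \<le> R" using U by (auto simp: bounded_iff)
  then have R: "U \<subseteq> cball 0 R" by auto
  have "finite (cell_l2 h ` (range (grid_corner h) \<inter> cball (0 :: 'a) (R + real DIM('a) * h)))"
    by (intro finite_imageI finite_grid_corners h bounded_cball)
  then obtain \<Phi> where \<Phi>: "finite \<Phi>" "orthonormal \<Phi>"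
    and span: "span \<Phi> = span (cell_l2 h ` (range (grid_corner h) \<inter> cball (0 :: 'a) (R + real DIM('a) * h)))"
    by (rule finite_span_orthonormal_basis)
  have "norm (u - fourier_sum \<Phi> u) \<le> sqrt (2 ^ DIM('a)) * real DIM('a) * h * norm G" if "(u, G) \<in> form_space U" for u G
    using that
  proof (induction rule: form_space_induct)
    case closed
    show ?case unfolding fourier_sum_def by (intro closed_Collect_le continuous_intros)
  next
    case (test \<phi>)
    show ?case by (rule grid_residual_test[OF h R test \<Phi> span])
  qed
  then show ?thesis using that \<Phi> by blast
qed

lemma compact_dres:
  fixes U :: "'a::euclidean_space set"
  assumes "bounded U" shows "compact_op (dres U)"
proof (rule compact_op_of_finite_rank_approx[OF pos_contraction_bounded_linear[OF pos_contraction_dres]])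
  fix \<epsilon> :: real assume "\<epsilon> > 0"
  let ?C = "sqrt (2 ^ DIM('a)) * real DIM('a)"
  have C: "?C > 0" by simp
  define h where "h = \<epsilon> / ?C"
  have h: "h > 0" "?C * h = \<epsilon>" using C \<open>\<epsilon> > 0\<close> by (auto simp: h_def)
  obtain \<Phi> where \<Phi>: "finite \<Phi>" "orthonormal \<Phi>"
    "\<And>u G. (u, G) \<in> form_space U \<Longrightarrow> norm (u - fourier_sum \<Phi> u) \<le> ?C * h * norm G"
    using grid_approximation[OF assms h(1)] by blast
  have "norm (dres U x - fourier_sum \<Phi> (dres U x)) \<le> \<epsilon>" if "norm x \<le> 1" for x
  proof -
    have "norm (dres_grad U x) \<le> norm (dres U x, dres_grad U x)" by (simp add: norm_prod_def real_le_rsqrt)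
    also have "\<dots> \<le> 1" using norm_dres_graph_le[of U x] that by simp
    finally have "\<epsilon> * norm (dres_grad U x) \<le> \<epsilon>" using \<open>\<epsilon> > 0\<close> by (simp add: mult_left_le)
    then show ?thesis using \<Phi>(3)[OF dres_in_form_space, of x] by (simp only: h(2))
  qed
  then show "\<exists>\<Phi>. finite \<Phi> \<and> orthonormal \<Phi> \<and> (\<forall>x. norm x \<le> 1 \<longrightarrow> norm (dres U x - fourier_sum \<Phi> (dres U x)) \<le> \<epsilon>)"
    using \<Phi>(1,2) by blast
qed

section \<open>Opening a thin tube\<close>

definition slit_cutoff :: "real \<Rightarrow> real \<Rightarrow> real" where
  "slit_cutoff s t = smooth_step (t / s - 1) + smooth_step (- t / s - 1)"

lemma smooth_slit_cutoff: "smooth_fun (slit_cutoff s)"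
proof -
  have "smooth_fun (\<lambda>t. smooth_step (c * t + - 1))" for c
    by (rule smooth_fun_compose_affine[OF bounded_linear_mult_right smooth_smooth_step])
  from smooth_fun_add[OF this[of "1 / s"] this[of "- 1 / s"]] show ?thesis
    by (simp add: slit_cutoff_def[abs_def])
qed

context
  fixes s :: real
  assumes s: "s > 0"
begin

lemma slit_cutoff_nonneg_side: "t \<ge> - s \<Longrightarrow> slit_cutoff s t = smooth_step (t / s - 1)"
  and slit_cutoff_nonpos_side: "t \<le> s \<Longrightarrow> slit_cutoff s t = smooth_step (- t / s - 1)"
  using s by (simp_all add: slit_cutoff_def smooth_step_0 field_simps)

lemma slit_cutoff_range: "0 \<le> slit_cutoff s t" "slit_cutoff s t \<le> 1"
  using slit_cutoff_nonneg_side[of t] slit_cutoff_nonpos_side[of t] smooth_step_range s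
  by (cases "t \<ge> 0"; simp)+

lemma slit_cutoff_eq_0: "\<bar>t\<bar> \<le> s \<Longrightarrow> slit_cutoff s t = 0"
  using s by (simp add: slit_cutoff_def smooth_step_0 field_simps)

lemma slit_cutoff_eq_1: "\<bar>t\<bar> \<ge> 2 * s \<Longrightarrow> slit_cutoff s t = 1"
  using slit_cutoff_nonneg_side[of t] slit_cutoff_nonpos_side[of t] s
  by (cases "t \<ge> 0") (simp_all add: smooth_step_1 field_simps)

lemma deriv_slit_cutoff_eq_0:
  assumes "\<bar>t\<bar> > 2 * s" shows "deriv (slit_cutoff s) t = 0"
proof -
  have "open {t. \<bar>t\<bar> > 2 * s}" by (intro open_Collect_less continuous_intros)
  then have "\<forall>\<^sub>F r in nhds t. r \<in> {t. \<bar>t\<bar> > 2 * s}" using assms by (intro eventually_nhds_in_open) auto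
  then have "\<forall>\<^sub>F r in nhds t. slit_cutoff s r = 1" by eventually_elim (simp add: slit_cutoff_eq_1)
  then show ?thesis by (simp add: deriv_cong_ev)
qed

lemma deriv_slit_cutoff_le: "\<bar>deriv (slit_cutoff s) t\<bar> \<le> 2 * smooth_step_slope / s"
proof -
  let ?d = "deriv smooth_step"
  have "(slit_cutoff s has_real_derivative ?d (t / s - 1) * (1 / s) + ?d (- t / s - 1) * (- 1 / s)) (at t)"
    unfolding slit_cutoff_def[abs_def]
    by (intro DERIV_add DERIV_chain2[OF smooth_fun_has_real_derivative[OF smooth_smooth_step]])
       (use s in \<open>auto intro!: derivative_eq_intros\<close>)
  then have "\<bar>deriv (slit_cutoff s) t\<bar> = \<bar>?d (t / s - 1) - ?d (- t / s - 1)\<bar> / s"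
    using s by (simp add: DERIV_imp_deriv diff_divide_distrib[symmetric])
  also have "\<dots> \<le> 2 * smooth_step_slope / s"
    using deriv_smooth_step_le[of "t / s - 1"] deriv_smooth_step_le[of "- t / s - 1"] s
    by (intro divide_right_mono) auto
  finally show ?thesis .
qed

end

context
  fixes \<Omega> S :: "'a::euclidean_space set" and \<phi> \<xi> :: "'a \<Rightarrow> real"
  assumes \<phi>: "test_fun \<Omega> \<phi>" and \<xi>: "smooth_fun \<xi>" "\<And>x. 0 \<le> \<xi> x" "\<And>x. \<xi> x \<le> 1"
    and S: "S \<in> sets lebesgue" "\<And>x. x \<notin> S \<Longrightarrow> \<xi> x = 1 \<and> grad \<xi> x = 0"
begin

lemma test_fun_cutoff: "test_fun \<Omega> (\<lambda>x. \<xi> x * \<phi> x)"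
  by (rule test_fun_mult[OF \<phi> \<xi>(1), of UNIV]) auto

lemma norm_cutoff_le: "norm (abs_l2 (\<lambda>x. \<xi> x * \<phi> x)) \<le> norm (abs_l2 \<phi>)"
  using norm_abs_l2_mono[OF L2_fun_test(1)[OF test_fun_cutoff] L2_fun_test(1)[OF \<phi>], of 1] \<xi>
  by (simp add: abs_mult mult_left_le_one_le)

lemma norm_cutoff_diff_le: "norm (abs_l2 \<phi> - abs_l2 (\<lambda>x. \<xi> x * \<phi> x)) \<le> norm (restr S (abs_l2 \<phi>))"
proof -
  note L2 = L2_fun_test(1)[OF \<phi>] L2_fun_test(1)[OF test_fun_cutoff]
  have "norm (\<phi> x - \<xi> x * \<phi> x) \<le> 1 * norm (indicator S x *\<^sub>R \<phi> x)" for x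
  proof (cases "x \<in> S")
    case True
    have "\<phi> x - \<xi> x * \<phi> x = (1 - \<xi> x) * \<phi> x" by (simp add: algebra_simps)
    then show ?thesis using True \<xi>(2,3)[of x] by (simp add: abs_mult mult_left_le_one_le)
  qed (simp add: S(2))
  from norm_abs_l2_mono[OF L2_fun_diff[OF L2] L2_fun_indicator[OF S(1) L2(1)] zero_le_one this]
  show ?thesis by (simp add: abs_l2_diff[OF L2] restr_abs_l2[OF S(1) L2(1)])
qed

lemma norm_grad_cutoff_le:
  assumes "C \<ge> 0" and slope: "\<And>x. norm (grad \<xi> x) \<le> C"
  shows "norm (abs_l2 (grad (\<lambda>x. \<xi> x * \<phi> x))) \<le> norm (abs_l2 (grad \<phi>)) + C * norm (restr S (abs_l2 \<phi>))"
proof -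
  note L2 = L2_fun_test[OF \<phi>]
  let ?a = "\<lambda>x. \<xi> x *\<^sub>R grad \<phi> x" and ?b = "\<lambda>x. \<phi> x *\<^sub>R grad \<xi> x"
  have measurable: "\<xi> \<in> borel_measurable lebesgue" "grad \<xi> \<in> borel_measurable lebesgue"
    using smooth_fun_continuous[OF \<xi>(1)] continuous_grad[OF \<xi>(1)]
    by (simp_all add: measurable_completion borel_measurable_continuous_onI)
  have bound_a: "norm (?a x) \<le> 1 * norm (grad \<phi> x)" for x
    using \<xi>(2,3)[of x] by (simp add: mult_left_le_one_le)
  have bound_b: "norm (?b x) \<le> C * norm (indicator S x *\<^sub>R \<phi> x)" for x
    using mult_right_mono[OF slope[of x], of "\<bar>\<phi> x\<bar>"] S(2)[of x] by (cases "x \<in> S") (simp_all add: mult.commute)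
  have L2_a: "L2_fun ?a"
    by (rule L2_fun_bound[OF borel_measurable_scaleR[OF measurable(1)] L2(2) AE_I2[OF bound_a]])
       (use L2(2) in \<open>simp add: L2_fun_def\<close>)
  have L2_b: "L2_fun ?b"
    by (rule L2_fun_bound[OF borel_measurable_scaleR[OF _ measurable(2)] L2_fun_indicator[OF S(1) L2(1)]
          AE_I2[OF bound_b]])
       (use L2(1) in \<open>simp add: L2_fun_def\<close>)
  have "grad (\<lambda>x. \<xi> x * \<phi> x) = (\<lambda>x. ?a x + ?b x)"
    using grad_mult[OF smooth_fun_differentiable[OF \<xi>(1)] test_fun_differentiable[OF \<phi>]] by (intro ext)
  then have "norm (abs_l2 (grad (\<lambda>x. \<xi> x * \<phi> x))) \<le> norm (abs_l2 ?a) + norm (abs_l2 ?b)"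
    by (simp only: abs_l2_add[OF L2_a L2_b, symmetric] norm_triangle_ineq)
  also have "\<dots> \<le> 1 * norm (abs_l2 (grad \<phi>)) + C * norm (abs_l2 (\<lambda>x. indicator S x *\<^sub>R \<phi> x))"
    by (intro add_mono norm_abs_l2_mono L2_a L2_b L2 L2_fun_indicator S(1) bound_a bound_b zero_le_one \<open>C \<ge> 0\<close>)
  finally show ?thesis by (simp add: restr_abs_l2[OF S(1) L2(1)])
qed

lemma norm_l2_graph_cutoff_le:
  assumes "C \<ge> 0" "\<And>x. norm (grad \<xi> x) \<le> C" and \<tau>: "C * norm (restr S (abs_l2 \<phi>)) \<le> \<tau> * norm (abs_l2 (grad \<phi>))" "\<tau> \<ge> 0"
  shows "norm (l2_graph (\<lambda>x. \<xi> x * \<phi> x)) \<le> (1 + \<tau>) * norm (l2_graph \<phi>)"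
proof (rule power2_le_imp_le)
  let ?\<psi> = "\<lambda>x. \<xi> x * \<phi> x"
  have "norm (abs_l2 ?\<psi>) \<le> (1 + \<tau>) * norm (abs_l2 \<phi>)"
    using norm_cutoff_le mult_right_mono[of 1 "1 + \<tau>" "norm (abs_l2 \<phi>)"] \<tau>(2) by simp
  moreover have "norm (abs_l2 (grad ?\<psi>)) \<le> (1 + \<tau>) * norm (abs_l2 (grad \<phi>))"
    using norm_grad_cutoff_le[OF assms(1,2)] \<tau>(1) by (simp add: distrib_right)
  ultimately have "(norm (abs_l2 ?\<psi>))\<^sup>2 + (norm (abs_l2 (grad ?\<psi>)))\<^sup>2
      \<le> ((1 + \<tau>) * norm (abs_l2 \<phi>))\<^sup>2 + ((1 + \<tau>) * norm (abs_l2 (grad \<phi>)))\<^sup>2"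
    by (intro add_mono power_mono) auto
  then show "(norm (l2_graph ?\<psi>))\<^sup>2 \<le> ((1 + \<tau>) * norm (l2_graph \<phi>))\<^sup>2"
    by (simp add: norm_prod_def power_mult_distrib distrib_left)
qed (use \<tau>(2) in simp)

end

definition slab :: "'a::euclidean_space \<Rightarrow> real \<Rightarrow> real \<Rightarrow> 'a set" where
  "slab e b r = {x. \<bar>x \<bullet> e - b\<bar> \<le> r}"

lemma slab_in_sets: "slab e b r \<in> sets lebesgue"
proof -
  have "closed (slab e b r)" unfolding slab_def by (intro closed_Collect_le continuous_intros)
  then show ?thesis by simp
qed

definition slab_cutoff :: "'a::euclidean_space \<Rightarrow> real \<Rightarrow> real \<Rightarrow> 'a \<Rightarrow> real" where
  "slab_cutoff e b s x = slit_cutoff s (x \<bullet> e + - b)"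

lemma smooth_slab_cutoff: "smooth_fun (slab_cutoff e b s)"
  unfolding slab_cutoff_def[abs_def]
  by (rule smooth_fun_compose_affine[OF bounded_linear_inner_left smooth_slit_cutoff])

lemma grad_slab_cutoff: "grad (slab_cutoff e b s) x = deriv (slit_cutoff s) (x \<bullet> e + - b) *\<^sub>R e"
  unfolding slab_cutoff_def[abs_def]
  by (rule grad_compose_inner[OF smooth_fun_has_real_derivative[OF smooth_slit_cutoff]])

lemma slab_cutoff_off_slab:
  assumes "s > 0" "x \<notin> slab e b (2 * s)" shows "slab_cutoff e b s x = 1 \<and> grad (slab_cutoff e b s) x = 0"
  using assms by (simp add: slab_def slab_cutoff_def[of e b s x] grad_slab_cutoff slit_cutoff_eq_1
      deriv_slit_cutoff_eq_0)

lemma norm_grad_slab_cutoff_le: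
  assumes "s > 0" "norm e = 1" shows "norm (grad (slab_cutoff e b s) x) \<le> 2 * smooth_step_slope / s"
  using deriv_slit_cutoff_le[OF assms(1)] assms(2) by (simp add: grad_slab_cutoff)

lemma slab_poincare_test:
  fixes e e2 :: "'a::euclidean_space"
  assumes "norm e2 = 1" "e \<bullet> e2 = 0" and M: "M \<ge> 0"
    and width: "\<And>x. x \<in> \<Omega> \<Longrightarrow> x \<in> slab e b r \<Longrightarrow> \<bar>x \<bullet> e2\<bar> < M" and \<phi>: "test_fun \<Omega> \<phi>"
  shows "norm (restr (slab e b r) (abs_l2 \<phi>)) \<le> 2 * M * norm (abs_l2 (grad \<phi>))"
proof -
  have slab: "slab e b r = {x. x \<bullet> e \<in> {b - r..b + r}}" by (auto simp: slab_def abs_le_iff)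
  have "norm (restr (slab e b r) (abs_l2 \<phi>)) \<le> 2 * M * norm (restr (slab e b r) (abs_l2 (grad \<phi>)))"
    unfolding slab by (rule strip_poincare_test[OF assms(1,2) _ M _ \<phi>]) (use width slab in auto)
  also have "\<dots> \<le> 2 * M * norm (abs_l2 (grad \<phi>))"
    using M by (intro mult_left_mono pos_contraction_norm[OF pos_contraction_restr[OF slab_in_sets]]) auto
  finally show ?thesis .
qed

lemma slit_test_approximable:
  fixes e e2 :: "'a::euclidean_space"
  assumes e: "norm e = 1" "norm e2 = 1" "e \<bullet> e2 = 0" and s: "s > 0" and M: "M \<ge> 0"
    and cut: "\<And>x. x \<in> \<Omega> \<Longrightarrow> \<bar>x \<bullet> e - b\<bar> \<ge> s \<Longrightarrow> x \<in> \<Omega>'"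
    and width: "\<And>x. x \<in> \<Omega> \<Longrightarrow> x \<in> slab e b (2 * s) \<Longrightarrow> \<bar>x \<bullet> e2\<bar> < M"
  defines "\<tau> \<equiv> 4 * M * smooth_step_slope / s"
  shows "test_approximable (2 * M + 2 * \<tau> + \<tau>\<^sup>2) \<Omega> \<Omega>'"
  unfolding test_approximable_def
proof (intro allI impI)
  fix \<phi> assume \<phi>: "test_fun \<Omega> \<phi>"
  let ?\<xi> = "slab_cutoff e b s" and ?S = "slab e b (2 * s)" and ?C = "2 * smooth_step_slope / s"
  let ?\<psi> = "\<lambda>x. ?\<xi> x * \<phi> x" and ?c = "2 * M + 2 * \<tau> + \<tau>\<^sup>2"
  have \<tau>: "\<tau> \<ge> 0" "?C * (2 * M) = \<tau>" "?C \<ge> 0" using M s smooth_step_slope_pos by (auto simp: \<tau>_def)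
  have range: "0 \<le> ?\<xi> x" "?\<xi> x \<le> 1" for x using slit_cutoff_range[OF s] by (simp_all add: slab_cutoff_def)
  note cutoff = \<phi> smooth_slab_cutoff range slab_in_sets slab_cutoff_off_slab[OF s]
  note strip = slab_poincare_test[OF e(2,3) M width \<phi>]
  have "closed {x. s \<le> \<bar>x \<bullet> e - b\<bar>}" by (intro closed_Collect_le continuous_intros)
  then have "test_fun \<Omega>' ?\<psi>"
    by (rule test_fun_mult[OF \<phi> smooth_slab_cutoff]) (use cut in \<open>auto simp: slab_cutoff_def slit_cutoff_eq_0[OF s]\<close>)
  moreover have "norm (abs_l2 \<phi> - abs_l2 ?\<psi>) \<le> ?c * norm (l2_graph \<phi>)"
  proof -
    have "norm (abs_l2 \<phi> - abs_l2 ?\<psi>) \<le> norm (restr ?S (abs_l2 \<phi>))" by (rule norm_cutoff_diff_le[OF cutoff])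
    also have "\<dots> \<le> 2 * M * norm (abs_l2 (grad \<phi>))" by (rule strip)
    also have "\<dots> \<le> ?c * norm (l2_graph \<phi>)"
      using M \<tau>(1) by (intro mult_mono) (auto simp: norm_prod_def real_le_rsqrt)
    finally show ?thesis .
  qed
  moreover have "(norm (l2_graph ?\<psi>))\<^sup>2 \<le> (1 + ?c) * (norm (l2_graph \<phi>))\<^sup>2"
  proof -
    have "?C * norm (restr ?S (abs_l2 \<phi>)) \<le> ?C * (2 * M * norm (abs_l2 (grad \<phi>)))"
      by (rule mult_left_mono[OF strip \<tau>(3)])
    also have "\<dots> = \<tau> * norm (abs_l2 (grad \<phi>))" by (simp only: \<tau>(2)[symmetric] mult.assoc)
    finally have "(norm (l2_graph ?\<psi>))\<^sup>2 \<le> ((1 + \<tau>) * norm (l2_graph \<phi>))\<^sup>2"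
      by (intro power_mono norm_l2_graph_cutoff_le[OF cutoff \<tau>(3) norm_grad_slab_cutoff_le[OF s e(1)]] \<tau>(1)) auto
    also have "\<dots> \<le> (1 + ?c) * (norm (l2_graph \<phi>))\<^sup>2"
      unfolding power_mult_distrib using M by (intro mult_right_mono) (auto simp: power2_eq_square algebra_simps)
    finally show ?thesis .
  qed
  ultimately show "\<exists>\<psi>. test_fun \<Omega>' \<psi> \<and> norm (abs_l2 \<phi> - abs_l2 \<psi>) \<le> ?c * norm (l2_graph \<phi>) \<and>
      (norm (l2_graph \<psi>))\<^sup>2 \<le> (1 + ?c) * (norm (l2_graph \<phi>))\<^sup>2" by blast
qed

section \<open>Similarities\<close>

definition similarity :: "real \<Rightarrow> 'a::euclidean_space \<Rightarrow> 'a \<Rightarrow> 'a" where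
  "similarity r p x = p + r *\<^sub>R x"

abbreviation similarity_inv :: "real \<Rightarrow> 'a::euclidean_space \<Rightarrow> 'a \<Rightarrow> 'a" where
  "similarity_inv r p \<equiv> similarity (1 / r) (- ((1 / r) *\<^sub>R p))"

lemma similarity_inverse:
  assumes "r > 0"
  shows "similarity r p (similarity_inv r p y) = y" "similarity_inv r p (similarity r p x) = x"
  using assms by (auto simp: similarity_def algebra_simps)

lemma similarity_affine: "similarity r p = (\<lambda>x. p + (\<Sum>j\<in>Basis. (r * (x \<bullet> j)) *\<^sub>R j))"
proof
  fix x :: 'a
  have "(\<Sum>j\<in>Basis. (r * (x \<bullet> j)) *\<^sub>R j) = r *\<^sub>R (\<Sum>j\<in>Basis. (x \<bullet> j) *\<^sub>R j)"
    by (simp add: scaleR_sum_right)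
  then show "similarity r p x = p + (\<Sum>j\<in>Basis. (r * (x \<bullet> j)) *\<^sub>R j)"
    by (simp add: similarity_def euclidean_representation)
qed

context
  fixes r :: real and p :: "'a::euclidean_space"
  assumes r: "r > 0"
begin

lemma measurable_similarity: "similarity r p \<in> lebesgue \<rightarrow>\<^sub>M lebesgue"
  unfolding similarity_affine using lebesgue_affine_measurable[of "\<lambda>_. r" p] r by simp

lemma lebesgue_similarity: "lebesgue = density (distr lebesgue lebesgue (similarity r p)) (\<lambda>_. ennreal (r ^ DIM('a)))"
  using lebesgue_affine_euclidean[of "\<lambda>_. r" p] r unfolding similarity_affine by simp

lemma measurable_compose_similarity:
  "f \<in> borel_measurable lebesgue \<Longrightarrow> (\<lambda>x. f (similarity r p x)) \<in> borel_measurable lebesgue"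
  by (rule measurable_compose[OF measurable_similarity])

lemma nn_integral_similarity:
  assumes "f \<in> borel_measurable lebesgue"
  shows "(\<integral>\<^sup>+ y. f y \<partial>lebesgue) = ennreal (r ^ DIM('a)) * (\<integral>\<^sup>+ x. f (similarity r p x) \<partial>lebesgue)"
proof -
  have "(\<integral>\<^sup>+ y. f y \<partial>lebesgue) = (\<integral>\<^sup>+ y. ennreal (r ^ DIM('a)) * f y \<partial>distr lebesgue lebesgue (similarity r p))"
    by (subst lebesgue_similarity, rule nn_integral_density)
       (auto simp: assms measurable_cong_sets[OF sets_distr refl])
  also have "\<dots> = ennreal (r ^ DIM('a)) * (\<integral>\<^sup>+ y. f y \<partial>distr lebesgue lebesgue (similarity r p))"
    by (rule nn_integral_cmult) (subst measurable_cong_sets[OF sets_distr refl], rule assms)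
  also have "(\<integral>\<^sup>+ y. f y \<partial>distr lebesgue lebesgue (similarity r p)) = (\<integral>\<^sup>+ x. f (similarity r p x) \<partial>lebesgue)"
    by (rule nn_integral_distr[OF measurable_similarity]) (simp add: assms measurable_cong_sets[OF sets_distr refl])
  finally show ?thesis .
qed

lemma integral_similarity:
  fixes f :: "'a \<Rightarrow> real"
  assumes "f \<in> borel_measurable lebesgue"
  shows "(\<integral> y. f y \<partial>lebesgue) = r ^ DIM('a) * (\<integral> x. f (similarity r p x) \<partial>lebesgue)"
proof -
  have "(\<integral> y. f y \<partial>lebesgue) = (\<integral> y. r ^ DIM('a) *\<^sub>R f y \<partial>distr lebesgue lebesgue (similarity r p))"
    using assms r by (subst lebesgue_similarity, intro integral_density)
       (auto simp: measurable_cong_sets[OF sets_distr refl])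
  also have "\<dots> = (\<integral> x. r ^ DIM('a) *\<^sub>R f (similarity r p x) \<partial>lebesgue)"
    using assms by (intro integral_distr measurable_similarity) simp
  finally show ?thesis by simp
qed

lemma L2_dist2_similarity:
  fixes f g :: "'a \<Rightarrow> 'b::euclidean_space"
  assumes "f \<in> borel_measurable lebesgue" "g \<in> borel_measurable lebesgue"
  shows "L2_dist2 (\<lambda>x. f (similarity r p x)) (\<lambda>x. g (similarity r p x)) = ennreal (1 / r ^ DIM('a)) * L2_dist2 f g"
proof -
  have "ennreal (1 / r ^ DIM('a)) * ennreal (r ^ DIM('a)) = 1" using r by (simp add: ennreal_mult[symmetric])
  moreover have "L2_dist2 f g = ennreal (r ^ DIM('a)) * L2_dist2 (\<lambda>x. f (similarity r p x)) (\<lambda>x. g (similarity r p x))"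
    unfolding L2_dist2_def using assms by (subst nn_integral_similarity) auto
  ultimately show ?thesis by (simp add: mult.assoc[symmetric])
qed

lemma smooth_fun_similarity: "smooth_fun \<phi> \<Longrightarrow> smooth_fun (\<lambda>x. \<phi> (similarity r p x))"
  using smooth_fun_compose_affine[of "\<lambda>x. r *\<^sub>R x" \<phi> p] bounded_linear_scaleR_right[of r]
  by (simp add: similarity_def add.commute)

lemma grad_similarity:
  assumes "smooth_fun \<phi>" shows "grad (\<lambda>x. \<phi> (similarity r p x)) x = r *\<^sub>R grad \<phi> (similarity r p x)"
proof (rule grad_eqI)
  have "(similarity r p has_derivative (\<lambda>h. r *\<^sub>R h)) (at x)"
    unfolding similarity_def[abs_def] by (auto intro!: derivative_eq_intros)
  from has_derivative_compose[OF this has_derivative_grad[OF smooth_fun_differentiable[OF assms]]]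
  show "((\<lambda>x. \<phi> (similarity r p x)) has_derivative (\<lambda>h. (r *\<^sub>R grad \<phi> (similarity r p x)) \<bullet> h)) (at x)" by simp
qed

lemma test_fun_similarity:
  assumes "test_fun (similarity r p ` \<Omega>) \<phi>" shows "test_fun \<Omega> (\<lambda>x. \<phi> (similarity r p x))"
proof -
  obtain K where K: "smooth_fun \<phi>" "compact K" "K \<subseteq> similarity r p ` \<Omega>" "\<And>x. x \<notin> K \<Longrightarrow> \<phi> x = 0"
    using assms by (auto simp: test_fun_def)
  let ?T = "similarity_inv r p"
  have "compact (?T ` K)" unfolding similarity_def[abs_def]
    by (intro compact_continuous_image continuous_intros K)
  moreover have "?T ` K \<subseteq> \<Omega>"
  proof
    fix y assume "y \<in> ?T ` K"
    then obtain x where "x \<in> \<Omega>" "y = ?T (similarity r p x)" using K(3) by blast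
    then show "y \<in> \<Omega>" using similarity_inverse(2)[OF r, of p x] by simp
  qed
  moreover have "\<phi> (similarity r p x) = 0" if "x \<notin> ?T ` K" for x
  proof (rule K(4))
    show "similarity r p x \<notin> K" using that similarity_inverse(2)[OF r, of p x] by (metis imageI)
  qed
  ultimately show ?thesis unfolding test_fun_def using smooth_fun_similarity[OF K(1)] by blast
qed

end

lemma L2_dist2_scaleR:
  fixes f g :: "'a::euclidean_space \<Rightarrow> 'b::euclidean_space"
  assumes [measurable]: "f \<in> borel_measurable lebesgue" "g \<in> borel_measurable lebesgue"
  shows "L2_dist2 (\<lambda>x. c *\<^sub>R f x) (\<lambda>x. c *\<^sub>R g x) = ennreal (c\<^sup>2) * L2_dist2 f g"
proof -
  have "L2_dist2 (\<lambda>x. c *\<^sub>R f x) (\<lambda>x. c *\<^sub>R g x) = (\<integral>\<^sup>+ x. ennreal (c\<^sup>2) * ennreal ((norm (f x - g x))\<^sup>2) \<partial>lebesgue)"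
    unfolding L2_dist2_def by (simp add: scaleR_diff_right[symmetric] power_mult_distrib ennreal_mult)
  also have "\<dots> = ennreal (c\<^sup>2) * L2_dist2 f g" unfolding L2_dist2_def by (rule nn_integral_cmult) measurable
  finally show ?thesis .
qed

lemma H10_similarity:
  fixes p :: "'a::euclidean_space"
  assumes r: "r > 0" and "(u, G) \<in> H10 (similarity r p ` \<Omega>)"
  shows "((\<lambda>x. u (similarity r p x)), (\<lambda>x. r *\<^sub>R G (similarity r p x))) \<in> H10 \<Omega>"
proof -
  let ?T = "similarity r p"
  obtain \<phi> where uG: "u \<in> borel_measurable lebesgue" "G \<in> borel_measurable lebesgue"
    and test: "\<And>n. test_fun (?T ` \<Omega>) (\<phi> n)"
    and lim: "(\<lambda>n. L2_dist2 (\<phi> n) u) \<longlonglongrightarrow> 0" "(\<lambda>n. L2_dist2 (grad (\<phi> n)) G) \<longlonglongrightarrow> 0"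
    using assms(2) by (auto simp: H10_def)
  have \<phi>: "\<phi> n \<in> borel_measurable lebesgue" "grad (\<phi> n) \<in> borel_measurable lebesgue" for n
    using L2_fun_test[OF test[of n]] by (auto simp: L2_fun_def)
  note compose = measurable_compose_similarity[OF r, of _ p]
  have null: "(\<lambda>n. ennreal c * a n) \<longlonglongrightarrow> 0" if "a \<longlonglongrightarrow> 0" for c and a :: "nat \<Rightarrow> ennreal"
    using ennreal_tendsto_cmult[OF _ that, of "ennreal c"] by simp
  have "(\<lambda>n. L2_dist2 (\<lambda>x. \<phi> n (?T x)) (\<lambda>x. u (?T x))) \<longlonglongrightarrow> 0"
    using null[OF lim(1)] by (simp add: L2_dist2_similarity[OF r \<phi>(1) uG(1)])
  moreover have "grad (\<lambda>x. \<phi> n (?T x)) = (\<lambda>x. r *\<^sub>R grad (\<phi> n) (?T x))" for n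
    by (rule ext) (rule grad_similarity[OF r test_fun_smooth[OF test]])
  then have "(\<lambda>n. L2_dist2 (grad (\<lambda>x. \<phi> n (?T x))) (\<lambda>x. r *\<^sub>R G (?T x))) \<longlonglongrightarrow> 0"
    using null[OF null[OF lim(2)]]
    by (simp add: L2_dist2_scaleR[OF compose compose] \<phi> uG L2_dist2_similarity[OF r \<phi>(2) uG(2)])
  ultimately show ?thesis
    unfolding H10_def using test_fun_similarity[OF r test] compose[OF uG(1)] compose[OF uG(2)]
    by (auto intro!: exI[of _ "\<lambda>n x. \<phi> n (?T x)"])
qed

lemma H10_scaleR:
  assumes "(u, G) \<in> H10 \<Omega>" shows "((\<lambda>x. c * u x), (\<lambda>x. c *\<^sub>R G x)) \<in> H10 \<Omega>"
proof -
  have "L2_fun u" "L2_fun G" "(abs_l2 u, abs_l2 G) \<in> form_space \<Omega>" using assms by (auto simp: H10_iff)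
  then show ?thesis
    using subspace_scale[OF closed_subspace_form_space(1), of "(abs_l2 u, abs_l2 G)" \<Omega> c]
      L2_fun_scaleR[of u c] L2_fun_scaleR[of G c]
    by (simp add: H10_iff abs_l2_scaleR)
qed

context
  fixes r :: real and p :: "'a::euclidean_space"
  assumes r: "r > 0"
begin

lemma H10_similarity_inv:
  assumes "(u, G) \<in> H10 \<Omega>"
  shows "((\<lambda>y. u (similarity_inv r p y)), (\<lambda>y. (1 / r) *\<^sub>R G (similarity_inv r p y))) \<in> H10 (similarity r p ` \<Omega>)"
proof (rule H10_similarity)
  have "similarity_inv r p ` similarity r p ` \<Omega> = \<Omega>"
    unfolding image_image by (simp add: similarity_inverse(2)[OF r])
  then show "(u, G) \<in> H10 (similarity_inv r p ` similarity r p ` \<Omega>)" using assms by simp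
qed (use r in simp)

lemma integral_inner_similarity_inv:
  fixes f g :: "'a \<Rightarrow> 'b::euclidean_space"
  assumes "f \<in> borel_measurable lebesgue" "g \<in> borel_measurable lebesgue"
  shows "(\<integral> y. f (similarity_inv r p y) \<bullet> g y \<partial>lebesgue) = r ^ DIM('a) * (\<integral> x. f x \<bullet> g (similarity r p x) \<partial>lebesgue)"
proof -
  have "(\<lambda>y. f (similarity_inv r p y)) \<in> borel_measurable lebesgue"
    using r by (intro measurable_compose_similarity[OF _ assms(1)]) simp
  from integral_similarity[OF r borel_measurable_inner[OF this assms(2)], of p]
  show ?thesis by (simp only: similarity_inverse(2)[OF r])
qed

lemma dirichlet_point_spectrum_similarity:
  assumes "lam \<in> dirichlet_point_spectrum \<Omega>"
  shows "lam / r\<^sup>2 \<in> dirichlet_point_spectrum (similarity r p ` \<Omega>)"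
proof -
  let ?T = "similarity r p" and ?S = "similarity_inv r p"
  obtain u G where uG: "(u, G) \<in> H10 \<Omega>" "(\<integral>\<^sup>+ x. ennreal ((u x)\<^sup>2) \<partial>lebesgue) > 0"
    and weak: "\<And>v H. (v, H) \<in> H10 \<Omega> \<Longrightarrow> (\<integral> x. G x \<bullet> H x \<partial>lebesgue) = lam * (\<integral> x. u x * v x \<partial>lebesgue)"
    using assms by (auto simp: dirichlet_point_spectrum_def)
  let ?u = "\<lambda>y. u (?S y)" and ?G = "\<lambda>y. (1 / r) *\<^sub>R G (?S y)"
  have pulled_back: "(?u, ?G) \<in> H10 (?T ` \<Omega>)" by (rule H10_similarity_inv[OF uG(1)])
  then have "?u \<in> borel_measurable lebesgue" by (simp add: H10_def)
  then have "(\<integral>\<^sup>+ y. ennreal ((?u y)\<^sup>2) \<partial>lebesgue) = ennreal (r ^ DIM('a)) * (\<integral>\<^sup>+ x. ennreal ((u x)\<^sup>2) \<partial>lebesgue)"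
    using nn_integral_similarity[OF r, of "\<lambda>y. ennreal ((?u y)\<^sup>2)" p] by (simp add: similarity_inverse(2)[OF r])
  then have "(\<integral>\<^sup>+ y. ennreal ((?u y)\<^sup>2) \<partial>lebesgue) > 0"
    using uG(2) r by (simp add: ennreal_zero_less_mult_iff)
  moreover have "(\<integral> y. ?G y \<bullet> H y \<partial>lebesgue) = lam / r\<^sup>2 * (\<integral> y. ?u y * v y \<partial>lebesgue)"
    if vH: "(v, H) \<in> H10 (?T ` \<Omega>)" for v H
  proof -
    have measurable: "u \<in> borel_measurable lebesgue" "G \<in> borel_measurable lebesgue"
      "v \<in> borel_measurable lebesgue" "H \<in> borel_measurable lebesgue" using uG(1) vH by (auto simp: H10_def)
    have "r * (\<integral> x. G x \<bullet> H (?T x) \<partial>lebesgue) = lam * (\<integral> x. u x * v (?T x) \<partial>lebesgue)"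
      using weak[OF H10_similarity[OF r vH]] by simp
    then have "(r ^ DIM('a) / r\<^sup>2) * (r * (\<integral> x. G x \<bullet> H (?T x) \<partial>lebesgue))
        = (r ^ DIM('a) / r\<^sup>2) * (lam * (\<integral> x. u x * v (?T x) \<partial>lebesgue))" by simp
    then show ?thesis
      using integral_inner_similarity_inv[OF measurable(2,4)] integral_inner_similarity_inv[OF measurable(1,3)] r
      by (simp add: power2_eq_square)
  qed
  ultimately show ?thesis unfolding dirichlet_point_spectrum_def using pulled_back by blast
qed

lemma dirichlet_resolvent_similarity:
  assumes f: "f \<in> borel_measurable lebesgue" and c: "c \<noteq> 0"
    and resolvent: "dirichlet_resolvent \<Omega> s (\<lambda>x. c * f (similarity r p x)) w"
  shows "dirichlet_resolvent (similarity r p ` \<Omega>) (s / r\<^sup>2) f (\<lambda>y. r\<^sup>2 / c * w (similarity_inv r p y))"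
proof -
  let ?T = "similarity r p" and ?S = "similarity_inv r p" and ?k = "r\<^sup>2 / c"
  obtain G where G: "(w, G) \<in> H10 \<Omega>"
    and weak: "\<And>v H. (v, H) \<in> H10 \<Omega> \<Longrightarrow>
      (\<integral> x. G x \<bullet> H x \<partial>lebesgue) + s * (\<integral> x. w x * v x \<partial>lebesgue) = (\<integral> x. c * f (?T x) * v x \<partial>lebesgue)"
    using resolvent by (auto simp: dirichlet_resolvent_def)
  let ?w = "\<lambda>y. ?k * w (?S y)" and ?G = "\<lambda>y. ?k *\<^sub>R (1 / r) *\<^sub>R G (?S y)"
  show ?thesis
    unfolding dirichlet_resolvent_def
  proof (intro exI[of _ ?G] conjI allI impI)
    show "(?w, ?G) \<in> H10 (?T ` \<Omega>)" by (rule H10_scaleR[OF H10_similarity_inv[OF G]])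
    fix v H assume vH: "(v, H) \<in> H10 (?T ` \<Omega>)"
    then have measurable: "w \<in> borel_measurable lebesgue" "G \<in> borel_measurable lebesgue"
      "v \<in> borel_measurable lebesgue" "H \<in> borel_measurable lebesgue" using G by (auto simp: H10_def)
    let ?GH = "\<integral> x. G x \<bullet> H (?T x) \<partial>lebesgue" and ?wv = "\<integral> x. w x * v (?T x) \<partial>lebesgue"
    have "(\<integral> y. ?G y \<bullet> H y \<partial>lebesgue) = r ^ DIM('a) * (?k / r * ?GH)"
      using integral_inner_similarity_inv[OF measurable(2,4)] by simp
    moreover have "(\<integral> y. ?w y * v y \<partial>lebesgue) = r ^ DIM('a) * (?k * ?wv)"
      using integral_inner_similarity_inv[OF measurable(1,3)]
      by (simp only: inner_real_def mult.assoc integral_mult_right_zero mult.left_commute)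
    ultimately have "(\<integral> y. ?G y \<bullet> H y \<partial>lebesgue) + s / r\<^sup>2 * (\<integral> y. ?w y * v y \<partial>lebesgue)
        = r ^ DIM('a) * (?k / r * ?GH) + s / r\<^sup>2 * (r ^ DIM('a) * (?k * ?wv))" by (simp only:)
    also have "\<dots> = r ^ DIM('a) / c * (r * ?GH + s * ?wv)" using r c by (simp add: field_simps power2_eq_square)
    also have "r * ?GH + s * ?wv = c * (\<integral> x. f (?T x) * v (?T x) \<partial>lebesgue)"
      using weak[OF H10_similarity[OF r vH]] by (simp add: mult.assoc)
    also have "r ^ DIM('a) / c * (c * (\<integral> x. f (?T x) * v (?T x) \<partial>lebesgue)) = (\<integral> y. f y * v y \<partial>lebesgue)"
      using integral_similarity[OF r, of "\<lambda>y. f y * v y" p] f measurable(3) c by simp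
    finally show "(\<integral> y. ?G y \<bullet> H y \<partial>lebesgue) + s / r\<^sup>2 * (\<integral> y. ?w y * v y \<partial>lebesgue) = (\<integral> y. f y * v y \<partial>lebesgue)" .
  qed
qed

lemma is_spectral_measure_similarity:
  assumes f: "f \<in> borel_measurable lebesgue" and \<mu>: "is_spectral_measure (similarity r p ` \<Omega>) f \<mu>"
  shows "is_spectral_measure \<Omega> (\<lambda>x. sqrt (r ^ DIM('a)) * f (similarity r p x)) (distr \<mu> borel (\<lambda>t. r\<^sup>2 * t))"
    (is "is_spectral_measure \<Omega> ?g ?\<nu>")
proof -
  let ?T = "similarity r p" and ?S = "similarity_inv r p" and ?c = "sqrt (r ^ DIM('a))"
  have sets: "sets \<mu> = sets borel" and "finite_measure \<mu>" "emeasure \<mu> {..<0} = 0"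
    and spectral: "\<And>s w. s > 0 \<Longrightarrow> dirichlet_resolvent (?T ` \<Omega>) s f w \<Longrightarrow>
      (\<integral> x. w x * f x \<partial>lebesgue) = (\<integral> t. 1 / (t + s) \<partial>\<mu>)"
    using \<mu> by (auto simp: is_spectral_measure_def)
  have space: "space \<mu> = UNIV" using sets_eq_imp_space_eq[OF sets] by simp
  have scale: "(\<lambda>t. r\<^sup>2 * t) \<in> \<mu> \<rightarrow>\<^sub>M borel" unfolding measurable_cong_sets[OF sets refl] by measurable
  have c: "?c \<noteq> 0" "?c * ?c = r ^ DIM('a)" using r by auto
  show ?thesis
    unfolding is_spectral_measure_def
  proof (intro conjI allI impI)
    show "finite_measure ?\<nu>" by (rule finite_measure.finite_measure_distr[OF \<open>finite_measure \<mu>\<close> scale])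
    have "(\<lambda>t. r\<^sup>2 * t) -` {..<0} \<inter> space \<mu> = {..<0}" using r space by (auto simp: mult_less_0_iff)
    then show "emeasure ?\<nu> {..<0} = 0" by (subst emeasure_distr[OF scale]) (auto simp: \<open>emeasure \<mu> {..<0} = 0\<close>)
    fix s :: real and w assume s: "s > 0" and w: "dirichlet_resolvent \<Omega> s ?g w"
    then have measurable: "w \<in> borel_measurable lebesgue" by (auto simp: dirichlet_resolvent_def H10_def)
    let ?wf = "\<integral> x. w x * f (?T x) \<partial>lebesgue"
    have rescale: "C * I = 1 / r\<^sup>2 * (r\<^sup>2 / C * (C * C * I))" if "C \<noteq> 0" for C I :: real using r that by simp
    have "(\<integral> x. w x * ?g x \<partial>lebesgue) = ?c * ?wf"
      by (simp only: mult.left_commute[of _ ?c] integral_mult_right_zero)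
    also have "\<dots> = 1 / r\<^sup>2 * (r\<^sup>2 / ?c * (?c * ?c * ?wf))" by (rule rescale[OF c(1)])
    also have "?c * ?c * ?wf = (\<integral> y. w (?S y) * f y \<partial>lebesgue)"
      using integral_inner_similarity_inv[OF measurable f] by (simp only: c(2) inner_real_def)
    also have "r\<^sup>2 / ?c * (\<integral> y. w (?S y) * f y \<partial>lebesgue) = (\<integral> t. 1 / (t + s / r\<^sup>2) \<partial>\<mu>)"
      using spectral[OF _ dirichlet_resolvent_similarity[OF f c(1) w]] s r
      by (simp only: mult.assoc integral_mult_right_zero) simp
    also have "1 / r\<^sup>2 * (\<integral> t. 1 / (t + s / r\<^sup>2) \<partial>\<mu>) = (\<integral> t. 1 / r\<^sup>2 * (1 / (t + s / r\<^sup>2)) \<partial>\<mu>)"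
      by (rule integral_mult_right_zero[symmetric])
    also have "\<dots> = (\<integral> t. 1 / (r\<^sup>2 * t + s) \<partial>\<mu>)" using r by (simp add: distrib_left)
    also have "\<dots> = (\<integral> t. 1 / (t + s) \<partial>?\<nu>)" by (subst integral_distr[OF scale]) auto
    finally show "(\<integral> x. w x * ?g x \<partial>lebesgue) = (\<integral> t. 1 / (t + s) \<partial>?\<nu>)" .
  qed simp
qed

lemma nn_integral_sq_similarity:
  assumes "f \<in> borel_measurable lebesgue"
  shows "(\<integral>\<^sup>+ x. ennreal ((sqrt (r ^ DIM('a)) * f (similarity r p x))\<^sup>2) \<partial>lebesgue) =
    (\<integral>\<^sup>+ y. ennreal ((f y)\<^sup>2) \<partial>lebesgue)"
proof -
  have "(\<integral>\<^sup>+ x. ennreal ((sqrt (r ^ DIM('a)) * f (similarity r p x))\<^sup>2) \<partial>lebesgue)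
      = (\<integral>\<^sup>+ x. ennreal (r ^ DIM('a)) * ennreal ((f (similarity r p x))\<^sup>2) \<partial>lebesgue)"
    using r by (simp add: power_mult_distrib ennreal_mult)
  also have "\<dots> = ennreal (r ^ DIM('a)) * (\<integral>\<^sup>+ x. ennreal ((f (similarity r p x))\<^sup>2) \<partial>lebesgue)"
    using measurable_compose_similarity[OF r assms] by (intro nn_integral_cmult) simp
  also have "\<dots> = (\<integral>\<^sup>+ y. ennreal ((f y)\<^sup>2) \<partial>lebesgue)"
    using nn_integral_similarity[OF r, of "\<lambda>y. ennreal ((f y)\<^sup>2)" p] assms by simp
  finally show ?thesis .
qed

lemma L2_on_similarity:
  assumes "f \<in> L2_on (similarity r p ` \<Omega>)"
  shows "(\<lambda>x. sqrt (r ^ DIM('a)) * f (similarity r p x)) \<in> L2_on \<Omega>"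
proof -
  have f: "f \<in> borel_measurable lebesgue" "(\<integral>\<^sup>+ x. ennreal ((f x)\<^sup>2) \<partial>lebesgue) < \<infinity>"
    and zero: "\<And>x. x \<notin> similarity r p ` \<Omega> \<Longrightarrow> f x = 0" using assms by (auto simp: L2_on_def)
  have "similarity r p x \<notin> similarity r p ` \<Omega>" if "x \<notin> \<Omega>" for x
    using that similarity_inverse(2)[OF r, of p] by (metis imageE)
  then show ?thesis
    using f zero measurable_compose_similarity[OF r f(1)] nn_integral_sq_similarity[OF f(1)] by (simp add: L2_on_def)
qed

end

lemma absolutely_continuous_distr_scale:
  assumes sets: "sets \<mu> = sets borel" and \<mu>: "absolutely_continuous lborel \<mu>" and a: "a \<noteq> (0 :: real)"
  shows "absolutely_continuous lborel (distr \<mu> borel (\<lambda>t. a * t))"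
  unfolding absolutely_continuous_def
proof
  fix N assume N: "N \<in> null_sets (lborel :: real measure)"
  let ?P = "(\<lambda>t. a * t) -` N"
  have preimage: "?P = (\<lambda>t. t / a) ` N" using a by (auto simp: image_iff field_simps intro!: bexI)
  have "negligible N" using N by (simp add: negligible_iff_null_sets null_sets_completionI)
  then have "negligible ?P"
    unfolding preimage by (rule negligible_differentiable_image_negligible[OF order_refl])
      (use a in \<open>auto simp: differentiable_on_def intro!: derivative_intros\<close>)
  moreover have "?P \<in> sets borel" using N by (intro measurable_sets_borel[of "\<lambda>t. a * t" borel N]) auto
  ultimately have "?P \<in> null_sets lborel" by (simp add: negligible_iff_null_sets null_sets_completion_iff)
  then have "?P \<in> null_sets \<mu>" using \<mu> by (auto simp: absolutely_continuous_def)
  moreover have "(\<lambda>t. a * t) \<in> \<mu> \<rightarrow>\<^sub>M borel" unfolding measurable_cong_sets[OF sets refl] by measurable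
  ultimately show "N \<in> null_sets (distr \<mu> borel (\<lambda>t. a * t))"
    using N sets_eq_imp_space_eq[OF sets] by (auto simp: null_sets_distr_iff)
qed

lemma dirichlet_ac_spectrum_empty_similarity:
  fixes p :: "'a::euclidean_space"
  assumes r: "r > 0" and empty: "dirichlet_ac_spectrum_empty \<Omega>"
  shows "dirichlet_ac_spectrum_empty (similarity r p ` \<Omega>)"
  unfolding dirichlet_ac_spectrum_empty_def
proof
  fix f assume "f \<in> ac_subspace (similarity r p ` \<Omega>)"
  then obtain \<mu> where f: "f \<in> L2_on (similarity r p ` \<Omega>)"
    and \<mu>: "is_spectral_measure (similarity r p ` \<Omega>) f \<mu>" "absolutely_continuous lborel \<mu>"
    by (auto simp: ac_subspace_def)
  let ?g = "\<lambda>x. sqrt (r ^ DIM('a)) * f (similarity r p x)"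
  have measurable: "f \<in> borel_measurable lebesgue" "?g \<in> borel_measurable lebesgue"
    using f L2_on_similarity[OF r f] by (auto simp: L2_on_def)
  have "absolutely_continuous lborel (distr \<mu> borel (\<lambda>t. r\<^sup>2 * t))"
    by (rule absolutely_continuous_distr_scale[OF _ \<mu>(2)]) (use \<mu>(1) r in \<open>auto simp: is_spectral_measure_def\<close>)
  then have "?g \<in> ac_subspace \<Omega>"
    using L2_on_similarity[OF r f] is_spectral_measure_similarity[OF r measurable(1) \<mu>(1)]
    by (auto simp: ac_subspace_def)
  from bspec[OF empty[unfolded dirichlet_ac_spectrum_empty_def] this] have "AE x in lebesgue. ?g x = 0" .
  then have "(\<integral>\<^sup>+ x. ennreal ((?g x)\<^sup>2) \<partial>lebesgue) = 0"
    using measurable(2) by (subst nn_integral_0_iff_AE) auto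
  then have "(\<integral>\<^sup>+ y. ennreal ((f y)\<^sup>2) \<partial>lebesgue) = 0" by (simp only: nn_integral_sq_similarity[OF r measurable(1)])
  then show "AE y in lebesgue. f y = 0" using measurable(1) by (subst (asm) nn_integral_0_iff_AE) auto
qed

section \<open>Density of test functions\<close>

definition box_bump :: "real \<Rightarrow> 'a::euclidean_space \<Rightarrow> 'a \<Rightarrow> 'a \<Rightarrow> real" where
  "box_bump k c d x = (\<Prod>i\<in>Basis. flat_exp (k * (x \<bullet> i - c \<bullet> i)) * flat_exp (- k * (x \<bullet> i - d \<bullet> i)))"

lemma smooth_box_bump: "smooth_fun (box_bump k c d)"
proof -
  have "smooth_fun (\<lambda>x::'a. flat_exp (m * (x \<bullet> i) + - (m * b)))" for m i b
    by (rule smooth_fun_compose_affine[OF bounded_linear_const_mult[OF bounded_linear_inner_left] smooth_flat_exp])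
  then have "smooth_fun (\<lambda>x::'a. flat_exp (m * (x \<bullet> i - b)))" for m i b by (simp add: right_diff_distrib)
  then show ?thesis unfolding box_bump_def[abs_def] by (intro smooth_fun_prod smooth_fun_mult)
qed

lemma box_bump_range: "0 \<le> box_bump k c d x" "box_bump k c d x \<le> 1"
  unfolding box_bump_def
  by (auto intro!: prod_nonneg prod_le_1 mult_nonneg_nonneg mult_le_one flat_exp_nonneg flat_exp_le_1)

lemma box_bump_eq_0:
  assumes "k > 0" "x \<notin> box c d" shows "box_bump k c d x = 0"
proof -
  obtain i where i: "i \<in> Basis" "x \<bullet> i \<le> c \<bullet> i \<or> d \<bullet> i \<le> x \<bullet> i" using assms(2) by (force simp: mem_box)
  then have "flat_exp (k * (x \<bullet> i - c \<bullet> i)) * flat_exp (- k * (x \<bullet> i - d \<bullet> i)) = 0"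
    using assms(1) by (auto simp: flat_exp_zero mult_nonneg_nonpos)
  then show ?thesis unfolding box_bump_def using i(1) by (intro prod_zero) auto
qed

lemma test_fun_box_bump:
  assumes "cbox c d \<subseteq> \<Omega>" "k > 0" shows "test_fun \<Omega> (box_bump k c d)"
proof -
  have "box_bump k c d x = 0" if "x \<notin> cbox c d" for x
    using that box_subset_cbox[of c d] by (intro box_bump_eq_0 assms(2)) auto
  then show ?thesis
    unfolding test_fun_def using smooth_box_bump assms(1) by (intro conjI exI[of _ "cbox c d"]) auto
qed

lemma flat_exp_tendsto_1:
  assumes "t > 0" shows "(\<lambda>n. flat_exp (real (Suc n) * t)) \<longlonglongrightarrow> 1"
proof -
  have "(\<lambda>n. exp (- (inverse (real (Suc n)) * inverse t))) \<longlonglongrightarrow> exp (- (0 * inverse t))"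
    by (intro tendsto_exp tendsto_minus tendsto_mult LIMSEQ_inverse_real_of_nat tendsto_const)
  moreover have "flat_exp (real (Suc n) * t) = exp (- (inverse (real (Suc n)) * inverse t))" for n
    using assms by (simp add: flat_exp_def)
  ultimately show ?thesis by simp
qed

lemma box_bump_tendsto: "(\<lambda>n. box_bump (real (Suc n)) c d x) \<longlonglongrightarrow> indicator (box c d) x"
proof (cases "x \<in> box c d")
  case True
  then have "(\<lambda>n. box_bump (real (Suc n)) c d x) \<longlonglongrightarrow> (\<Prod>i\<in>(Basis::'a set). 1 * 1)"
    unfolding box_bump_def minus_mult_commute
    by (intro tendsto_prod tendsto_mult flat_exp_tendsto_1) (auto simp: mem_box)
  then show ?thesis using True by simp
next
  case False
  then have "(\<lambda>n. box_bump (real (Suc n)) c d x) = (\<lambda>n. 0)" by (intro ext box_bump_eq_0) auto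
  then show ?thesis using False by simp
qed

lemma integrable_L2_lmeasurable:
  fixes f :: "'a::euclidean_space \<Rightarrow> real"
  assumes "L2_fun f" "S \<in> lmeasurable" shows "integrable lebesgue (\<lambda>x. indicator S x * f x)"
  using integrable_inner_L2[OF L2_fun_indicator_lmeasurable[OF assms(2)] assms(1)] by simp

lemma integral_box_eq_0:
  fixes f :: "'a::euclidean_space \<Rightarrow> real"
  assumes f: "L2_fun f" and orth: "\<And>\<phi>. test_fun \<Omega> \<phi> \<Longrightarrow> (\<integral> x. f x * \<phi> x \<partial>lebesgue) = 0"
    and "cbox c d \<subseteq> \<Omega>"
  shows "(\<integral> x. indicator (box c d) x * f x \<partial>lebesgue) = 0"
proof -
  let ?\<phi> = "\<lambda>n. box_bump (real (Suc n)) c d"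
  have test: "test_fun \<Omega> (?\<phi> n)" for n by (rule test_fun_box_bump[OF assms(3)]) simp
  have measurable: "f \<in> borel_measurable lebesgue" using f by (simp add: L2_fun_def)
  have "(\<lambda>n. \<integral> x. f x * ?\<phi> n x \<partial>lebesgue) \<longlonglongrightarrow> (\<integral> x. f x * indicator (box c d) x \<partial>lebesgue)"
  proof (rule integral_dominated_convergence)
    show "(\<lambda>x. f x * indicator (box c d) x) \<in> borel_measurable lebesgue"
      by (intro borel_measurable_times borel_measurable_indicator measurable) auto
    show "(\<lambda>x. f x * ?\<phi> n x) \<in> borel_measurable lebesgue" for n
      using L2_fun_test(1)[OF test] by (intro borel_measurable_times measurable) (simp add: L2_fun_def)
    show "integrable lebesgue (\<lambda>x. norm (indicator (box c d) x * f x))"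
      by (intro integrable_norm integrable_L2_lmeasurable[OF f] lmeasurable_box)
    show "AE x in lebesgue. norm (f x * ?\<phi> n x) \<le> norm (indicator (box c d) x * f x)" for n
    proof (rule AE_I2)
      fix x
      have "?\<phi> n x \<le> indicator (box c d) x"
      proof (cases "x \<in> box c d")
        case True
        then show ?thesis by (simp only: indicator_simps box_bump_range)
      next
        case False
        then have "?\<phi> n x = 0" by (intro box_bump_eq_0) auto
        then show ?thesis by (simp only: indicator_pos_le)
      qed
      then show "norm (f x * ?\<phi> n x) \<le> norm (indicator (box c d) x * f x)"
        using mult_left_mono[of "?\<phi> n x" "indicator (box c d) x" "\<bar>f x\<bar>"] box_bump_range(1)[of "real (Suc n)" c d x]
        by (simp add: abs_mult mult.commute del: of_nat_Suc)
    qed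
    show "AE x in lebesgue. (\<lambda>n. f x * ?\<phi> n x) \<longlonglongrightarrow> f x * indicator (box c d) x"
      by (intro AE_I2 tendsto_mult tendsto_const box_bump_tendsto)
  qed
  moreover have "(\<integral> x. f x * ?\<phi> n x \<partial>lebesgue) = 0" for n by (rule orth[OF test])
  ultimately have "(\<lambda>n::nat. 0::real) \<longlonglongrightarrow> (\<integral> x. f x * indicator (box c d) x \<partial>lebesgue)" by (simp only:)
  then show ?thesis by (simp add: LIMSEQ_const_iff mult.commute)
qed

lemma AE_zero_of_generator_integrals:
  fixes g :: "'a \<Rightarrow> real"
  assumes g: "integrable M g" "(\<integral> x. g x \<partial>M) = 0"
    and G: "Int_stable G" "G \<subseteq> Pow (space M)" "sets M = sigma_sets (space M) G"
    and zero: "\<And>A. A \<in> G \<Longrightarrow> (LINT x:A|M. g x) = 0"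
  shows "AE x in M. g x = 0"
proof (rule density_unique_real[of M g "\<lambda>_. 0"])
  fix A assume "A \<in> sets M"
  then have "A \<in> sigma_sets (space M) G" by (simp only: G(3))
  with G(1,2) have "(LINT x:A|M. g x) = 0"
  proof (induction A rule: sigma_sets_induct_disjoint)
    case (basic A)
    then show ?case by (rule zero)
  next
    case empty
    show ?case by (simp add: set_lebesgue_integral_def)
  next
    case (compl A)
    then have A: "A \<in> sets M" by (simp only: G(3))
    have "integrable M (\<lambda>x. indicator A x *\<^sub>R g x)" using integrable_mult_indicator[OF A g(1)] .
    moreover have "(LINT x:space M - A|M. g x) = (\<integral> x. g x - indicator A x *\<^sub>R g x \<partial>M)"
      unfolding set_lebesgue_integral_def by (intro Bochner_Integration.integral_cong) (auto simp: indicator_def)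
    ultimately show ?case using g compl(2) by (simp add: set_lebesgue_integral_def)
  next
    case (union A)
    then have A: "A i \<in> sets M" for i by (auto simp: G(3))
    have "set_integrable M (\<Union>i. A i) g"
      unfolding set_integrable_def using A g(1) by (intro integrable_mult_indicator) auto
    then have "(LINT x:(\<Union>i. A i)|M. g x) = (\<Sum>i. LINT x:A i|M. g x)"
      using A union(1) by (intro lebesgue_integral_countable_add) (auto simp: disjoint_family_on_def)
    then show ?case using union(3) by simp
  qed
  then show "(LINT x:A|M. g x) = (LINT x:A|M. 0)" by (simp add: set_lebesgue_integral_def)
qed (use g in auto)

lemma AE_zero_of_box_integrals:
  fixes g :: "'a::euclidean_space \<Rightarrow> real"
  assumes "integrable lborel g" "(\<integral> x. g x \<partial>lborel) = 0" "\<And>c d. (LINT x:box c d|lborel. g x) = 0"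
  shows "AE x in lborel. g x = 0"
proof (rule AE_zero_of_generator_integrals[OF assms(1,2)])
  let ?G = "range (\<lambda>(a, b). box a b :: 'a set)"
  show "Int_stable ?G"
  proof (rule Int_stableI)
    fix X Y assume "X \<in> ?G" "Y \<in> ?G"
    then obtain a b c d where "X = box a b" "Y = box c d" by auto
    then show "X \<inter> Y \<in> ?G" unfolding box_Int_box by (simp add: box_Int_box range_eqI[of _ _ "(_, _)"])
  qed
  show "sets lborel = sigma_sets (space lborel) ?G"
    by (simp, subst borel_eq_box) (simp add: sets_measure_of)
qed (use assms(3) in auto)

lemma borel_AE_zero_on_cbox_of_orthogonal:
  fixes f :: "'a::euclidean_space \<Rightarrow> real"
  assumes [measurable]: "f \<in> borel_measurable borel" and f: "L2_fun f"
    and orth: "\<And>\<phi>. test_fun \<Omega> \<phi> \<Longrightarrow> (\<integral> x. f x * \<phi> x \<partial>lebesgue) = 0" and cd: "cbox c d \<subseteq> \<Omega>"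
  shows "AE x in lborel. x \<in> cbox c d \<longrightarrow> f x = 0"
proof -
  let ?g = "\<lambda>x. indicator (box c d) x * f x"
  have integrable: "integrable lborel ?g"
    using integrable_L2_lmeasurable[OF f lmeasurable_box] by (subst (asm) integrable_completion) measurable
  have sub_box: "(\<integral> x. indicator (box a b) x * f x \<partial>lborel) = 0" if "box a b \<subseteq> box c d" for a b
  proof (cases "box a b = {}")
    case False
    then have "cbox a b \<subseteq> cbox c d" using closure_mono[OF that] that by (metis closure_box subset_empty)
    then show ?thesis
      using integral_box_eq_0[OF f orth, where c = a and d = b] cd by (subst (asm) integral_completion) auto
  qed simp
  have "AE x in lborel. ?g x = 0"
  proof (rule AE_zero_of_box_integrals[OF integrable])
    show "(\<integral> x. ?g x \<partial>lborel) = 0" by (rule sub_box) simp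
    fix a b :: 'a
    obtain a' b' where box: "box a b \<inter> box c d = box a' b'" using box_Int_box by blast
    then have "(LINT x:box a b|lborel. ?g x) = (\<integral> x. indicator (box a' b') x * f x \<partial>lborel)"
      unfolding set_lebesgue_integral_def
      by (intro Bochner_Integration.integral_cong) (auto simp: indicator_def)
    also have "\<dots> = 0" using box by (intro sub_box) auto
    finally show "(LINT x:box a b|lborel. ?g x) = 0" .
  qed
  moreover have "AE x in lborel. x \<notin> cbox c d - box c d"
    using negligible_frontier_interval[of c d]
    by (intro AE_not_in) (simp add: negligible_iff_null_sets null_sets_completion_iff)
  ultimately show ?thesis by eventually_elim (auto simp: indicator_def split: if_splits)
qed

lemma test_functions_separate:
  fixes f :: "'a::euclidean_space \<Rightarrow> real"
  assumes \<Omega>: "open \<Omega>" and f: "L2_fun f" and orth: "\<And>\<phi>. test_fun \<Omega> \<phi> \<Longrightarrow> (\<integral> x. f x * \<phi> x \<partial>lebesgue) = 0"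
  shows "AE x in lebesgue. x \<in> \<Omega> \<longrightarrow> f x = 0"
proof -
  obtain g where g: "g \<in> borel_measurable lborel" and "AE x in lborel. f x = g x"
    using completion_ex_borel_measurable_real[of f lborel] f by (auto simp: L2_fun_def)
  then have agree: "AE x in lebesgue. f x = g x" by (intro AE_completion)
  have g_lebesgue: "g \<in> borel_measurable lebesgue" using g by (rule measurable_completion)
  have "AE x in lebesgue. norm (g x) \<le> 1 * norm (f x)" using agree by eventually_elim simp
  with g_lebesgue f have g_L2: "L2_fun g" by (rule L2_fun_bound)
  have g_orth: "(\<integral> x. g x * \<phi> x \<partial>lebesgue) = 0" if "test_fun \<Omega> \<phi>" for \<phi>
  proof -
    have "\<phi> \<in> borel_measurable lebesgue" using L2_fun_test(1)[OF that] by (simp add: L2_fun_def)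
    then have "(\<integral> x. g x * \<phi> x \<partial>lebesgue) = (\<integral> x. f x * \<phi> x \<partial>lebesgue)"
      using g_lebesgue f agree by (intro integral_cong_AE) (auto simp: L2_fun_def)
    then show ?thesis using orth[OF that] by simp
  qed
  obtain \<D> where \<D>: "countable \<D>" "\<D> \<subseteq> Pow \<Omega>" "\<And>X. X \<in> \<D> \<Longrightarrow> \<exists>c d. X = cbox c d" "\<Union>\<D> = \<Omega>"
    using open_countable_Union_open_cbox[OF \<Omega>] by blast
  have "AE x in lborel. \<forall>X\<in>\<D>. x \<in> X \<longrightarrow> g x = 0"
    unfolding AE_ball_countable[OF \<D>(1)]
  proof
    fix X assume X: "X \<in> \<D>"
    then obtain c d where "X = cbox c d" "cbox c d \<subseteq> \<Omega>" using \<D>(2,3) by blast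
    then show "AE x in lborel. x \<in> X \<longrightarrow> g x = 0"
      using borel_AE_zero_on_cbox_of_orthogonal[OF _ g_L2 g_orth] g by simp
  qed
  then have "AE x in lebesgue. \<forall>X\<in>\<D>. x \<in> X \<longrightarrow> g x = 0" by (rule AE_completion)
  then show ?thesis using agree by eventually_elim (use \<D>(4) in auto)
qed

lemma dres_injective:
  assumes \<Omega>: "open \<Omega>" and "restr \<Omega> f = f" "dres \<Omega> f = 0"
  shows "f = 0"
proof -
  have "dres_grad \<Omega> f = 0"
    using dres_weak[OF dres_in_form_space, of \<Omega> f f] assms(3) by simp
  then have orth: "f \<bullet> v = 0" if "(v, H) \<in> form_space \<Omega>" for v H using dres_weak[OF that, of f] assms(3) by simp
  have "AE x in lebesgue. x \<in> \<Omega> \<longrightarrow> rep_l2 f x = 0"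
  proof (rule test_functions_separate[OF \<Omega> L2_fun_rep])
    show "(\<integral> x. rep_l2 f x * \<phi> x \<partial>lebesgue) = 0" if "test_fun \<Omega> \<phi>" for \<phi>
      using orth[OF l2_graph_in_form_space[OF that]] inner_rep_l2[OF L2_fun_test(1)[OF that], of f] by simp
  qed
  moreover have "AE x in lebesgue. x \<notin> \<Omega> \<longrightarrow> rep_l2 f x = 0"
    using assms(2) restr_eq_self_iff[of \<Omega> f] \<Omega> by simp
  ultimately have "AE x in lebesgue. rep_l2 f x = 0" by eventually_elim blast
  then show ?thesis using abs_l2_eq_0_iff[OF L2_fun_rep, of f] by simp
qed

section \<open>Chains of rooms\<close>

definition axial_region :: "'a::euclidean_space \<Rightarrow> real \<Rightarrow> real \<Rightarrow> (real \<Rightarrow> real) \<Rightarrow> 'a set" where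
  "axial_region e a b g = {x. a < x \<bullet> e \<and> x \<bullet> e < b \<and> (\<forall>i\<in>Basis - {e}. \<bar>x \<bullet> i\<bar> < g (x \<bullet> e))}"

lemma axial_regionD:
  assumes "x \<in> axial_region e a b g"
  shows "a < x \<bullet> e" "x \<bullet> e < b" "i \<in> Basis \<Longrightarrow> i \<noteq> e \<Longrightarrow> \<bar>x \<bullet> i\<bar> < g (x \<bullet> e)"
  using assms by (auto simp: axial_region_def)

lemma open_axial_region:
  assumes "continuous_on UNIV g" shows "open (axial_region e a b g)"
proof -
  have "axial_region e a b g
      = {x. a < x \<bullet> e} \<inter> {x. x \<bullet> e < b} \<inter> (\<Inter>i\<in>Basis - {e}. {x. \<bar>x \<bullet> i\<bar> < g (x \<bullet> e)})"
    by (auto simp: axial_region_def)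
  also have "open \<dots>"
    by (intro open_Int open_INT open_Collect_less finite_Diff finite_Basis ballI continuous_intros
        continuous_on_compose2[OF assms]) auto
  finally show ?thesis .
qed

lemma bounded_axial_region:
  fixes e :: "'a::euclidean_space"
  assumes g: "\<And>t. a < t \<Longrightarrow> t < b \<Longrightarrow> g t \<le> B"
  shows "bounded (axial_region e a b g)"
proof -
  have "\<bar>x \<bullet> i\<bar> \<le> max (max \<bar>a\<bar> \<bar>b\<bar>) B" if x: "x \<in> axial_region e a b g" and i: "i \<in> Basis" for x i
  proof (cases "i = e")
    case True
    then show ?thesis using axial_regionD(1,2)[OF x] by (simp add: max_def abs_if)
  next
    case False
    then have "\<bar>x \<bullet> i\<bar> < g (x \<bullet> e)" by (rule axial_regionD(3)[OF x i])
    also have "\<dots> \<le> B" using axial_regionD(1,2)[OF x] by (rule g)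
    finally show ?thesis by simp
  qed
  then have "norm x \<le> real DIM('a) * max (max \<bar>a\<bar> \<bar>b\<bar>) B" if "x \<in> axial_region e a b g" for x
    using that by (intro norm_le_DIM_mult)
  then show ?thesis by (auto simp: bounded_iff)
qed

context
  fixes e :: "'a::euclidean_space"
  assumes e: "e \<in> Basis"
begin

lemma axis_in_axial_region: "a < t \<Longrightarrow> t < b \<Longrightarrow> g t > 0 \<Longrightarrow> t *\<^sub>R e \<in> axial_region e a b g"
  using e by (auto simp: axial_region_def inner_Basis)

lemma segment_to_axis_subset_axial_region:
  assumes x: "x \<in> axial_region e a b g"
  shows "closed_segment x ((x \<bullet> e) *\<^sub>R e) \<subseteq> axial_region e a b g"
proof
  fix y assume "y \<in> closed_segment x ((x \<bullet> e) *\<^sub>R e)"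
  then obtain u where u: "0 \<le> u" "u \<le> 1" and y: "y = (1 - u) *\<^sub>R x + u *\<^sub>R ((x \<bullet> e) *\<^sub>R e)" by (auto simp: in_segment)
  have "y \<bullet> e = (1 - u) * (x \<bullet> e) + u * (x \<bullet> e)" using e by (simp add: y inner_add_left)
  then have y_e: "y \<bullet> e = x \<bullet> e" by (simp add: algebra_simps)
  have "\<bar>y \<bullet> i\<bar> < g (y \<bullet> e)" if i: "i \<in> Basis" "i \<noteq> e" for i
  proof -
    have "y \<bullet> i = (1 - u) * (x \<bullet> i)" using e i by (simp add: y inner_add_left inner_Basis)
    then have "\<bar>y \<bullet> i\<bar> \<le> \<bar>x \<bullet> i\<bar>" using u by (simp add: abs_mult mult_left_le_one_le)
    also have "\<dots> < g (y \<bullet> e)" unfolding y_e by (rule axial_regionD(3)[OF x i])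
    finally show ?thesis .
  qed
  then show "y \<in> axial_region e a b g" using axial_regionD(1,2)[OF x] y_e by (simp add: axial_region_def)
qed

lemma connected_axial_region:
  assumes g: "\<And>t. a < t \<Longrightarrow> t < b \<Longrightarrow> 0 < g t" and "a < b"
  shows "connected (axial_region e a b g)"
proof -
  let ?P = "axial_region e a b g" and ?A = "(\<lambda>t. t *\<^sub>R e) ` {a<..<b}"
  let ?S = "\<lambda>x. closed_segment x ((x \<bullet> e) *\<^sub>R e)"
  have A: "connected ?A" by (intro connected_continuous_image continuous_intros) simp
  have "?A \<subseteq> ?P" using g axis_in_axial_region by auto
  then have "?P = \<Union>((\<lambda>x. ?S x \<union> ?A) ` ?P)"
    using segment_to_axis_subset_axial_region by fastforce
  moreover have "connected (\<Union>((\<lambda>x. ?S x \<union> ?A) ` ?P))"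
  proof (rule connected_Union)
    show "connected T" if T: "T \<in> (\<lambda>x. ?S x \<union> ?A) ` ?P" for T
    proof -
      obtain x where x: "T = ?S x \<union> ?A" "x \<in> ?P" using T by (rule imageE)
      have "(x \<bullet> e) *\<^sub>R e \<in> ?S x \<inter> ?A" using axial_regionD(1,2)[OF x(2)] by auto
      then show ?thesis unfolding x(1) by (intro connected_Un connected_segment A) blast
    qed
    have "((a + b) / 2) *\<^sub>R e \<in> ?A" using \<open>a < b\<close> by (intro imageI) auto
    then show "\<Inter>((\<lambda>x. ?S x \<union> ?A) ` ?P) \<noteq> {}" by blast
  qed
  ultimately show ?thesis by simp
qed

lemma axial_region_similarity:
  assumes r: "r > 0"
  shows "similarity r (c *\<^sub>R e) ` axial_region e a b g
    = axial_region e (c + r * a) (c + r * b) (\<lambda>t. r * g ((t - c) / r))" (is "?T ` ?P = ?Q")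
proof -
  have T_e: "?T x \<bullet> e = c + r * (x \<bullet> e)" for x
    using e by (simp add: similarity_def inner_add_left)
  have T_i: "?T x \<bullet> i = r * (x \<bullet> i)" if "i \<in> Basis" "i \<noteq> e" for x i
    using e that by (simp add: similarity_def inner_add_left inner_Basis)
  have member: "?T x \<in> ?Q \<longleftrightarrow> x \<in> ?P" for x
    using r by (auto simp: axial_region_def T_e T_i abs_mult)
  show ?thesis
  proof (intro subset_antisym subsetI)
    fix y assume "y \<in> ?Q"
    then show "y \<in> ?T ` ?P"
      using member[of "similarity_inv r (c *\<^sub>R e) y"] similarity_inverse(1)[OF r, of "c *\<^sub>R e" y]
      by (metis imageI)
  qed (use member in auto)
qed

end

definition room_profile :: "real \<Rightarrow> real \<Rightarrow> real \<Rightarrow> real" where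
  "room_profile a b t = (t - a)\<^sup>2 * (b - t)\<^sup>2 / (b - a) ^ 3"

definition room :: "'a::euclidean_space \<Rightarrow> real \<Rightarrow> real \<Rightarrow> 'a set" where
  "room e a b = axial_region e a b (room_profile a b)"

definition tube :: "'a::euclidean_space \<Rightarrow> real \<Rightarrow> real \<Rightarrow> 'a set" where
  "tube e b s = axial_region e (b - s) (b + s) (\<lambda>_. s\<^sup>2)"

lemma room_profile_pos: "a < t \<Longrightarrow> t < b \<Longrightarrow> 0 < room_profile a b t"
  by (simp add: room_profile_def)

lemma room_profile_le:
  assumes "a < t" "t < b"
  shows "room_profile a b t \<le> (b - t)\<^sup>2 / (b - a)" "room_profile a b t \<le> (t - a)\<^sup>2 / (b - a)"
    "room_profile a b t \<le> b - a"
proof -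
  let ?L = "b - a"
  have L: "?L > 0" using assms by simp
  have factor: "x * y / ?L ^ 3 = (x / ?L\<^sup>2) * (y / ?L)" for x y by (simp add: power3_eq_cube power2_eq_square)
  have le_1: "(t - a)\<^sup>2 / ?L\<^sup>2 \<le> 1" "(b - t)\<^sup>2 / ?L\<^sup>2 \<le> 1"
    using assms by (auto simp: divide_le_eq_1 intro!: power_mono)
  show right: "room_profile a b t \<le> (b - t)\<^sup>2 / ?L"
    unfolding room_profile_def factor using le_1(1) L by (intro mult_left_le_one_le) auto
  show "room_profile a b t \<le> (t - a)\<^sup>2 / ?L"
    unfolding room_profile_def mult.commute[of "(t - a)\<^sup>2"] factor using le_1(2) L by (intro mult_left_le_one_le) auto
  have "(b - t)\<^sup>2 / ?L \<le> ?L\<^sup>2 / ?L" using assms L by (intro divide_right_mono power_mono) auto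
  also have "\<dots> = ?L" by (simp add: power2_eq_square)
  finally show "room_profile a b t \<le> ?L" using right by simp
qed

lemma open_room: "open (room e a b)"
  unfolding room_def room_profile_def[abs_def] divide_inverse by (intro open_axial_region continuous_intros)

lemma open_tube: "open (tube e b s)"
  unfolding tube_def by (intro open_axial_region continuous_intros)

lemma bounded_room: "bounded (room e a b)"
  unfolding room_def by (rule bounded_axial_region[OF room_profile_le(3)])

lemma bounded_tube: "bounded (tube e b s)"
  unfolding tube_def by (rule bounded_axial_region[OF order_refl])

text \<open>The profile vanishes quadratically at both ends, so neighbouring rooms touch in a pair of cusps.\<close>

lemma room_cusp:
  assumes "x \<in> room e a b" "i \<in> Basis" "i \<noteq> e"
  shows "\<bar>x \<bullet> i\<bar> \<le> (b - x \<bullet> e)\<^sup>2 / (b - a)" "\<bar>x \<bullet> i\<bar> \<le> (x \<bullet> e - a)\<^sup>2 / (b - a)"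
  using axial_regionD(3)[OF assms[unfolded room_def]] room_profile_le[of a "x \<bullet> e" b]
    axial_regionD(1,2)[OF assms(1)[unfolded room_def]] by auto

context
  fixes e :: "'a::euclidean_space"
  assumes e: "e \<in> Basis"
begin

lemma connected_room: "a < b \<Longrightarrow> connected (room e a b)"
  unfolding room_def by (rule connected_axial_region[OF e room_profile_pos])

lemma connected_tube: "s > 0 \<Longrightarrow> connected (tube e b s)"
  unfolding tube_def by (rule connected_axial_region[OF e]) auto

lemma axis_in_room: "a < t \<Longrightarrow> t < b \<Longrightarrow> t *\<^sub>R e \<in> room e a b"
  unfolding room_def by (intro axis_in_axial_region[OF e] room_profile_pos)

lemma axis_in_tube: "b - s < t \<Longrightarrow> t < b + s \<Longrightarrow> t *\<^sub>R e \<in> tube e b s"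
  unfolding tube_def by (intro axis_in_axial_region[OF e]) auto

lemma room_contains_ball:
  assumes "a < b" shows "ball (((a + b) / 2) *\<^sub>R e) ((b - a) / 256) \<subseteq> room e a b"
proof
  let ?L = "b - a" and ?c = "((a + b) / 2) *\<^sub>R e"
  fix x assume "x \<in> ball ?c (?L / 256)"
  then have "norm (x - ?c) < ?L / 256" by (simp add: dist_norm norm_minus_commute)
  then have component: "\<bar>x \<bullet> i - ?c \<bullet> i\<bar> < ?L / 256" if "i \<in> Basis" for i
    using Basis_le_norm[OF that, of "x - ?c"] unfolding inner_diff_left by linarith
  have "\<bar>x \<bullet> e - (a + b) / 2\<bar> < ?L / 256" using component[OF e] e by simp
  then have "x \<bullet> e - (a + b) / 2 < ?L / 256" "- (x \<bullet> e - (a + b) / 2) < ?L / 256" by (simp_all only: abs_less_iff)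
  then have central: "?L / 4 \<le> x \<bullet> e - a" "?L / 4 \<le> b - x \<bullet> e" using assms by (simp_all add: field_simps)
  have "?L / 256 = (?L / 4)\<^sup>2 * (?L / 4)\<^sup>2 / ?L ^ 3" using assms by (simp add: power2_eq_square power3_eq_cube)
  also have "\<dots> \<le> room_profile a b (x \<bullet> e)"
    unfolding room_profile_def using central assms by (intro divide_right_mono mult_mono power_mono) auto
  finally have profile: "?L / 256 \<le> room_profile a b (x \<bullet> e)" .
  have "\<bar>x \<bullet> i\<bar> < room_profile a b (x \<bullet> e)" if "i \<in> Basis" "i \<noteq> e" for i
  proof -
    have "?c \<bullet> i = 0" using e that by (simp add: inner_Basis)
    then have "\<bar>x \<bullet> i\<bar> < ?L / 256" using component[OF that(1)] by (simp only: diff_0_right)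
    then show ?thesis using profile by (rule less_le_trans)
  qed
  moreover have "a < x \<bullet> e" "x \<bullet> e < b" using central assms by (simp_all add: field_simps)
  ultimately show "x \<in> room e a b" by (simp add: room_def axial_region_def)
qed

lemma room_similarity:
  assumes "b < b'" shows "similarity_inv (b' - b) (b *\<^sub>R e) ` room e b b' = room e 0 1"
proof -
  let ?L = "b' - b"
  have L: "?L > 0" using assms by simp
  have "room_profile b b' t = ?L * room_profile 0 1 ((t - b) / ?L)" for t
  proof -
    have "1 - (t - b) / ?L = (b' - t) / ?L" using L by (simp add: field_simps)
    then show ?thesis by (simp add: room_profile_def power_divide power2_eq_square power3_eq_cube mult.assoc)
  qed
  then have "(\<lambda>t. ?L * room_profile 0 1 ((t - b) / ?L)) = room_profile b b'" by (intro ext) (rule sym)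
  then have "room e b b' = similarity ?L (b *\<^sub>R e) ` room e 0 1"
    by (simp add: room_def axial_region_similarity[OF e L])
  then show ?thesis by (simp only: image_image similarity_inverse(2)[OF L] image_ident)
qed

end

definition cusp_at :: "'a::euclidean_space \<Rightarrow> 'a \<Rightarrow> 'a set \<Rightarrow> real \<Rightarrow> bool" where
  "cusp_at e e2 U b \<longleftrightarrow> (\<exists>c>0. \<exists>K>0. (\<forall>t. b - c < t \<and> t < b \<longrightarrow> t *\<^sub>R e \<in> U) \<and>
     (\<forall>x\<in>U. b - c < x \<bullet> e \<longrightarrow> \<bar>x \<bullet> e2\<bar> \<le> K * (b - x \<bullet> e)\<^sup>2))"

definition admissible :: "'a::euclidean_space \<Rightarrow> 'a \<Rightarrow> 'a set \<Rightarrow> real \<Rightarrow> bool" where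
  "admissible e e2 U b \<longleftrightarrow> open U \<and> bounded U \<and> connected U \<and> U \<noteq> {} \<and> (\<forall>x\<in>U. x \<bullet> e < b) \<and> cusp_at e e2 U b"

lemma admissibleD:
  assumes "admissible e e2 U b"
  shows "open U" "bounded U" "connected U" "U \<noteq> {}" "x \<in> U \<Longrightarrow> x \<bullet> e < b" "cusp_at e e2 U b"
  using assms by (auto simp: admissible_def)

lemma eigenvalue_less_1:
  fixes U :: "'a::euclidean_space set"
  assumes U: "bounded U" and x: "dres U x = a *\<^sub>R x" "x \<noteq> 0"
  shows "a < 1"
proof (rule ccontr)
  assume "\<not> a < 1"
  moreover have "a \<le> 1" using x
    by (intro pos_contraction_eigenvalue_le_1[OF pos_contraction_dres]) (auto simp: eigenspace_def)
  ultimately have fixed: "dres U x = x" using x(1) by simp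
  then have "dres_grad U x = 0" using dres_energy[of U x] by (simp add: norm_prod_def power2_norm_eq_inner)
  then have in_form: "(x, 0) \<in> form_space U" using dres_in_form_space[of U x] fixed by simp
  obtain i :: 'a where i: "i \<in> Basis" using nonempty_Basis by blast
  obtain R where R: "\<And>y. y \<in> U \<Longrightarrow> norm y \<le> R" using U by (auto simp: bounded_iff)
  have "norm (restr {y. y \<bullet> 0 \<in> UNIV} x) \<le> 2 * (\<bar>R\<bar> + 1) * norm (restr {y. y \<bullet> 0 \<in> UNIV} (0 :: ('a, 'a) l2))"
  proof (rule strip_poincare[OF _ _ _ _ _ in_form, of i])
    show "\<bar>y \<bullet> i\<bar> < \<bar>R\<bar> + 1" if "y \<in> U" for y using Basis_le_norm[OF i, of y] R[OF that] by linarith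
  qed (use i in auto)
  moreover have "restr UNIV (0 :: ('a, 'a) l2) = 0" by (intro linear_0 linear_restr) simp
  moreover have "restr UNIV x = x" by (simp add: restr_eq_self_iff)
  ultimately show False using x(2) by simp
qed

context
  fixes e e2 :: "'a::euclidean_space"
  assumes e: "e \<in> Basis" "e2 \<in> Basis" "e \<noteq> e2"
begin

lemma cusp_at_end_of_room:
  assumes "a < b" "0 < c" "c \<le> b - a" "room e a b \<subseteq> U" "\<And>x. x \<in> U \<Longrightarrow> b - c < x \<bullet> e \<Longrightarrow> x \<in> room e a b"
  shows "cusp_at e e2 U b"
  unfolding cusp_at_def
proof (rule exI[of _ c], rule conjI[OF \<open>0 < c\<close>], rule exI[of _ "1 / (b - a)"], intro conjI allI ballI impI)
  show "0 < 1 / (b - a)" using assms(1) by simp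
  show "t *\<^sub>R e \<in> U" if "b - c < t \<and> t < b" for t
    using axis_in_room[OF e(1), of a t b] that assms(3,4) by auto
  show "\<bar>x \<bullet> e2\<bar> \<le> 1 / (b - a) * (b - x \<bullet> e)\<^sup>2" if "x \<in> U" "b - c < x \<bullet> e" for x
    using room_cusp(1)[OF assms(5)[OF that] e(2)] e(3) by auto
qed

lemma admissible_room: assumes "a < b" shows "admissible e e2 (room e a b) b"
  unfolding admissible_def
proof (intro conjI open_room bounded_room connected_room[OF e(1)] assms)
  show "room e a b \<noteq> {}" using axis_in_room[OF e(1), of a "(a + b) / 2" b] assms by auto
  show "\<forall>x\<in>room e a b. x \<bullet> e < b" by (auto simp: room_def axial_region_def)
  show "cusp_at e e2 (room e a b) b" by (rule cusp_at_end_of_room[of a b "b - a"]) (use assms in auto)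
qed

lemma connected_extension:
  assumes U: "connected U" "cusp_at e e2 U b" and "b < b'" "0 < s" "s < b' - b"
  shows "connected (U \<union> room e b b' \<union> tube e b s)"
proof -
  obtain c where c: "c > 0" "\<And>t. b - c < t \<Longrightarrow> t < b \<Longrightarrow> t *\<^sub>R e \<in> U" using U(2) by (auto simp: cusp_at_def)
  have "b - s < b - min c s / 2" "b - c < b - min c s / 2" "b - min c s / 2 < b" "b - min c s / 2 < b + s"
    using c(1) assms by (auto simp: min_def)
  then have "(b - min c s / 2) *\<^sub>R e \<in> U \<inter> tube e b s" using c(2) axis_in_tube[OF e(1)] by blast
  then have "connected (U \<union> tube e b s)"
    by (intro connected_Un[OF U(1) connected_tube[OF e(1) \<open>0 < s\<close>]]) blast
  moreover have "(b + s / 2) *\<^sub>R e \<in> (U \<union> tube e b s) \<inter> room e b b'"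
    using axis_in_room[OF e(1), of b "b + s / 2" b'] axis_in_tube[OF e(1), of b s "b + s / 2"] assms by auto
  ultimately have "connected ((U \<union> tube e b s) \<union> room e b b')"
    by (intro connected_Un[OF _ connected_room[OF e(1) \<open>b < b'\<close>]]) blast+
  then show ?thesis by (simp add: Un_ac)
qed

lemma admissible_extend:
  assumes U: "admissible e e2 U b" and b': "b < b'" and s: "0 < s" "s < b' - b"
  shows "admissible e e2 (U \<union> room e b b' \<union> tube e b s) b'" (is "admissible e e2 ?U b'")
  unfolding admissible_def
proof (intro conjI)
  note U = admissibleD[OF U]
  show "open ?U" by (intro open_Un U(1) open_room open_tube)
  show "bounded ?U" using U(2) by (simp add: bounded_room bounded_tube)
  show "connected ?U" by (rule connected_extension[OF U(3,6) b' s])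
  show "?U \<noteq> {}" using U(4) by auto
  have tube_below: "x \<bullet> e < b + s" if "x \<in> tube e b s" for x using that by (simp add: tube_def axial_region_def)
  have room_below: "x \<bullet> e < b'" if "x \<in> room e b b'" for x using that by (simp add: room_def axial_region_def)
  show "\<forall>x\<in>?U. x \<bullet> e < b'" using U(5) room_below tube_below b' s by fastforce
  show "cusp_at e e2 ?U b'"
  proof (rule cusp_at_end_of_room[of b b' "b' - b - s"])
    show "x \<in> room e b b'" if "x \<in> ?U" "b' - (b' - b - s) < x \<bullet> e" for x
      using that U(5)[of x] tube_below[of x] s(1) by auto
  qed (use b' s in auto)
qed

lemma tube_width:
  assumes cusp: "K > 0" "\<And>x. x \<in> U \<Longrightarrow> b - c < x \<bullet> e \<Longrightarrow> \<bar>x \<bullet> e2\<bar> \<le> K * (b - x \<bullet> e)\<^sup>2"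
    and s: "0 < s" "2 * s < c" and b': "b + 1 \<le> b'"
    and x: "x \<in> U \<union> room e b b' \<union> tube e b s" "x \<in> slab e b (2 * s)"
  shows "\<bar>x \<bullet> e2\<bar> < (4 * K + 5) * s\<^sup>2"
proof -
  have pos: "0 < s\<^sup>2" "0 < K * (4 * s\<^sup>2)" using s(1) cusp(1) by auto
  have near: "\<bar>x \<bullet> e - b\<bar> \<le> 2 * s" using x(2) by (simp add: slab_def)
  then have square: "(x \<bullet> e - b)\<^sup>2 \<le> 4 * s\<^sup>2"
    using power_mono[OF near, of 2] by (simp add: power_mult_distrib)
  consider (base) "x \<in> U" | (room) "x \<in> room e b b'" | (tube) "x \<in> tube e b s" using x(1) by auto
  then have "\<bar>x \<bullet> e2\<bar> \<le> K * (4 * s\<^sup>2) + 4 * s\<^sup>2"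
  proof cases
    case base
    have "\<bar>x \<bullet> e2\<bar> \<le> K * (b - x \<bullet> e)\<^sup>2" using near s by (intro cusp(2) base) (auto simp: abs_le_iff)
    also have "\<dots> \<le> K * (4 * s\<^sup>2)" using square cusp(1) by (intro mult_left_mono) (auto simp: power2_commute)
    finally show ?thesis by (rule order_trans) simp
  next
    case room
    have "\<bar>x \<bullet> e2\<bar> \<le> (x \<bullet> e - b)\<^sup>2 / (b' - b)" using room_cusp(2)[OF room e(2)] e(3) by auto
    also have "\<dots> \<le> (x \<bullet> e - b)\<^sup>2 / 1" using b' by (intro divide_left_mono) auto
    also have "\<dots> \<le> 4 * s\<^sup>2" using square by simp
    finally show ?thesis using pos by linarith
  next
    case tube
    have "\<bar>x \<bullet> e2\<bar> < s\<^sup>2" using axial_regionD(3)[OF tube[unfolded tube_def] e(2)] e(3) by auto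
    then show ?thesis using pos by linarith
  qed
  moreover have "(4 * K + 5) * s\<^sup>2 = K * (4 * s\<^sup>2) + 4 * s\<^sup>2 + s\<^sup>2" by (simp add: distrib_right)
  ultimately show ?thesis using pos(1) by linarith
qed

lemma tube_test_approximable:
  assumes cusp: "K > 0" "\<And>x. x \<in> U \<Longrightarrow> b - c < x \<bullet> e \<Longrightarrow> \<bar>x \<bullet> e2\<bar> \<le> K * (b - x \<bullet> e)\<^sup>2"
    and s: "0 < s" "2 * s < c" and b': "b + 1 \<le> b'"
  shows "test_approximable (2 * ((4 * K + 5) * s\<^sup>2) + 2 * (4 * (4 * K + 5) * smooth_step_slope * s) +
      (4 * (4 * K + 5) * smooth_step_slope * s)\<^sup>2) (U \<union> room e b b' \<union> tube e b s) (U \<union> room e b b')"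
proof -
  let ?V = "U \<union> room e b b'" and ?M = "(4 * K + 5) * s\<^sup>2"
  let ?W = "?V \<union> tube e b s"
  have slope: "4 * ?M * smooth_step_slope / s = 4 * (4 * K + 5) * smooth_step_slope * s"
    using s(1) by (simp add: power2_eq_square)
  show ?thesis
    unfolding slope[symmetric]
  proof (rule slit_test_approximable[of e e2 s ?M ?W b ?V])
    show "norm e = 1" "norm e2 = 1" "e \<bullet> e2 = 0" using e by (auto simp: inner_Basis)
    show "x \<in> ?V" if "x \<in> ?W" "s \<le> \<bar>x \<bullet> e - b\<bar>" for x
      using that by (auto simp: tube_def axial_region_def abs_if split: if_splits)
    show "\<bar>x \<bullet> e2\<bar> < ?M" if "x \<in> ?W" "x \<in> slab e b (2 * s)" for x
      by (rule tube_width[OF cusp s b' that])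
  qed (use s(1) cusp(1) in auto)
qed

lemma tube_close:
  assumes U: "cusp_at e e2 U b" and b': "b + 1 \<le> b'" and \<delta>: "\<delta> > 0"
  obtains s where "0 < s" "s < 1/2"
    "\<And>f. norm (dres (U \<union> room e b b' \<union> tube e b s) f - dres (U \<union> room e b b') f) \<le> \<delta> * norm f"
proof -
  obtain c K where cusp: "c > 0" "K > 0" "\<And>x. x \<in> U \<Longrightarrow> b - c < x \<bullet> e \<Longrightarrow> \<bar>x \<bullet> e2\<bar> \<le> K * (b - x \<bullet> e)\<^sup>2"
    using U unfolding cusp_at_def by auto
  define \<kappa> where "\<kappa> = 4 * K + 5"
  define \<sigma> where "\<sigma> = 4 * \<kappa> * smooth_step_slope"
  define B where "B = 3 * (2 * \<kappa> + 2 * \<sigma> + \<sigma>\<^sup>2)"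
  have pos: "\<kappa> > 0" "\<sigma> > 0" using cusp(2) smooth_step_slope_pos by (simp_all add: \<kappa>_def \<sigma>_def)
  then have B: "B > 0" by (simp add: B_def add_pos_nonneg)
  define s where "s = min (min (1/4) (c / 4)) (\<delta> / B)"
  have s: "0 < s" "s \<le> 1/4" "s \<le> c / 4" "s \<le> \<delta> / B"
    using cusp(1) \<delta> B by (auto simp only: s_def min_less_iff_conj min_le_iff_disj) auto
  let ?W = "U \<union> room e b b' \<union> tube e b s" and ?V = "U \<union> room e b b'"
  have "2 * s < c" using s(3) cusp(1) by simp
  note approx = tube_test_approximable[OF cusp(2,3) s(1) this b', folded \<kappa>_def, folded \<sigma>_def]
  have "norm (dres ?W f - dres ?V f) \<le> \<delta> * norm f" for f
  proof -
    have "norm (dres ?W f - dres ?V f) \<le> 3 * (2 * (\<kappa> * s\<^sup>2) + 2 * (\<sigma> * s) + (\<sigma> * s)\<^sup>2) * norm f"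
      by (rule dres_perturbation[OF _ _ approx]) (use s(1) pos in auto)
    also have "\<dots> \<le> (B * s) * norm f"
    proof (rule mult_right_mono)
      have "s\<^sup>2 \<le> s" using s by (simp add: power2_eq_square mult_left_le_one_le)
      then have "3 * (2 * (\<kappa> * s\<^sup>2) + 2 * (\<sigma> * s) + \<sigma>\<^sup>2 * s\<^sup>2) \<le> 3 * (2 * (\<kappa> * s) + 2 * (\<sigma> * s) + \<sigma>\<^sup>2 * s)"
        using pos by (intro mult_left_mono add_mono order_refl) auto
      then show "3 * (2 * (\<kappa> * s\<^sup>2) + 2 * (\<sigma> * s) + (\<sigma> * s)\<^sup>2) \<le> B * s"
        by (simp add: B_def power_mult_distrib algebra_simps)
    qed simp
    also have "\<dots> \<le> \<delta> * norm f" using s(4) B by (intro mult_right_mono) (auto simp: le_divide_eq mult.commute)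
    finally show ?thesis .
  qed
  moreover have "s < 1/2" using s(2) by simp
  ultimately show ?thesis using that[of s] s(1) by blast
qed

end

context
  fixes e :: "'a::euclidean_space"
  assumes e: "e \<in> Basis"
begin

lemma room_eigenvalue_scaling:
  assumes "eigenspace (dres (room e b (b + L))) (1 / (1 + lam)) \<noteq> {0}" "L > 0" "lam > 0"
  shows "eigenspace (dres (room e 0 1)) (1 / (1 + lam * L\<^sup>2)) \<noteq> {0}"
proof -
  obtain x where x: "dres (room e b (b + L)) x = (1 / (1 + lam)) *\<^sub>R x" "x \<noteq> 0"
    using eigenspace_nontrivialE[OF pos_contraction_linear[OF pos_contraction_dres] assms(1)]
    by (auto simp: eigenspace_def)
  then have "lam \<in> dirichlet_point_spectrum (room e b (b + L))"
    using dres_eigenvalue_imp_point_spectrum[OF x] assms(3) by simp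
  then have "lam / (1 / L)\<^sup>2 \<in> dirichlet_point_spectrum (similarity_inv L (b *\<^sub>R e) ` room e b (b + L))"
    by (rule dirichlet_point_spectrum_similarity[rotated]) (use assms(2) in simp)
  then have "lam * L\<^sup>2 \<in> dirichlet_point_spectrum (room e 0 1)"
    using room_similarity[OF e, of b "b + L"] assms(2) by (simp add: power_divide)
  then show ?thesis by (rule point_spectrum_imp_dres_eigenvalue(2))
qed

lemma nonresonant_room:
  assumes "0 < a" "a < 1"
  obtains b' where "b + B \<le> b'" "b < b'" "eigenspace (dres (room e b b')) a = {0}"
proof -
  define lam where "lam = 1 / a - 1"
  have lam: "lam > 0" "1 / (1 + lam) = a" using assms by (simp_all add: lam_def)
  let ?resonant = "{L. L > 0 \<and> eigenspace (dres (room e b (b + L))) a \<noteq> {0}}" and ?g = "\<lambda>L. 1 / (1 + lam * L\<^sup>2)"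
  have "?g ` ?resonant \<subseteq> {c. c > 0 \<and> eigenspace (dres (room e 0 1)) c \<noteq> {0}}"
  proof (rule image_subsetI)
    fix L assume L: "L \<in> ?resonant"
    then have "eigenspace (dres (room e 0 1)) (?g L) \<noteq> {0}"
      by (intro room_eigenvalue_scaling[of b L lam]) (simp_all add: lam)
    moreover have "?g L > 0" using lam(1) by (simp add: add_pos_nonneg)
    ultimately show "?g L \<in> {c. c > 0 \<and> eigenspace (dres (room e 0 1)) c \<noteq> {0}}" by simp
  qed
  then have "countable (?g ` ?resonant)"
    by (rule countable_subset)
       (rule countable_eigenvalues[OF pos_contraction_positive[OF pos_contraction_dres] compact_dres[OF bounded_room]])
  moreover have "inj_on ?g ?resonant"
  proof (rule inj_onI)
    fix L L' assume L: "L \<in> ?resonant" "L' \<in> ?resonant" "?g L = ?g L'"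
    have "1 + lam * L\<^sup>2 \<noteq> 0" "1 + lam * L'\<^sup>2 \<noteq> 0" using lam(1) by (auto simp: add_pos_nonneg less_imp_neq[symmetric])
    then have "lam * L\<^sup>2 = lam * L'\<^sup>2" using L(3) by (simp add: field_simps)
    then show "L = L'" using lam(1) L(1,2) by (simp add: power2_eq_iff)
  qed
  ultimately have resonant: "countable ?resonant" by (rule countable_image_inj_on)
  have "\<not> {max 1 B<..<max 1 B + 1} \<subseteq> ?resonant"
  proof
    assume "{max 1 B<..<max 1 B + 1} \<subseteq> ?resonant"
    then have "countable {max 1 B<..<max 1 B + 1}" using resonant by (rule countable_subset)
    then show False using uncountable_open_interval[of "max 1 B" "max 1 B + 1"] by simp
  qed
  then obtain L where "L \<in> {max 1 B<..<max 1 B + 1}" "L \<notin> ?resonant" by (auto simp only: subset_iff)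
  then show ?thesis by (intro that[of "b + L"]) auto
qed

end

section \<open>Inductive construction of the chain\<close>

definition has_spectral_selector :: "nat \<Rightarrow> 'a::euclidean_space set \<Rightarrow> real \<Rightarrow> bool" where
  "has_spectral_selector n U \<beta> \<longleftrightarrow> (\<exists>\<Phi> a Q Y. eigen_truncation (dres U) ((1/2) ^ n) \<Phi> a \<and> open Y \<and>
     emeasure lborel Y \<le> ennreal ((1/2) ^ n) \<and> localized_poly ((1/2) ^ n) Y Q \<and> stably_fixes \<beta> ((1/2) ^ n) a \<Phi> Q)"

lemma positive_op_dres: "positive_op (dres U)"
  by (rule pos_contraction_positive[OF pos_contraction_dres])

lemma has_spectral_selector_exists:
  assumes "bounded U" "B > 0"
  obtains \<beta> where "0 < \<beta>" "\<beta> \<le> B" "has_spectral_selector n U \<beta>"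
proof -
  have \<epsilon>: "(0::real) < (1/2) ^ n" by simp
  obtain \<Phi> a where truncation: "eigen_truncation (dres U) ((1/2) ^ n) \<Phi> a"
    using eigen_truncation_exists[OF positive_op_dres compact_dres[OF assms(1)] \<epsilon>] .
  note \<Phi> = eigen_truncationD[OF truncation]
  have "a ` \<Phi> \<subseteq> {0..1}"
  proof (rule image_subsetI)
    fix \<phi> assume \<phi>: "\<phi> \<in> \<Phi>"
    then have "\<phi> \<noteq> 0" using orthonormal_norm[OF \<Phi>(2)] by force
    then have "a \<phi> \<le> 1" by (rule pos_contraction_eigenvalue_le_1[OF pos_contraction_dres \<Phi>(3)[OF \<phi>]])
    moreover have "0 \<le> a \<phi>" by (rule order_trans[OF less_imp_le[OF \<epsilon>] \<Phi>(4)[OF \<phi>]])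
    ultimately show "a \<phi> \<in> {0..1}" by simp
  qed
  then obtain \<delta> Q Y where "\<delta> > 0" and Y: "open Y" "emeasure lborel Y \<le> ennreal ((1/2) ^ n)"
    and Q: "localized_poly ((1/2) ^ n) Y Q" "stably_fixes \<delta> ((1/2) ^ n) a \<Phi> Q"
    by (rule spectral_selector_exists[OF \<Phi>(1,2) _ \<epsilon>])
  have "stably_fixes (min \<delta> B) ((1/2) ^ n) a \<Phi> Q" by (rule stably_fixes_antimono[OF Q(2)]) simp
  then have "has_spectral_selector n U (min \<delta> B)"
    unfolding has_spectral_selector_def using truncation Y Q(1) by (intro exI conjI)
  then show ?thesis using that[of "min \<delta> B"] \<open>\<delta> > 0\<close> assms(2) by simp
qed

lemma dres_nonzero:
  fixes \<Omega> :: "'a::euclidean_space set"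
  assumes "open \<Omega>" "\<Omega> \<noteq> {}"
  obtains f where "dres \<Omega> f \<noteq> 0"
proof -
  obtain x r where "r > 0" and ball: "ball x r \<subseteq> \<Omega>" using assms open_contains_ball by blast
  let ?i = "\<lambda>y. indicator (ball x r) y :: real"
  have "ball x r \<in> lmeasurable" by (intro bounded_set_imp_lmeasurable) auto
  then have L2: "L2_fun ?i" by (rule L2_fun_indicator_lmeasurable)
  have "abs_l2 ?i \<noteq> 0"
  proof
    assume "abs_l2 ?i = 0"
    then have "AE y in lebesgue. ?i y = 0" by (simp add: abs_l2_eq_0_iff[OF L2])
    then have "AE y in lebesgue. y \<notin> ball x r" by eventually_elim (auto simp: indicator_def split: if_splits)
    then have "negligible (ball x r)" unfolding negligible_iff_null_sets by (subst AE_iff_null_sets) auto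
    then show False using open_not_negligible[of "ball x r"] \<open>r > 0\<close> by auto
  qed
  moreover have "restr \<Omega> (abs_l2 ?i) = abs_l2 ?i"
    by (rule restr_abs_l2_self[OF _ L2]) (use assms(1) ball in \<open>auto simp: indicator_def\<close>)
  ultimately show ?thesis using that dres_injective[OF assms(1)] by blast
qed

definition min_multiplicity :: "'a::euclidean_space \<Rightarrow> 'a \<Rightarrow> nat" where
  "min_multiplicity e e2 = (LEAST m. \<exists>U b a. admissible e e2 U b \<and> a > 0 \<and>
     eigenspace (dres U) a \<noteq> {0} \<and> dim (eigenspace (dres U) a) = m)"

lemma min_multiplicity_le:
  assumes "admissible e e2 U b" "a > 0" "eigenspace (dres U) a \<noteq> {0}"
  shows "min_multiplicity e e2 \<le> dim (eigenspace (dres U) a)"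
  unfolding min_multiplicity_def using assms by (intro Least_le) blast

record (overloaded) ('a::euclidean_space) chain_stage =
  region :: "'a set"
  tip :: real
  eigval :: real
  eigvec :: "('a, real) l2"
  tolerance :: real

text \<open>The tolerance bounds the total effect of all later modifications on functions supported in the region.\<close>

definition stage :: "'a::euclidean_space \<Rightarrow> 'a \<Rightarrow> nat \<Rightarrow> 'a chain_stage \<Rightarrow> bool" where
  "stage e e2 n S \<longleftrightarrow> admissible e e2 (region S) (tip S) \<and>
     eigval S > 0 \<and> dres (region S) (eigvec S) = eigval S *\<^sub>R eigvec S \<and> eigvec S \<noteq> 0 \<and>
     dim (eigenspace (dres (region S)) (eigval S)) = min_multiplicity e e2 \<and>
     tolerance S > 0 \<and> has_spectral_selector n (region S) (tolerance S)"

definition stage_step :: "'a::euclidean_space \<Rightarrow> real \<Rightarrow> nat \<Rightarrow> 'a chain_stage \<Rightarrow> 'a chain_stage \<Rightarrow> bool" where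
  "stage_step e \<eta> n S T \<longleftrightarrow> (\<exists>s. region T = region S \<union> room e (tip S) (tip T) \<union> tube e (tip S) s) \<and>
     tip S + (1 + real n) \<le> tip T \<and> tolerance T \<le> tolerance S / 2 \<and>
     (\<forall>f. norm (dres (region T) f - dres (region S \<union> room e (tip S) (tip T)) f) \<le> tolerance S / 2 * norm f) \<and>
     norm (eigvec T - eigvec S) \<le> \<eta> \<and> \<bar>eigval T - eigval S\<bar> \<le> \<eta>"

lemma stageD:
  assumes "stage e e2 n S"
  shows "admissible e e2 (region S) (tip S)" "eigval S > 0" "dres (region S) (eigvec S) = eigval S *\<^sub>R eigvec S"
    "eigvec S \<noteq> 0" "dim (eigenspace (dres (region S)) (eigval S)) = min_multiplicity e e2"
    "tolerance S > 0" "has_spectral_selector n (region S) (tolerance S)"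
  using assms by (auto simp: stage_def)

lemma stage_stepD:
  assumes "stage_step e \<eta> n S T"
  shows "region S \<subseteq> region T" "room e (tip S) (tip T) \<subseteq> region T" "tip S + (1 + real n) \<le> tip T"
    "tolerance T \<le> tolerance S / 2"
    "norm (dres (region T) f - dres (region S \<union> room e (tip S) (tip T)) f) \<le> tolerance S / 2 * norm f"
    "norm (eigvec T - eigvec S) \<le> \<eta>" "norm (eigval T - eigval S) \<le> \<eta>"
  using assms by (auto simp: stage_step_def)

lemma stage_eigval_less_1: "stage e e2 n S \<Longrightarrow> eigval S < 1"
  by (rule eigenvalue_less_1[OF admissibleD(2)[OF stageD(1)] stageD(3,4)])

context
  fixes e e2 :: "'a::euclidean_space"
  assumes e: "e \<in> Basis" "e2 \<in> Basis" "e \<noteq> e2"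
begin

lemma min_multiplicity_attained:
  obtains U b a where "admissible e e2 U b" "a > 0" "eigenspace (dres U) a \<noteq> {0}"
    "dim (eigenspace (dres U) a) = min_multiplicity e e2"
proof -
  let ?U = "room e 0 1" and ?P = "\<lambda>m. \<exists>U b a. admissible e e2 U b \<and> a > 0 \<and>
     eigenspace (dres U) a \<noteq> {0} \<and> dim (eigenspace (dres U) a) = m"
  have U: "admissible e e2 ?U 1" by (rule admissible_room[OF e]) simp
  obtain f where "dres ?U f \<noteq> 0" by (rule dres_nonzero[OF admissibleD(1,4)[OF U]])
  then obtain a where "a > 0" "eigenspace (dres ?U) a \<noteq> {0}"
    using compact_positive_eigenvalue_exists[OF positive_op_dres compact_dres[OF admissibleD(2)[OF U]]] by blast
  then have "\<exists>m. ?P m" using U by blast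
  then have "?P (min_multiplicity e e2)" unfolding min_multiplicity_def by (rule LeastI_ex)
  then show ?thesis using that by blast
qed

lemma initial_stage_exists:
  obtains S where "stage e e2 0 S" "norm (eigvec S) = 1"
proof -
  obtain U b a where U: "admissible e e2 U b" "a > 0" "eigenspace (dres U) a \<noteq> {0}"
    "dim (eigenspace (dres U) a) = min_multiplicity e e2" by (rule min_multiplicity_attained)
  note linear = positive_op_linear[OF positive_op_dres, of U]
  obtain x where x: "dres U x = a *\<^sub>R x" "x \<noteq> 0" by (rule eigenspace_nontrivialE[OF linear U(3)])
  let ?u = "(1 / norm x) *\<^sub>R x"
  have u: "dres U ?u = a *\<^sub>R ?u" "norm ?u = 1" using x by (simp_all add: linear_cmul[OF linear])
  obtain \<beta> where "\<beta> > 0" "has_spectral_selector 0 U \<beta>"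
    by (rule has_spectral_selector_exists[OF admissibleD(2)[OF U(1)] zero_less_one])
  then have "stage e e2 0 \<lparr>region = U, tip = b, eigval = a, eigvec = ?u, tolerance = \<beta>\<rparr>"
    using U u x(2) by (simp add: stage_def)
  then show ?thesis using that u(2) by simp
qed

lemma nonresonant_extension:
  assumes U: "open U" "\<And>x. x \<in> U \<Longrightarrow> x \<bullet> e < b" and a: "0 < a" "a < 1"
  obtains b' where "b + B \<le> b'" "b < b'"
    "eigenspace (dres (U \<union> room e b b')) a = eigenspace (dres U) a"
proof -
  obtain b' where b': "b + B \<le> b'" "b < b'" and nonresonant: "eigenspace (dres (room e b b')) a = {0}"
    using nonresonant_room[OF e(1) a] .
  have "U \<inter> room e b b' = {}" using U(2) by (fastforce simp: room_def axial_region_def)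
  then have "eigenspace (dres (U \<union> room e b b')) a = eigenspace (dres U) a"
    using a(1) by (intro eigenspace_disjoint_union[OF U(1) open_room _ _ nonresonant]) auto
  with b' show ?thesis by (rule that)
qed

lemma admissible_persistence:
  assumes V: "bounded V" "a > 0" "u \<in> eigenspace (dres V) a" "u \<noteq> 0"
    "dim (eigenspace (dres V) a) = min_multiplicity e e2" and \<eta>: "0 < \<eta>" "\<eta> < 1"
  obtains \<delta> where "\<delta> > 0"
    "\<forall>W b. admissible e e2 W b \<longrightarrow> (\<forall>f. norm (dres W f - dres V f) \<le> \<delta> * norm f) \<longrightarrow>
       (\<exists>c v. c > 0 \<and> \<bar>c - a\<bar> \<le> \<eta> \<and> dres W v = c *\<^sub>R v \<and> v \<noteq> 0 \<and> norm (v - u) \<le> \<eta> \<and>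
         dim (eigenspace (dres W) c) = min_multiplicity e e2)"
proof -
  let ?\<eta> = "\<eta> / (1 + norm u)"
  have norm_pos: "1 + norm u > 0" by (rule add_pos_nonneg) simp_all
  have \<eta>': "?\<eta> > 0" "?\<eta> \<le> \<eta>" "?\<eta> * norm u \<le> \<eta>"
    using \<eta>(1) norm_pos by (simp_all add: pos_divide_le_eq distrib_left)
  have nontrivial: "eigenspace (dres V) a \<noteq> {0}" using V(3,4) by (metis singletonD)
  show ?thesis
  proof (rule eigenvector_persistence[OF positive_op_dres compact_dres[OF V(1)] V(2) nontrivial \<eta>'(1)])
    fix \<delta> :: real assume "\<delta> > 0"
      and persistence: "\<And>L u. \<lbrakk>positive_op L; compact_op L; \<And>x. norm (L x - dres V x) \<le> \<delta> * norm x;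
          \<forall>c>0. eigenspace L c \<noteq> {0} \<longrightarrow> dim (eigenspace (dres V) a) \<le> dim (eigenspace L c);
          u \<in> eigenspace (dres V) a\<rbrakk>
        \<Longrightarrow> \<exists>c v. c > 0 \<and> \<bar>c - a\<bar> \<le> ?\<eta> \<and> L v = c *\<^sub>R v \<and> norm (v - u) \<le> ?\<eta> * norm u \<and>
              dim (eigenspace L c) = dim (eigenspace (dres V) a)"
    have "\<exists>c v. c > 0 \<and> \<bar>c - a\<bar> \<le> \<eta> \<and> dres W v = c *\<^sub>R v \<and> v \<noteq> 0 \<and> norm (v - u) \<le> \<eta> \<and>
        dim (eigenspace (dres W) c) = min_multiplicity e e2"
      if W: "admissible e e2 W b" and close: "\<And>f. norm (dres W f - dres V f) \<le> \<delta> * norm f" for W b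
    proof -
      have minimal: "\<forall>c>0. eigenspace (dres W) c \<noteq> {0} \<longrightarrow>
          dim (eigenspace (dres V) a) \<le> dim (eigenspace (dres W) c)"
        unfolding V(5) using min_multiplicity_le[OF W] by (intro allI impI)
      obtain c v where cv: "c > 0" "\<bar>c - a\<bar> \<le> ?\<eta>" "dres W v = c *\<^sub>R v" "norm (v - u) \<le> ?\<eta> * norm u"
        "dim (eigenspace (dres W) c) = dim (eigenspace (dres V) a)"
        using persistence[OF positive_op_dres compact_dres[OF admissibleD(2)[OF W]] close minimal V(3)]
        by (elim exE conjE)
      have "?\<eta> * norm u < 1 * norm u"
        using le_less_trans[OF \<eta>'(2) \<eta>(2)] V(4) by (intro mult_strict_right_mono) auto
      then have "v \<noteq> 0" using cv(4) by auto
      then show ?thesis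
        using cv(1,3,5) V(5) order_trans[OF cv(2) \<eta>'(2)] order_trans[OF cv(4) \<eta>'(3)] by metis
    qed
    with \<open>\<delta> > 0\<close> show ?thesis by (intro that) auto
  qed
qed

lemma extend_stage:
  assumes S: "stage e e2 n S" and \<eta>: "0 < \<eta>" "\<eta> < 1"
  obtains T where "stage e e2 (Suc n) T" "stage_step e \<eta> n S T"
proof -
  note D = stageD[OF S]
  let ?b = "tip S" and ?a = "eigval S" and ?u = "eigvec S" and ?\<beta> = "tolerance S / 2"
  obtain b' where b': "?b + (1 + real n) \<le> b'" "?b < b'"
    and same: "eigenspace (dres (region S \<union> room e ?b b')) ?a = eigenspace (dres (region S)) ?a"
    by (rule nonresonant_extension[OF admissibleD(1,5)[OF D(1)] D(2) stage_eigval_less_1[OF S]])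
  let ?V = "region S \<union> room e ?b b'"
  have V: "bounded ?V" "?u \<in> eigenspace (dres ?V) ?a" "dim (eigenspace (dres ?V) ?a) = min_multiplicity e e2"
    using admissibleD(2)[OF D(1)] D(3,5) unfolding same by (simp_all add: bounded_room eigenspace_def)
  obtain \<delta> where \<delta>: "\<delta> > 0"
    and persistence: "\<forall>W b. admissible e e2 W b \<longrightarrow> (\<forall>f. norm (dres W f - dres ?V f) \<le> \<delta> * norm f) \<longrightarrow>
       (\<exists>c v. c > 0 \<and> \<bar>c - ?a\<bar> \<le> \<eta> \<and> dres W v = c *\<^sub>R v \<and> v \<noteq> 0 \<and> norm (v - ?u) \<le> \<eta> \<and>
         dim (eigenspace (dres W) c) = min_multiplicity e e2)"
    by (rule admissible_persistence[OF V(1) D(2) V(2) D(4) V(3) \<eta>])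
  have "?b + 1 \<le> b'" "min \<delta> ?\<beta> > 0" using b'(1) \<delta> D(6) by auto
  then obtain s where s: "0 < s" "s < 1/2"
    and close: "\<And>f. norm (dres (?V \<union> tube e ?b s) f - dres ?V f) \<le> min \<delta> ?\<beta> * norm f"
    by (rule tube_close[OF e admissibleD(6)[OF D(1)]]) blast
  let ?W = "?V \<union> tube e ?b s"
  have close_min: "norm (dres ?W f - dres ?V f) \<le> \<delta> * norm f" "norm (dres ?W f - dres ?V f) \<le> ?\<beta> * norm f" for f
    by (rule order_trans[OF close mult_right_mono]; simp)+
  have W: "admissible e e2 ?W b'" by (rule admissible_extend[OF e D(1) b'(2) s(1)]) (use s(2) b'(1) in simp)
  obtain c v where cv: "c > 0" "\<bar>c - ?a\<bar> \<le> \<eta>" "dres ?W v = c *\<^sub>R v" "v \<noteq> 0" "norm (v - ?u) \<le> \<eta>"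
    "dim (eigenspace (dres ?W) c) = min_multiplicity e e2"
    using persistence[rule_format, OF W close_min(1)] by (elim exE conjE)
  obtain \<gamma> where \<gamma>: "0 < \<gamma>" "\<gamma> \<le> ?\<beta>" "has_spectral_selector (Suc n) ?W \<gamma>"
    by (rule has_spectral_selector_exists[OF admissibleD(2)[OF W], of ?\<beta>]) (use D(6) in auto)
  let ?T = "\<lparr>region = ?W, tip = b', eigval = c, eigvec = v, tolerance = \<gamma>\<rparr>"
  have "stage e e2 (Suc n) ?T" using W cv \<gamma> by (simp add: stage_def)
  moreover have "stage_step e \<eta> n S ?T" using b'(1) \<gamma>(2) close_min(2) cv(2,5) by (auto simp: stage_step_def)
  ultimately show ?thesis by (rule that)
qed

lemma stages_exist:
  obtains S \<kappa> where "\<And>n. stage e e2 n (S n)" "\<And>n. stage_step e (\<kappa> * (1/2) ^ n) n (S n) (S (Suc n))"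
    "norm (eigvec (S 0)) = 1" "0 < \<kappa>" "\<kappa> \<le> eigval (S 0) / 8" "\<kappa> \<le> (1 - eigval (S 0)) / 8"
proof -
  obtain S0 where S0: "stage e e2 0 S0" "norm (eigvec S0) = 1" by (rule initial_stage_exists)
  define \<kappa> where "\<kappa> = min (eigval S0 / 8) ((1 - eigval S0) / 8)"
  have \<kappa>: "0 < \<kappa>" "\<kappa> \<le> eigval S0 / 8" "\<kappa> \<le> (1 - eigval S0) / 8"
    using stageD(2)[OF S0(1)] stage_eigval_less_1[OF S0(1)] by (auto simp: \<kappa>_def min_def)
  have "\<exists>S. \<forall>n. (stage e e2 n (S n) \<and> (n = 0 \<longrightarrow> S n = S0)) \<and> stage_step e (\<kappa> * (1/2) ^ n) n (S n) (S (Suc n))"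
  proof (rule dependent_nat_choice)
    show "\<exists>S. stage e e2 0 S \<and> (0 = 0 \<longrightarrow> S = S0)" using S0(1) by blast
    fix S n assume S: "stage e e2 n S \<and> (n = 0 \<longrightarrow> S = S0)"
    have "\<kappa> * (1/2) ^ n \<le> \<kappa> * 1" using \<kappa>(1) by (intro mult_left_mono power_le_one) auto
    also have "\<kappa> * 1 < 1" using \<kappa>(3) stageD(2)[OF S0(1)] by simp
    finally have less_1: "\<kappa> * (1/2) ^ n < 1" .
    have "0 < \<kappa> * (1/2) ^ n" using \<kappa>(1) by simp
    then obtain T where "stage e e2 (Suc n) T" "stage_step e (\<kappa> * (1/2) ^ n) n S T"
      by (rule extend_stage[OF conjunct1[OF S] _ less_1])
    then show "\<exists>T. (stage e e2 (Suc n) T \<and> (Suc n = 0 \<longrightarrow> T = S0)) \<and> stage_step e (\<kappa> * (1/2) ^ n) n S T" by blast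
  qed
  then obtain S where "\<And>n. stage e e2 n (S n)" "S 0 = S0" "\<And>n. stage_step e (\<kappa> * (1/2) ^ n) n (S n) (S (Suc n))"
    by blast
  then show ?thesis using that[of S \<kappa>] S0(2) \<kappa> by simp
qed

end

section \<open>The limit domain\<close>

lemma restr_mono_self:
  assumes "open S" "open T" "S \<subseteq> T" "restr S f = f" shows "restr T f = f"
proof -
  have "restr T (restr S f) = restr (T \<inter> S) f" using assms by (intro restr_restr) auto
  then show ?thesis using assms(3,4) by (simp add: Int_absorb1)
qed

lemma dres_beyond_support:
  assumes UW: "open U" "open W" "U \<inter> W = {}" and f: "restr U f = f"
  shows "dres (U \<union> W) f = dres U f"
proof -
  have "W \<inter> U = {}" using UW(3) by blast
  then have "dres W f = 0" using dres_restr_disjoint[OF UW(2), of U f] UW(1) f by simp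
  then show ?thesis by (simp add: dres_disjoint_union[OF UW])
qed

lemma stage_step_dres:
  assumes "stage e e2 n S" "stage_step e \<eta> n S T" and f: "restr (region S) f = f"
  shows "norm (dres (region T) f - dres (region S) f) \<le> tolerance S / 2 * norm f"
proof -
  note U = admissibleD[OF stageD(1)[OF assms(1)]]
  have "region S \<inter> room e (tip S) (tip T) = {}" using U(5) by (fastforce simp: room_def axial_region_def)
  then have "dres (region S \<union> room e (tip S) (tip T)) f = dres (region S) f"
    by (rule dres_beyond_support[OF U(1) open_room _ f])
  then show ?thesis using stage_stepD(5)[OF assms(2), of f] by simp
qed

lemma dres_spectral_moments:
  assumes \<mu>: "is_spectral_measure \<Omega> f \<mu>" and f: "L2_fun f"
  shows "(dres \<Omega> ^^ Suc k) (abs_l2 f) \<bullet> abs_l2 f = (\<integral> t. (1 / (1 + t)) ^ Suc k \<partial>\<mu>)"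
proof (rule spectral_moments[OF _ _ _ pos_contraction_dres])
  show "sets \<mu> = sets borel" "finite_measure \<mu>" "emeasure \<mu> {..<0} = 0"
    using \<mu> by (auto simp: is_spectral_measure_def)
  fix s :: real and w assume s: "0 < s" and w: "w = dres \<Omega> (abs_l2 f + (1 - s) *\<^sub>R w)"
  have "(\<integral> x. rep_l2 w x * f x \<partial>lebesgue) = (\<integral> t. 1 / (t + s) \<partial>\<mu>)"
    using \<mu> s dirichlet_resolvent_dres[OF f w] by (simp add: is_spectral_measure_def)
  then show "w \<bullet> abs_l2 f = (\<integral> t. 1 / (t + s) \<partial>\<mu>)" by (simp add: inner_rep_l2[OF f])
qed

context
  fixes U :: "nat \<Rightarrow> 'a::euclidean_space set" and \<beta> :: "nat \<Rightarrow> real"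
  assumes U: "\<And>n. open (U n)" "incseq U"
    and step: "\<And>n f. restr (U n) f = f \<Longrightarrow> norm (dres (U (Suc n)) f - dres (U n) f) \<le> \<beta> n / 2 * norm f"
    and \<beta>: "\<And>n. \<beta> n > 0" "\<And>n. \<beta> (Suc n) \<le> \<beta> n / 2"
begin

lemma dres_stage_estimate:
  assumes f: "restr (U n) f = f"
  shows "norm (dres (U (n + j)) f - dres (U n) f) \<le> (\<beta> n - \<beta> (n + j)) * norm f"
proof (induction j)
  case (Suc j)
  have "restr (U (n + j)) f = f" by (rule restr_mono_self[OF U(1) U(1) _ f]) (simp add: incseqD[OF U(2)])
  then have "norm (dres (U (Suc (n + j))) f - dres (U (n + j)) f) \<le> \<beta> (n + j) / 2 * norm f" by (rule step)
  then have "norm (dres (U (n + Suc j)) f - dres (U n) f) \<le> \<beta> (n + j) / 2 * norm f + (\<beta> n - \<beta> (n + j)) * norm f"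
    using norm_diff_triangle_le[OF _ Suc] by simp
  also have "\<dots> = (\<beta> n - \<beta> (n + j) / 2) * norm f" by (simp add: field_simps)
  also have "\<dots> \<le> (\<beta> n - \<beta> (n + Suc j)) * norm f"
    using \<beta>(2)[of "n + j"] by (intro mult_right_mono) auto
  finally show ?case .
qed simp

lemma dres_limit_estimate:
  assumes f: "restr (U n) f = f"
  shows "norm (dres (\<Union>n. U n) f - dres (U n) f) \<le> \<beta> n * norm f"
proof -
  have "(\<lambda>j. dres (U (j + n)) f) \<longlonglongrightarrow> dres (\<Union>n. U n) f"
    by (rule LIMSEQ_ignore_initial_segment[OF dres_exhaustion[of U, OF U]])
  then have "(\<lambda>j. norm (dres (U (j + n)) f - dres (U n) f)) \<longlonglongrightarrow> norm (dres (\<Union>n. U n) f - dres (U n) f)"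
    by (intro tendsto_intros)
  moreover have "norm (dres (U (j + n)) f - dres (U n) f) \<le> \<beta> n * norm f" for j
  proof -
    have "(\<beta> n - \<beta> (n + j)) * norm f \<le> \<beta> n * norm f" using \<beta>(1)[of "n + j"] by (intro mult_right_mono) auto
    then show ?thesis using dres_stage_estimate[OF f, of j] by (simp add: add.commute)
  qed
  ultimately show ?thesis by (intro LIMSEQ_le_const2) auto
qed

lemma tolerances_tendsto_0: "\<beta> \<longlonglongrightarrow> 0"
proof (rule tendsto_sandwich[of "\<lambda>_. 0" _ _ "\<lambda>n. \<beta> 0 * (1/2) ^ n"])
  have "\<beta> n \<le> \<beta> 0 * (1/2) ^ n" for n
  proof (induction n)
    case (Suc n)
    then show ?case using \<beta>(2)[of n] by simp
  qed simp
  then show "eventually (\<lambda>n. \<beta> n \<le> \<beta> 0 * (1/2) ^ n) sequentially" by simp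
  show "eventually (\<lambda>n. 0 \<le> \<beta> n) sequentially" using \<beta>(1) by (simp add: less_imp_le)
  show "(\<lambda>n. \<beta> 0 * (1/2) ^ n) \<longlonglongrightarrow> 0" by (intro tendsto_mult_right_zero LIMSEQ_realpow_zero) auto
qed simp

lemma dres_limit_eigenvector:
  assumes u: "\<And>n. dres (U n) (u n) = a n *\<^sub>R u n" "\<And>n. a n \<noteq> 0"
    and lim: "u \<longlonglongrightarrow> v" "a \<longlonglongrightarrow> c"
  shows "dres (\<Union>n. U n) v = c *\<^sub>R v"
proof -
  let ?A = "dres (\<Union>n. U n)"
  have "(\<lambda>n. ?A (u n) - a n *\<^sub>R u n) \<longlonglongrightarrow> 0"
  proof (rule Lim_null_comparison)
    have "norm (?A (u n) - a n *\<^sub>R u n) \<le> \<beta> n * norm (u n)" for n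
      using dres_limit_estimate[OF dres_eigenvector_support[OF U(1) u(1,2)], of n] by (simp add: u(1))
    then show "eventually (\<lambda>n. norm (?A (u n) - a n *\<^sub>R u n) \<le> \<beta> n * norm (u n)) sequentially" by simp
    show "(\<lambda>n. \<beta> n * norm (u n)) \<longlonglongrightarrow> 0"
      using tendsto_mult[OF tolerances_tendsto_0 tendsto_norm[OF lim(1)]] by simp
  qed
  moreover have "(\<lambda>n. ?A (u n) - a n *\<^sub>R u n) \<longlonglongrightarrow> ?A v - c *\<^sub>R v"
    by (intro tendsto_diff tendsto_scaleR lim pos_contraction_tendsto[OF pos_contraction_dres])
  ultimately have "?A v - c *\<^sub>R v = 0" by (rule LIMSEQ_unique[rotated])
  then show ?thesis by simp
qed

lemma spectral_selector_almost_fixes: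
  assumes "has_spectral_selector n (U n) (\<beta> n)"
  shows "\<exists>Q Y h. open Y \<and> emeasure lborel Y \<le> ennreal ((1/2) ^ n) \<and> localized_poly ((1/2) ^ n) Y Q \<and>
    norm (dres (U n) f - h) \<le> (1/2) ^ n * norm f \<and>
    norm (h - poly_op (dres (\<Union>n. U n)) Q h) \<le> (1/2) ^ n * norm h"
proof -
  obtain \<Phi> a Q Y where truncation: "eigen_truncation (dres (U n)) ((1/2) ^ n) \<Phi> a"
    and Y: "open Y" "emeasure lborel Y \<le> ennreal ((1/2) ^ n)" and Q: "localized_poly ((1/2) ^ n) Y Q"
    and fixes_span: "stably_fixes (\<beta> n) ((1/2) ^ n) a \<Phi> Q"
    using assms unfolding has_spectral_selector_def by blast
  note \<Phi> = eigen_truncationD[OF truncation]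
  have "norm (dres (\<Union>n. U n) \<phi> - a \<phi> *\<^sub>R \<phi>) \<le> \<beta> n" if "\<phi> \<in> \<Phi>" for \<phi>
  proof -
    have "a \<phi> > 0" by (rule less_le_trans[OF _ \<Phi>(4)[OF that]]) simp
    then have "restr (U n) \<phi> = \<phi>" by (intro dres_eigenvector_support[OF U(1) \<Phi>(3)[OF that]]) simp
    from dres_limit_estimate[OF this] show ?thesis
      using \<Phi>(3)[OF that] orthonormal_norm[OF \<Phi>(2) that] by simp
  qed
  then have "norm (h - poly_op (dres (\<Union>n. U n)) Q h) \<le> (1/2) ^ n * norm h" if "h \<in> span \<Phi>" for h
    using fixes_span pos_contraction_dres that unfolding stably_fixes_def by blast
  moreover obtain h where "h \<in> span \<Phi>" "norm (dres (U n) f - h) \<le> (1/2) ^ n * norm f"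
    using eigen_truncation_range_approx[OF pos_contraction_linear[OF pos_contraction_dres] truncation, of f] by auto
  ultimately show ?thesis using Y Q by blast
qed

lemma tendsto_of_geometric_error:
  fixes x y :: "nat \<Rightarrow> 'v::real_normed_vector"
  assumes "x \<longlonglongrightarrow> l" "\<And>n. norm (x n - y n) \<le> (1/2) ^ n * C"
  shows "y \<longlonglongrightarrow> l"
proof -
  have "(\<lambda>n. (1/2) ^ n * C) \<longlonglongrightarrow> 0" by (intro tendsto_mult_left_zero LIMSEQ_realpow_zero) auto
  then have "(\<lambda>n. x n - y n) \<longlonglongrightarrow> 0" by (rule Lim_null_comparison[OF always_eventually[OF allI[OF assms(2)]]])
  from tendsto_diff[OF assms(1) this] show ?thesis by simp
qed

lemma ac_spectrum_empty_of_spectral_selectors: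
  assumes selected: "\<And>n. has_spectral_selector n (U n) (\<beta> n)"
  shows "dirichlet_ac_spectrum_empty (\<Union>n. U n)"
  unfolding dirichlet_ac_spectrum_empty_def
proof
  let ?\<Omega> = "\<Union>n. U n"
  let ?A = "dres ?\<Omega>"
  have \<Omega>: "open ?\<Omega>" using U(1) by auto
  fix f assume "f \<in> ac_subspace ?\<Omega>"
  then obtain \<mu> where f: "f \<in> L2_on ?\<Omega>" and spectral: "is_spectral_measure ?\<Omega> f \<mu>"
    and ac: "absolutely_continuous lborel \<mu>"
    unfolding ac_subspace_def by blast
  have \<mu>: "sets \<mu> = sets borel" "finite_measure \<mu>" "emeasure \<mu> {..<0} = 0"
    using spectral by (auto simp: is_spectral_measure_def)
  have L2: "L2_fun f" using f by (simp add: L2_on_def L2_fun_iff_nn_integral)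
  let ?F = "abs_l2 f"
  obtain Q Y h where Y: "\<And>n. open (Y n)" "\<And>n. emeasure lborel (Y n) \<le> ennreal ((1/2) ^ n)"
    and Q: "\<And>n. localized_poly ((1/2) ^ n) (Y n) (Q n)" and h: "\<And>n. norm (dres (U n) ?F - h n) \<le> (1/2) ^ n * norm ?F"
    and almost_fixed: "\<And>n. norm (h n - poly_op ?A (Q n) (h n)) \<le> (1/2) ^ n * norm (h n)"
    using spectral_selector_almost_fixes[OF selected, where f = ?F] by metis
  have "?A ?F = 0"
  proof (rule zero_of_annihilated_almost_fixed)
    show "poly_op ?A (Q n) x \<bullet> y = x \<bullet> poly_op ?A (Q n) y" for n x y
      by (rule poly_op_symmetric[OF pos_contraction_linear pos_contraction_symmetric]) (rule pos_contraction_dres)+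
    have "AE y in lborel. eventually (\<lambda>n. y \<notin> Y n) sequentially" by (rule AE_eventually_avoids) (use Y in auto)
    then have avoid: "AE t in \<mu>. eventually (\<lambda>n. 1 / (1 + t) \<notin> Y n) sequentially"
      by (rule AE_resolvent_of_AE_lborel[OF \<mu> ac])
    show "(\<lambda>n. poly_op ?A (Q n) (?A ?F)) \<longlonglongrightarrow> 0"
      by (rule localized_poly_op_tendsto_0[OF \<mu> pos_contraction_dres dres_spectral_moments[OF spectral L2] Q _ avoid])
         (rule LIMSEQ_realpow_zero, auto)
    show h_lim: "h \<longlonglongrightarrow> ?A ?F" by (rule tendsto_of_geometric_error[OF dres_exhaustion[of U, OF U] h])
    have "(\<lambda>n. (1/2) ^ n * norm (h n)) \<longlonglongrightarrow> 0 * norm (?A ?F)"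
      by (intro tendsto_mult tendsto_norm h_lim LIMSEQ_realpow_zero) auto
    then show "(\<lambda>n. h n - poly_op ?A (Q n) (h n)) \<longlonglongrightarrow> 0"
      using Lim_null_comparison[OF always_eventually[OF allI[OF almost_fixed]]] by simp
  qed
  moreover have "restr ?\<Omega> ?F = ?F"
    using f \<Omega> by (intro restr_abs_l2_self L2) (auto simp: L2_on_def)
  ultimately have "?F = 0" using dres_injective[OF \<Omega>] by blast
  then show "AE x in lebesgue. f x = 0" by (simp add: abs_l2_eq_0_iff[OF L2])
qed

end

lemma connected_incseq_union:
  assumes "\<And>n::nat. connected (U n)" "incseq U" "U 0 \<noteq> {}"
  shows "connected (\<Union>n. U n)"
proof (rule connected_Union)
  have "U 0 \<subseteq> U n" for n using assms(2) by (rule incseqD) simp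
  then show "\<Inter> (range U) \<noteq> {}" using assms(3) by blast
qed (use assms(1) in auto)

lemma quasi_conical_of_growing_rooms:
  assumes e: "e \<in> Basis" and growth: "\<And>n. b n + (1 + real n) \<le> b (Suc n)"
    and rooms: "\<And>n. room e (b n) (b (Suc n)) \<subseteq> \<Omega>"
  shows "quasi_conical \<Omega>"
  unfolding quasi_conical_def
proof (intro allI impI)
  fix r :: real
  obtain n :: nat where n: "256 * r \<le> real n" using real_arch_simple by blast
  have "ball (((b n + b (Suc n)) / 2) *\<^sub>R e) r \<subseteq> ball (((b n + b (Suc n)) / 2) *\<^sub>R e) ((b (Suc n) - b n) / 256)"
    using growth[of n] n by (intro subset_ball) simp
  also have "\<dots> \<subseteq> room e (b n) (b (Suc n))" using growth[of n] by (intro room_contains_ball[OF e]) simp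
  also have "\<dots> \<subseteq> \<Omega>" by (rule rooms)
  finally show "\<exists>x. ball x r \<subseteq> \<Omega>" by blast
qed

lemma geometric_increments_converge:
  fixes x :: "nat \<Rightarrow> 'v::banach"
  assumes "\<And>n. norm (x (Suc n) - x n) \<le> \<kappa> * (1/2) ^ n"
  obtains l where "x \<longlonglongrightarrow> l" "norm (l - x 0) \<le> 2 * \<kappa>"
proof -
  have "(\<lambda>n. \<kappa> * (1/2) ^ n) sums (2 * \<kappa>)"
    using sums_mult[OF geometric_sums[of "1/2::real"], of \<kappa>] by (simp add: mult.commute)
  then show ?thesis using summable_increments_converge[of x, OF assms] that by blast
qed

lemma distinct_Basis_exist:
  assumes "DIM('a::euclidean_space) \<ge> 2"
  obtains e e2 :: "'a::euclidean_space" where "e \<in> Basis" "e2 \<in> Basis" "e \<noteq> e2"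
proof -
  obtain B :: "'a set" where "B \<subseteq> Basis" "card B = 2" using obtain_subset_with_card_n[OF assms] by blast
  then show ?thesis using that by (auto simp: card_2_iff)
qed

lemma quasi_conical_domain_exists:
  assumes "DIM('a::euclidean_space) \<ge> 2"
  obtains \<Omega> :: "'a::euclidean_space set" and lam where "open \<Omega>" "connected \<Omega>" "quasi_conical \<Omega>"
    "dirichlet_ac_spectrum_empty \<Omega>" "lam > 0" "lam \<in> dirichlet_point_spectrum \<Omega>"
proof -
  obtain e e2 :: 'a where e: "e \<in> Basis" "e2 \<in> Basis" "e \<noteq> e2" by (rule distinct_Basis_exist[OF assms])
  obtain S \<kappa> where stage: "\<And>n. stage e e2 n (S n)" and step: "\<And>n. stage_step e (\<kappa> * (1/2) ^ n) n (S n) (S (Suc n))"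
    and unit: "norm (eigvec (S 0)) = 1" and \<kappa>: "0 < \<kappa>" "\<kappa> \<le> eigval (S 0) / 8" "\<kappa> \<le> (1 - eigval (S 0)) / 8"
    by (rule stages_exist[OF e]) blast
  define U where "U n = region (S n)" for n
  note U = admissibleD[OF stageD(1)[OF stage], folded U_def]
  have incseq: "incseq U" using stage_stepD(1)[OF step] by (intro incseq_SucI) (simp add: U_def)
  have exhaustion: "\<And>n. open (U n)" "incseq U"
    "\<And>n f. restr (U n) f = f \<Longrightarrow> norm (dres (U (Suc n)) f - dres (U n) f) \<le> tolerance (S n) / 2 * norm f"
    "\<And>n. tolerance (S n) > 0" "\<And>n. tolerance (S (Suc n)) \<le> tolerance (S n) / 2"
    using stage_step_dres[OF stage step] U(1) incseq stageD(6)[OF stage] stage_stepD(4)[OF step]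
    by (simp_all add: U_def)
  let ?\<Omega> = "\<Union>n. U n"
  obtain v where v: "(\<lambda>n. eigvec (S n)) \<longlonglongrightarrow> v" "norm (v - eigvec (S 0)) \<le> 2 * \<kappa>"
    using geometric_increments_converge[of "\<lambda>n. eigvec (S n)", OF stage_stepD(6)[OF step]] .
  obtain c where c: "(\<lambda>n. eigval (S n)) \<longlonglongrightarrow> c" "norm (c - eigval (S 0)) \<le> 2 * \<kappa>"
    using geometric_increments_converge[of "\<lambda>n. eigval (S n)", OF stage_stepD(7)[OF step]] .
  have "dres ?\<Omega> v = c *\<^sub>R v"
    using stageD(2,3)[OF stage]
    by (intro dres_limit_eigenvector[OF exhaustion _ _ v(1) c(1)]) (auto simp: U_def less_imp_neq[symmetric])
  moreover have "v \<noteq> 0" using v(2) unit \<kappa> stage_eigval_less_1[OF stage, of 0] by auto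
  moreover have "0 < c" "c < 1"
    using c(2) \<kappa> stageD(2)[OF stage, of 0] stage_eigval_less_1[OF stage, of 0] by (auto simp: abs_le_iff)
  ultimately have "1 / c - 1 \<in> dirichlet_point_spectrum ?\<Omega>" "1 / c - 1 > 0"
    by (auto intro: dres_eigenvalue_imp_point_spectrum)
  moreover have "dirichlet_ac_spectrum_empty ?\<Omega>"
    by (rule ac_spectrum_empty_of_spectral_selectors[OF exhaustion stageD(7)[OF stage, folded U_def]])
  moreover have "connected ?\<Omega>" by (rule connected_incseq_union[OF U(3) incseq U(4)])
  moreover have "open ?\<Omega>" using U(1) by auto
  moreover have "quasi_conical ?\<Omega>"
  proof (rule quasi_conical_of_growing_rooms[OF e(1) stage_stepD(3)[OF step]])
    show "room e (tip (S n)) (tip (S (Suc n))) \<subseteq> ?\<Omega>" for n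
      using stage_stepD(2)[OF step] unfolding U_def by (rule order_trans) auto
  qed
  ultimately show ?thesis using that by blast
qed

lemma similarity_ball:
  assumes "r > 0" shows "similarity r p ` ball x R = ball (similarity r p x) (r * R)"
proof -
  have "similarity r p ` ball x R = (+) p ` (*\<^sub>R) r ` ball x R" by (simp add: similarity_def image_image)
  also have "(*\<^sub>R) r ` ball x R = ball (r *\<^sub>R x) (r * R)" using ball_scale[of r x R] assms by simp
  also have "(+) p ` \<dots> = ball (p + r *\<^sub>R x) (r * R)" by (rule ball_translation[symmetric])
  finally show ?thesis by (simp add: similarity_def)
qed

lemma quasi_conical_similarity:
  assumes "r > 0" "quasi_conical \<Omega>" shows "quasi_conical (similarity r p ` \<Omega>)"
  unfolding quasi_conical_def
proof (intro allI impI)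
  fix R :: real assume "R > 0"
  then obtain x where "ball x (R / r) \<subseteq> \<Omega>" using assms unfolding quasi_conical_def by (metis divide_pos_pos)
  then have "similarity r p ` ball x (R / r) \<subseteq> similarity r p ` \<Omega>" by (rule image_mono)
  then show "\<exists>x. ball x R \<subseteq> similarity r p ` \<Omega>" using assms(1) by (auto simp: similarity_ball)
qed

theorem theorem1p1:
  assumes "DIM('a::euclidean_space) \<ge> 2"
  shows "(\<forall>lam>0. \<exists>\<Omega>::'a set. open \<Omega> \<and> connected \<Omega> \<and> quasi_conical \<Omega> \<and>
             lam \<in> dirichlet_point_spectrum \<Omega>) \<and>
         (\<forall>lam>0. \<exists>\<Omega>::'a set. open \<Omega> \<and> connected \<Omega> \<and> quasi_conical \<Omega> \<and>
             lam \<in> dirichlet_point_spectrum \<Omega> \<and> dirichlet_ac_spectrum_empty \<Omega>)"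
proof -
  obtain \<Omega> :: "'a set" and l where \<Omega>: "open \<Omega>" "connected \<Omega>" "quasi_conical \<Omega>" "dirichlet_ac_spectrum_empty \<Omega>"
    and l: "l > 0" "l \<in> dirichlet_point_spectrum \<Omega>" by (rule quasi_conical_domain_exists[OF assms])
  have "\<exists>\<Omega>::'a set. open \<Omega> \<and> connected \<Omega> \<and> quasi_conical \<Omega> \<and>
      lam \<in> dirichlet_point_spectrum \<Omega> \<and> dirichlet_ac_spectrum_empty \<Omega>"
    if lam: "lam > 0" for lam
  proof (intro exI conjI)
    define r where "r = sqrt (l / lam)"
    have r: "r > 0" "l / r\<^sup>2 = lam" using lam l(1) by (auto simp: r_def)
    have scaling: "similarity r 0 = (\<lambda>x::'a. r *\<^sub>R x)" by (simp add: similarity_def fun_eq_iff)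
    show "open (similarity r 0 ` \<Omega>)" unfolding scaling using r(1) by (intro open_scaling \<Omega>(1)) simp
    show "connected (similarity r 0 ` \<Omega>)" unfolding scaling
      by (intro connected_continuous_image \<Omega>(2) continuous_intros)
    show "quasi_conical (similarity r 0 ` \<Omega>)" by (rule quasi_conical_similarity[OF r(1) \<Omega>(3)])
    show "lam \<in> dirichlet_point_spectrum (similarity r 0 ` \<Omega>)"
      using dirichlet_point_spectrum_similarity[OF r(1) l(2), of 0] r(2) by simp
    show "dirichlet_ac_spectrum_empty (similarity r 0 ` \<Omega>)"
      by (rule dirichlet_ac_spectrum_empty_similarity[OF r(1) \<Omega>(4)])
  qed
  then show ?thesis by blast
qed

end
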